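(* Let $d\ge2$. If there is no function $u\in W^{1,1}([0,1]^d)$ attaining the infimum defining $G_Q(d)$, then $G_Q(d)=G(d)/4$.
   Context: $G(d)=\inf_{0\ne u\in H^1(\mathbb{R}^d)}\frac{\int_{\mathbb{R}^d}|\nabla u|^2\left(\int_{\mathbb{R}^d}u^2\right)^{2/d}}{\int_{\mathbb{R}^d}|u|^{2+4/d}}$. With $Q=[0,1]^d$, $G_Q(d)=\inf\frac{\int_{Q}|\nabla u|^2\left(\int_{Q}u^2\right)^{2/d}}{\int_{Q}|u-u_{Q}|^{2+4/d}}$, the infimum over (non-constant) $u\in W^{1,1}(Q)$, where $u_Q=\int_Q u$. *)

theory Defs
  imports "HOL-Analysis.Analysis"
begin

definition partial_deriv :: "'n::finite \<Rightarrow> (real^'n \<Rightarrow> real) \<Rightarrow> real^'n \<Rightarrow> real" where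
  "partial_deriv i f x = frechet_derivative f (at x) (axis i 1)"

fun iter_partial :: "'n::finite list \<Rightarrow> (real^'n \<Rightarrow> real) \<Rightarrow> real^'n \<Rightarrow> real" where
  "iter_partial [] f = f"
| "iter_partial (i # is) f = partial_deriv i (iter_partial is f)"

definition smooth_fun :: "(real^'n::finite \<Rightarrow> real) \<Rightarrow> bool" where
  "smooth_fun f \<longleftrightarrow> (\<forall>is x. iter_partial is f differentiable (at x))"

definition test_funs :: "(real^'n::finite) set \<Rightarrow> (real^'n \<Rightarrow> real) set" where
  "test_funs S = {\<phi>. smooth_fun \<phi> \<and> compact (closure {x. \<phi> x \<noteq> 0})
                      \<and> closure {x. \<phi> x \<noteq> 0} \<subseteq> S}"

definition weak_gradient :: "(real^'n::finite) set \<Rightarrow> (real^'n \<Rightarrow> real) \<Rightarrow> (real^'n \<Rightarrow> real^'n) \<Rightarrow> bool" where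
  "weak_gradient S u g \<longleftrightarrow>
     (\<forall>K. compact K \<and> K \<subseteq> S \<longrightarrow>
        set_integrable lebesgue K u \<and> (\<forall>i. set_integrable lebesgue K (\<lambda>x. g x $ i))) \<and>
     (\<forall>\<phi>\<in>test_funs S. \<forall>i.
        (LINT x:S|lebesgue. u x * partial_deriv i \<phi> x) = - (LINT x:S|lebesgue. g x $ i * \<phi> x))"

definition cubeQ :: "(real^'n::finite) set" where
  "cubeQ = cbox 0 1"

definition W11Q :: "(real^'n::finite \<Rightarrow> real) \<Rightarrow> (real^'n \<Rightarrow> real^'n) \<Rightarrow> bool" where
  "W11Q u g \<longleftrightarrow> set_integrable lebesgue cubeQ u \<and>
     (\<forall>i. set_integrable lebesgue cubeQ (\<lambda>x. g x $ i)) \<and> weak_gradient (interior cubeQ) u g"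

definition H1 :: "(real^'n::finite \<Rightarrow> real) \<Rightarrow> (real^'n \<Rightarrow> real^'n) \<Rightarrow> bool" where
  "H1 u g \<longleftrightarrow> u \<in> borel_measurable lebesgue \<and> integrable lebesgue (\<lambda>x. (u x)\<^sup>2) \<and>
     g \<in> borel_measurable lebesgue \<and> integrable lebesgue (\<lambda>x. (norm (g x))\<^sup>2) \<and>
     weak_gradient UNIV u g"

text \<open>The Gagliardo--Nirenberg-type quotient
  (\<integral>_S |g|^2) (\<integral>_S u^2)^{2/d} / \<integral>_S |u - c|^{2+4/d}, valued in [0,\<infinity>],
  with the convention that it is \<infinity> when the numerator is infinite
  (and finite/\<infinity> = 0).\<close>
definition GN_quot :: "(real^'n::finite) set \<Rightarrow> real \<Rightarrow> (real^'n \<Rightarrow> real) \<Rightarrow> (real^'n \<Rightarrow> real^'n) \<Rightarrow> ennreal" where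
  "GN_quot S c u g =
    (let d = real CARD('n);
         A = (\<integral>\<^sup>+ x. ennreal ((norm (g x))\<^sup>2) * indicator S x \<partial>lebesgue);
         B = (\<integral>\<^sup>+ x. ennreal ((u x)\<^sup>2) * indicator S x \<partial>lebesgue);
         C = (\<integral>\<^sup>+ x. ennreal (\<bar>u x - c\<bar> powr (2 + 4 / d)) * indicator S x \<partial>lebesgue)
     in if A = \<infinity> \<or> B = \<infinity> then \<infinity>
        else ennreal (enn2real A * enn2real B powr (2 / d)) / C)"

definition G_const :: "'n::finite itself \<Rightarrow> ennreal" where
  "G_const _ = (INF ug \<in> {(u, g). H1 (u :: real^'n \<Rightarrow> real) g \<and> \<not> (AE x in lebesgue. u x = 0)}.
                  GN_quot UNIV 0 (fst ug) (snd ug))"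

definition GQ_admissible :: "(real^'n::finite \<Rightarrow> real) \<Rightarrow> (real^'n \<Rightarrow> real^'n) \<Rightarrow> bool" where
  "GQ_admissible u g \<longleftrightarrow> W11Q u g \<and> \<not> (\<exists>c. AE x in lebesgue_on cubeQ. u x = c)"

text \<open>Mean value u_Q = \<integral>_Q u (|Q| = 1).\<close>
definition meanQ :: "(real^'n::finite \<Rightarrow> real) \<Rightarrow> real" where
  "meanQ u = (LINT x:cubeQ|lebesgue. u x)"

definition GQ_quot :: "(real^'n::finite \<Rightarrow> real) \<Rightarrow> (real^'n \<Rightarrow> real^'n) \<Rightarrow> ennreal" where
  "GQ_quot u g = GN_quot cubeQ (meanQ u) u g"

definition GQ_const :: "'n::finite itself \<Rightarrow> ennreal" where
  "GQ_const _ = (INF ug \<in> {(u, g). GQ_admissible (u :: real^'n \<Rightarrow> real) g}.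
                   GQ_quot (fst ug) (snd ug))"

end

theory Submission
  imports Defs "HOL-Real_Asymp.Real_Asymp" "HOL-Library.Diagonal_Subsequence"
begin

text \<open>
  Upper bound: given a competitor for \<open>G\<close>, bisect its \<open>L\<^sup>2\<close> mass successively by a hyperplane
  orthogonal to each coordinate axis and keep the better half. After \<open>d\<close> steps an orthant remains
  whose quotient is smaller by the factor \<open>(2^d) powr (2/d) = 4\<close>. Shrinking it to the corner of the
  cube makes the mean negligible.

  Lower bound: suppose \<open>4 G\<^sub>Q < \<kappa> \<le> G\<close>. A function on the cube that vanishes away from one corner
  extends by reflection to the whole space, so it satisfies the inequality with constant \<open>\<kappa>/4\<close>.
  Cutting a general function in each direction inside a thin strip that carries little
  \<open>L\<^sup>p\<close> mass yields \<open>\<kappa>'/4 C \<le> (A + K B) B powr (2/d)\<close> for every \<open>\<kappa>' < \<kappa>\<close>. Hence a minimizing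
  sequence, normalized by \<open>B = 1\<close> and mean zero, has bounded Dirichlet integral. By compactness it
  converges in \<open>L\<^sup>2\<close> and, by the same inequality, in \<open>L\<^sup>p\<close>, so that the limit is a minimizer.
\<close>

subsection \<open>Smooth functions of one variable\<close>

text \<open>The exponent 2 + 4/d makes the quotient invariant under dilations, so a minimizing
  sequence on the cube could shrink to a point at constant quotient; this is the loss of compactness
  to be excluded. A corner is the cheapest place for it: reflection makes 2^d copies, each of the
  three integrals is multiplied by 2^d, and the power 2/d of one of these factors is the 4 of the
  theorem. Below that level, cutting gives an inequality whose error K * B contains no derivatives.
  For B = 1 it bounds the minimizing sequence, because \<kappa>'/4 exceeds G_Q. For differences v_n
  - u, where A stays bounded and B tends to 0, the right-hand side (A + K B) B^(2/d) tends to 0,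
  which is the strong L^p convergence. Estimates are proved for C1 functions on the whole space and
  transferred by density and Fatou's lemma, with gradients of the approximants controlled in norm.
  The gradient of the limit is obtained from the parallelogram law, as for the projection onto a
  closed convex set.\<close>

primrec ndiff :: "nat \<Rightarrow> (real \<Rightarrow> real) \<Rightarrow> bool" where
  "ndiff 0 f = True"
| "ndiff (Suc n) f = (\<exists>f'. (\<forall>t. (f has_real_derivative f' t) (at t)) \<and> ndiff n f')"

definition smooth1 :: "(real \<Rightarrow> real) \<Rightarrow> bool" where
  "smooth1 f \<longleftrightarrow> (\<forall>n. ndiff n f)"

lemma ndiff_SucD: "ndiff (Suc n) f \<Longrightarrow> ndiff n f"
proof (induction n arbitrary: f)
  case (Suc n)
  then obtain f' where "\<forall>t. (f has_real_derivative f' t) (at t)" "ndiff (Suc n) f'"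
    by (metis ndiff.simps(2))
  then show ?case using Suc.IH[of f'] by auto
qed simp

lemma ndiff_const: "ndiff n (\<lambda>_. c)"
proof (induction n arbitrary: c)
  case (Suc n)
  show ?case using Suc[of 0] by (auto intro!: exI[of _ "\<lambda>_. 0"])
qed simp

lemma ndiff_add: "ndiff n f \<Longrightarrow> ndiff n g \<Longrightarrow> ndiff n (\<lambda>t. f t + g t)"
proof (induction n arbitrary: f g)
  case (Suc n)
  then obtain f' g' where *: "\<forall>t. (f has_real_derivative f' t) (at t)" "ndiff n f'"
    "\<forall>t. (g has_real_derivative g' t) (at t)" "ndiff n g'" by auto
  have "((\<lambda>t. f t + g t) has_real_derivative f' t + g' t) (at t)" for t
    using * by (auto intro!: derivative_eq_intros)
  then show ?case using Suc.IH[OF *(2,4)] by (auto intro!: exI[of _ "\<lambda>t. f' t + g' t"])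
qed simp

lemma ndiff_mult: "ndiff n f \<Longrightarrow> ndiff n g \<Longrightarrow> ndiff n (\<lambda>t. f t * g t)"
proof (induction n arbitrary: f g)
  case (Suc n)
  then obtain f' g' where *: "\<forall>t. (f has_real_derivative f' t) (at t)" "ndiff n f'"
    "\<forall>t. (g has_real_derivative g' t) (at t)" "ndiff n g'" by auto
  have "((\<lambda>t. f t * g t) has_real_derivative f' t * g t + f t * g' t) (at t)" for t
    using DERIV_mult[OF *(1)[rule_format, of t] *(3)[rule_format, of t]] by (simp add: algebra_simps)
  moreover have "ndiff n (\<lambda>t. f' t * g t + f t * g' t)"
    using Suc.IH *(2,4) ndiff_SucD Suc.prems by (intro ndiff_add Suc.IH) auto
  ultimately show ?case by (auto intro!: exI[of _ "\<lambda>t. f' t * g t + f t * g' t"])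
qed simp

lemma ndiff_affine: "ndiff n f \<Longrightarrow> ndiff n (\<lambda>t. f (a * t + b))"
proof (induction n arbitrary: f)
  case (Suc n)
  then obtain f' where *: "\<forall>t. (f has_real_derivative f' t) (at t)" "ndiff n f'" by auto
  have "((\<lambda>t. f (a * t + b)) has_real_derivative a * f' (a * t + b)) (at t)" for t
  proof -
    have "((\<lambda>t. a * t + b) has_real_derivative a) (at t)"
      by (auto intro!: derivative_eq_intros)
    then show ?thesis
      using DERIV_chain2[of f "f' (a * t + b)" "\<lambda>t. a * t + b" t a UNIV] *(1)
      by (simp add: mult.commute[of "f' _"])
  qed
  moreover have "ndiff n (\<lambda>t. a * f' (a * t + b))"
    by (intro ndiff_mult ndiff_const Suc.IH *)
  ultimately show ?case by (auto intro!: exI[of _ "\<lambda>t. a * f' (a * t + b)"])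
qed simp

lemma smooth1_DERIV: "smooth1 f \<Longrightarrow> (f has_real_derivative deriv f t) (at t)"
  unfolding smooth1_def by (metis DERIV_imp_deriv ndiff.simps(2))

lemma smooth1_deriv: assumes "smooth1 f" shows "smooth1 (deriv f)"
  unfolding smooth1_def
proof
  fix n
  obtain f' where f': "\<forall>t. (f has_real_derivative f' t) (at t)" "ndiff n f'"
    using assms unfolding smooth1_def by (metis ndiff.simps(2))
  then have "deriv f = f'" using DERIV_imp_deriv by blast
  then show "ndiff n (deriv f)" using f' by simp
qed

lemma smooth1_mult: "smooth1 f \<Longrightarrow> smooth1 g \<Longrightarrow> smooth1 (\<lambda>t. f t * g t)"
  by (simp add: smooth1_def ndiff_mult)

lemma smooth1_affine: "smooth1 f \<Longrightarrow> smooth1 (\<lambda>t. f (a * t + b))"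
  by (simp add: smooth1_def ndiff_affine)

text \<open>The exponent \<open>k\<close> is free for the sake of the induction: the tail of
  \<open>pCons a p\<close> comes with one more factor y. With y = 1/h and k = 1 the expression is
  the right difference quotient of \<open>hexp\<close> at 0.\<close>

lemma poly_times_exp_tendsto_0:
  "((\<lambda>y::real. y ^ k * poly p y * exp (- y)) \<longlongrightarrow> 0) at_top"
proof (induction p arbitrary: k)
  case 0
  then show ?case by simp
next
  case (pCons a p)
  have "((\<lambda>y::real. a * (y ^ k / exp y) + y ^ Suc k * poly p y * exp (- y)) \<longlongrightarrow> a * 0 + 0) at_top"
    by (intro tendsto_intros tendsto_power_div_exp_0 pCons.IH)
  then show ?case by (simp add: algebra_simps exp_minus divide_simps)
qed

text \<open>The flat function exp(-1/t), continued by 0 to the left, times a polynomial in 1/t. The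
  polynomial factor makes the family closed under differentiation, so one derivative formula settles
  all orders.\<close>

definition hexp :: "real poly \<Rightarrow> real \<Rightarrow> real" where
  "hexp p t = (if t > 0 then poly p (inverse t) * exp (- inverse t) else 0)"

text \<open>With s = 1/t one has d/dt = - s^2 d/ds, and - s^2 (p(s) exp(-s))' = s^2 (p - p')(s)
  exp(-s); \<open>[:0,0,1:]\<close> is the polynomial s^2. At t = 0 the exponential beats every
  polynomial.\<close>

lemma DERIV_hexp: "(hexp p has_real_derivative hexp ([:0,0,1:] * (p - pderiv p)) t) (at t)"
proof -
  consider "t > 0" | "t < 0" | "t = 0" by linarith
  then show ?thesis
  proof cases
    case 1
    have "((\<lambda>t. poly p (inverse t) * exp (- inverse t)) has_real_derivative
        hexp ([:0,0,1:] * (p - pderiv p)) t) (at t)"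
      using 1
      by (auto intro!: derivative_eq_intros DERIV_chain2[OF poly_DERIV] 
          simp: hexp_def algebra_simps power2_eq_square)
    then show ?thesis
      by (rule has_field_derivative_transform_within_open[where S="{0<..}"])
         (use 1 in \<open>auto simp: hexp_def\<close>)
  next
    case 2
    have "((\<lambda>t. 0) has_real_derivative hexp ([:0,0,1:] * (p - pderiv p)) t) (at t)"
      using 2 by (simp add: hexp_def)
    then show ?thesis
      by (rule has_field_derivative_transform_within_open[where S="{..<0}"])
         (use 2 in \<open>auto simp: hexp_def\<close>)
  next
    case 3
    have r: "((\<lambda>h. hexp p h / h) \<longlongrightarrow> 0) (at_right 0)"
    proof -
      have "((\<lambda>h. (inverse h) ^ 1 * poly p (inverse h) * exp (- inverse h)) \<longlongrightarrow> 0) (at_right (0::real))"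
        using filterlim_compose[OF poly_times_exp_tendsto_0 filterlim_inverse_at_top_right] .
      then show ?thesis
        by (rule Lim_transform_eventually)
           (auto simp: eventually_at_filter hexp_def field_simps)
    qed
    have l: "((\<lambda>h. hexp p h / h) \<longlongrightarrow> 0) (at_left 0)"
      by (rule Lim_transform_eventually[OF tendsto_const])
         (auto simp: eventually_at_filter hexp_def)
    have "((\<lambda>h. hexp p h / h) \<longlongrightarrow> 0) (at 0)"
      using l r by (simp add: filterlim_split_at)
    then show ?thesis using 3 by (simp add: DERIV_def hexp_def)
  qed
qed

lemma smooth1_hexp: "smooth1 (hexp p)"
proof -
  have "ndiff n (hexp p)" for n
    by (induction n arbitrary: p) (use DERIV_hexp in auto)
  then show ?thesis by (simp add: smooth1_def)
qed

text \<open>The arguments are spelled \<open>1 * t + 1\<close> and \<open>(-1) * t + 1\<close> to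
  match the pattern of \<open>smooth1_affine\<close>.\<close>

definition bump1 :: "real \<Rightarrow> real" where
  "bump1 t = hexp 1 (1 * t + 1) * hexp 1 ((-1) * t + 1)"

lemma smooth1_bump1: "smooth1 bump1"
  unfolding bump1_def by (intro smooth1_mult smooth1_affine smooth1_hexp)

lemma bump1_nonneg: "0 \<le> bump1 t"
  by (simp add: bump1_def hexp_def)

lemma bump1_pos_iff: "bump1 t \<noteq> 0 \<longleftrightarrow> \<bar>t\<bar> < 1"
  by (auto simp: bump1_def hexp_def)

subsection \<open>Smooth functions of several variables\<close>

text \<open>Partial derivatives of a product of one-variable functions are again such products, so
  smoothness in the sense of iterated partials becomes an induction over lists. All concrete smooth
  functions of the proof have this form.\<close>

definition prodf :: "('n::finite \<Rightarrow> real \<Rightarrow> real) \<Rightarrow> real^'n \<Rightarrow> real" where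
  "prodf F x = (\<Prod>i\<in>UNIV. F i (x $ i))"

lemma prodf_deriv:
  assumes "\<And>i. smooth1 (F i)"
  shows "(prodf F has_derivative (\<lambda>y. \<Sum>i\<in>UNIV. deriv (F i) (x $ i) * y $ i * (\<Prod>j\<in>UNIV-{i}. F j (x $ j)))) (at x)"
proof -
  have "((\<lambda>x. F i (x $ i)) has_derivative (\<lambda>y. deriv (F i) (x $ i) * y $ i)) (at x)" for i
  proof -
    have "(F i has_derivative (*) (deriv (F i) (x $ i))) (at (x $ i))"
      using smooth1_DERIV[OF assms] has_field_derivative_def by blast
    moreover have "((\<lambda>x. x $ i) has_derivative (\<lambda>y. y $ i)) (at x)"
      by (simp add: bounded_linear_imp_has_derivative bounded_linear_vec_nth)
    ultimately show ?thesis
      using has_derivative_compose by fastforce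
  qed
  then show ?thesis
    unfolding prodf_def[abs_def] by (auto intro!: has_derivative_prod)
qed

lemma partial_deriv_prodf:
  assumes "\<And>i. smooth1 (F i)"
  shows "partial_deriv i (prodf F) = prodf (F(i := deriv (F i)))"
proof
  fix x
  have "partial_deriv i (prodf F) x
      = (\<Sum>j\<in>UNIV. deriv (F j) (x $ j) * axis i 1 $ j * (\<Prod>k\<in>UNIV-{j}. F k (x $ k)))"
    unfolding partial_deriv_def by (subst frechet_derivative_at[OF prodf_deriv[OF assms], symmetric]) (rule refl)
  also have "\<dots> = (\<Sum>j\<in>UNIV. if j = i then deriv (F i) (x $ i) * (\<Prod>k\<in>UNIV-{i}. F k (x $ k)) else 0)"
    by (intro sum.cong) (auto simp: axis_def)
  also have "\<dots> = deriv (F i) (x $ i) * (\<Prod>k\<in>UNIV-{i}. (F(i := deriv (F i))) k (x $ k))"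
    by (auto intro!: prod.cong)
  also have "\<dots> = prodf (F(i := deriv (F i))) x"
    unfolding prodf_def by (subst (2) prod.remove[of _ i]) auto
  finally show "partial_deriv i (prodf F) x = prodf (F(i := deriv (F i))) x" .
qed

lemma smooth_fun_prodf:
  assumes "\<And>i. smooth1 (F i)"
  shows "smooth_fun (prodf F)"
proof -
  have *: "\<exists>F'. (\<forall>i. smooth1 (F' i)) \<and> iter_partial is (prodf F) = prodf F'" for "is"
  proof (induction "is")
    case Nil
    then show ?case using assms by auto
  next
    case (Cons i "is")
    then obtain F' where F': "\<forall>i. smooth1 (F' i)" "iter_partial is (prodf F) = prodf F'" by auto
    then have "iter_partial (i # is) (prodf F) = prodf (F'(i := deriv (F' i)))"
      using partial_deriv_prodf[of F' i] by (simp only: iter_partial.simps)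
    moreover have "\<forall>j. smooth1 ((F'(i := deriv (F' i))) j)" using F' by (simp add: smooth1_deriv)
    ultimately show ?case by blast
  qed
  have "iter_partial is (prodf F) differentiable (at x)" for "is" x
  proof -
    obtain F' where F': "\<forall>i. smooth1 (F' i)" "iter_partial is (prodf F) = prodf F'"
      using *[of "is"] by blast
    then show ?thesis using differentiableI[OF prodf_deriv[of F' x]] by simp
  qed
  then show ?thesis by (simp add: smooth_fun_def)
qed

section \<open>Gradients, C1 functions and diagonal affine maps\<close>

definition grad :: "(real^'n::finite \<Rightarrow> real) \<Rightarrow> real^'n \<Rightarrow> real^'n" where
  "grad f x = (\<chi> i. partial_deriv i f x)"

text \<open>The gradient is a second argument, as in the Sobolev predicates. The inequalities on the
  cube are first proved for functions of this class, which live on the whole space.\<close>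

definition C1 :: "(real^'n::finite \<Rightarrow> real) \<Rightarrow> (real^'n \<Rightarrow> real^'n) \<Rightarrow> bool" where
  "C1 f D \<longleftrightarrow> (\<forall>x. (f has_derivative (\<lambda>h. D x \<bullet> h)) (at x)) \<and> continuous_on UNIV D"

lemma has_derivative_imp_partial:
  assumes "(f has_derivative (\<lambda>h. D \<bullet> h)) (at x)"
  shows "partial_deriv i f x = D $ i"
  using frechet_derivative_at[OF assms] unfolding partial_deriv_def
  by (metis inner_axis inner_real_def mult.right_neutral)

lemma differentiable_imp_grad:
  assumes "f differentiable (at x)"
  shows "(f has_derivative (\<lambda>h. grad f x \<bullet> h)) (at x)"
proof -
  let ?D = "frechet_derivative f (at x)"
  have D: "(f has_derivative ?D) (at x)" using assms frechet_derivative_works by blast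
  interpret D: linear ?D using D has_derivative_linear by blast
  have "?D h = grad f x \<bullet> h" for h
  proof -
    have "?D h = ?D (\<Sum>i\<in>UNIV. h $ i *\<^sub>R axis i 1)"
      using basis_expansion[of h] by (simp add: scalar_mult_eq_scaleR)
    also have "\<dots> = (\<Sum>i\<in>UNIV. h $ i * partial_deriv i f x)"
      by (simp add: D.sum D.scale partial_deriv_def)
    finally show ?thesis by (simp add: inner_vec_def grad_def mult.commute)
  qed
  then show ?thesis using D by (metis (no_types, lifting) ext)
qed

lemma smooth_fun_C1: "smooth_fun f \<Longrightarrow> C1 f (grad f)"
  unfolding C1_def
proof
  assume s: "smooth_fun f"
  show "\<forall>x. (f has_derivative (\<lambda>h. grad f x \<bullet> h)) (at x)"
    using s unfolding smooth_fun_def by (metis differentiable_imp_grad iter_partial.simps(1))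
  have "partial_deriv i f differentiable (at x)" for i x
    using s unfolding smooth_fun_def by (metis iter_partial.simps)
  then have "continuous_on UNIV (partial_deriv i f)" for i
    by (simp add: continuous_at_imp_continuous_on differentiable_imp_continuous_within)
  then show "continuous_on UNIV (grad f)"
    unfolding grad_def by (intro continuous_on_vec_lambda) auto
qed

text \<open>Axis-parallel affine maps. Translations, dilations, reflections of single coordinates,
  contractions of the cube and maps onto subcubes are all of this form, so one change of variables
  serves the whole proof.\<close>

definition diag :: "('n::finite \<Rightarrow> real) \<Rightarrow> real^'n \<Rightarrow> real^'n \<Rightarrow> real^'n" where
  "diag m t x = (\<chi> i. t $ i + m i * x $ i)"

lemma diag_nth [simp]: "diag m t x $ i = t $ i + m i * x $ i"
  by (simp add: diag_def)

lemma diag_has_derivative: "(diag m t has_derivative diag m 0) (at x within S)"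
proof -
  have "linear (diag m 0)"
    by (auto simp: linear_iff vec_eq_iff algebra_simps)
  then have "bounded_linear (diag m 0)" by (rule linear_conv_bounded_linear[THEN iffD1])
  then have "((\<lambda>x. t + diag m 0 x) has_derivative (\<lambda>h. 0 + diag m 0 h)) (at x within S)"
    by (intro has_derivative_add has_derivative_const bounded_linear_imp_has_derivative)
  moreover have "(\<lambda>x. t + diag m 0 x) = diag m t" by (auto simp: vec_eq_iff)
  ultimately show ?thesis by simp
qed

lemma continuous_on_diag: "continuous_on S (diag m t)"
  using diag_has_derivative by (meson continuous_on_eq_continuous_within has_derivative_continuous)

lemma C1_diag:
  assumes "C1 f D"
  shows "C1 (\<lambda>x. f (diag m t x)) (\<lambda>x. \<chi> i. m i * D (diag m t x) $ i)"
  unfolding C1_def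
proof safe
  fix x
  have "((\<lambda>x. f (diag m t x)) has_derivative (\<lambda>h. D (diag m t x) \<bullet> diag m 0 h)) (at x)"
    using has_derivative_compose[OF diag_has_derivative] assms unfolding C1_def by blast
  then show "((\<lambda>x. f (diag m t x)) has_derivative (\<bullet>) (\<chi> i. m i * D (diag m t x) $ i)) (at x)"
    by (rule has_derivative_eq_rhs) (auto simp: inner_vec_def algebra_simps)
next
  show "continuous_on UNIV (\<lambda>x. \<chi> i. m i * D (diag m t x) $ i)"
    using assms unfolding C1_def
    by (intro continuous_intros continuous_on_compose2[OF _ continuous_on_diag]) auto
qed

lemma partial_deriv_cmult_diag:
  assumes "\<And>x. f differentiable (at x)"
  shows "partial_deriv i (\<lambda>x. c * f (diag m t x)) = (\<lambda>x. c * m i * partial_deriv i f (diag m t x))"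
    and "(\<lambda>x. c * f (diag m t x)) differentiable (at x)"
proof -
  have *: "((\<lambda>x. c * f (diag m t x)) has_derivative
     (\<lambda>h. (\<chi> i. c * m i * partial_deriv i f (diag m t x)) \<bullet> h)) (at x)" for x
  proof -
    have "((\<lambda>x. f (diag m t x)) has_derivative (\<lambda>h. grad f (diag m t x) \<bullet> diag m 0 h)) (at x)"
      using has_derivative_compose[OF diag_has_derivative differentiable_imp_grad[OF assms]] .
    then have "((\<lambda>x. c * f (diag m t x)) has_derivative (\<lambda>h. c * (grad f (diag m t x) \<bullet> diag m 0 h))) (at x)"
      by (intro has_derivative_mult_right)
    then show ?thesis
      by (rule has_derivative_eq_rhs) (auto simp: inner_vec_def algebra_simps grad_def sum_distrib_left)
  qed
  show "(\<lambda>x. c * f (diag m t x)) differentiable (at x)" using * differentiableI by blast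
  show "partial_deriv i (\<lambda>x. c * f (diag m t x)) = (\<lambda>x. c * m i * partial_deriv i f (diag m t x))"
    using has_derivative_imp_partial[OF *] by auto
qed

text \<open>By the chain rule each partial derivative contributes a constant factor, so an iterated
  partial of the composition is a multiple of the same iterated partial of \<open>f\<close> after
  the map; this shape survives the induction over the list.\<close>

lemma smooth_fun_diag:
  assumes "smooth_fun f"
  shows "smooth_fun (\<lambda>x. f (diag m t x))"
proof -
  have d: "\<And>is x. iter_partial is f differentiable (at x)" using assms by (simp add: smooth_fun_def)
  have *: "\<exists>c. iter_partial is (\<lambda>x. f (diag m t x)) = (\<lambda>x. c * iter_partial is f (diag m t x))" for "is"
  proof (induction "is")
    case Nil
    then show ?case by (auto intro!: exI[of _ 1])
  next
    case (Cons i "is")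
    then obtain c where "iter_partial is (\<lambda>x. f (diag m t x)) = (\<lambda>x. c * iter_partial is f (diag m t x))" by auto
    then show ?case using partial_deriv_cmult_diag(1)[OF d] by auto
  qed
  show ?thesis unfolding smooth_fun_def
  proof (intro allI)
    fix "is" x
    obtain c where "iter_partial is (\<lambda>x. f (diag m t x)) = (\<lambda>x. c * iter_partial is f (diag m t x))"
      using * by blast
    then show "iter_partial is (\<lambda>x. f (diag m t x)) differentiable at x"
      using partial_deriv_cmult_diag(2)[OF d] by simp
  qed
qed

lemma C1_continuous: "C1 f D \<Longrightarrow> continuous_on S f"
  unfolding C1_def by (rule has_derivative_continuous_on[where f'="\<lambda>x h. D x \<bullet> h"]) (simp add: has_derivative_at_withinI)

lemma C1_continuous_grad: "C1 f D \<Longrightarrow> continuous_on S D"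
  unfolding C1_def using continuous_on_subset by blast

lemma closure_support_outside:
  assumes "x \<notin> closure {x. f x \<noteq> 0}"
  shows "f x = (0::real)" "partial_deriv i f x = 0"
proof -
  show "f x = 0" using assms closure_subset[of "{x. f x \<noteq> 0}"] by blast
  have "((\<lambda>x. 0) has_derivative (\<lambda>h. 0 \<bullet> h)) (at x)" by simp
  then have "(f has_derivative (\<lambda>h. 0 \<bullet> h)) (at x)"
  proof (rule has_derivative_transform_within_open[where s="- closure {x. f x \<noteq> 0}"])
    show "\<And>y. y \<in> - closure {x. f x \<noteq> 0} \<Longrightarrow> 0 = f y"
      using closure_subset by (metis (mono_tags, lifting) ComplD mem_Collect_eq subsetD)
  qed (use assms in auto)
  from has_derivative_imp_partial[OF this, of i] show "partial_deriv i f x = 0" by simp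
qed

subsection \<open>Change of variables by diagonal affine maps\<close>

lemma Basis_vec_real: "(Basis :: (real^'n::finite) set) = range (\<lambda>i. axis i 1)"
  by (auto simp: Basis_vec_def)

lemma inj_axis_one: "inj (\<lambda>i::'n::finite. axis i (1::real))"
  by (auto simp: inj_on_def axis_eq_axis)

lemma
  fixes m :: "'n::finite \<Rightarrow> real"
  assumes m: "\<And>i. m i \<noteq> 0"
  shows lebesgue_diag: "lebesgue = density (distr lebesgue lebesgue (diag m t)) (\<lambda>_. ennreal (\<Prod>i\<in>UNIV. \<bar>m i\<bar>))"
    and diag_measurable_lebesgue: "diag m t \<in> lebesgue \<rightarrow>\<^sub>M lebesgue"
proof -
  \<comment> \<open>The affine change of variables for \<open>lebesgue\<close> indexes its factors
    by basis vectors; \<open>c\<close> translates, taking the value \<open>m i\<close> at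
    \<open>axis i 1\<close>.\<close>
  define c :: "real^'n \<Rightarrow> real" where "c j = (\<Sum>i\<in>UNIV. m i * j $ i)" for j
  have c: "c (axis i 1) = m i" for i
    by (simp add: c_def axis_def if_distrib cong: if_cong)
  have c0: "\<And>j. j \<in> Basis \<Longrightarrow> c j \<noteq> 0" using m c by (auto simp: Basis_vec_real)
  have T: "(\<lambda>x. t + (\<Sum>j\<in>Basis. (c j * (x \<bullet> j)) *\<^sub>R j)) = diag m t"
  proof
    fix x
    have "(\<Sum>j\<in>Basis. (c j * (x \<bullet> j)) *\<^sub>R j) = (\<Sum>i\<in>UNIV. (m i * x $ i) *\<^sub>R axis i 1)"
      unfolding Basis_vec_real sum.reindex[OF inj_axis_one] by (simp add: c inner_axis)
    then show "t + (\<Sum>j\<in>Basis. (c j * (x \<bullet> j)) *\<^sub>R j) = diag m t x"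
      by (simp add: vec_eq_iff axis_def if_distrib cong: if_cong)
  qed
  have P: "(\<Prod>j\<in>Basis. \<bar>c j\<bar>) = (\<Prod>i\<in>UNIV. \<bar>m i\<bar>)"
    by (simp add: Basis_vec_real prod.reindex[OF inj_axis_one] c)
  show "lebesgue = density (distr lebesgue lebesgue (diag m t)) (\<lambda>_. ennreal (\<Prod>i\<in>UNIV. \<bar>m i\<bar>))"
    using lebesgue_affine_euclidean[of c t, OF c0] unfolding T P .
  show "diag m t \<in> lebesgue \<rightarrow>\<^sub>M lebesgue"
    using lebesgue_affine_measurable[of c t, OF c0] unfolding T .
qed

lemma nn_integral_diag:
  fixes m :: "'n::finite \<Rightarrow> real"
  assumes m: "\<And>i. m i \<noteq> 0" and f[measurable]: "f \<in> borel_measurable lebesgue"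
  shows "(\<integral>\<^sup>+x. f x \<partial>lebesgue) = ennreal (\<Prod>i\<in>UNIV. \<bar>m i\<bar>) * (\<integral>\<^sup>+x. f (diag m t x) \<partial>lebesgue)"
proof -
  note [measurable] = diag_measurable_lebesgue[OF m, where t=t]
  have "(\<integral>\<^sup>+x. f x \<partial>lebesgue) = (\<integral>\<^sup>+x. f x \<partial>density (distr lebesgue lebesgue (diag m t)) (\<lambda>_. ennreal (\<Prod>i\<in>UNIV. \<bar>m i\<bar>)))"
    using lebesgue_diag[OF m, where t=t] by simp
  also have "\<dots> = ennreal (\<Prod>i\<in>UNIV. \<bar>m i\<bar>) * (\<integral>\<^sup>+x. f (diag m t x) \<partial>lebesgue)"
    by (subst nn_integral_density) (auto simp: nn_integral_distr nn_integral_cmult)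
  finally show ?thesis .
qed

lemma
  fixes m :: "'n::finite \<Rightarrow> real" and f :: "real^'n \<Rightarrow> real"
  assumes m: "\<And>i. m i \<noteq> 0" and f: "integrable lebesgue f"
  shows integrable_diag: "integrable lebesgue (\<lambda>x. f (diag m t x))"
    and integral_diag: "(\<integral>x. f x \<partial>lebesgue) = (\<Prod>i\<in>UNIV. \<bar>m i\<bar>) * (\<integral>x. f (diag m t x) \<partial>lebesgue)"
proof -
  note [measurable] = diag_measurable_lebesgue[OF m, where t=t] borel_measurable_integrable[OF f]
  let ?P = "\<Prod>i\<in>UNIV. \<bar>m i\<bar>"
  have P: "?P > 0" using m by (simp add: prod_pos)
  have i: "integrable (density (distr lebesgue lebesgue (diag m t)) (\<lambda>_. ennreal ?P)) f"
    using f lebesgue_diag[OF m, where t=t] by simp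
  then have "integrable (distr lebesgue lebesgue (diag m t)) (\<lambda>x. ?P *\<^sub>R f x)"
    using P by (subst (asm) integrable_density) auto
  then have "integrable lebesgue (\<lambda>x. ?P *\<^sub>R f (diag m t x))"
    by (subst (asm) integrable_distr_eq) auto
  then show "integrable lebesgue (\<lambda>x. f (diag m t x))"
    using P m by simp
  have "(\<integral>x. f x \<partial>lebesgue) = (\<integral>x. f x \<partial>density (distr lebesgue lebesgue (diag m t)) (\<lambda>_. ennreal ?P))"
    using lebesgue_diag[OF m, where t=t] by simp
  also have "\<dots> = (\<integral>x. ?P *\<^sub>R f x \<partial>distr lebesgue lebesgue (diag m t))"
    using P by (subst integral_density) auto
  also have "\<dots> = ?P * (\<integral>x. f (diag m t x) \<partial>lebesgue)"
    by (subst integral_distr) auto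
  finally show "(\<integral>x. f x \<partial>lebesgue) = ?P * (\<integral>x. f (diag m t x) \<partial>lebesgue)" .
qed

lemma diag_inverse:
  assumes "\<And>i. m i \<noteq> 0"
  shows "diag m t (diag (\<lambda>i. 1 / m i) (\<chi> i. - t $ i / m i) x) = x"
    and "diag (\<lambda>i. 1 / m i) (\<chi> i. - t $ i / m i) (diag m t x) = x"
  using assms by (auto simp: vec_eq_iff field_simps)

lemma integrable_diag_iff:
  fixes m :: "'n::finite \<Rightarrow> real" and f :: "real^'n \<Rightarrow> real"
  assumes m: "\<And>i. m i \<noteq> 0"
  shows "integrable lebesgue (\<lambda>x. f (diag m t x)) \<longleftrightarrow> integrable lebesgue f"
proof
  assume "integrable lebesgue (\<lambda>x. f (diag m t x))"
  from integrable_diag[OF _ this, of "\<lambda>i. 1 / m i" "\<chi> i. - t $ i / m i"]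
  show "integrable lebesgue f" using m by (simp only: diag_inverse(1)[OF m]) simp
qed (rule integrable_diag[OF m])

text \<open>No integrability is assumed: a diagonal map preserves non-integrability, and the Bochner
  integral of a non-integrable function is 0 on both sides.\<close>

lemma integral_diag':
  fixes m :: "'n::finite \<Rightarrow> real" and f :: "real^'n \<Rightarrow> real"
  assumes m: "\<And>i. m i \<noteq> 0"
  shows "(\<integral>x. f x \<partial>lebesgue) = (\<Prod>i\<in>UNIV. \<bar>m i\<bar>) * (\<integral>x. f (diag m t x) \<partial>lebesgue)"
proof (cases "integrable lebesgue f")
  case True
  then show ?thesis by (rule integral_diag[OF m])
next
  case False
  then have "\<not> integrable lebesgue (\<lambda>x. f (diag m t x))" using integrable_diag_iff[OF m, where f=f and t=t] by simp
  then show ?thesis using False by (simp add: not_integrable_integral_eq)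
qed

subsection \<open>Integration by parts\<close>

lemma borel_measurable_lebesgue_continuous:
  fixes f :: "real^'n::finite \<Rightarrow> 'b::{metric_space}"
  assumes "continuous_on UNIV f"
  shows "f \<in> borel_measurable lebesgue"
proof -
  have "f \<in> borel_measurable lborel" using borel_measurable_continuous_onI[OF assms] by simp
  then show ?thesis by (rule measurable_completion)
qed

lemma continuous_compact_support_bounded:
  fixes f :: "'a::heine_borel \<Rightarrow> 'b::real_normed_vector"
  assumes "continuous_on UNIV f" "\<And>x. x \<notin> K \<Longrightarrow> f x = 0" "compact K"
  obtains M where "M \<ge> 0" "\<And>x. norm (f x) \<le> M"
proof -
  have "bounded (f ` K)"
    using assms by (intro compact_imp_bounded compact_continuous_image) (auto intro: continuous_on_subset)
  then obtain M where M: "\<And>x. x \<in> K \<Longrightarrow> norm (f x) \<le> M" by (auto simp: bounded_iff)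
  have "norm (f x) \<le> max M 0" for x
    using M[of x] assms(2)[of x] by (cases "x \<in> K") auto
  then show ?thesis using that[of "max M 0"] by auto
qed

lemma integrable_bounded_support:
  fixes f :: "real^'n::finite \<Rightarrow> real"
  assumes "f \<in> borel_measurable lebesgue" "\<And>x. x \<notin> K \<Longrightarrow> f x = 0" "K \<in> lmeasurable" "\<And>x. \<bar>f x\<bar> \<le> M"
  shows "integrable lebesgue f"
proof (rule Bochner_Integration.integrable_bound)
  show "integrable lebesgue (\<lambda>x. M * indicator K x :: real)"
    using assms(3) by (auto simp: fmeasurable_def)
  show "AE x in lebesgue. norm (f x) \<le> norm (M * indicator K x :: real)"
    using assms(2,4) by (auto simp: indicator_def intro!: AE_I2 order_trans[OF assms(4)])
qed fact

text \<open>Difference quotients integrate to 0 by translation invariance, and the Lipschitz bound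
  dominates them on a fixed ball, so their almost everywhere limit integrates to 0 as well.
  Differentiability almost everywhere admits functions with kinks, such as even reflections.\<close>

lemma integral_partial_eq_0:
  fixes F D :: "real^'n::finite \<Rightarrow> real"
  assumes F: "continuous_on UNIV F" "\<And>x. x \<notin> K \<Longrightarrow> F x = 0" "compact K"
    and L: "\<delta> > 0" "\<And>x h. \<bar>h\<bar> < \<delta> \<Longrightarrow> \<bar>F (x + h *\<^sub>R axis i 1) - F x\<bar> \<le> L * \<bar>h\<bar>"
    and D: "D \<in> borel_measurable lebesgue"
    and ae: "AE x in lebesgue. ((\<lambda>h. (F (x + h *\<^sub>R axis i 1) - F x) / h) \<longlongrightarrow> D x) (at 0)"
  shows "integrable lebesgue D" "(\<integral>x. D x \<partial>lebesgue) = 0"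
proof -
  let ?e = "axis i 1 :: real^'n"
  \<comment> \<open>The summand 2 keeps the increments strictly below \<delta> from n = 0
    on.\<close>
  define h where "h n = \<delta> / (real n + 2)" for n
  have h: "0 < h n" "h n < \<delta>" for n using L(1) mult_pos_pos[of \<delta> "real n + 1"] by (auto simp: h_def field_simps)
  define s where "s n x = (F (x + h n *\<^sub>R ?e) - F x) / h n" for n x
  have h0: "h \<longlonglongrightarrow> 0" unfolding h_def by real_asymp
  then have hat: "filterlim h (at 0) sequentially"
    using h by (auto simp: filterlim_at eventually_sequentially intro!: exI[of _ 0]) (metis less_irrefl)
  obtain R where R: "\<And>x. x \<in> K \<Longrightarrow> norm x \<le> R"
    using F(3) compact_imp_bounded bounded_iff by metis
  \<comment> \<open>Shifts by less than \<delta> keep the support inside this enlarged ball, which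
    carries the dominating function for all n.\<close>
  define B where "B = cball (0::real^'n) (R + \<delta>)"
  have [measurable]: "B \<in> sets lebesgue" "B \<in> lmeasurable" by (auto simp: B_def)
  have F0: "F x = 0 \<and> F (x + h n *\<^sub>R ?e) = 0" if "x \<notin> B" for x n
  proof -
    have "norm x > R + \<delta>" using that by (auto simp: B_def)
    moreover have "norm x \<le> norm (x + h n *\<^sub>R ?e) + h n"
      using norm_triangle_ineq4[of "x + h n *\<^sub>R ?e" "h n *\<^sub>R ?e"] h[of n] by simp
    ultimately have "norm (x + h n *\<^sub>R ?e) > R" "norm x > R" using h[of n] by linarith+
    then have "x \<notin> K" "x + h n *\<^sub>R ?e \<notin> K" using R by force+
    then show ?thesis using F(2) by auto
  qed
  have L0: "L \<ge> 0" using order_trans[OF abs_ge_zero L(2)[of "h 0" 0]] h[of 0]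
    by (simp add: zero_le_mult_iff)
  have bound: "\<bar>s n x\<bar> \<le> L * indicator B x" for n x
  proof (cases "x \<in> B")
    case True
    have "\<bar>F (x + h n *\<^sub>R ?e) - F x\<bar> \<le> L * h n" using L(2)[of "h n" x] h[of n] by simp
    then show ?thesis using h[of n] True by (simp add: s_def abs_divide divide_le_eq)
  qed (use F0 in \<open>simp add: s_def\<close>)
  have intF: "integrable lebesgue F"
  proof -
    obtain M where "M \<ge> 0" "\<And>x. norm (F x) \<le> M" using continuous_compact_support_bounded[OF F] by metis
    then show ?thesis using F 
      by (intro integrable_bounded_support[where K=K and M=M])
         (auto intro: borel_measurable_lebesgue_continuous lmeasurable_compact)
  qed
  have tr: "diag (\<lambda>_. 1) (h n *\<^sub>R ?e) x = x + h n *\<^sub>R ?e" for n x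
    by (auto simp: vec_eq_iff)
  have intF': "integrable lebesgue (\<lambda>x. F (x + h n *\<^sub>R ?e))"
    and eqF: "(\<integral>x. F (x + h n *\<^sub>R ?e) \<partial>lebesgue) = (\<integral>x. F x \<partial>lebesgue)" for n
    using integrable_diag[OF _ intF, of "\<lambda>_. 1" "h n *\<^sub>R ?e"] integral_diag[OF _ intF, of "\<lambda>_. 1" "h n *\<^sub>R ?e"]
    by (auto simp: tr)
  have ints: "(\<integral>x. s n x \<partial>lebesgue) = 0" for n
    unfolding s_def using intF intF' eqF by simp
  have ae': "AE x in lebesgue. (\<lambda>n. s n x) \<longlonglongrightarrow> D x"
    using ae unfolding s_def by eventually_elim (rule filterlim_compose[OF _ hat])
  have s_meas: "s n \<in> borel_measurable lebesgue" for n
    unfolding s_def using intF intF'[of n] by (intro borel_measurable_divide borel_measurable_diff) auto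
  have w: "integrable lebesgue (\<lambda>x. L * indicator B x :: real)"
    using \<open>B \<in> lmeasurable\<close> by (auto simp: fmeasurable_def)
  have bd: "AE x in lebesgue. norm (s n x) \<le> L * indicator B x" for n
    using bound by auto
  show "integrable lebesgue D"
    by (rule integrable_dominated_convergence[OF D s_meas w ae' bd])
  have "(\<lambda>n. \<integral>x. s n x \<partial>lebesgue) \<longlonglongrightarrow> (\<integral>x. D x \<partial>lebesgue)"
    by (rule integral_dominated_convergence[OF D s_meas w ae' bd])
  then show "(\<integral>x. D x \<partial>lebesgue) = 0"
    unfolding ints by (simp add: LIMSEQ_const_iff)
qed

lemma test_funsD:
  assumes "\<phi> \<in> test_funs S"
  shows "C1 \<phi> (grad \<phi>)" "compact (closure {x. \<phi> x \<noteq> 0})" "closure {x. \<phi> x \<noteq> 0} \<subseteq> S"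
    "\<And>x. x \<notin> closure {x. \<phi> x \<noteq> 0} \<Longrightarrow> \<phi> x = 0"
    "\<And>x i. x \<notin> closure {x. \<phi> x \<noteq> 0} \<Longrightarrow> partial_deriv i \<phi> x = 0"
    "continuous_on UNIV \<phi>" "\<And>i. continuous_on UNIV (partial_deriv i \<phi>)"
proof -
  show *: "C1 \<phi> (grad \<phi>)" "compact (closure {x. \<phi> x \<noteq> 0})" "closure {x. \<phi> x \<noteq> 0} \<subseteq> S"
    using assms smooth_fun_C1 by (auto simp: test_funs_def)
  show "\<And>x. x \<notin> closure {x. \<phi> x \<noteq> 0} \<Longrightarrow> \<phi> x = 0"
    "\<And>x i. x \<notin> closure {x. \<phi> x \<noteq> 0} \<Longrightarrow> partial_deriv i \<phi> x = 0"
    by (fact closure_support_outside)+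
  show "continuous_on UNIV \<phi>" using C1_continuous[OF *(1)] .
  show "continuous_on UNIV (partial_deriv i \<phi>)" for i
    using continuous_on_component[OF C1_continuous_grad[OF *(1), of UNIV], of i]
    by (simp add: grad_def)
qed

lemma C1_directional:
  assumes "C1 f D"
  shows "((\<lambda>h. (f (x + h *\<^sub>R axis i 1) - f x) / h) \<longlongrightarrow> D x $ i) (at 0)"
proof -
  have "(f has_derivative (\<lambda>h. D x \<bullet> h)) (at (x + 0 *\<^sub>R axis i 1))" using assms by (simp add: C1_def)
  moreover have "((\<lambda>h. x + h *\<^sub>R axis i 1) has_derivative (\<lambda>h. h *\<^sub>R axis i 1)) (at (0::real))"
    by (auto intro!: derivative_eq_intros)
  ultimately have "((\<lambda>h. f (x + h *\<^sub>R axis i 1)) has_derivative (\<lambda>h. D x \<bullet> (h *\<^sub>R axis i 1))) (at 0)"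
    using has_derivative_compose by blast
  then have "((\<lambda>h. f (x + h *\<^sub>R axis i 1)) has_derivative (*) (D x $ i)) (at 0)"
    by (rule has_derivative_eq_rhs) (auto simp: inner_axis mult.commute)
  then have "((\<lambda>h. f (x + h *\<^sub>R axis i 1)) has_real_derivative D x $ i) (at 0)"
    by (simp add: has_field_derivative_def)
  then show ?thesis by (simp add: DERIV_def)
qed

lemma C1_lipschitz_convex:
  assumes f: "C1 f D" and S: "convex S" and M: "\<And>x. x \<in> S \<Longrightarrow> norm (D x) \<le> M" and "x \<in> S" "y \<in> S"
  shows "\<bar>f x - f y\<bar> \<le> M * norm (x - y)"
proof -
  have "norm (f x - f y) \<le> M * norm (x - y)"
  proof (rule differentiable_bound[OF S _ _ \<open>x \<in> S\<close> \<open>y \<in> S\<close>])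
    show "(f has_derivative (\<lambda>h. D x \<bullet> h)) (at x within S)" for x
      using f by (simp add: C1_def has_derivative_at_withinI)
    show "onorm (\<lambda>h. D x \<bullet> h) \<le> M" if "x \<in> S" for x
    proof (rule onorm_le)
      fix h
      have "\<bar>D x \<bullet> h\<bar> \<le> norm (D x) * norm h" by (rule Cauchy_Schwarz_ineq2)
      also have "\<dots> \<le> M * norm h" using M[OF that] by (rule mult_right_mono) simp
      finally show "norm (D x \<bullet> h) \<le> M * norm h" by simp
    qed
  qed
  then show ?thesis by simp
qed

lemma test_funs_lipschitz:
  assumes "\<phi> \<in> test_funs S"
  obtains L M where "L \<ge> 0" "M \<ge> 0" "\<And>x. \<bar>\<phi> x\<bar> \<le> M" "\<And>x i. \<bar>partial_deriv i \<phi> x\<bar> \<le> L"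
    "\<And>x y. \<bar>\<phi> x - \<phi> y\<bar> \<le> L * norm (x - y)"
proof -
  note T = test_funsD[OF assms]
  have g0: "x \<notin> closure {x. \<phi> x \<noteq> 0} \<Longrightarrow> grad \<phi> x = 0" for x
    using T(5) by (auto simp: grad_def vec_eq_iff)
  have gc: "continuous_on UNIV (grad \<phi>)" using T(1) by (simp add: C1_def)
  obtain L where L: "L \<ge> 0" "\<And>x. norm (grad \<phi> x) \<le> L"
    using continuous_compact_support_bounded[OF gc g0 T(2)] by metis
  obtain M where M: "M \<ge> 0" "\<And>x. norm (\<phi> x) \<le> M"
    using continuous_compact_support_bounded[OF T(6) T(4) T(2)] by metis
  show thesis
  proof (rule that[OF L(1) M(1)])
    show "\<bar>partial_deriv i \<phi> x\<bar> \<le> L" for i x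
      using component_le_norm_cart[of "grad \<phi> x" i] L(2)[of x] by (simp add: grad_def)
    show "\<bar>\<phi> x - \<phi> y\<bar> \<le> L * norm (x - y)" for x y
      by (rule C1_lipschitz_convex[OF T(1) convex_UNIV]) (use L in auto)
  qed (use M in auto)
qed

section \<open>Calculus of weak gradients\<close>

lemma set_integral_test:
  fixes f :: "real^'n::finite \<Rightarrow> real"
  assumes "\<And>x. x \<notin> S \<Longrightarrow> f x = 0"
  shows "(LINT x:S|lebesgue. f x) = (\<integral>x. f x \<partial>lebesgue)"
  unfolding set_lebesgue_integral_def using assms
  by (intro Bochner_Integration.integral_cong) (auto simp: indicator_def)

text \<open>Test functions and their partials vanish outside \<open>S\<close>, so both integrals can
  be taken over the whole space, where the change of variables and dominated convergence
  apply.\<close>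

lemma weak_gradient_iff:
  "weak_gradient S u g \<longleftrightarrow>
     (\<forall>K. compact K \<and> K \<subseteq> S \<longrightarrow>
        set_integrable lebesgue K u \<and> (\<forall>i. set_integrable lebesgue K (\<lambda>x. g x $ i))) \<and>
     (\<forall>\<phi>\<in>test_funs S. \<forall>i.
        (\<integral>x. u x * partial_deriv i \<phi> x \<partial>lebesgue) = - (\<integral>x. g x $ i * \<phi> x \<partial>lebesgue))"
proof -
  have "(LINT x:S|lebesgue. u x * partial_deriv i \<phi> x) = (\<integral>x. u x * partial_deriv i \<phi> x \<partial>lebesgue)"
    "(LINT x:S|lebesgue. g x $ i * \<phi> x) = (\<integral>x. g x $ i * \<phi> x \<partial>lebesgue)"
    if "\<phi> \<in> test_funs S" for \<phi> i
  proof -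
    note T = test_funsD(3,4,5)[OF that]
    have "\<phi> x = 0 \<and> partial_deriv i \<phi> x = 0" if "x \<notin> S" for x using T that by blast
    then show "(LINT x:S|lebesgue. u x * partial_deriv i \<phi> x) = (\<integral>x. u x * partial_deriv i \<phi> x \<partial>lebesgue)"
      "(LINT x:S|lebesgue. g x $ i * \<phi> x) = (\<integral>x. g x $ i * \<phi> x \<partial>lebesgue)"
      by (simp_all add: set_integral_test)
  qed
  then show ?thesis unfolding weak_gradient_def by (intro conj_cong ball_cong) auto
qed

lemma weak_gradient_mono:
  assumes "weak_gradient S u g" "T \<subseteq> S"
  shows "weak_gradient T u g"
  using assms unfolding weak_gradient_iff test_funs_def by blast

text \<open>A test function on \<open>T\<close> is transported to \<open>S\<close> by the inverse
  map; the chain rule produces the factor \<open>m i\<close> on both sides, and the Jacobian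
  cancels.\<close>

lemma weak_gradient_diag:
  fixes m :: "'n::finite \<Rightarrow> real" and u :: "real^'n \<Rightarrow> real"
  assumes w: "weak_gradient S u g" and m: "\<And>i. m i \<noteq> 0" and T: "diag m t ` T \<subseteq> S"
  shows "weak_gradient T (\<lambda>x. u (diag m t x)) (\<lambda>x. \<chi> i. m i * g (diag m t x) $ i)"
proof -
  let ?P = "\<Prod>i\<in>UNIV. \<bar>m i\<bar>"
  have P: "?P > 0" using m by (simp add: prod_pos)
  define m' t' where "m' = (\<lambda>i. 1 / m i)" and "t' = (\<chi> i. - t $ i / m i)"
  have inv: "diag m t (diag m' t' x) = x" "diag m' t' (diag m t x) = x" for x
    unfolding m'_def t'_def by (rule diag_inverse, rule m)+
  have "inj (diag m t)" by (rule inj_on_inverseI[where g="diag m' t'"]) (rule inv(2))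
  then have inj: "diag m t x \<in> diag m t ` K \<longleftrightarrow> x \<in> K" for x K by (simp add: inj_image_mem_iff)
  have int: "set_integrable lebesgue K (\<lambda>x. f (diag m t x))" if "set_integrable lebesgue (diag m t ` K) f"
    for f :: "real^'n \<Rightarrow> real" and K
    using integrable_diag[where m=m and t=t, OF m that[unfolded set_integrable_def]]
    unfolding set_integrable_def by (simp add: indicator_def inj)
  show ?thesis unfolding weak_gradient_iff
  proof (intro conjI allI impI ballI)
    fix K assume K: "compact K \<and> K \<subseteq> T"
    then have "compact (diag m t ` K)" "diag m t ` K \<subseteq> S"
      using T by (auto intro!: compact_continuous_image continuous_on_diag)
    then have si: "set_integrable lebesgue (diag m t ` K) u" "\<And>i. set_integrable lebesgue (diag m t ` K) (\<lambda>x. g x $ i)"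
      using w unfolding weak_gradient_def by auto
    show "set_integrable lebesgue K (\<lambda>x. u (diag m t x))" using int[OF si(1)] .
    show "set_integrable lebesgue K (\<lambda>x. (\<chi> i. m i * g (diag m t x) $ i) $ i)" for i
      using set_integrable_mult_right[OF int[OF si(2)[of i]], of "m i"] by simp
  next
    fix \<phi> i assume \<phi>: "\<phi> \<in> test_funs T"
    define \<psi> where "\<psi> y = \<phi> (diag m' t' y)" for y
    have \<psi>\<phi>: "\<phi> = (\<lambda>x. \<psi> (diag m t x))" by (simp add: \<psi>_def inv fun_eq_iff)
    have sm: "smooth_fun \<psi>" unfolding \<psi>_def using \<phi> by (auto simp: test_funs_def intro: smooth_fun_diag)
    let ?K = "closure {x. \<phi> x \<noteq> 0}"
    have c: "compact (diag m t ` ?K)" "diag m t ` ?K \<subseteq> S"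
      using test_funsD(2,3)[OF \<phi>] T by (auto intro!: compact_continuous_image continuous_on_diag)
    have "{y. \<psi> y \<noteq> 0} \<subseteq> diag m t ` ?K"
    proof
      fix y assume "y \<in> {y. \<psi> y \<noteq> 0}"
      then have "diag m' t' y \<in> ?K" using closure_subset[of "{x. \<phi> x \<noteq> 0}"] by (auto simp: \<psi>_def)
      then show "y \<in> diag m t ` ?K" by (metis image_eqI inv(1))
    qed
    then have sub: "closure {y. \<psi> y \<noteq> 0} \<subseteq> diag m t ` ?K"
      using c(1) by (simp add: closure_minimal compact_imp_closed)
    then have "compact (closure {y. \<psi> y \<noteq> 0})"
      using compact_Int_closed[OF c(1) closed_closure, of "{y. \<psi> y \<noteq> 0}"] sub by (simp add: Int_absorb1)
    then have \<psi>T: "\<psi> \<in> test_funs S" using sm sub c(2) by (auto simp: test_funs_def)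
    have pd: "partial_deriv i \<phi> x = m i * partial_deriv i \<psi> (diag m t x)" for x
    proof -
      have "\<And>x. \<psi> differentiable (at x)" using sm unfolding smooth_fun_def by (metis iter_partial.simps(1))
      from partial_deriv_cmult_diag(1)[OF this, of i 1 m t] show ?thesis by (simp add: \<psi>\<phi>)
    qed
    \<comment> \<open>Multiplying by the Jacobian \<open>?P\<close> turns both integrals into
      integrals over the original variable; it is cancelled at the end.\<close>
    have "?P * (\<integral>x. u (diag m t x) * partial_deriv i \<phi> x \<partial>lebesgue)
       = m i * (?P * (\<integral>x. u (diag m t x) * partial_deriv i \<psi> (diag m t x) \<partial>lebesgue))"
    proof -
      have "(\<integral>x. u (diag m t x) * partial_deriv i \<phi> x \<partial>lebesgue) = (\<integral>x. m i * (u (diag m t x) * partial_deriv i \<psi> (diag m t x)) \<partial>lebesgue)"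
        unfolding pd by (rule Bochner_Integration.integral_cong) auto
      then show ?thesis by simp
    qed
    also have "\<dots> = m i * (\<integral>x. u x * partial_deriv i \<psi> x \<partial>lebesgue)"
      by (subst (2) integral_diag'[where m=m and t=t, OF m]) simp
    also have "\<dots> = - (m i * (\<integral>x. g x $ i * \<psi> x \<partial>lebesgue))"
      using w \<psi>T unfolding weak_gradient_iff by simp
    also have "\<dots> = - (m i * (?P * (\<integral>x. g (diag m t x) $ i * \<phi> x \<partial>lebesgue)))"
      by (subst integral_diag'[where m=m and t=t, OF m]) (simp add: \<psi>\<phi>)
    also have "\<dots> = ?P * (- (\<integral>x. m i * (g (diag m t x) $ i * \<phi> x) \<partial>lebesgue))"
      by simp
    finally have "(\<integral>x. u (diag m t x) * partial_deriv i \<phi> x \<partial>lebesgue) = - (\<integral>x. m i * (g (diag m t x) $ i * \<phi> x) \<partial>lebesgue)"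
      by (rule mult_left_cancel[THEN iffD1, rotated]) (use P in linarith)
    then show "(\<integral>x. u (diag m t x) * partial_deriv i \<phi> x \<partial>lebesgue) =
       - (\<integral>x. (\<chi> i. m i * g (diag m t x) $ i) $ i * \<phi> x \<partial>lebesgue)"
      by (simp add: mult.assoc)
  qed
qed

lemma integrable_times_test:
  fixes u f :: "real^'n::finite \<Rightarrow> real"
  assumes u: "set_integrable lebesgue K u" and f: "continuous_on UNIV f" "\<And>x. x \<notin> K \<Longrightarrow> f x = 0" and K: "compact K"
  shows "integrable lebesgue (\<lambda>x. u x * f x)"
proof -
  obtain M where M: "M \<ge> 0" "\<And>x. norm (f x) \<le> M" using continuous_compact_support_bounded[OF f K] by metis
  have eq: "u x * f x = indicator K x *\<^sub>R u x * f x" for x using f(2)[of x] by (auto simp: indicator_def)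
  have "integrable lebesgue (\<lambda>x. M * (indicator K x *\<^sub>R u x))"
    using u by (simp add: set_integrable_def)
  then show ?thesis unfolding eq
  proof (rule Bochner_Integration.integrable_bound)
    show "(\<lambda>x. indicator K x *\<^sub>R u x * f x) \<in> borel_measurable lebesgue"
      using u borel_measurable_lebesgue_continuous[OF f(1)] unfolding set_integrable_def
      by (intro borel_measurable_times) auto
    show "AE x in lebesgue. norm (indicator K x *\<^sub>R u x * f x) \<le> norm (M * (indicator K x *\<^sub>R u x))"
      using M by (intro AE_I2) (auto simp: abs_mult mult.commute[of _ "\<bar>f _\<bar>"] indicator_def intro!: mult_right_mono)
  qed
qed

lemma weak_gradient_integrable:
  assumes "weak_gradient S u g" "\<phi> \<in> test_funs S"
  shows "integrable lebesgue (\<lambda>x. u x * partial_deriv i \<phi> x)" "integrable lebesgue (\<lambda>x. g x $ i * \<phi> x)"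
proof -
  note T = test_funsD[OF assms(2)]
  have *: "set_integrable lebesgue (closure {x. \<phi> x \<noteq> 0}) u"
     "set_integrable lebesgue (closure {x. \<phi> x \<noteq> 0}) (\<lambda>x. g x $ i)"
    using assms(1) T(2,3) unfolding weak_gradient_def by auto
  show "integrable lebesgue (\<lambda>x. u x * partial_deriv i \<phi> x)"
    by (rule integrable_times_test[OF *(1) T(7) T(5) T(2)])
  show "integrable lebesgue (\<lambda>x. g x $ i * \<phi> x)"
    by (rule integrable_times_test[OF *(2) T(6) T(4) T(2)])
qed

lemma weak_gradient_lincomb:
  assumes w: "weak_gradient S u g" "weak_gradient S v h"
  shows "weak_gradient S (\<lambda>x. a * u x + b * v x) (\<lambda>x. a *\<^sub>R g x + b *\<^sub>R h x)"
  unfolding weak_gradient_iff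
proof (intro conjI allI impI ballI)
  fix K assume K: "compact K \<and> K \<subseteq> S"
  show "set_integrable lebesgue K (\<lambda>x. a * u x + b * v x)"
    "set_integrable lebesgue K (\<lambda>x. (a *\<^sub>R g x + b *\<^sub>R h x) $ i)" for i
    using w K unfolding weak_gradient_def by (auto intro!: set_integral_add(1) set_integrable_mult_right)
next
  fix \<phi> i assume \<phi>: "\<phi> \<in> test_funs S"
  note I = weak_gradient_integrable[OF w(1) \<phi>, of i] weak_gradient_integrable[OF w(2) \<phi>, of i]
  have "(\<integral>x. (a * u x + b * v x) * partial_deriv i \<phi> x \<partial>lebesgue)
    = (\<integral>x. a * (u x * partial_deriv i \<phi> x) + b * (v x * partial_deriv i \<phi> x) \<partial>lebesgue)"
    by (simp add: algebra_simps)
  also have "\<dots> = a * (\<integral>x. u x * partial_deriv i \<phi> x \<partial>lebesgue) + b * (\<integral>x. v x * partial_deriv i \<phi> x \<partial>lebesgue)"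
    using I by simp
  also have "\<dots> = - (a * (\<integral>x. g x $ i * \<phi> x \<partial>lebesgue) + b * (\<integral>x. h x $ i * \<phi> x \<partial>lebesgue))"
    using w \<phi> unfolding weak_gradient_iff by simp
  also have "\<dots> = - (\<integral>x. a * (g x $ i * \<phi> x) + b * (h x $ i * \<phi> x) \<partial>lebesgue)"
    using I by simp
  finally show "(\<integral>x. (a * u x + b * v x) * partial_deriv i \<phi> x \<partial>lebesgue) =
     - (\<integral>x. (a *\<^sub>R g x + b *\<^sub>R h x) $ i * \<phi> x \<partial>lebesgue)"
    by (simp add: algebra_simps)
qed

text \<open>The product of \<open>w\<close> with a test function is Lipschitz along the axes and has
  compact support, so the integral of its partial derivative vanishes by
  \<open>integral_partial_eq_0\<close>; the product rule splits it into the two sides. The compact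
  support is that of the test function.\<close>

lemma weak_gradient_compact_support:
  fixes w :: "real^'n::finite \<Rightarrow> real"
  assumes w: "continuous_on UNIV w" "\<And>x. \<bar>w x\<bar> \<le> M"
    and L: "\<delta> > 0" "\<And>x h i. \<bar>h\<bar> < \<delta> \<Longrightarrow> \<bar>w (x + h *\<^sub>R axis i 1) - w x\<bar> \<le> L * \<bar>h\<bar>"
    and g: "g \<in> borel_measurable lebesgue" "\<And>x i. \<bar>g x $ i\<bar> \<le> M'"
    and ae: "\<And>i. AE x in lebesgue. ((\<lambda>h. (w (x + h *\<^sub>R axis i 1) - w x) / h) \<longlongrightarrow> g x $ i) (at 0)"
  shows "weak_gradient UNIV w g"
  unfolding weak_gradient_iff
proof (intro conjI allI impI ballI)
  have gi: "(\<lambda>x. g x $ i) \<in> borel_measurable lebesgue" for i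
    using measurable_compose[OF g(1) borel_measurable_nth] .
  fix K assume K: "compact K \<and> K \<subseteq> (UNIV::(real^'n) set)"
  have s: "set_integrable lebesgue K f" if "f \<in> borel_measurable lebesgue" "\<And>x. \<bar>f x\<bar> \<le> M" for f :: "real^'n \<Rightarrow> real" and M
    unfolding set_integrable_def
  proof (rule integrable_bounded_support[where K=K and M=M])
    have "K \<in> sets lebesgue" using K lmeasurable_compact by blast
    then show "(\<lambda>x. indicat_real K x *\<^sub>R f x) \<in> borel_measurable lebesgue" using that by auto
    show "\<bar>indicat_real K x *\<^sub>R f x\<bar> \<le> M" for x 
      using that(2)[of x] by (auto simp: indicator_def)
  qed (use K lmeasurable_compact in auto)
  show "set_integrable lebesgue K w" using s[OF borel_measurable_lebesgue_continuous[OF w(1)] w(2)] .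
  show "set_integrable lebesgue K (\<lambda>x. g x $ i)" for i using s[OF gi g(2)] .
next
  have gi: "(\<lambda>x. g x $ i) \<in> borel_measurable lebesgue" for i
    using measurable_compose[OF g(1) borel_measurable_nth] .
  fix \<phi> i assume \<phi>: "\<phi> \<in> test_funs (UNIV::(real^'n) set)"
  note T = test_funsD[OF \<phi>]
  obtain L' M2 where B: "L' \<ge> 0" "M2 \<ge> 0" "\<And>x. \<bar>\<phi> x\<bar> \<le> M2" "\<And>x i. \<bar>partial_deriv i \<phi> x\<bar> \<le> L'"
    "\<And>x y. \<bar>\<phi> x - \<phi> y\<bar> \<le> L' * norm (x - y)" using test_funs_lipschitz[OF \<phi>] by metis
  let ?K = "closure {x. \<phi> x \<noteq> 0}"
  let ?e = "axis i 1 :: real^'n"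
  define D where "D x = g x $ i * \<phi> x + w x * partial_deriv i \<phi> x" for x
  have m: "\<phi> \<in> borel_measurable lebesgue" "w \<in> borel_measurable lebesgue" "partial_deriv i \<phi> \<in> borel_measurable lebesgue"
    by (intro borel_measurable_lebesgue_continuous T w)+
  have M0: "M \<ge> 0" "M' \<ge> 0" using order_trans[OF abs_ge_zero w(2)] order_trans[OF abs_ge_zero g(2)] by auto
  have i1: "integrable lebesgue (\<lambda>x. g x $ i * \<phi> x)"
  proof (rule integrable_bounded_support[where K="?K" and M="M' * M2"])
    show "\<bar>g x $ i * \<phi> x\<bar> \<le> M' * M2" for x
      unfolding abs_mult by (intro mult_mono g B M0) auto
    show "g x $ i * \<phi> x = 0" if "x \<notin> ?K" for x using T(4)[OF that] by simp
  qed (intro borel_measurable_times gi m lmeasurable_compact T)+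
  have i2: "integrable lebesgue (\<lambda>x. w x * partial_deriv i \<phi> x)"
  proof (rule integrable_bounded_support[where K="?K" and M="M * L'"])
    show "\<bar>w x * partial_deriv i \<phi> x\<bar> \<le> M * L'" for x
      unfolding abs_mult by (intro mult_mono w B M0) auto
    show "w x * partial_deriv i \<phi> x = 0" if "x \<notin> ?K" for x using T(5)[OF that] by simp
  qed (intro borel_measurable_times m lmeasurable_compact T)+
  have "(\<integral>x. D x \<partial>lebesgue) = 0"
  proof (rule integral_partial_eq_0(2)[where F="\<lambda>x. w x * \<phi> x" and K="?K" and i=i and L="M * L' + M2 * L", OF _ _ _ L(1)])
    show "continuous_on UNIV (\<lambda>x. w x * \<phi> x)" by (intro continuous_on_mult w T)
    show "D \<in> borel_measurable lebesgue" unfolding D_def using i1 i2 by auto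
    show "\<bar>w (x + h *\<^sub>R ?e) * \<phi> (x + h *\<^sub>R ?e) - w x * \<phi> x\<bar> \<le> (M * L' + M2 * L) * \<bar>h\<bar>" if "\<bar>h\<bar> < \<delta>" for x h
    proof -
      have "w (x + h *\<^sub>R ?e) * \<phi> (x + h *\<^sub>R ?e) - w x * \<phi> x = w (x + h *\<^sub>R ?e) * (\<phi> (x + h *\<^sub>R ?e) - \<phi> x) + \<phi> x * (w (x + h *\<^sub>R ?e) - w x)"
        by (simp add: algebra_simps)
      then have "\<bar>w (x + h *\<^sub>R ?e) * \<phi> (x + h *\<^sub>R ?e) - w x * \<phi> x\<bar> \<le> \<bar>w (x + h *\<^sub>R ?e)\<bar> * \<bar>\<phi> (x + h *\<^sub>R ?e) - \<phi> x\<bar> + \<bar>\<phi> x\<bar> * \<bar>w (x + h *\<^sub>R ?e) - w x\<bar>"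
        by (metis abs_mult abs_triangle_ineq)
      also have "\<dots> \<le> M * (L' * \<bar>h\<bar>) + M2 * (L * \<bar>h\<bar>)"
        using B(5)[of "x + h *\<^sub>R ?e" x]
        by (intro add_mono mult_mono w(2) B L(2)[OF that] M0 abs_ge_zero) simp_all
      finally show ?thesis by (simp add: algebra_simps)
    qed
    show "AE x in lebesgue. ((\<lambda>h. (w (x + h *\<^sub>R ?e) * \<phi> (x + h *\<^sub>R ?e) - w x * \<phi> x) / h) \<longlongrightarrow> D x) (at 0)"
      using ae[of i]
    proof eventually_elim
      case (elim x)
      have d: "((\<lambda>h. (\<phi> (x + h *\<^sub>R ?e) - \<phi> x) / h) \<longlongrightarrow> partial_deriv i \<phi> x) (at 0)"
        using C1_directional[OF T(1), of x i] by (simp add: grad_def)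
      have c: "((\<lambda>h. \<phi> (x + h *\<^sub>R ?e)) \<longlongrightarrow> \<phi> (x + 0 *\<^sub>R ?e)) (at 0)"
        by (rule continuous_on_tendsto_compose[OF T(6)]) (auto intro!: tendsto_eq_intros)
      have "((\<lambda>h. (w (x + h *\<^sub>R ?e) - w x) / h * \<phi> (x + h *\<^sub>R ?e) + w x * ((\<phi> (x + h *\<^sub>R ?e) - \<phi> x) / h)) \<longlongrightarrow> g x $ i * \<phi> (x + 0 *\<^sub>R ?e) + w x * partial_deriv i \<phi> x) (at 0)"
        by (intro tendsto_intros elim c d)
      then show ?case by (simp add: D_def diff_divide_distrib algebra_simps)
    qed
    show "w x * \<phi> x = 0" if "x \<notin> ?K" for x using T(4)[OF that] by simp
    show "compact ?K" by (rule T)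
  qed
  then show "(\<integral>x. w x * partial_deriv i \<phi> x \<partial>lebesgue) = - (\<integral>x. g x $ i * \<phi> x \<partial>lebesgue)"
    unfolding D_def using i1 i2 by simp
qed

lemma weak_gradient_const: "weak_gradient S (\<lambda>x::real^'n::finite. c) (\<lambda>x. 0)"
proof -
  have "weak_gradient UNIV (\<lambda>x::real^'n. c) (\<lambda>x. 0)"
    by (rule weak_gradient_compact_support[where M="\<bar>c\<bar>" and \<delta>=1 and L=0 and M'=0]) auto
  then show ?thesis by (rule weak_gradient_mono) auto
qed

subsection \<open>Approximation in the mean\<close>

text \<open>Induction over integrable functions. For a multiple of an indicator, a Urysohn function
  between a closed set inside and an open set outside, both close in measure, is the
  approximation.\<close>

lemma continuous_approx_L1:
  fixes u :: "real^'n::finite \<Rightarrow> real"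
  assumes "integrable lebesgue u" "e > 0"
  shows "\<exists>f. continuous_on UNIV f \<and> integrable lebesgue f \<and> (\<integral>x. \<bar>u x - f x\<bar> \<partial>lebesgue) < e"
  using assms
proof (induction u arbitrary: e rule: integrable_induct)
  case (base A c)
  show ?case
  proof (cases "c = 0")
    case True
    then show ?thesis using base by (intro exI[of _ "\<lambda>_. 0"]) auto
  next
    case False
    \<comment> \<open>The set on which \<open>f0\<close> may differ from the indicator has measure
      at most 2 e', so the error is at most e/2.\<close>
    define e' where "e' = e / (4 * \<bar>c\<bar>)"
    have e': "e' > 0" using False base by (simp add: e'_def)
    obtain U where U: "open U" "A \<subseteq> U" "U - A \<in> lmeasurable" "emeasure lebesgue (U - A) < ennreal e'"
      using sets_lebesgue_outer_open[OF base(1) e'] by metis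
    obtain T where T: "closed T" "T \<subseteq> A" "A - T \<in> lmeasurable" "emeasure lebesgue (A - T) < ennreal e'"
      using sets_lebesgue_inner_closed[OF base(1) e'] by metis
    obtain f0 :: "real^'n \<Rightarrow> real" where f0: "continuous_on UNIV f0" "\<And>x. f0 x \<in> closed_segment 1 0"
      "\<And>x. x \<in> T \<Longrightarrow> f0 x = 1" "\<And>x. x \<in> - U \<Longrightarrow> f0 x = 0"
    proof -
      have "closed (- U)" "T \<inter> - U = {}" using U T by auto
      from Urysohn[OF T(1) this, of "1::real" 0] show ?thesis using that by metis
    qed
    have f01: "0 \<le> f0 x" "f0 x \<le> 1" for x using f0(2)[of x] by (auto simp: closed_segment_eq_real_ivl)
    let ?B = "(U - A) \<union> (A - T)"
    have B: "?B \<in> lmeasurable" using U T by blast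
    have mB: "measure lebesgue ?B \<le> 2 * e'"
    proof -
      have "measure lebesgue ?B \<le> measure lebesgue (U - A) + measure lebesgue (A - T)"
        using U T by (intro measure_Un_le) auto
      moreover have "measure lebesgue (U - A) \<le> e'" "measure lebesgue (A - T) \<le> e'"
        using U(3,4) T(3,4) e' by (auto simp: emeasure_eq_measure2 ennreal_less_iff)
      ultimately show ?thesis by linarith
    qed
    have pt: "\<bar>indicator A x *\<^sub>R c - c * f0 x\<bar> \<le> \<bar>c\<bar> * indicator ?B x" for x
    proof -
      have "indicator A x *\<^sub>R c - c * f0 x = c * (indicator A x - f0 x)" by (simp add: algebra_simps)
      then have "\<bar>indicator A x *\<^sub>R c - c * f0 x\<bar> = \<bar>c\<bar> * \<bar>indicator A x - f0 x\<bar>" by (simp add: abs_mult)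
      moreover have "\<bar>indicator A x - f0 x\<bar> \<le> indicator ?B x"
        using f0(3)[of x] f0(4)[of x] f01[of x] U(2) T(2) by (auto simp: indicator_def)
      ultimately show ?thesis by (simp add: mult_left_mono)
    qed
    have iA: "integrable lebesgue (\<lambda>x. indicator A x *\<^sub>R c)" using base by simp
    have iB: "integrable lebesgue (\<lambda>x. \<bar>c\<bar> * indicator ?B x :: real)"
      using B by (auto simp: fmeasurable_def)
    have m: "(\<lambda>x. c * f0 x) \<in> borel_measurable lebesgue"
      by (intro borel_measurable_lebesgue_continuous continuous_intros f0)
    have iD: "integrable lebesgue (\<lambda>x. \<bar>indicator A x *\<^sub>R c - c * f0 x\<bar>)"
      by (rule Bochner_Integration.integrable_bound[OF iB]) (use pt m iA in \<open>auto intro!: AE_I2 order_trans[OF pt]\<close>)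
    have iD': "integrable lebesgue (\<lambda>x. indicator A x *\<^sub>R c - c * f0 x)"
      using iD m iA by (subst (asm) integrable_abs_iff) auto
    have "integrable lebesgue (\<lambda>x. indicator A x *\<^sub>R c - (indicator A x *\<^sub>R c - c * f0 x))"
      using iA iD' by (rule Bochner_Integration.integrable_diff)
    then have "integrable lebesgue (\<lambda>x. c * f0 x)" by simp
    moreover have "(\<integral>x. \<bar>indicator A x *\<^sub>R c - c * f0 x\<bar> \<partial>lebesgue) \<le> (\<integral>x. \<bar>c\<bar> * indicator ?B x \<partial>lebesgue)"
      by (rule integral_mono[OF iD iB pt])
    moreover have "(\<integral>x. \<bar>c\<bar> * indicator ?B x \<partial>lebesgue) \<le> \<bar>c\<bar> * (2 * e')"
      using mB by (simp add: mult_left_mono)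
    moreover have "\<bar>c\<bar> * (2 * e') < e" using False base by (simp add: e'_def)
    moreover have "continuous_on UNIV (\<lambda>x. c * f0 x)" using f0 by (intro continuous_intros)
    ultimately show ?thesis by (intro exI[of _ "\<lambda>x. c * f0 x"]) auto
  qed
next
  case (add f g)
  obtain f' where f': "continuous_on UNIV f'" "integrable lebesgue f'" "(\<integral>x. \<bar>f x - f' x\<bar> \<partial>lebesgue) < e / 2"
    using add(3)[of "e/2"] add.prems by auto
  obtain g' where g': "continuous_on UNIV g'" "integrable lebesgue g'" "(\<integral>x. \<bar>g x - g' x\<bar> \<partial>lebesgue) < e / 2"
    using add(4)[of "e/2"] add.prems by auto
  have "(\<integral>x. \<bar>f x + g x - (f' x + g' x)\<bar> \<partial>lebesgue) \<le> (\<integral>x. \<bar>f x - f' x\<bar> + \<bar>g x - g' x\<bar> \<partial>lebesgue)"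
    using add(1,2) f' g' by (intro integral_mono) auto
  also have "\<dots> < e" using add(1,2) f' g' by simp
  finally show ?case using f' g' add
    by (intro exI[of _ "\<lambda>x. f' x + g' x"]) (auto intro!: continuous_intros)
next
  case (lim f s)
  have "(\<lambda>n. \<integral>x. \<bar>f x - s n x\<bar> \<partial>lebesgue) \<longlonglongrightarrow> (\<integral>x. 0 \<partial>(lebesgue :: (real^'n) measure))"
  proof (rule integral_dominated_convergence[where w="\<lambda>x. 3 * \<bar>f x\<bar>"])
    show "AE x in lebesgue. (\<lambda>n. \<bar>f x - s n x\<bar>) \<longlonglongrightarrow> 0"
    proof (rule AE_I2)
      fix x
      have "(\<lambda>n. \<bar>f x - s n x\<bar>) \<longlonglongrightarrow> \<bar>f x - f x\<bar>" using lim(2)[of x] by (intro tendsto_intros) auto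
      then show "(\<lambda>n. \<bar>f x - s n x\<bar>) \<longlonglongrightarrow> 0" by simp
    qed
    show "AE x in lebesgue. norm \<bar>f x - s n x\<bar> \<le> 3 * \<bar>f x\<bar>" for n
    proof (rule AE_I2)
      fix x show "norm \<bar>f x - s n x\<bar> \<le> 3 * \<bar>f x\<bar>" using lim(3)[of x n] by simp
    qed
  qed (use lim in auto)
  then have "eventually (\<lambda>n. (\<integral>x. \<bar>f x - s n x\<bar> \<partial>lebesgue) < e / 2) sequentially"
    using lim.prems by (intro order_tendstoD) auto
  then obtain n where n: "(\<integral>x. \<bar>f x - s n x\<bar> \<partial>lebesgue) < e / 2" by (auto simp: eventually_sequentially)
  obtain g' where g': "continuous_on UNIV g'" "integrable lebesgue g'" "(\<integral>x. \<bar>s n x - g' x\<bar> \<partial>lebesgue) < e / 2"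
    using lim.IH[of "e/2" n] lim.prems by auto
  have "(\<integral>x. \<bar>f x - g' x\<bar> \<partial>lebesgue) \<le> (\<integral>x. \<bar>f x - s n x\<bar> + \<bar>s n x - g' x\<bar> \<partial>lebesgue)"
    using lim g' by (intro integral_mono) auto
  also have "\<dots> < e" using lim g' n by simp
  finally show ?case using g' by auto
qed

text \<open>The Borel version of \<open>nn_integral_diag\<close>: the mollification and Poincare
  estimates exchange integrals over products of \<open>lborel\<close>.\<close>

lemma nn_integral_diag_lborel:
  fixes m :: "'n::finite \<Rightarrow> real"
  assumes m: "\<And>i. m i \<noteq> 0" and f[measurable]: "f \<in> borel_measurable borel"
  shows "(\<integral>\<^sup>+x. f (diag m t x) \<partial>lborel) = ennreal (1 / (\<Prod>i\<in>UNIV. \<bar>m i\<bar>)) * (\<integral>\<^sup>+x. f x \<partial>lborel)"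
proof -
  let ?P = "\<Prod>i\<in>UNIV. \<bar>m i\<bar>"
  have P: "?P > 0" using m by (simp add: prod_pos)
  have "f \<in> borel_measurable lebesgue" using f by (simp add: measurable_completion)
  from nn_integral_diag[where m=m and t=t, OF m this]
  have "(\<integral>\<^sup>+x. f x \<partial>lborel) = ennreal ?P * (\<integral>\<^sup>+x. f (diag m t x) \<partial>lborel)"
    by (simp add: nn_integral_completion)
  then have "ennreal (1 / ?P) * (\<integral>\<^sup>+x. f x \<partial>lborel) = (ennreal (1 / ?P) * ennreal ?P) * (\<integral>\<^sup>+x. f (diag m t x) \<partial>lborel)"
    by (simp add: mult.assoc)
  also have "ennreal (1 / ?P) * ennreal ?P = 1"
    using P m by (subst ennreal_mult[symmetric]) (auto intro!: less_imp_le)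
  finally show ?thesis by simp
qed

section \<open>The unit cube and its contractions\<close>

lemma mem_cubeQ: "x \<in> cubeQ \<longleftrightarrow> (\<forall>i. 0 \<le> x $ i \<and> x $ i \<le> 1)"
  by (auto simp: cubeQ_def mem_box_cart)

lemma interior_cubeQ: "interior cubeQ = box 0 1"
  by (simp add: cubeQ_def interior_cbox)

lemma compact_cubeQ: "compact cubeQ"
  by (simp add: cubeQ_def)

lemma borel_cubeQ [measurable]: "cubeQ \<in> sets borel"
  by (simp add: cubeQ_def)

lemma lebesgue_cubeQ [measurable]: "cubeQ \<in> sets lebesgue"
  by (simp add: cubeQ_def)

lemma emeasure_cubeQ [simp]: "emeasure lborel (cubeQ::(real^'n::finite) set) = 1"
  by (simp add: cubeQ_def emeasure_lborel_cbox_eq Basis_vec_real prod.reindex[OF inj_axis_one] inner_axis)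

lemma emeasure_lebesgue_cubeQ [simp]: "emeasure lebesgue (cubeQ::(real^'n::finite) set) = 1"
  by simp

text \<open>The map (1 - 2s) x + s sends the unit cube onto the concentric cube [s, 1 - s]^d and
  leaves room for a shift by any z with components of size at most s. A function on the cube can
  thus be averaged over z without being extended across the boundary.\<close>

abbreviation (input) shrink :: "real \<Rightarrow> real^'n \<Rightarrow> real^'n::finite \<Rightarrow> real^'n" where
  "shrink s z \<equiv> diag (\<lambda>_. 1 - 2 * s) (\<chi> i. s - z $ i)"

lemma shrink_cubeQ:
  fixes x z :: "real^'n::finite"
  assumes "0 \<le> s" "s \<le> 1/4" "\<And>i. \<bar>z $ i\<bar> \<le> s" "x \<in> cubeQ"
  shows "shrink s z x \<in> cubeQ" "norm (shrink s z x - x) \<le> 2 * s * real CARD('n)"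
proof -
  have *: "0 \<le> x $ i" "x $ i \<le> 1" "- s \<le> z $ i" "z $ i \<le> s" for i
    using assms(3)[of i] assms(4) by (auto simp: mem_cubeQ abs_le_iff)
  have p: "0 \<le> (1 - 2 * s) * x $ i" "(1 - 2 * s) * x $ i \<le> 1 - 2 * s" "0 \<le> s * x $ i" "s * x $ i \<le> s" for i
    using * assms(1,2) by (auto intro: mult_nonneg_nonneg mult_left_le)
  show "shrink s z x \<in> cubeQ"
    unfolding mem_cubeQ using * p assms by (auto simp: algebra_simps) (smt (verit))+
  have "norm (shrink s z x - x) \<le> (\<Sum>i\<in>(UNIV::'n set). \<bar>(shrink s z x - x) $ i\<bar>)"
    by (rule norm_le_l1_cart)
  also have "\<dots> \<le> (\<Sum>i\<in>(UNIV::'n set). 2 * s)"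
  proof (rule sum_mono)
    fix i :: 'n
    have "(shrink s z x - x) $ i = s - z $ i - 2 * (s * x $ i)" by (simp add: algebra_simps)
    then show "\<bar>(shrink s z x - x) $ i\<bar> \<le> 2 * s"
      using p(3,4)[of i] *(3,4)[of i] by linarith
  qed
  finally show "norm (shrink s z x - x) \<le> 2 * s * real CARD('n)" by (simp add: mult.commute)
qed

text \<open>Continuity in the mean, uniformly in the shift z. A continuous approximation f is
  uniformly continuous on the cube, and the error u - f after the contraction grows at most by the
  Jacobian, which is bounded by 2^d.\<close>

lemma L1_shrink_small:
  fixes u :: "real^'n::finite \<Rightarrow> real" and e :: real
  assumes ub[measurable]: "u \<in> borel_measurable borel" and ui: "integrable lborel u" and e: "e > 0"
  shows "\<exists>\<delta>>0. \<delta> \<le> 1/4 \<and> (\<forall>s z. 0 \<le> s \<and> s \<le> \<delta> \<and> (\<forall>i. \<bar>z $ i\<bar> \<le> s) \<longrightarrow>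
     (\<integral>\<^sup>+x. ennreal \<bar>u (shrink s z x) - u x\<bar> * indicator cubeQ x \<partial>lborel) \<le> ennreal e)"
proof -
  define d where "d = CARD('n)"
  \<comment> \<open>Three errors are added: u - f after the contraction costs 2^d e', u - f itself
    and the oscillation of f cost e' each.\<close>
  define e' where "e' = e / (2 + 2 ^ d)"
  have e': "e' > 0" using e by (simp add: e'_def add_pos_pos)
  have "integrable lebesgue u" using ui by (simp add: integrable_completion)
  then obtain f where f: "continuous_on UNIV f" "integrable lebesgue f" "(\<integral>x. \<bar>u x - f x\<bar> \<partial>lebesgue) < e'"
    using continuous_approx_L1 e' by blast
  have fb[measurable]: "f \<in> borel_measurable borel" using f(1) by (rule borel_measurable_continuous_onI)
  have uf: "(\<integral>\<^sup>+x. ennreal \<bar>u x - f x\<bar> \<partial>lborel) \<le> ennreal e'"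
  proof -
    have "integrable lborel f" using f(2) by (simp add: integrable_completion)
    then have "(\<integral>\<^sup>+x. ennreal \<bar>u x - f x\<bar> \<partial>lborel) = ennreal (\<integral>x. \<bar>u x - f x\<bar> \<partial>lborel)"
      using ui by (intro nn_integral_eq_integral) auto
    also have "(\<integral>x. \<bar>u x - f x\<bar> \<partial>lborel) = (\<integral>x. \<bar>u x - f x\<bar> \<partial>lebesgue)"
      by (rule integral_completion[symmetric]) simp
    finally show ?thesis using f(3) by (simp add: ennreal_leI)
  qed
  have "uniformly_continuous_on cubeQ f"
    using f(1) by (intro compact_uniformly_continuous compact_cubeQ) (auto intro: continuous_on_subset)
  then obtain r where r: "r > 0" "\<And>x y. x \<in> cubeQ \<Longrightarrow> y \<in> cubeQ \<Longrightarrow> dist y x < r \<Longrightarrow> dist (f y) (f x) < e'"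
    unfolding uniformly_continuous_on_def using e' by metis
  \<comment> \<open>The bound 1/4 keeps 1 - 2s above 1/2; the other bound limits the displacement 2
    s d to at most r/2.\<close>
  define \<delta> where "\<delta> = min (1/4) (r / (4 * real d))"
  have d0: "real d > 0" by (simp add: d_def)
  have \<delta>: "\<delta> > 0" "\<delta> \<le> 1/4" "2 * \<delta> * real d < r"
    using r(1) d0 by (auto simp: \<delta>_def min_def field_simps)
  show ?thesis
  proof (intro exI conjI allI impI \<delta>)
    fix s and z :: "real^'n"
    assume a: "0 \<le> s \<and> s \<le> \<delta> \<and> (\<forall>i. \<bar>z $ i\<bar> \<le> s)"
    then have s: "0 \<le> s" "s \<le> 1/4" and z: "\<And>i. \<bar>z $ i\<bar> \<le> s" using \<delta> by auto
    let ?T = "shrink s z"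
    have [measurable]: "?T \<in> borel_measurable borel"
      using borel_measurable_continuous_onI[OF continuous_on_diag] .
    have "(\<integral>\<^sup>+x. ennreal \<bar>u (?T x) - u x\<bar> * indicator cubeQ x \<partial>lborel)
        \<le> (\<integral>\<^sup>+x. ennreal \<bar>u (?T x) - f (?T x)\<bar> + (ennreal \<bar>u x - f x\<bar> + ennreal e' * indicator cubeQ x) \<partial>lborel)"
    proof (intro nn_integral_mono)
      fix x :: "real^'n"
      show "ennreal \<bar>u (?T x) - u x\<bar> * indicator cubeQ x \<le> ennreal \<bar>u (?T x) - f (?T x)\<bar> + (ennreal \<bar>u x - f x\<bar> + ennreal e' * indicator cubeQ x)"
      proof (cases "x \<in> cubeQ")
        case True
        have "norm (?T x - x) \<le> 2 * s * real d" using shrink_cubeQ(2)[OF s z True] by (simp add: d_def)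
        also have "\<dots> \<le> 2 * \<delta> * real d" using a by (intro mult_right_mono) auto
        also have "\<dots> < r" by fact
        finally have "dist (f (?T x)) (f x) < e'"
          using r(2)[OF True shrink_cubeQ(1)[OF s z True]] by (simp add: dist_norm)
        then have "\<bar>u (?T x) - u x\<bar> \<le> \<bar>u (?T x) - f (?T x)\<bar> + (\<bar>u x - f x\<bar> + e')"
          by (simp add: dist_real_def)
        then have "ennreal \<bar>u (?T x) - u x\<bar> \<le> ennreal (\<bar>u (?T x) - f (?T x)\<bar> + (\<bar>u x - f x\<bar> + e'))"
          by (rule ennreal_leI)
        also have "\<dots> = ennreal \<bar>u (?T x) - f (?T x)\<bar> + (ennreal \<bar>u x - f x\<bar> + ennreal e')"
          using e' by (simp add: ennreal_plus)
        finally show ?thesis using True by simp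
      qed simp
    qed
    also have "\<dots> = (\<integral>\<^sup>+x. ennreal \<bar>u (?T x) - f (?T x)\<bar> \<partial>lborel) + ((\<integral>\<^sup>+x. ennreal \<bar>u x - f x\<bar> \<partial>lborel) + ennreal e')"
      by (simp add: nn_integral_add nn_integral_cmult)
    also have "(\<integral>\<^sup>+x. ennreal \<bar>u (?T x) - f (?T x)\<bar> \<partial>lborel) = ennreal (1 / (\<Prod>i\<in>(UNIV::'n set). \<bar>1 - 2 * s\<bar>)) * (\<integral>\<^sup>+x. ennreal \<bar>u x - f x\<bar> \<partial>lborel)"
      using s by (intro nn_integral_diag_lborel) auto
    also have "\<dots> \<le> ennreal (2 ^ d) * ennreal e'"
    proof (intro mult_mono uf ennreal_leI)
      have "1 / (\<Prod>i\<in>(UNIV::'n set). \<bar>1 - 2 * s\<bar>) = (1 / (1 - 2 * s)) ^ d"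
        using s by (simp add: d_def power_divide)
      also have "\<dots> \<le> 2 ^ d" using s by (intro power_mono) (auto simp: field_simps)
      finally show "1 / (\<Prod>i\<in>(UNIV::'n set). \<bar>1 - 2 * s\<bar>) \<le> 2 ^ d" .
    qed auto
    also have "ennreal (2 ^ d) * ennreal e' + ((\<integral>\<^sup>+x. ennreal \<bar>u x - f x\<bar> \<partial>lborel) + ennreal e')
        \<le> ennreal (2 ^ d) * ennreal e' + (ennreal e' + ennreal e')"
      using uf by (intro add_mono) auto
    also have "\<dots> = ennreal (2 ^ d * e' + (e' + e'))"
      using e' by (simp add: ennreal_plus[symmetric] ennreal_mult[symmetric] del: ennreal_plus)
    also have "2 ^ d * e' + (e' + e') = e' * (2 + 2 ^ d)" by (simp add: algebra_simps)
    also have "\<dots> = e"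
    proof -
      have "(2 + 2 ^ d :: real) \<noteq> 0" using zero_less_power[of "2::real" d] by linarith
      then show ?thesis by (simp add: e'_def)
    qed
    finally show "(\<integral>\<^sup>+x. ennreal \<bar>u (?T x) - u x\<bar> * indicator cubeQ x \<partial>lborel) \<le> ennreal e" by (simp add: add_mono)
  qed (use \<delta> in auto)
qed

subsection \<open>Mollifiers\<close>

lemma smooth1_const: "smooth1 (\<lambda>_. c)"
  by (simp add: smooth1_def ndiff_const)

text \<open>Besides the kernel, its reflected translates y -> k (x - y) have to be smooth: they are
  the test functions by which the convolution of a weakly differentiable function is
  differentiated.\<close>

lemma mollifier_exists:
  assumes \<epsilon>: "\<epsilon> > 0"
  obtains k :: "real^'n::finite \<Rightarrow> real" where "\<And>z. 0 \<le> k z" "\<And>z i. k z \<noteq> 0 \<Longrightarrow> \<bar>z $ i\<bar> \<le> \<epsilon>"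
    "integrable lborel k" "(\<integral>z. k z \<partial>lborel) = 1" "smooth_fun k" "\<And>x. smooth_fun (\<lambda>y. k (x - y))"
proof -
  define d where "d = CARD('n)"
  have d: "d > 0" by (simp add: d_def)
  define k0 :: "real^'n \<Rightarrow> real" where "k0 = prodf (\<lambda>i t. bump1 ((1/\<epsilon>) * t + 0))"
  have s0: "smooth_fun k0" unfolding k0_def by (intro smooth_fun_prodf smooth1_affine smooth1_bump1)
  then have c0: "continuous_on UNIV k0" using C1_continuous smooth_fun_C1 by blast
  have k00: "0 \<le> k0 z" for z by (auto simp: k0_def prodf_def intro!: prod_nonneg bump1_nonneg)
  have k0nz: "k0 z \<noteq> 0 \<longleftrightarrow> (\<forall>i. \<bar>z $ i\<bar> < \<epsilon>)" for z
    using \<epsilon> by (simp add: k0_def prodf_def bump1_pos_iff abs_divide field_simps)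
  define C where "C = cbox (\<chi> i. - \<epsilon>) (\<chi> i::'n. \<epsilon>)"
  have C0: "z \<notin> C \<Longrightarrow> k0 z = 0" for z
    using k0nz[of z] unfolding C_def mem_box_cart by (simp add: abs_less_iff) (smt (verit))
  obtain M where M: "M \<ge> 0" "\<And>x. norm (k0 x) \<le> M"
    using continuous_compact_support_bounded[OF c0 C0] unfolding C_def by (metis compact_cbox)
  have "integrable lebesgue k0"
    using M c0 by (intro integrable_bounded_support[where K=C and M=M, OF _ C0]) (auto simp: C_def intro: borel_measurable_lebesgue_continuous)
  then have i0: "integrable lborel k0"
    using borel_measurable_continuous_onI[OF c0] by (simp add: integrable_completion)
  define I where "I = (\<integral>z. k0 z \<partial>lborel)"
  have "I \<noteq> 0"
  proof
    assume "I = 0"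
    then have "AE z in lborel. k0 z = 0"
      using integral_nonneg_eq_0_iff_AE[OF i0] k00 by (auto simp: I_def)
    then have "AE z in lborel. z \<notin> box (\<chi> i. - \<epsilon>) (\<chi> i::'n. \<epsilon>)"
    proof eventually_elim
      case (elim z)
      then have "\<not> (\<forall>i. \<bar>z $ i\<bar> < \<epsilon>)" using k0nz[of z] by simp
      then show ?case by (auto simp: mem_box_cart abs_less_iff minus_less_iff)
    qed
    then have "emeasure lborel (box (\<chi> i. - \<epsilon>) (\<chi> i::'n. \<epsilon>)) = 0"
      by (subst (asm) AE_iff_measurable[OF _ refl]) auto
    moreover have "emeasure lborel (box (\<chi> i. - \<epsilon>) (\<chi> i::'n. \<epsilon>)) > 0"
      using \<epsilon> by (subst emeasure_lborel_box_eq) (auto simp: Basis_vec_real inner_axis prod.reindex[OF inj_axis_one])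
    ultimately show False by simp
  qed
  then have I: "I > 0" using k00 unfolding I_def by (simp add: integral_nonneg less_le)
  \<comment> \<open>The normalizing constant 1/I is distributed over the d factors as its d-th root,
    so that \<open>k\<close> is again a product of one-variable functions.\<close>
  define a where "a = root d (1 / I)"
  have a: "a ^ d = 1 / I" "a \<ge> 0" using I d by (auto simp: a_def)
  define k :: "real^'n \<Rightarrow> real" where "k = prodf (\<lambda>i t. a * bump1 ((1/\<epsilon>) * t + 0))"
  have k: "k z = k0 z / I" for z
    using a by (simp add: k_def k0_def prodf_def prod.distrib d_def)
  show thesis
  proof (rule that[of k])
    show "smooth_fun k" unfolding k_def
      by (intro smooth_fun_prodf smooth1_mult smooth1_const smooth1_affine smooth1_bump1)
    show "smooth_fun (\<lambda>y. k (x - y))" for x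
    proof -
      have "(\<lambda>y. k (x - y)) = prodf (\<lambda>i t. a * bump1 ((- 1/\<epsilon>) * t + x $ i / \<epsilon>))"
        by (auto simp: k_def prodf_def fun_eq_iff diff_divide_distrib)
      then show ?thesis by (simp only:) (intro smooth_fun_prodf smooth1_mult smooth1_const smooth1_affine smooth1_bump1)
    qed
    show "integrable lborel k" "(\<integral>z. k z \<partial>lborel) = 1"
      unfolding k using i0 I by (auto simp: I_def)
    show "0 \<le> k z" for z using k00 I by (simp add: k)
    show "\<bar>z $ i\<bar> \<le> \<epsilon>" if "k z \<noteq> 0" for z i using that k0nz[of z] by (auto simp: k intro: less_imp_le)
  qed
qed

text \<open>\<open>iter_partial\<close> applies its list from the right, so a derivative taken first
  is appended at the end of the list.\<close>

lemma smooth_fun_partial: "smooth_fun f \<Longrightarrow> smooth_fun (partial_deriv i f)"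
proof -
  have "iter_partial is (partial_deriv i f) = iter_partial (is @ [i]) f" for "is"
    by (induction "is") auto
  then show "smooth_fun f \<Longrightarrow> smooth_fun (partial_deriv i f)" by (simp add: smooth_fun_def)
qed

lemma smooth_fun_bounds:
  fixes k :: "real^'n::finite \<Rightarrow> real"
  assumes s: "smooth_fun k" and c: "compact K" "\<And>x. x \<notin> K \<Longrightarrow> k x = 0"
  obtains M where "M \<ge> 0" "\<And>x. \<bar>k x\<bar> \<le> M" "\<And>x. norm (grad k x) \<le> M"
    "\<And>x y. norm (grad k x - grad k y) \<le> M * norm (x - y)"
proof -
  have K: "closure {x. k x \<noteq> 0} \<subseteq> K"
    using c by (intro closure_minimal) (auto intro: compact_imp_closed)
  have tk: "k \<in> test_funs UNIV"
    unfolding test_funs_def using s K c(1) by (auto simp: compact_closure intro: bounded_subset compact_imp_bounded)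
     (meson bounded_subset closure_subset compact_imp_bounded subset_trans)
  have tp: "partial_deriv i k \<in> test_funs UNIV" for i
  proof -
    have "x \<in> K" if "partial_deriv i k x \<noteq> 0" for x
      using that K closure_support_outside(2)[of x k i] by blast
    then have "bounded {x. partial_deriv i k x \<noteq> 0}"
      using c(1) by (metis (mono_tags) bounded_subset compact_imp_bounded mem_Collect_eq subsetI)
    then show ?thesis unfolding test_funs_def using smooth_fun_partial[OF s] by (auto simp: compact_closure)
  qed
  obtain L M where LM: "L \<ge> 0" "M \<ge> 0" "\<And>x. \<bar>k x\<bar> \<le> M" "\<And>x i. \<bar>partial_deriv i k x\<bar> \<le> L"
    using test_funs_lipschitz[OF tk] by metis
  have "\<forall>i. \<exists>L. L \<ge> 0 \<and> (\<forall>x y. \<bar>partial_deriv i k x - partial_deriv i k y\<bar> \<le> L * norm (x - y))"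
    using test_funs_lipschitz[OF tp] by metis
  then obtain L' where L': "\<And>i. L' i \<ge> 0" "\<And>i x y. \<bar>partial_deriv i k x - partial_deriv i k y\<bar> \<le> L' i * norm (x - y)"
    by metis
  define M' where "M' = M + real CARD('n) * L + (\<Sum>i\<in>UNIV. L' i)"
  have S0: "(\<Sum>i\<in>UNIV. L' i) \<ge> 0" using L'(1) by (simp add: sum_nonneg)
  have S1: "real CARD('n) * L \<ge> 0" using LM by simp
  show thesis
  proof (rule that[of M'])
    show "M' \<ge> 0" using S0 S1 LM by (simp add: M'_def)
    show "\<bar>k x\<bar> \<le> M'" for x using LM(3)[of x] S0 S1 by (simp add: M'_def)
    show "norm (grad k x) \<le> M'" for x
    proof -
      have "norm (grad k x) \<le> (\<Sum>i\<in>UNIV. \<bar>grad k x $ i\<bar>)" by (rule norm_le_l1_cart)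
      also have "\<dots> \<le> (\<Sum>i\<in>(UNIV::'n set). L)" using LM(4) by (intro sum_mono) (simp add: grad_def)
      finally show ?thesis using S0 LM(2) by (simp add: M'_def)
    qed
    show "norm (grad k x - grad k y) \<le> M' * norm (x - y)" for x y
    proof -
      have "norm (grad k x - grad k y) \<le> (\<Sum>i\<in>UNIV. \<bar>(grad k x - grad k y) $ i\<bar>)" by (rule norm_le_l1_cart)
      also have "\<dots> \<le> (\<Sum>i\<in>(UNIV::'n set). L' i * norm (x - y))" using L'(2) by (intro sum_mono) (simp add: grad_def)
      also have "\<dots> = (\<Sum>i\<in>(UNIV::'n set). L' i) * norm (x - y)" by (simp add: sum_distrib_right)
      also have "\<dots> \<le> M' * norm (x - y)" using S1 LM(2) by (intro mult_right_mono) (auto simp: M'_def)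
      finally show ?thesis .
    qed
  qed
qed

text \<open>All derivatives fall on the kernel. Its Taylor remainder is at most M |h|^2, so the
  remainder of the convolution is at most M |h|^2 times the L^1 norm of u; continuity of the
  gradient follows in the same way from the Lipschitz bound on \<open>grad k\<close>.\<close>

lemma C1_convolution:
  fixes k u :: "real^'n::finite \<Rightarrow> real"
  assumes s: "smooth_fun k" and c: "compact K" "\<And>x. x \<notin> K \<Longrightarrow> k x = 0" and u: "integrable lebesgue u"
  shows "C1 (\<lambda>y. \<integral>w. u w * k (y - w) \<partial>lebesgue) (\<lambda>y. \<chi> i. \<integral>w. u w * grad k (y - w) $ i \<partial>lebesgue)"
    and "\<And>y. integrable lebesgue (\<lambda>w. u w * k (y - w))"
proof -
  obtain M where M: "M \<ge> 0" "\<And>x. \<bar>k x\<bar> \<le> M" "\<And>x. norm (grad k x) \<le> M"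
    "\<And>x y. norm (grad k x - grad k y) \<le> M * norm (x - y)" using smooth_fun_bounds[OF s c] by metis
  have Ck: "C1 k (grad k)" using smooth_fun_C1[OF s] .
  have kc: "continuous_on UNIV k" "continuous_on UNIV (\<lambda>x. grad k x $ i)" for i
    using C1_continuous[OF Ck] C1_continuous_grad[OF Ck] by (auto intro!: continuous_on_component)
  have int: "integrable lebesgue (\<lambda>w. u w * f (y - w))" if f: "continuous_on UNIV f" "\<And>x. \<bar>f x\<bar> \<le> M" for f y
  proof (rule Bochner_Integration.integrable_bound)
    show "integrable lebesgue (\<lambda>w. M * u w)" using u by simp
    have "continuous_on UNIV (\<lambda>w. f (y - w))"
      by (rule continuous_on_compose2[OF f(1)]) (auto intro!: continuous_intros)
    then show "(\<lambda>w. u w * f (y - w)) \<in> borel_measurable lebesgue"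
      using borel_measurable_integrable[OF u] by (intro borel_measurable_times) (auto intro: borel_measurable_lebesgue_continuous)
    show "AE w in lebesgue. norm (u w * f (y - w)) \<le> norm (M * u w)"
      using f(2) M(1) by (intro AE_I2) (auto simp: abs_mult mult.commute[of "\<bar>u _\<bar>"] intro!: mult_right_mono)
  qed
  show ik: "integrable lebesgue (\<lambda>w. u w * k (y - w))" for y using int[OF kc(1) M(2)] .
  have gM: "\<bar>grad k x $ i\<bar> \<le> M" for x i using component_le_norm_cart[of "grad k x" i] M(3)[of x] by linarith
  have ig: "integrable lebesgue (\<lambda>w. u w * grad k (y - w) $ i)" for y i using int[OF kc(2) gM] .
  define N where "N = (\<integral>w. \<bar>u w\<bar> \<partial>lebesgue)"
  define U where "U y = (\<integral>w. u w * k (y - w) \<partial>lebesgue)" for y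
  define DU where "DU y = (\<chi> i. \<integral>w. u w * grad k (y - w) $ i \<partial>lebesgue)" for y
  have taylor: "\<bar>k (z + h) - k z - grad k z \<bullet> h\<bar> \<le> M * norm h * norm h" for z h
  proof -
    \<comment> \<open>The mean value inequality is applied to k minus its linear part at z, whose
      gradient is at most M |h| on the ball of radius |h| around z.\<close>
    have "C1 (\<lambda>x. k x - grad k z \<bullet> x) (\<lambda>x. grad k x - grad k z)"
      unfolding C1_def
    proof safe
      fix x
      have "((\<lambda>x. k x - grad k z \<bullet> x) has_derivative (\<lambda>h. grad k x \<bullet> h - grad k z \<bullet> h)) (at x)"
        using Ck unfolding C1_def by (intro derivative_intros) auto
      then show "((\<lambda>x. k x - grad k z \<bullet> x) has_derivative (\<bullet>) (grad k x - grad k z)) (at x)"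
        by (rule has_derivative_eq_rhs) (auto simp: inner_diff_left)
    qed (use Ck in \<open>auto simp: C1_def intro!: continuous_intros\<close>)
    then have "\<bar>(k (z + h) - grad k z \<bullet> (z + h)) - (k z - grad k z \<bullet> z)\<bar> \<le> M * norm h * norm (z + h - z)"
    proof (rule C1_lipschitz_convex[where S="cball z (norm h)"])
      show "norm (grad k x - grad k z) \<le> M * norm h" if "x \<in> cball z (norm h)" for x
        using that M(1) by (intro order_trans[OF M(4)] mult_left_mono) (auto simp: dist_norm norm_minus_commute)
    qed (auto simp: dist_norm)
    then show ?thesis by (simp add: inner_add_right algebra_simps)
  qed
  have der: "(U has_derivative (\<lambda>h. DU y \<bullet> h)) (at y)" for y
  proof (rule has_derivativeI_sandwich[of 1 _ _ _ _ "\<lambda>x. M * N * norm (x - y)"])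
    show "bounded_linear (\<lambda>h. DU y \<bullet> h)" by (rule bounded_linear_inner_right)
    show "((\<lambda>x. M * N * norm (x - y)) \<longlongrightarrow> 0) (at y)"
      by (auto intro!: tendsto_eq_intros)
    fix x assume xy: "x \<noteq> y"
    define h where "h = x - y"
    have DUh: "DU y \<bullet> h = (\<integral>w. u w * (grad k (y - w) \<bullet> h) \<partial>lebesgue)"
    proof -
      have "DU y \<bullet> h = (\<Sum>i\<in>UNIV. (\<integral>w. u w * grad k (y - w) $ i \<partial>lebesgue) * h $ i)"
        by (simp add: inner_vec_def DU_def)
      also have "\<dots> = (\<integral>w. (\<Sum>i\<in>UNIV. u w * grad k (y - w) $ i * h $ i) \<partial>lebesgue)"
        using ig by (subst Bochner_Integration.integral_sum) auto
      finally show ?thesis by (simp add: inner_vec_def sum_distrib_left mult.assoc)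
    qed
    have id: "integrable lebesgue (\<lambda>w. u w * (grad k (y - w) \<bullet> h))"
    proof -
      have "integrable lebesgue (\<lambda>w. (\<Sum>i\<in>UNIV. u w * grad k (y - w) $ i * h $ i))"
        using ig by (intro Bochner_Integration.integrable_sum) auto
      then show ?thesis by (simp add: inner_vec_def sum_distrib_left mult.assoc)
    qed
    have "\<bar>U x - U y - DU y \<bullet> h\<bar> = \<bar>\<integral>w. u w * k (x - w) - u w * k (y - w) - u w * (grad k (y - w) \<bullet> h) \<partial>lebesgue\<bar>"
      using ik id by (simp add: U_def DUh)
    also have "\<dots> \<le> (\<integral>w. \<bar>u w * k (x - w) - u w * k (y - w) - u w * (grad k (y - w) \<bullet> h)\<bar> \<partial>lebesgue)"
      by (rule integral_abs_bound)
    also have "\<dots> \<le> (\<integral>w. \<bar>u w\<bar> * (M * norm h * norm h) \<partial>lebesgue)"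
    proof (rule integral_mono)
      show "\<bar>u w * k (x - w) - u w * k (y - w) - u w * (grad k (y - w) \<bullet> h)\<bar> \<le> \<bar>u w\<bar> * (M * norm h * norm h)" for w
      proof -
        have "u w * k (x - w) - u w * k (y - w) - u w * (grad k (y - w) \<bullet> h) = u w * (k ((y - w) + h) - k (y - w) - grad k (y - w) \<bullet> h)"
          by (simp add: h_def algebra_simps)
        then show ?thesis using taylor[of "y - w" h] by (simp add: abs_mult mult_left_mono)
      qed
    qed (use ik id u in auto)
    also have "\<dots> = M * N * norm h * norm h" by (simp add: N_def algebra_simps)
    finally show "norm (U x - U y - DU y \<bullet> (x - y)) / norm (x - y) \<le> M * N * norm (x - y)"
      using xy by (simp add: h_def divide_le_eq)
  qed simp
  have cont: "continuous_on UNIV DU"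
    unfolding DU_def
  proof (rule continuous_on_vec_lambda)
    fix i
    have N0: "N \<ge> 0" by (simp add: N_def)
    have "(M * N)-lipschitz_on UNIV (\<lambda>y. \<integral>w. u w * grad k (y - w) $ i \<partial>lebesgue)"
    proof (rule lipschitz_onI)
      fix x y :: "real^'n"
      have "\<bar>(\<integral>w. u w * grad k (x - w) $ i \<partial>lebesgue) - (\<integral>w. u w * grad k (y - w) $ i \<partial>lebesgue)\<bar>
         = \<bar>\<integral>w. u w * grad k (x - w) $ i - u w * grad k (y - w) $ i \<partial>lebesgue\<bar>"
        using ig by simp
      also have "\<dots> \<le> (\<integral>w. \<bar>u w * grad k (x - w) $ i - u w * grad k (y - w) $ i\<bar> \<partial>lebesgue)"
        by (rule integral_abs_bound)
      also have "\<dots> \<le> (\<integral>w. \<bar>u w\<bar> * (M * norm (x - y)) \<partial>lebesgue)"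
      proof (rule integral_mono)
        fix w
        have "\<bar>grad k (x - w) $ i - grad k (y - w) $ i\<bar> \<le> norm (grad k (x - w) - grad k (y - w))"
          using component_le_norm_cart[of "grad k (x - w) - grad k (y - w)" i] by simp
        also have "\<dots> \<le> M * norm (x - y)" using M(4)[of "x - w" "y - w"] by simp
        finally show "\<bar>u w * grad k (x - w) $ i - u w * grad k (y - w) $ i\<bar> \<le> \<bar>u w\<bar> * (M * norm (x - y))"
          by (simp add: right_diff_distrib[symmetric] abs_mult mult_left_mono)
      qed (use ig u in auto)
      also have "\<dots> = M * N * norm (x - y)" by (simp add: N_def)
      finally show "dist (\<integral>w. u w * grad k (x - w) $ i \<partial>lebesgue) (\<integral>w. u w * grad k (y - w) $ i \<partial>lebesgue) \<le> M * N * dist x y"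
        by (simp add: dist_norm)
    qed (use M N0 in auto)
    then show "continuous_on UNIV (\<lambda>y. \<integral>w. u w * grad k (y - w) $ i \<partial>lebesgue)"
      by (rule lipschitz_on_continuous_on)
  qed
  show "C1 (\<lambda>y. \<integral>w. u w * k (y - w) \<partial>lebesgue) (\<lambda>y. \<chi> i. \<integral>w. u w * grad k (y - w) $ i \<partial>lebesgue)"
    using der cont unfolding C1_def U_def[abs_def] DU_def[abs_def] by blast
qed

lemma integrable_mult_square:
  fixes h k :: "'a \<Rightarrow> real"
  assumes k: "integrable M k" "\<And>z. 0 \<le> k z" and h: "h \<in> borel_measurable M"
    and hk: "integrable M (\<lambda>z. (h z)\<^sup>2 * k z)"
  shows "integrable M (\<lambda>z. h z * k z)"
proof (rule Bochner_Integration.integrable_bound)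
  show "integrable M (\<lambda>z. k z + (h z)\<^sup>2 * k z)" using k hk by simp
  show "(\<lambda>z. h z * k z) \<in> borel_measurable M" using h k by auto
  have "\<bar>h z\<bar> * k z \<le> k z + (h z)\<^sup>2 * k z" for z
  proof -
    have "\<bar>h z\<bar> \<le> 1 + (h z)\<^sup>2" using zero_le_power2[of "\<bar>h z\<bar> - 1"] by (simp add: power2_diff)
    from mult_right_mono[OF this k(2)] show ?thesis by (simp add: algebra_simps)
  qed
  then show "AE z in M. norm (h z * k z) \<le> norm (k z + (h z)\<^sup>2 * k z)"
    using k(2) by (intro AE_I2) (auto simp: abs_mult)
qed

text \<open>Jensen's inequality for the square: the variance of h under the probability density k is
  nonnegative.\<close>

lemma square_integral_le:
  fixes h k :: "'a \<Rightarrow> real"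
  assumes k: "integrable M k" "\<And>z. 0 \<le> k z" "(\<integral>z. k z \<partial>M) = 1" and h[measurable]: "h \<in> borel_measurable M"
  shows "ennreal ((\<integral>z. h z * k z \<partial>M)\<^sup>2) \<le> (\<integral>\<^sup>+z. ennreal ((h z)\<^sup>2 * k z) \<partial>M)"
proof (cases "(\<integral>\<^sup>+z. ennreal ((h z)\<^sup>2 * k z) \<partial>M) = \<infinity>")
  case False
  note [measurable] = borel_measurable_integrable[OF k(1)]
  have i2: "integrable M (\<lambda>z. (h z)\<^sup>2 * k z)"
    using False k(2) by (intro integrableI_nonneg) (auto simp: top.not_eq_extremum)
  have i1: "integrable M (\<lambda>z. h z * k z)" by (rule integrable_mult_square[OF k(1,2) h i2])
  define m where "m = (\<integral>z. h z * k z \<partial>M)"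
  have "0 \<le> (\<integral>z. (h z - m)\<^sup>2 * k z \<partial>M)" using k(2) by (intro Bochner_Integration.integral_nonneg) auto
  also have "\<dots> = (\<integral>z. (h z)\<^sup>2 * k z - 2 * m * (h z * k z) + m\<^sup>2 * k z \<partial>M)"
    by (intro Bochner_Integration.integral_cong) (auto simp: power2_eq_square algebra_simps)
  also have "\<dots> = (\<integral>z. (h z)\<^sup>2 * k z \<partial>M) - m\<^sup>2"
    using i1 i2 k by (simp add: m_def[symmetric] power2_eq_square)
  finally have "m\<^sup>2 \<le> (\<integral>z. (h z)\<^sup>2 * k z \<partial>M)" by simp
  then show ?thesis
    using i2 k(2) by (subst nn_integral_eq_integral) (auto simp: m_def ennreal_leI)
qed simp

text \<open>The contraction without the shift: with \<open>shrink s z x = ctr s x - z\<close> an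
  average over z is a convolution evaluated at \<open>ctr s x\<close>.\<close>

abbreviation (input) ctr :: "real \<Rightarrow> real^'n \<Rightarrow> real^'n::finite" where
  "ctr s \<equiv> diag (\<lambda>_. 1 - 2 * s) (\<chi> i. s)"

lemma shrink_eq: "shrink s z x = ctr s x - z"
  by (simp add: vec_eq_iff)

lemma measurable_ctr [measurable]: "diag m t \<in> borel_measurable borel"
  using borel_measurable_continuous_onI[OF continuous_on_diag] .

text \<open>Fubini: a bound for every shift z that occurs in the average survives averaging with a
  probability density.\<close>

lemma nn_integral_mollify_le:
  fixes F :: "real^'n::finite \<Rightarrow> real^'n \<Rightarrow> ennreal"
  assumes k[measurable]: "integrable lborel k" "\<And>z. 0 \<le> k z" "(\<integral>z. k z \<partial>lborel) = 1"
    and F[measurable]: "case_prod F \<in> borel_measurable (lborel \<Otimes>\<^sub>M lborel)"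
    and c: "\<And>z. k z \<noteq> 0 \<Longrightarrow> (\<integral>\<^sup>+x. F x z \<partial>lborel) \<le> c"
  shows "(\<integral>\<^sup>+x. (\<integral>\<^sup>+z. F x z * ennreal (k z) \<partial>lborel) \<partial>lborel) \<le> c"
proof -
  note [measurable] = borel_measurable_integrable[OF k(1)]
  have "(\<integral>\<^sup>+x. (\<integral>\<^sup>+z. F x z * ennreal (k z) \<partial>lborel) \<partial>lborel) = (\<integral>\<^sup>+z. (\<integral>\<^sup>+x. F x z * ennreal (k z) \<partial>lborel) \<partial>lborel)"
    by (rule lborel_pair.Fubini'[symmetric]) measurable
  also have "\<dots> = (\<integral>\<^sup>+z. (\<integral>\<^sup>+x. F x z \<partial>lborel) * ennreal (k z) \<partial>lborel)"
    by (intro nn_integral_cong nn_integral_multc) measurable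
  also have "\<dots> \<le> (\<integral>\<^sup>+z. c * ennreal (k z) \<partial>lborel)"
  proof (intro nn_integral_mono)
    fix z show "(\<integral>\<^sup>+x. F x z \<partial>lborel) * ennreal (k z) \<le> c * ennreal (k z)"
      using c[of z] by (cases "k z = 0") (auto intro: mult_right_mono)
  qed
  also have "\<dots> = c * (\<integral>\<^sup>+z. ennreal (k z) \<partial>lborel)" by (rule nn_integral_cmult) measurable
  also have "(\<integral>\<^sup>+z. ennreal (k z) \<partial>lborel) = 1"
    using k by (subst nn_integral_eq_integral) auto
  finally show ?thesis by simp
qed

text \<open>Jensen's inequality inside, Fubini outside; the constant is the Jacobian of the
  contraction and tends to 1 with s.\<close>

lemma mollify_square:
  fixes f k :: "real^'n::finite \<Rightarrow> real"
  assumes f[measurable]: "f \<in> borel_measurable borel"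
    and k: "integrable lborel k" "\<And>z. 0 \<le> k z" "(\<integral>z. k z \<partial>lborel) = 1"
    and s: "0 \<le> s" "s \<le> 1/4"
  shows "(\<integral>\<^sup>+x. ennreal ((\<integral>z. f (ctr s x - z) * k z \<partial>lborel)\<^sup>2) * indicator cubeQ x \<partial>lborel)
    \<le> ennreal ((1 / (1 - 2 * s)) ^ CARD('n)) * (\<integral>\<^sup>+x. ennreal ((f x)\<^sup>2) \<partial>lborel)"
proof -
  have "(\<integral>\<^sup>+x. ennreal ((\<integral>z. f (ctr s x - z) * k z \<partial>lborel)\<^sup>2) * indicator cubeQ x \<partial>lborel)
     \<le> (\<integral>\<^sup>+x. (\<integral>\<^sup>+z. ennreal ((f (ctr s x - z))\<^sup>2) * ennreal (k z) \<partial>lborel) \<partial>lborel)"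
  proof (rule nn_integral_mono)
    fix x
    have "ennreal ((\<integral>z. f (ctr s x - z) * k z \<partial>lborel)\<^sup>2) * indicator cubeQ x \<le> ennreal ((\<integral>z. f (ctr s x - z) * k z \<partial>lborel)\<^sup>2)"
      by (simp add: indicator_def)
    also have "\<dots> \<le> (\<integral>\<^sup>+z. ennreal ((f (ctr s x - z))\<^sup>2 * k z) \<partial>lborel)"
      by (rule square_integral_le[OF k]) measurable
    also have "\<dots> = (\<integral>\<^sup>+z. ennreal ((f (ctr s x - z))\<^sup>2) * ennreal (k z) \<partial>lborel)"
      using k(2) by (intro nn_integral_cong) (simp add: ennreal_mult)
    finally show "ennreal ((\<integral>z. f (ctr s x - z) * k z \<partial>lborel)\<^sup>2) * indicator cubeQ x
      \<le> (\<integral>\<^sup>+z. ennreal ((f (ctr s x - z))\<^sup>2) * ennreal (k z) \<partial>lborel)" .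
  qed
  also have "\<dots> \<le> ennreal ((1 / (1 - 2 * s)) ^ CARD('n)) * (\<integral>\<^sup>+x. ennreal ((f x)\<^sup>2) \<partial>lborel)"
  proof (rule nn_integral_mollify_le[OF k])
    show "(\<lambda>(x, z). ennreal ((f (ctr s x - z))\<^sup>2)) \<in> borel_measurable (lborel \<Otimes>\<^sub>M lborel)"
      by measurable
    fix z
    have "(\<integral>\<^sup>+x. ennreal ((f (ctr s x - z))\<^sup>2) \<partial>lborel) = (\<integral>\<^sup>+x. ennreal ((f (shrink s z x))\<^sup>2) \<partial>lborel)"
      by (simp add: shrink_eq)
    also have "\<dots> = ennreal (1 / (\<Prod>i\<in>(UNIV::'n set). \<bar>1 - 2 * s\<bar>)) * (\<integral>\<^sup>+x. ennreal ((f x)\<^sup>2) \<partial>lborel)"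
      using s by (intro nn_integral_diag_lborel) auto
    also have "1 / (\<Prod>i\<in>(UNIV::'n set). \<bar>1 - 2 * s\<bar>) = (1 / (1 - 2 * s)) ^ CARD('n)"
      using s by (simp add: power_divide)
    finally show "(\<integral>\<^sup>+x. ennreal ((f (ctr s x - z))\<^sup>2) \<partial>lborel) \<le> ennreal ((1 / (1 - 2 * s)) ^ CARD('n)) * (\<integral>\<^sup>+x. ennreal ((f x)\<^sup>2) \<partial>lborel)" 
      by simp
  qed
  finally show ?thesis .
qed

subsection \<open>Sobolev functions on the cube\<close>

text \<open>The extended-valued integral over the cube: Dirichlet integrals and p-th powers may be
  infinite, and \<open>ennreal\<close> cuts off negative values.\<close>

definition EQ :: "(real^'n::finite \<Rightarrow> real) \<Rightarrow> ennreal" where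
  "EQ f = (\<integral>\<^sup>+x. ennreal (f x) * indicator cubeQ x \<partial>lebesgue)"

lemma EQ_cong_AE: "(AE x in lebesgue. x \<in> cubeQ \<longrightarrow> f x = g x) \<Longrightarrow> EQ f = EQ g"
  unfolding EQ_def by (rule nn_integral_cong_AE) (auto elim!: eventually_mono simp: indicator_def)

lemma EQ_cong: "(\<And>x. x \<in> cubeQ \<Longrightarrow> f x = g x) \<Longrightarrow> EQ f = EQ g"
  by (rule EQ_cong_AE) auto

lemma EQ_mono: "(\<And>x. x \<in> cubeQ \<Longrightarrow> f x \<le> g x) \<Longrightarrow> EQ f \<le> EQ g"
  unfolding EQ_def by (rule nn_integral_mono) (auto simp: indicator_def ennreal_leI)

lemma weak_gradient_cong_AE:
  fixes u :: "real^'n::finite \<Rightarrow> real"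
  assumes w: "weak_gradient S u g" and ae: "AE x in lebesgue. x \<in> S \<longrightarrow> u x = u' x \<and> g x = g' x"
    and m: "u' \<in> borel_measurable lebesgue" "g' \<in> borel_measurable lebesgue"
  shows "weak_gradient S u' g'"
  unfolding weak_gradient_iff
proof (intro conjI allI impI ballI)
  have gi: "(\<lambda>x. g' x $ i) \<in> borel_measurable lebesgue" for i
    using measurable_compose[OF m(2) borel_measurable_nth] .
  fix K :: "(real^'n) set" assume K: "compact K \<and> K \<subseteq> S"
  then have Km: "K \<in> sets lebesgue" using lmeasurable_compact by blast
  have si: "set_integrable lebesgue K u" "set_integrable lebesgue K (\<lambda>x. g x $ i)" for i
    using w K unfolding weak_gradient_def by auto
  show "set_integrable lebesgue K u'" unfolding set_integrable_def
  proof (rule integrable_cong_AE_imp[OF si(1)[unfolded set_integrable_def]])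
    show "AE x in lebesgue. indicat_real K x *\<^sub>R u x = indicat_real K x *\<^sub>R u' x"
      using ae by eventually_elim (use K in \<open>auto simp: indicator_def\<close>)
  qed (use m Km in auto)
  show "set_integrable lebesgue K (\<lambda>x. g' x $ i)" for i unfolding set_integrable_def
  proof (rule integrable_cong_AE_imp[OF si(2)[unfolded set_integrable_def]])
    show "AE x in lebesgue. indicat_real K x *\<^sub>R g x $ i = indicat_real K x *\<^sub>R g' x $ i"
      using ae by eventually_elim (use K in \<open>auto simp: indicator_def\<close>)
  qed (use gi[of i] Km in auto)
next
  have gi: "(\<lambda>x. g' x $ i) \<in> borel_measurable lebesgue" for i
    using measurable_compose[OF m(2) borel_measurable_nth] .
  fix \<phi> i assume \<phi>: "\<phi> \<in> test_funs S"
  note T = test_funsD[OF \<phi>]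
  have z: "\<phi> x = 0 \<and> partial_deriv i \<phi> x = 0" if "x \<notin> S" for x using T(3,4,5) that by blast
  note I = weak_gradient_integrable[OF w \<phi>]
  have mm: "\<phi> \<in> borel_measurable lebesgue" "partial_deriv i \<phi> \<in> borel_measurable lebesgue"
    by (intro borel_measurable_lebesgue_continuous T)+
  have "(\<integral>x. u' x * partial_deriv i \<phi> x \<partial>lebesgue) = (\<integral>x. u x * partial_deriv i \<phi> x \<partial>lebesgue)"
  proof (rule integral_cong_AE)
    show "AE x in lebesgue. u' x * partial_deriv i \<phi> x = u x * partial_deriv i \<phi> x"
      using ae by eventually_elim (metis z mult_zero_right)
  qed (use m mm I in auto)
  moreover have "(\<integral>x. g' x $ i * \<phi> x \<partial>lebesgue) = (\<integral>x. g x $ i * \<phi> x \<partial>lebesgue)"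
  proof (rule integral_cong_AE)
    show "AE x in lebesgue. g' x $ i * \<phi> x = g x $ i * \<phi> x"
      using ae by eventually_elim (metis z mult_zero_right)
  qed (use gi[of i] mm I in auto)
  ultimately show "(\<integral>x. u' x * partial_deriv i \<phi> x \<partial>lebesgue) = - (\<integral>x. g' x $ i * \<phi> x \<partial>lebesgue)"
    using w \<phi> unfolding weak_gradient_iff by simp
qed

text \<open>The exchange of integrals in the mollification needs Borel functions, so u and the
  components of its gradient are replaced by Borel versions that vanish off the cube.\<close>

lemma borel_representative:
  fixes f :: "real^'n::finite \<Rightarrow> real"
  assumes "set_integrable lebesgue cubeQ f"
  obtains f' where "f' \<in> borel_measurable borel" "integrable lborel f'" "\<And>x. x \<notin> cubeQ \<Longrightarrow> f' x = 0"
    "AE x in lebesgue. x \<in> cubeQ \<longrightarrow> f x = f' x"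
proof -
  let ?f = "\<lambda>x. indicator cubeQ x *\<^sub>R f x"
  have i: "integrable lebesgue ?f" using assms by (simp add: set_integrable_def)
  then obtain h where h: "h \<in> borel_measurable lborel" "AE x in lborel. ?f x = h x"
    using completion_ex_borel_measurable_real[of ?f lborel] by auto
  define f' where "f' x = indicator cubeQ x * h x" for x
  have b: "f' \<in> borel_measurable borel" unfolding f'_def using h by (auto intro!: borel_measurable_times)
  have ae: "AE x in lebesgue. ?f x = f' x"
    using AE_completion[OF h(2)] by eventually_elim (auto simp: f'_def indicator_def)
  have "integrable lebesgue f'"
    by (rule integrable_cong_AE_imp[OF i]) (use b ae in \<open>auto simp: measurable_completion\<close>)
  then have "integrable lborel f'" using b by (simp add: integrable_completion)
  moreover have "AE x in lebesgue. x \<in> cubeQ \<longrightarrow> f x = f' x"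
    using ae by eventually_elim (auto simp: indicator_def)
  ultimately show thesis using b by (intro that[of f']) (auto simp: f'_def)
qed

lemma borel_measurable_vec_components:
  fixes g :: "'a \<Rightarrow> real^'n::finite"
  assumes "\<And>i. (\<lambda>x. g x $ i) \<in> borel_measurable M"
  shows "g \<in> borel_measurable M"
proof -
  have "(\<lambda>x. g x \<bullet> b) \<in> borel_measurable M" if "b \<in> Basis" for b
    using that assms by (auto simp: Basis_vec_real inner_axis)
  then show ?thesis by (subst borel_measurable_euclidean_space) auto
qed

lemma norm_power2_vec: "(norm (x::real^'n::finite))\<^sup>2 = (\<Sum>i\<in>UNIV. (x $ i)\<^sup>2)"
  unfolding power2_norm_eq_inner inner_vec_def by (simp add: power2_eq_square)

text \<open>The approximation is the mollified function composed with the contraction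
  \<open>ctr s\<close>. At the points of [s, 1 - s]^d a kernel of smaller radius sees only the open
  cube, so the gradient of the convolution is the mollified weak gradient. For the gradients only a
  norm bound with factor 1 + e is recorded, which is what inequalities with the Dirichlet integral
  on the larger side need.\<close>

lemma C1_density:
  fixes u :: "real^'n::finite \<Rightarrow> real"
  assumes W: "W11Q u g" and e: "e > 0"
  obtains v Dv where "C1 v Dv" "EQ (\<lambda>x. \<bar>v x - u x\<bar>) \<le> ennreal e"
    "EQ (\<lambda>x. (norm (Dv x))\<^sup>2) \<le> ennreal (1 + e) * EQ (\<lambda>x. (norm (g x))\<^sup>2)"
    "EQ (\<lambda>x. (v x)\<^sup>2) \<le> ennreal (1 + e) * EQ (\<lambda>x. (u x)\<^sup>2)"
proof -
  define d where "d = CARD('n)"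
  have si: "set_integrable lebesgue cubeQ u" "\<And>i. set_integrable lebesgue cubeQ (\<lambda>x. g x $ i)"
    and wg: "weak_gradient (box 0 1) u g" using W by (auto simp: W11Q_def interior_cubeQ)
  obtain u' where u': "u' \<in> borel_measurable borel" "integrable lborel u'" "\<And>x. x \<notin> cubeQ \<Longrightarrow> u' x = 0"
    "AE x in lebesgue. x \<in> cubeQ \<longrightarrow> u x = u' x" by (rule borel_representative[OF si(1)]) blast
  have "\<forall>i. \<exists>h. h \<in> borel_measurable borel \<and> integrable lborel h \<and> (\<forall>x. x \<notin> cubeQ \<longrightarrow> h x = 0) \<and>
    (AE x in lebesgue. x \<in> cubeQ \<longrightarrow> g x $ i = h x)"
  proof
    fix i
    obtain h where "h \<in> borel_measurable borel" "integrable lborel h" "\<And>x. x \<notin> cubeQ \<Longrightarrow> h x = 0"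
      "AE x in lebesgue. x \<in> cubeQ \<longrightarrow> g x $ i = h x" by (rule borel_representative[OF si(2)[of i]]) blast
    then show "\<exists>h. h \<in> borel_measurable borel \<and> integrable lborel h \<and> (\<forall>x. x \<notin> cubeQ \<longrightarrow> h x = 0) \<and>
      (AE x in lebesgue. x \<in> cubeQ \<longrightarrow> g x $ i = h x)" by blast
  qed
  from choice[OF this] obtain h where hh: "\<forall>i. h i \<in> borel_measurable borel \<and> integrable lborel (h i) \<and>
    (\<forall>x. x \<notin> cubeQ \<longrightarrow> h i x = 0) \<and> (AE x in lebesgue. x \<in> cubeQ \<longrightarrow> g x $ i = h i x)" by blast
  have h: "\<And>i. h i \<in> borel_measurable borel" "\<And>i. integrable lborel (h i)"
    "\<And>i x. x \<notin> cubeQ \<Longrightarrow> h i x = 0" "\<And>i. AE x in lebesgue. x \<in> cubeQ \<longrightarrow> g x $ i = h i x"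
    using hh by blast+
  note [measurable] = u'(1) h(1)
  define g' where "g' x = (\<chi> i. h i x)" for x
  have [measurable]: "g' \<in> borel_measurable borel"
    by (rule borel_measurable_vec_components) (simp add: g'_def)
  have aeg: "AE x in lebesgue. x \<in> cubeQ \<longrightarrow> g x = g' x"
  proof -
    have "AE x in lebesgue. \<forall>i\<in>UNIV. x \<in> cubeQ \<longrightarrow> g x $ i = h i x"
      by (rule AE_finite_allI) (use h in auto)
    then show ?thesis by eventually_elim (auto simp: g'_def vec_eq_iff)
  qed
  have box_sub: "box 0 1 \<subseteq> (cubeQ :: (real^'n) set)" by (simp add: cubeQ_def box_subset_cbox)
  have ae2: "AE x in lebesgue. x \<in> box 0 1 \<longrightarrow> u x = u' x \<and> g x = g' x"
    using u'(4) aeg by eventually_elim (use box_sub in blast)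
  have wg': "weak_gradient (box 0 1) u' g'"
    by (rule weak_gradient_cong_AE[OF wg ae2]) (auto intro: measurable_completion)
  obtain \<delta> where \<delta>01: "\<delta> > 0" "\<delta> \<le> 1/4" and \<delta>2: "\<forall>s z. 0 \<le> s \<and> s \<le> \<delta> \<and> (\<forall>i. \<bar>z $ i\<bar> \<le> s) \<longrightarrow>
     (\<integral>\<^sup>+x. ennreal \<bar>u' (shrink s z x) - u' x\<bar> * indicator cubeQ x \<partial>lborel) \<le> ennreal e"
    using L1_shrink_small[OF u'(1,2) e] by blast
  have \<delta>: "\<delta> > 0" "\<delta> \<le> 1/4" "\<And>s z. 0 \<le> s \<Longrightarrow> s \<le> \<delta> \<Longrightarrow> (\<And>i. \<bar>z $ i\<bar> \<le> s) \<Longrightarrow>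
     (\<integral>\<^sup>+x. ennreal \<bar>u' (shrink s z x) - u' x\<bar> * indicator cubeQ x \<partial>lborel) \<le> ennreal e"
    using \<delta>01 \<delta>2 by blast+
  \<comment> \<open>The Jacobian of the contraction becomes the factor 1 + e of the last two
    conclusions.\<close>
  have "((\<lambda>s::real. (1 / (1 - 2 * s)) ^ d) \<longlongrightarrow> (1 / (1 - 2 * 0)) ^ d) (at_right 0)"
    by (intro tendsto_intros) auto
  then have "eventually (\<lambda>s::real. (1 / (1 - 2 * s)) ^ d < 1 + e) (at_right 0)"
    using e by (intro order_tendstoD) auto
  moreover have "eventually (\<lambda>s::real. s < \<delta>) (at_right 0)"
    using \<delta>(1) by (metis eventually_at_right_field)
  moreover have "eventually (\<lambda>s::real. s > 0) (at_right 0)"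
    by (simp add: eventually_at_right_less)
  ultimately have "eventually (\<lambda>s::real. (1 / (1 - 2 * s)) ^ d < 1 + e \<and> s < \<delta> \<and> s > 0) (at_right 0)"
    by eventually_elim simp
  then obtain s where s: "(1 / (1 - 2 * s)) ^ d \<le> 1 + e" "s \<le> \<delta>" "s > 0"
    using eventually_happens'[OF trivial_limit_at_right_real] less_imp_le by blast
  have s4: "s \<le> 1/4" "0 \<le> s" using s \<delta> by auto
  \<comment> \<open>Radius s/2 instead of s: the support of the kernel around a point of
    [s, 1 - s]^d is then a compact subset of the open cube.\<close>
  obtain k :: "real^'n \<Rightarrow> real" where k: "\<And>z. 0 \<le> k z" "\<And>z i. k z \<noteq> 0 \<Longrightarrow> \<bar>z $ i\<bar> \<le> s/2"
    "integrable lborel k" "(\<integral>z. k z \<partial>lborel) = 1" "smooth_fun k" "\<And>x. smooth_fun (\<lambda>y. k (x - y))"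
    by (rule mollifier_exists[of "s/2"]) (use s(3) in \<open>simp, blast\<close>)
  note [measurable] = borel_measurable_integrable[OF k(3), simplified]
  define K where "K = cbox (\<chi> i. - (s/2)) (\<chi> i::'n. s/2)"
  have "x \<in> K" if "k x \<noteq> 0" for x
  proof -
    have "- (s/2) \<le> x $ i \<and> x $ i \<le> s/2" for i using k(2)[OF that, of i] by linarith
    then show ?thesis by (simp add: K_def mem_box_cart)
  qed
  then have K: "compact K" "\<And>x. x \<notin> K \<Longrightarrow> k x = 0" by (auto simp: K_def)
  have iu: "integrable lebesgue u'" using u'(1,2) by (simp add: integrable_completion)
  define U where "U y = (\<integral>w. u' w * k (y - w) \<partial>lebesgue)" for y
  define DU where "DU y = (\<chi> i. \<integral>w. u' w * grad k (y - w) $ i \<partial>lebesgue)" for y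
  have CU: "C1 U DU" unfolding U_def DU_def by (rule C1_convolution(1)[OF k(5) K iu])
  define v where "v x = U (ctr s x)" for x
  define Dv where "Dv x = (\<chi> i. (1 - 2 * s) * DU (ctr s x) $ i)" for x
  have Cv: "C1 v Dv" unfolding v_def Dv_def by (rule C1_diag[OF CU])
  \<comment> \<open>Both forms of the convolution are used: in w the kernel is differentiated, in z
    the function is averaged.\<close>
  have conv: "(\<integral>w. f w * k (y - w) \<partial>lebesgue) = (\<integral>z. f (y - z) * k z \<partial>lborel)"
    if [measurable]: "f \<in> borel_measurable borel" for f y
  proof -
    have dd: "diag (\<lambda>_. -1) y z = y - z" for z by (simp add: vec_eq_iff)
    have "(\<integral>w. f w * k (y - w) \<partial>lebesgue) = (\<integral>z. f (y - z) * k z \<partial>lebesgue)"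
      using integral_diag'[of "\<lambda>_. -1" "\<lambda>w. f w * k (y - w)" y] by (simp add: dd)
    also have "\<dots> = (\<integral>z. f (y - z) * k z \<partial>lborel)" by (rule integral_completion) measurable
    finally show ?thesis .
  qed
  have EQu: "EQ f = EQ f'" if "AE x in lebesgue. x \<in> cubeQ \<longrightarrow> f x = f' x" for f f' :: "real^'n \<Rightarrow> real"
    using EQ_cong_AE that .
  show thesis
  proof (rule that[OF Cv])
    have "EQ (\<lambda>x. \<bar>v x - u x\<bar>) = EQ (\<lambda>x. \<bar>v x - u' x\<bar>)"
      by (rule EQ_cong_AE) (use u'(4) in eventually_elim, simp)
    also have "\<dots> = (\<integral>\<^sup>+x. ennreal \<bar>v x - u' x\<bar> * indicator cubeQ x \<partial>lborel)"
      by (simp add: EQ_def nn_integral_completion)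
    also have "\<dots> \<le> (\<integral>\<^sup>+x. (\<integral>\<^sup>+z. (ennreal \<bar>u' (ctr s x - z) - u' x\<bar> * indicator cubeQ x) * ennreal (k z) \<partial>lborel) \<partial>lborel)"
    proof (rule nn_integral_mono)
      fix x :: "real^'n"
      have ic: "integrable lborel (\<lambda>z. u' (ctr s x - z) * k z)"
      proof -
        have "integrable lebesgue (\<lambda>w. u' w * k (ctr s x - w))" by (rule C1_convolution(2)[OF k(5) K iu])
        then have "integrable lebesgue (\<lambda>z. u' (diag (\<lambda>_. -1) (ctr s x) z) * k (ctr s x - diag (\<lambda>_. -1) (ctr s x) z))"
          by (rule integrable_diag[rotated]) simp
        moreover have "diag (\<lambda>_. -1) (ctr s x) z = ctr s x - z" for z by (simp add: vec_eq_iff)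
        ultimately have "integrable lebesgue (\<lambda>z. u' (ctr s x - z) * k z)" by simp
        then show ?thesis by (subst (asm) integrable_completion) measurable
      qed
      have "v x - u' x = (\<integral>z. u' (ctr s x - z) * k z - u' x * k z \<partial>lborel)"
        unfolding v_def U_def conv[OF u'(1)] using ic k(3,4) by simp
      then have "\<bar>v x - u' x\<bar> \<le> (\<integral>z. \<bar>u' (ctr s x - z) * k z - u' x * k z\<bar> \<partial>lborel)"
        by (simp only: integral_abs_bound)
      then have "ennreal \<bar>v x - u' x\<bar> \<le> ennreal (\<integral>z. \<bar>u' (ctr s x - z) * k z - u' x * k z\<bar> \<partial>lborel)"
        by (rule ennreal_leI)
      also have "\<dots> = (\<integral>\<^sup>+z. ennreal \<bar>u' (ctr s x - z) * k z - u' x * k z\<bar> \<partial>lborel)"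
        using ic k(3) by (intro nn_integral_eq_integral[symmetric]) auto
      also have "\<dots> = (\<integral>\<^sup>+z. ennreal \<bar>u' (ctr s x - z) - u' x\<bar> * ennreal (k z) \<partial>lborel)"
        using k(1) by (intro nn_integral_cong) (simp add: ennreal_mult[symmetric] abs_mult left_diff_distrib[symmetric])
      finally show "ennreal \<bar>v x - u' x\<bar> * indicator cubeQ x \<le> (\<integral>\<^sup>+z. (ennreal \<bar>u' (ctr s x - z) - u' x\<bar> * indicator cubeQ x) * ennreal (k z) \<partial>lborel)"
        by (cases "x \<in> cubeQ") auto
    qed
    also have "\<dots> \<le> ennreal e"
    proof (rule nn_integral_mollify_le[OF k(3,1,4)])
      show "(\<lambda>(x, z). ennreal \<bar>u' (ctr s x - z) - u' x\<bar> * indicator cubeQ x) \<in> borel_measurable (lborel \<Otimes>\<^sub>M lborel)"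
        by measurable
      fix z assume "k z \<noteq> 0"
      then have "\<bar>z $ i\<bar> \<le> s" for i using k(2)[of z i] s(3) by linarith
      then have "(\<integral>\<^sup>+x. ennreal \<bar>u' (shrink s z x) - u' x\<bar> * indicator cubeQ x \<partial>lborel) \<le> ennreal e"
        using s s4 by (intro \<delta>(3)) auto
      then show "(\<integral>\<^sup>+x. ennreal \<bar>u' (ctr s x - z) - u' x\<bar> * indicator cubeQ x \<partial>lborel) \<le> ennreal e"
        by (simp add: shrink_eq)
    qed
    finally show "EQ (\<lambda>x. \<bar>v x - u x\<bar>) \<le> ennreal e" .
  next
    have fin: "EQ (\<lambda>x. (\<integral>z. f (ctr s x - z) * k z \<partial>lborel)\<^sup>2) \<le> ennreal (1 + e) * EQ (\<lambda>x. (f x)\<^sup>2)"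
      if f[measurable]: "f \<in> borel_measurable borel" and f0: "\<And>x. x \<notin> cubeQ \<Longrightarrow> f x = 0" for f :: "real^'n \<Rightarrow> real"
    proof -
      have "EQ (\<lambda>x. (\<integral>z. f (ctr s x - z) * k z \<partial>lborel)\<^sup>2) \<le> ennreal ((1 / (1 - 2 * s)) ^ d) * (\<integral>\<^sup>+x. ennreal ((f x)\<^sup>2) \<partial>lborel)"
        unfolding EQ_def nn_integral_completion d_def by (rule mollify_square[OF f k(3,1,4) s4(2,1)])
      also have "\<dots> \<le> ennreal (1 + e) * (\<integral>\<^sup>+x. ennreal ((f x)\<^sup>2) \<partial>lborel)"
        using s(1) by (intro mult_right_mono ennreal_leI) auto
      also have "(\<integral>\<^sup>+x. ennreal ((f x)\<^sup>2) \<partial>lborel) = EQ (\<lambda>x. (f x)\<^sup>2)"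
        unfolding EQ_def nn_integral_completion using f0 by (intro nn_integral_cong) (auto simp: indicator_def)
      finally show ?thesis .
    qed
    have "EQ (\<lambda>x. (v x)\<^sup>2) \<le> ennreal (1 + e) * EQ (\<lambda>x. (u' x)\<^sup>2)"
      unfolding v_def U_def conv[OF u'(1)] by (rule fin[OF u'(1,3)])
    also have "EQ (\<lambda>x. (u' x)\<^sup>2) = EQ (\<lambda>x. (u x)\<^sup>2)"
      by (rule EQ_cong_AE) (use u'(4) in eventually_elim, simp)
    finally show "EQ (\<lambda>x. (v x)\<^sup>2) \<le> ennreal (1 + e) * EQ (\<lambda>x. (u x)\<^sup>2)" .
    \<comment> \<open>As a function of w the kernel k (y - w) is a test function on the open cube.
      Its derivative in w is minus that of k, and this sign cancels the one in the definition of the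
      weak gradient.\<close>
    have DUg: "DU (ctr s x) $ i = (\<integral>z. h i (ctr s x - z) * k z \<partial>lborel)" if x: "x \<in> cubeQ" for x i
    proof -
      let ?y = "ctr s x"
      define \<phi> where "\<phi> w = k (?y - w)" for w
      have y: "s \<le> ?y $ j" "?y $ j \<le> 1 - s" for j
      proof -
        have "0 \<le> x $ j" "x $ j \<le> 1" using x by (auto simp: mem_cubeQ)
        then have "0 \<le> (1 - 2 * s) * x $ j" "(1 - 2 * s) * x $ j \<le> 1 - 2 * s"
          using s4 by (auto intro: mult_nonneg_nonneg mult_left_le)
        then show "s \<le> ?y $ j" "?y $ j \<le> 1 - s" by auto
      qed
      have "{w. \<phi> w \<noteq> 0} \<subseteq> cbox (?y - (\<chi> i. s/2)) (?y + (\<chi> i. s/2))"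
      proof
        fix w assume "w \<in> {w. \<phi> w \<noteq> 0}"
        then have "\<bar>(?y - w) $ j\<bar> \<le> s/2" for j by (intro k(2)) (simp add: \<phi>_def)
        then have "?y $ j - s/2 \<le> w $ j \<and> w $ j \<le> ?y $ j + s/2" for j
          unfolding vector_minus_component by (smt (verit))
        then show "w \<in> cbox (?y - (\<chi> i. s/2)) (?y + (\<chi> i. s/2))"
          unfolding mem_box_cart vector_minus_component vector_add_component vec_lambda_beta by blast
      qed
      then have cl: "closure {w. \<phi> w \<noteq> 0} \<subseteq> cbox (?y - (\<chi> i. s/2)) (?y + (\<chi> i. s/2))"
        by (intro closure_minimal) auto
      also have "\<dots> \<subseteq> box 0 1"
      proof
        fix w assume w: "w \<in> cbox (?y - (\<chi> i. s/2)) (?y + (\<chi> i. s/2))"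
        have "0 < w $ j \<and> w $ j < 1" for j
        proof -
          have "?y $ j - s/2 \<le> w $ j" "w $ j \<le> ?y $ j + s/2"
            using w unfolding mem_box_cart by (auto dest!: spec[of _ j])
          then show ?thesis using y[of j] s(3) by linarith
        qed
        then show "w \<in> box 0 1" by (simp add: mem_box_cart)
      qed
      finally have "closure {w. \<phi> w \<noteq> 0} \<subseteq> box 0 1" .
      moreover have "compact (closure {w. \<phi> w \<noteq> 0})"
        using compact_Int_closed[OF compact_cbox closed_closure, of _ _ "{w. \<phi> w \<noteq> 0}"] cl by (metis Int_absorb1)
      moreover have "smooth_fun \<phi>" unfolding \<phi>_def by (rule k(6))
      ultimately have T: "\<phi> \<in> test_funs (box 0 1)" by (simp add: test_funs_def)
      have pd: "partial_deriv i \<phi> w = - (grad k (?y - w) $ i)" for w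
      proof -
        have "((\<lambda>w. ?y - w) has_derivative (\<lambda>h. - h)) (at w)" by (auto intro!: derivative_eq_intros)
        moreover have "(k has_derivative (\<lambda>h. grad k (?y - w) \<bullet> h)) (at (?y - w))"
          using smooth_fun_C1[OF k(5)] by (simp add: C1_def)
        ultimately have "(\<phi> has_derivative (\<lambda>h. grad k (?y - w) \<bullet> - h)) (at w)"
          unfolding \<phi>_def by (rule has_derivative_compose)
        then have "(\<phi> has_derivative (\<lambda>h. - grad k (?y - w) \<bullet> h)) (at w)" by simp
        from has_derivative_imp_partial[OF this, of i] show ?thesis by simp
      qed
      have "DU ?y $ i = (\<integral>w. u' w * grad k (?y - w) $ i \<partial>lebesgue)" by (simp add: DU_def)
      also have "\<dots> = - (\<integral>w. u' w * partial_deriv i \<phi> w \<partial>lebesgue)" unfolding pd by simp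
      also have "\<dots> = (\<integral>w. g' w $ i * \<phi> w \<partial>lebesgue)"
        using wg' T unfolding weak_gradient_iff by simp
      also have "\<dots> = (\<integral>w. h i w * k (?y - w) \<partial>lebesgue)" by (simp add: g'_def \<phi>_def)
      finally show ?thesis by (simp only: conv[OF h(1)])
    qed
    have "EQ (\<lambda>x. (norm (Dv x))\<^sup>2) \<le> EQ (\<lambda>x. \<Sum>i\<in>UNIV. (\<integral>z. h i (ctr s x - z) * k z \<partial>lborel)\<^sup>2)"
    proof (rule EQ_mono)
      fix x :: "real^'n" assume x: "x \<in> cubeQ"
      have "(norm (Dv x))\<^sup>2 = (\<Sum>i\<in>UNIV. (1 - 2 * s)\<^sup>2 * (\<integral>z. h i (ctr s x - z) * k z \<partial>lborel)\<^sup>2)"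
        by (simp add: norm_power2_vec Dv_def power_mult_distrib DUg[OF x])
      \<comment> \<open>The chain rule factor (1 - 2s)^2 is at most 1 and is dropped.\<close>
      also have "\<dots> \<le> (\<Sum>i\<in>UNIV. 1 * (\<integral>z. h i (ctr s x - z) * k z \<partial>lborel)\<^sup>2)"
        using s4 by (intro sum_mono mult_right_mono) (auto intro!: power_le_one)
      finally show "(norm (Dv x))\<^sup>2 \<le> (\<Sum>i\<in>UNIV. (\<integral>z. h i (ctr s x - z) * k z \<partial>lborel)\<^sup>2)" by simp
    qed
    also have "\<dots> = (\<Sum>i\<in>UNIV. EQ (\<lambda>x. (\<integral>z. h i (ctr s x - z) * k z \<partial>lborel)\<^sup>2))"
    proof -
      have mm: "(\<lambda>x. (\<integral>z. h i (ctr s x - z) * k z \<partial>lborel)) \<in> borel_measurable lborel" for i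
        by measurable
      then have mm': "(\<lambda>x. ennreal ((\<integral>z. h i (ctr s x - z) * k z \<partial>lborel)\<^sup>2) * indicator cubeQ x) \<in> borel_measurable lborel" for i
        by measurable
      have "ennreal (\<Sum>i\<in>UNIV. (\<integral>z. h i (ctr s x - z) * k z \<partial>lborel)\<^sup>2) * indicator cubeQ x
        = (\<Sum>i\<in>UNIV. ennreal ((\<integral>z. h i (ctr s x - z) * k z \<partial>lborel)\<^sup>2) * indicator cubeQ x)" for x
        by (simp add: sum_ennreal sum_distrib_right[symmetric])
      then show ?thesis unfolding EQ_def nn_integral_completion
        using mm' by (subst nn_integral_sum[symmetric]) auto
    qed
    also have "\<dots> \<le> (\<Sum>i\<in>UNIV. ennreal (1 + e) * EQ (\<lambda>x. (h i x)\<^sup>2))"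
      by (intro sum_mono fin h)
    also have "\<dots> = ennreal (1 + e) * (\<Sum>i\<in>UNIV. EQ (\<lambda>x. (h i x)\<^sup>2))"
      by (simp add: sum_distrib_left)
    also have "(\<Sum>i\<in>UNIV. EQ (\<lambda>x. (h i x)\<^sup>2)) = EQ (\<lambda>x. (norm (g' x))\<^sup>2)"
    proof -
      have "ennreal (\<Sum>i\<in>UNIV. (h i x)\<^sup>2) * indicator cubeQ x = (\<Sum>i\<in>UNIV. ennreal ((h i x)\<^sup>2) * indicator cubeQ x)" for x
        by (simp add: sum_ennreal sum_distrib_right[symmetric])
      then show ?thesis unfolding EQ_def nn_integral_completion norm_power2_vec g'_def
        by (subst nn_integral_sum[symmetric]) auto
    qed
    also have "EQ (\<lambda>x. (norm (g' x))\<^sup>2) = EQ (\<lambda>x. (norm (g x))\<^sup>2)"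
      by (rule EQ_cong_AE) (use aeg in eventually_elim, simp)
    finally show "EQ (\<lambda>x. (norm (Dv x))\<^sup>2) \<le> ennreal (1 + e) * EQ (\<lambda>x. (norm (g x))\<^sup>2)" .
  qed
qed

section \<open>Real-valued integrals over the cube\<close>

definition IQ :: "(real^'n::finite \<Rightarrow> real) \<Rightarrow> real" where
  "IQ f = (LINT x:cubeQ|lebesgue. f x)"

lemma set_integrable_IQ: "continuous_on cubeQ f \<Longrightarrow> set_integrable lebesgue cubeQ (f :: real^'n::finite \<Rightarrow> real)"
  unfolding cubeQ_def by (rule absolutely_integrable_continuous)

lemma IQ_add: "continuous_on cubeQ f \<Longrightarrow> continuous_on cubeQ g \<Longrightarrow> IQ (\<lambda>x. f x + g x) = IQ f + IQ g"
  unfolding IQ_def by (intro set_integral_add(2) set_integrable_IQ)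

lemma IQ_diff: "continuous_on cubeQ f \<Longrightarrow> continuous_on cubeQ g \<Longrightarrow> IQ (\<lambda>x. f x - g x) = IQ f - IQ g"
  unfolding IQ_def by (intro set_integral_diff(2) set_integrable_IQ)

lemma IQ_cmult: "IQ (\<lambda>x. c * f x) = c * IQ f"
  unfolding IQ_def by simp

lemma IQ_mono: "continuous_on cubeQ f \<Longrightarrow> continuous_on cubeQ g \<Longrightarrow> (\<And>x. x \<in> cubeQ \<Longrightarrow> f x \<le> g x) \<Longrightarrow> IQ f \<le> IQ g"
  unfolding IQ_def by (intro set_integral_mono set_integrable_IQ)

lemma IQ_nonneg: "(\<And>x. 0 \<le> f x) \<Longrightarrow> 0 \<le> IQ f"
  unfolding IQ_def set_lebesgue_integral_def by (intro Bochner_Integration.integral_nonneg) auto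

lemma IQ_sum:
  assumes "\<And>j. j \<in> J \<Longrightarrow> continuous_on cubeQ (f j)"
  shows "IQ (\<lambda>x. \<Sum>j\<in>J. f j x) = (\<Sum>j\<in>J. IQ (f j))"
  unfolding IQ_def set_lebesgue_integral_def scaleR_sum_right
  by (rule Bochner_Integration.integral_sum) (use assms set_integrable_IQ set_integrable_def in blast)

lemma EQ_eq_IQ:
  assumes "continuous_on cubeQ f" "\<And>x. 0 \<le> f x"
  shows "EQ f = ennreal (IQ f)"
proof -
  have "EQ f = (\<integral>\<^sup>+x. ennreal (indicator cubeQ x *\<^sub>R f x) \<partial>lebesgue)"
    unfolding EQ_def by (intro nn_integral_cong) (auto simp: indicator_def)
  also have "\<dots> = ennreal (\<integral>x. indicator cubeQ x *\<^sub>R f x \<partial>lebesgue)"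
    using set_integrable_IQ[OF assms(1)] assms(2) unfolding set_integrable_def
    by (intro nn_integral_eq_integral) auto
  finally show ?thesis by (simp add: IQ_def set_lebesgue_integral_def)
qed

lemma continuous_on_abs_powr:
  fixes f :: "'a::topological_space \<Rightarrow> real"
  assumes "continuous_on S f" "p > 0"
  shows "continuous_on S (\<lambda>x. \<bar>f x\<bar> powr p)"
  using assms by (intro continuous_on_powr' continuous_intros) auto

lemma diag_cubeQ_invariant:
  fixes f :: "real^'n::finite \<Rightarrow> real"
  assumes m: "\<And>i. \<bar>m i\<bar> = 1" and inv: "\<And>x. diag m t x \<in> cubeQ \<longleftrightarrow> x \<in> cubeQ"
  shows "IQ (\<lambda>x. f (diag m t x)) = IQ f"
proof -
  have m0: "m i \<noteq> 0" for i using m[of i] by auto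
  have "IQ f = (\<Prod>i\<in>UNIV. \<bar>m i\<bar>) * (\<integral>x. indicator cubeQ (diag m t x) *\<^sub>R f (diag m t x) \<partial>lebesgue)"
    unfolding IQ_def set_lebesgue_integral_def by (rule integral_diag'[where m=m and t=t, OF m0])
  then show ?thesis by (simp add: m IQ_def set_lebesgue_integral_def indicator_def inv)
qed

subsection \<open>Reflection at a corner\<close>

text \<open>Folding onto the first orthant: composing with it is the even reflection in all
  coordinate hyperplanes.\<close>

definition vabs :: "real^'n::finite \<Rightarrow> real^'n" where
  "vabs x = (\<chi> i. \<bar>x $ i\<bar>)"

lemma continuous_vabs: "continuous_on S vabs"
  unfolding vabs_def by (intro continuous_on_vec_lambda continuous_intros)

lemma AE_coordinate_neq:
  "AE x in lebesgue. \<forall>i::'n::finite. (x::real^'n) $ i \<noteq> a"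
proof -
  have "AE x in lebesgue. (x::real^'n) $ i \<noteq> a" for i
  proof -
    have "negligible {x::real^'n. x $ i = a}"       using negligible_standard_hyperplane[of "axis i 1 :: real^'n" a] by (simp add: inner_axis Basis_vec_real)
    then have "AE x in lebesgue. x \<notin> {x::real^'n. x $ i = a}"
      by (intro AE_not_in) (simp add: negligible_iff_null_sets)
    then show ?thesis by simp
  qed
  then have "AE x in lebesgue. \<forall>i\<in>(UNIV::'n set). (x::real^'n) $ i \<noteq> a"
    by (intro AE_finite_allI) auto
  then show ?thesis by simp
qed

text \<open>The reflected cube splits into 2^d pieces, one per orthant, and a sign change of
  coordinates maps each of them to the cube up to a null set.\<close>

lemma nn_integral_fold:
  fixes F :: "real^'n::finite \<Rightarrow> ennreal"
  assumes F[measurable]: "F \<in> borel_measurable borel"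
  shows "(\<integral>\<^sup>+x. F (vabs x) * indicator cubeQ (vabs x) \<partial>lebesgue) = 2 ^ CARD('n) * (\<integral>\<^sup>+x. F x * indicator cubeQ x \<partial>lebesgue)"
proof -
  define H where "H x = F (vabs x) * indicator cubeQ (vabs x)" for x
  have [measurable]: "vabs \<in> borel_measurable borel"
    using borel_measurable_continuous_onI[OF continuous_vabs] .
  have "H \<in> borel_measurable lborel" unfolding H_def by measurable
  then have Hm[measurable]: "H \<in> borel_measurable lebesgue" by (rule measurable_completion)
  \<comment> \<open>An orthant is coded by the set of its nonnegative coordinates; counting 0 as
    nonnegative puts every point in exactly one of them.\<close>
  define Oc where "Oc \<sigma> = {x::real^'n. \<forall>i. \<sigma> i \<longleftrightarrow> 0 \<le> x $ i}" for \<sigma> :: "'n \<Rightarrow> bool"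
  have "Oc \<sigma> \<in> sets borel" for \<sigma>
  proof -
    have eq: "Oc \<sigma> = (\<Inter>i\<in>UNIV. {x. \<sigma> i \<longleftrightarrow> 0 \<le> x $ i})" by (auto simp: Oc_def)
    have "{x::real^'n. 0 \<le> x $ i} \<in> sets borel" for i
      by (intro borel_closed closed_halfspace_component_ge_cart)
    moreover have "{x::real^'n. x $ i < 0} \<in> sets borel" for i
      by (intro borel_open open_halfspace_component_lt_cart)
    ultimately have "{x::real^'n. \<sigma> i \<longleftrightarrow> 0 \<le> x $ i} \<in> sets borel" for i
      by (cases "\<sigma> i") (auto simp: not_le)
    then show ?thesis unfolding eq by (intro sets.finite_INT) auto
  qed
  then have Om[measurable]: "Oc \<sigma> \<in> sets lebesgue" for \<sigma> by (simp add: sets_completionI_sets)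
  have part: "(\<Sum>\<sigma>\<in>UNIV. H x * indicator (Oc \<sigma>) x) = H x" for x
  proof -
    have "indicator (Oc \<sigma>) x = (if \<sigma> = (\<lambda>i. 0 \<le> x $ i) then 1 else (0::ennreal))" for \<sigma>
      by (auto simp: Oc_def indicator_def fun_eq_iff)
    then show ?thesis by (simp add: if_distrib[of "(*) (H x)"] cong: if_cong)
  qed
  have each: "(\<integral>\<^sup>+x. H x * indicator (Oc \<sigma>) x \<partial>lebesgue) = (\<integral>\<^sup>+x. F x * indicator cubeQ x \<partial>lebesgue)" for \<sigma>
  proof -
    define m where "m i = (if \<sigma> i then 1 else - 1 :: real)" for i
    have m: "m i \<noteq> 0" "\<bar>m i\<bar> = 1" for i by (auto simp: m_def)
    have "(\<integral>\<^sup>+x. H x * indicator (Oc \<sigma>) x \<partial>lebesgue) = ennreal (\<Prod>i\<in>UNIV. \<bar>m i\<bar>) * (\<integral>\<^sup>+x. H (diag m 0 x) * indicator (Oc \<sigma>) (diag m 0 x) \<partial>lebesgue)"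
      by (rule nn_integral_diag[where m=m and t=0, OF m(1)]) measurable
    also have "\<dots> = (\<integral>\<^sup>+x. H (diag m 0 x) * indicator (Oc \<sigma>) (diag m 0 x) \<partial>lebesgue)" by (simp add: m)
    also have "\<dots> = (\<integral>\<^sup>+x. F x * indicator cubeQ x \<partial>lebesgue)"
    proof (rule nn_integral_cong_AE)
      \<comment> \<open>On the coordinate hyperplanes the sign change does not respect the coding,
        hence only almost everywhere.\<close>
      show "AE x in lebesgue. H (diag m 0 x) * indicator (Oc \<sigma>) (diag m 0 x) = F x * indicator cubeQ x"
        using AE_coordinate_neq[of 0]
      proof eventually_elim
        case (elim x)
        have v: "vabs (diag m 0 x) = vabs x" by (simp add: vabs_def abs_mult m)
        have o: "diag m 0 x \<in> Oc \<sigma> \<longleftrightarrow> (\<forall>i. 0 \<le> x $ i)"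
          using elim unfolding Oc_def m_def by (auto simp: less_le) (smt (verit))+
        show ?case
        proof (cases "\<forall>i. 0 \<le> x $ i")
          case True
          then have "vabs x = x" by (simp add: vabs_def vec_eq_iff)
          then show ?thesis using o True v by (simp add: H_def)
        next
          case False
          then have "x \<notin> cubeQ" by (auto simp: mem_cubeQ)
          then show ?thesis using o False by simp
        qed
      qed
    qed
    finally show ?thesis .
  qed
  have "(\<integral>\<^sup>+x. H x \<partial>lebesgue) = (\<integral>\<^sup>+x. (\<Sum>\<sigma>\<in>UNIV. H x * indicator (Oc \<sigma>) x) \<partial>lebesgue)"
    by (simp only: part)
  also have "\<dots> = (\<Sum>\<sigma>\<in>(UNIV::('n \<Rightarrow> bool) set). (\<integral>\<^sup>+x. H x * indicator (Oc \<sigma>) x \<partial>lebesgue))"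
    by (rule nn_integral_sum) measurable
  also have "\<dots> = 2 ^ CARD('n) * (\<integral>\<^sup>+x. F x * indicator cubeQ x \<partial>lebesgue)"
    by (simp add: each card_fun)
  finally show ?thesis by (simp add: H_def)
qed

text \<open>The inequality \<kappa> <= G multiplied out: it also covers w = 0, and for \<kappa> > 0
  it asserts that the p-th power is integrable.\<close>

definition GN_bound :: "'n::finite itself \<Rightarrow> real \<Rightarrow> real \<Rightarrow> bool" where
  "GN_bound _ p \<kappa> \<longleftrightarrow> (\<forall>(w::real^'n \<Rightarrow> real) g. H1 w g \<longrightarrow>
     ennreal \<kappa> * (\<integral>\<^sup>+x. ennreal (\<bar>w x\<bar> powr p) \<partial>lebesgue)
       \<le> ennreal ((\<integral>x. (norm (g x))\<^sup>2 \<partial>lebesgue) * (\<integral>x. (w x)\<^sup>2 \<partial>lebesgue) powr (2 / real CARD('n))))"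

text \<open>The even reflection of v, continued by 0, belongs to \<open>H1\<close>, and reflection
  multiplies all three integrals by 2^d. One of these factors cancels, and the power 2/d of the
  other is 4. The threshold 2/3 is dictated by the strips in [1/3, 2/3] where general functions are
  cut later.\<close>

lemma corner_inequality:
  fixes v :: "real^'n::finite \<Rightarrow> real"
  assumes GN: "GN_bound TYPE('n) p \<kappa>" and p: "p > 0" and \<kappa>: "\<kappa> > 0"
    and v: "C1 v Dv" and van: "\<And>x i. x \<in> cubeQ \<Longrightarrow> x $ i \<ge> 2/3 \<Longrightarrow> v x = 0"
  shows "\<kappa> / 4 * IQ (\<lambda>x. \<bar>v x\<bar> powr p) \<le> IQ (\<lambda>x. (norm (Dv x))\<^sup>2) * IQ (\<lambda>x. (v x)\<^sup>2) powr (2 / real CARD('n))"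
proof -
  define d where "d = real CARD('n)"
  have d: "d > 0" by (simp add: d_def)
  have cv: "continuous_on S v" "continuous_on S Dv" for S
    using C1_continuous[OF v] C1_continuous_grad[OF v] by auto
  \<comment> \<open>Folding followed by truncation at 1 is nonexpansive with values in the cube, so
    \<open>w\<close> is continuous and Lipschitz along the axes; beyond the reflected cube some
    coordinate is truncated to 1, where v vanishes.\<close>
  define clip :: "real^'n \<Rightarrow> real^'n" where "clip x = (\<chi> i. min \<bar>x $ i\<bar> 1)" for x
  have clipQ: "clip x \<in> cubeQ" for x by (auto simp: clip_def mem_cubeQ)
  have clip_eq: "clip x = vabs x" if "vabs x \<in> cubeQ" for x
    using that by (auto simp: clip_def vabs_def mem_cubeQ vec_eq_iff min_def)
  have cclip: "continuous_on UNIV clip"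
    unfolding clip_def by (intro continuous_on_vec_lambda continuous_intros)
  define w where "w x = v (clip x)" for x
  have w_out: "w x = 0" if vx: "vabs x \<notin> cubeQ" for x
  proof -
    obtain i where "\<bar>x $ i\<bar> > 1" using vx by (auto simp: mem_cubeQ vabs_def not_le)
    then have "clip x $ i \<ge> 2/3" by (simp add: clip_def)
    then show ?thesis using van[OF clipQ] by (simp add: w_def)
  qed
  have w_eq: "w x = v (vabs x) * indicator cubeQ (vabs x)" for x
    using w_out[of x] clip_eq[of x] by (cases "vabs x \<in> cubeQ") (auto simp: w_def)
  \<comment> \<open>The sign is the derivative of the absolute value in the folded
    coordinate.\<close>
  define g where "g x = (\<chi> i. sgn (x $ i) * Dv (vabs x) $ i * indicator cubeQ (vabs x))" for x
  have [measurable]: "vabs \<in> borel_measurable borel" "v \<in> borel_measurable borel" "Dv \<in> borel_measurable borel"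
    using borel_measurable_continuous_onI continuous_vabs cv by blast+
  have gb[measurable]: "g \<in> borel_measurable borel"
  proof (rule borel_measurable_vec_components)
    fix i
    have [measurable]: "(\<lambda>x::real^'n. x $ i) \<in> borel_measurable borel" by (rule borel_measurable_nth)
    have s: "(\<lambda>x::real^'n. sgn (x $ i)) \<in> borel_measurable borel" by measurable
    have D: "(\<lambda>x. Dv (vabs x) $ i) \<in> borel_measurable borel"
      by (rule measurable_compose[OF _ borel_measurable_nth]) measurable
    have I: "(\<lambda>x::real^'n. indicat_real cubeQ (vabs x)) \<in> borel_measurable borel"
      by (rule measurable_compose[of vabs borel borel "indicat_real cubeQ"]) (auto intro: borel_measurable_indicator)
    show "(\<lambda>x. g x $ i) \<in> borel_measurable borel"
      unfolding g_def using borel_measurable_times[OF borel_measurable_times[OF s D] I] by simp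
  qed
  have cw: "continuous_on UNIV w" unfolding w_def
    by (rule continuous_on_compose2[OF cv(1) cclip]) auto
  have wb[measurable]: "w \<in> borel_measurable borel" using cw by (rule borel_measurable_continuous_onI)
  have bd: "bounded (v ` cubeQ)" "bounded (Dv ` cubeQ)"
    using cv compact_cubeQ by (auto intro!: compact_imp_bounded compact_continuous_image)
  obtain M where M: "\<And>x. x \<in> cubeQ \<Longrightarrow> \<bar>v x\<bar> \<le> M" using bd(1) by (auto simp: bounded_iff)
  obtain L where L: "\<And>x. x \<in> cubeQ \<Longrightarrow> norm (Dv x) \<le> L" using bd(2) by (auto simp: bounded_iff)
  have L0: "L \<ge> 0" using L[OF clipQ[of 0]] norm_ge_zero order_trans by blast
  have cvx: "convex (cubeQ :: (real^'n) set)" by (simp add: cubeQ_def)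
  have wlip: "\<bar>w (x + h *\<^sub>R axis i 1) - w x\<bar> \<le> L * \<bar>h\<bar>" for x h i
  proof -
    have "\<bar>w (x + h *\<^sub>R axis i 1) - w x\<bar> \<le> L * norm (clip (x + h *\<^sub>R axis i 1) - clip x)"
      unfolding w_def using L by (intro C1_lipschitz_convex[OF v cvx] clipQ) auto
    also have "norm (clip (x + h *\<^sub>R axis i 1) - clip x) \<le> norm (h *\<^sub>R (axis i 1 :: real^'n))"
      by (rule norm_le_componentwise_cart) (auto simp: clip_def axis_def min_def)
    finally show ?thesis using L0 by (simp add: mult_left_mono)
  qed
  have wg: "weak_gradient UNIV w g"
  proof (rule weak_gradient_compact_support[OF cw, where M=M and \<delta>=1 and L=L and M'=L])
    show "\<bar>w x\<bar> \<le> M" for x using M[OF clipQ] by (simp add: w_def)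
    show "g \<in> borel_measurable lebesgue" using gb by (simp add: measurable_completion)
    show "\<bar>g x $ i\<bar> \<le> L" for x i
    proof (cases "vabs x \<in> cubeQ")
      case True
      have "\<bar>g x $ i\<bar> = \<bar>sgn (x $ i)\<bar> * \<bar>Dv (vabs x) $ i\<bar>" using True by (simp add: g_def abs_mult)
      also have "\<dots> \<le> 1 * \<bar>Dv (vabs x) $ i\<bar>" by (intro mult_right_mono) (auto simp: sgn_if)
      also have "\<dots> \<le> L" using component_le_norm_cart[of "Dv (vabs x)" i] L[OF True] by simp
      finally show ?thesis .
    qed (use L0 in \<open>simp add: g_def\<close>)
    \<comment> \<open>The excluded hyperplanes with coordinate 0, 1 or -1 contain the kinks of the
      folding and the faces of the reflected cube.\<close>
    show "AE x in lebesgue. ((\<lambda>h. (w (x + h *\<^sub>R axis i 1) - w x) / h) \<longlongrightarrow> g x $ i) (at 0)" for i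
      using AE_coordinate_neq[of 0] AE_coordinate_neq[of 1] AE_coordinate_neq[of "-1"]
    proof eventually_elim
      case (elim x)
      let ?e = "axis i 1 :: real^'n"
      show ?case
      proof (cases "vabs x \<in> cubeQ")
        case True
        define \<sigma> where "\<sigma> = sgn (x $ i)"
        have \<sigma>: "\<sigma> = 1 \<or> \<sigma> = -1" "\<sigma> * x $ i = \<bar>x $ i\<bar>" "\<sigma> \<noteq> 0" "inverse \<sigma> = \<sigma>"
          using elim by (auto simp: \<sigma>_def sgn_if)
        have xi: "0 < \<bar>x $ i\<bar>" "\<bar>x $ i\<bar> < 1"
          using elim True by (auto simp: mem_cubeQ vabs_def abs_if less_le split: if_splits)
        define r where "r = min \<bar>x $ i\<bar> (1 - \<bar>x $ i\<bar>)"
        have r: "r > 0" using xi by (simp add: r_def)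
        \<comment> \<open>Away from the kinks, moving x by a small h in direction i moves the folded
          point by h or -h.\<close>
        have cl: "clip (x + h *\<^sub>R ?e) = vabs x + (\<sigma> * h) *\<^sub>R ?e" if "\<bar>h\<bar> < r" for h
        proof -
          have hh: "\<bar>h\<bar> < \<bar>x $ i\<bar>" "\<bar>h\<bar> < 1 - \<bar>x $ i\<bar>" using that by (auto simp: r_def)
          have "min \<bar>x $ i + h\<bar> 1 = \<bar>x $ i\<bar> + \<sigma> * h"
            using hh xi \<sigma>(1) unfolding \<sigma>_def by (auto simp: sgn_if min_def abs_if split: if_splits)
          moreover have "min \<bar>x $ j\<bar> 1 = \<bar>x $ j\<bar>" for j
            using True by (auto simp: mem_cubeQ vabs_def)
          ultimately show ?thesis by (auto simp: vec_eq_iff clip_def vabs_def axis_def)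
        qed
        have "((\<lambda>h. (v (vabs x + h *\<^sub>R ?e) - v (vabs x)) / h) \<longlongrightarrow> Dv (vabs x) $ i) (at 0)"
          by (rule C1_directional[OF v])
        moreover have "filterlim (\<lambda>h. \<sigma> * h) (at 0) (at 0)"
          using \<sigma>(3) by (auto simp: filterlim_at eventually_at_filter intro!: tendsto_eq_intros)
        ultimately have "((\<lambda>h. (v (vabs x + (\<sigma> * h) *\<^sub>R ?e) - v (vabs x)) / (\<sigma> * h)) \<longlongrightarrow> Dv (vabs x) $ i) (at 0)"
          by (rule filterlim_compose)
        then have "((\<lambda>h. \<sigma> * ((v (vabs x + (\<sigma> * h) *\<^sub>R ?e) - v (vabs x)) / (\<sigma> * h))) \<longlongrightarrow> \<sigma> * Dv (vabs x) $ i) (at 0)"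
          by (intro tendsto_intros)
        then have lim: "((\<lambda>h. \<sigma> * ((v (vabs x + (\<sigma> * h) *\<^sub>R ?e) - v (vabs x)) / (\<sigma> * h))) \<longlongrightarrow> g x $ i) (at 0)"
          using True by (simp add: g_def \<sigma>_def)
        show ?thesis
        proof (rule Lim_transform_eventually[OF lim])
          have "eventually (\<lambda>h. \<bar>h\<bar> < r) (at (0::real))"
            using r by (auto simp: eventually_at intro!: exI[of _ r])
          then show "eventually (\<lambda>h. \<sigma> * ((v (vabs x + (\<sigma> * h) *\<^sub>R ?e) - v (vabs x)) / (\<sigma> * h)) = (w (x + h *\<^sub>R ?e) - w x) / h) (at 0)"
          proof eventually_elim
            case (elim h)
            then show ?case using cl[of h] cl[of 0] r \<sigma>(3) by (simp add: w_def)
          qed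
        qed
      next
        case False
        then obtain j where j: "\<bar>x $ j\<bar> > 1" by (auto simp: mem_cubeQ vabs_def not_le)
        have "eventually (\<lambda>h. \<bar>h\<bar> < \<bar>x $ j\<bar> - 1) (at (0::real))"
          using j by (auto simp: eventually_at intro!: exI[of _ "\<bar>x $ j\<bar> - 1"])
        then have "eventually (\<lambda>h. 0 = (w (x + h *\<^sub>R ?e) - w x) / h) (at 0)"
        proof eventually_elim
          case (elim h)
          have "\<bar>(x + h *\<^sub>R ?e) $ j\<bar> > 1" using j elim by (auto simp: axis_def)
          then have "vabs (x + h *\<^sub>R ?e) \<notin> cubeQ" by (auto simp: mem_cubeQ vabs_def not_le)
          then show ?case using w_out False by simp
        qed
        then have "((\<lambda>h. (w (x + h *\<^sub>R ?e) - w x) / h) \<longlongrightarrow> 0) (at 0)"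
          by (rule Lim_transform_eventually[OF tendsto_const])
        then show ?thesis using False by (simp add: g_def)
      qed
    qed
  qed (use wlip in auto)
  have fold: "(\<integral>\<^sup>+x. ennreal (f (vabs x)) * indicator cubeQ (vabs x) \<partial>lebesgue) = ennreal (2 ^ CARD('n) * IQ f)"
    if "continuous_on UNIV f" "\<And>x. 0 \<le> f x" for f :: "real^'n \<Rightarrow> real"
  proof -
    have [measurable]: "f \<in> borel_measurable borel" using that(1) by (rule borel_measurable_continuous_onI)
    have "(\<integral>\<^sup>+x. ennreal (f (vabs x)) * indicator cubeQ (vabs x) \<partial>lebesgue) = 2 ^ CARD('n) * EQ f"
      unfolding EQ_def by (rule nn_integral_fold) measurable
    also have "\<dots> = 2 ^ CARD('n) * ennreal (IQ f)"
      using that by (subst EQ_eq_IQ) (auto intro: continuous_on_subset)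
    also have "\<dots> = ennreal (2 ^ CARD('n) * IQ f)"
      by (simp add: ennreal_mult' ennreal_power[symmetric])
    finally show ?thesis .
  qed
  have A: "(\<integral>\<^sup>+x. ennreal ((norm (g x))\<^sup>2) \<partial>lebesgue) = ennreal (2 ^ CARD('n) * IQ (\<lambda>x. (norm (Dv x))\<^sup>2))"
  proof -
    have "(\<integral>\<^sup>+x. ennreal ((norm (g x))\<^sup>2) \<partial>lebesgue) = (\<integral>\<^sup>+x. ennreal ((norm (Dv (vabs x)))\<^sup>2) * indicator cubeQ (vabs x) \<partial>lebesgue)"
    proof (rule nn_integral_cong_AE)
      show "AE x in lebesgue. ennreal ((norm (g x))\<^sup>2) = ennreal ((norm (Dv (vabs x)))\<^sup>2) * indicator cubeQ (vabs x)"
        using AE_coordinate_neq[of 0]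
      proof eventually_elim
        case (elim x)
        have "(sgn (x $ i))\<^sup>2 = 1" for i using elim by (auto simp: sgn_if)
        then show ?case
          by (cases "vabs x \<in> cubeQ") (auto simp: norm_power2_vec g_def power_mult_distrib)
      qed
    qed
    also have "\<dots> = ennreal (2 ^ CARD('n) * IQ (\<lambda>x. (norm (Dv x))\<^sup>2))"
      using cv by (intro fold continuous_intros) auto
    finally show ?thesis .
  qed
  have B: "(\<integral>\<^sup>+x. ennreal ((w x)\<^sup>2) \<partial>lebesgue) = ennreal (2 ^ CARD('n) * IQ (\<lambda>x. (v x)\<^sup>2))"
  proof -
    have "(\<integral>\<^sup>+x. ennreal ((w x)\<^sup>2) \<partial>lebesgue) = (\<integral>\<^sup>+x. ennreal ((v (vabs x))\<^sup>2) * indicator cubeQ (vabs x) \<partial>lebesgue)"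
      by (intro nn_integral_cong) (auto simp: w_eq indicator_def)
    then show ?thesis using cv by (subst fold[symmetric]) (auto intro!: continuous_intros)
  qed
  have C: "(\<integral>\<^sup>+x. ennreal (\<bar>w x\<bar> powr p) \<partial>lebesgue) = ennreal (2 ^ CARD('n) * IQ (\<lambda>x. \<bar>v x\<bar> powr p))"
  proof -
    have "(\<integral>\<^sup>+x. ennreal (\<bar>w x\<bar> powr p) \<partial>lebesgue) = (\<integral>\<^sup>+x. ennreal (\<bar>v (vabs x)\<bar> powr p) * indicator cubeQ (vabs x) \<partial>lebesgue)"
      by (intro nn_integral_cong) (auto simp: w_eq indicator_def)
    then show ?thesis using cv p by (subst fold[symmetric]) (auto intro!: continuous_on_abs_powr)
  qed
  have wl: "w \<in> borel_measurable lebesgue" "g \<in> borel_measurable lebesgue"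
    using wb gb by (auto simp: measurable_completion)
  have nn: "0 \<le> IQ (\<lambda>x. (norm (Dv x))\<^sup>2)" "0 \<le> IQ (\<lambda>x. (v x)\<^sup>2)" "0 \<le> IQ (\<lambda>x. \<bar>v x\<bar> powr p)"
    by (auto intro!: IQ_nonneg)
  have iB: "integrable lebesgue (\<lambda>x. (w x)\<^sup>2)"
    using B wl by (intro integrableI_nonneg) auto
  have iA: "integrable lebesgue (\<lambda>x. (norm (g x))\<^sup>2)"
    using A wl by (intro integrableI_nonneg) auto
  have A': "(\<integral>x. (norm (g x))\<^sup>2 \<partial>lebesgue) = 2 ^ CARD('n) * IQ (\<lambda>x. (norm (Dv x))\<^sup>2)"
    using A iA nn by (subst (asm) nn_integral_eq_integral) auto
  have B': "(\<integral>x. (w x)\<^sup>2 \<partial>lebesgue) = 2 ^ CARD('n) * IQ (\<lambda>x. (v x)\<^sup>2)"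
    using B iB nn by (subst (asm) nn_integral_eq_integral) auto
  have "H1 w g" using wl iA iB wg by (simp add: H1_def)
  with GN have "ennreal \<kappa> * (\<integral>\<^sup>+x. ennreal (\<bar>w x\<bar> powr p) \<partial>lebesgue)
       \<le> ennreal ((\<integral>x. (norm (g x))\<^sup>2 \<partial>lebesgue) * (\<integral>x. (w x)\<^sup>2 \<partial>lebesgue) powr (2 / real CARD('n)))"
    unfolding GN_bound_def by blast
  then have "\<kappa> * (2 ^ CARD('n) * IQ (\<lambda>x. \<bar>v x\<bar> powr p)) \<le> 
     2 ^ CARD('n) * IQ (\<lambda>x. (norm (Dv x))\<^sup>2) * (2 ^ CARD('n) * IQ (\<lambda>x. (v x)\<^sup>2)) powr (2 / real CARD('n))"
    unfolding A' B' C using \<kappa> nn by (subst (asm) ennreal_mult[symmetric]) (auto simp: ennreal_le_iff)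
  \<comment> \<open>The origin of the 4: (2^d)^(2/d) = 4.\<close>
  also have "(2 ^ CARD('n) * IQ (\<lambda>x. (v x)\<^sup>2)) powr (2 / real CARD('n)) = 4 * IQ (\<lambda>x. (v x)\<^sup>2) powr (2 / real CARD('n))"
  proof -
    have "((2::real) ^ CARD('n)) powr (2 / real CARD('n)) = (2 powr real CARD('n)) powr (2 / real CARD('n))"
      by (simp add: powr_realpow)
    also have "\<dots> = 2 powr 2" by (simp add: powr_powr)
    also have "\<dots> = 4" using powr_realpow[of 2 2] by simp
    finally show ?thesis using nn by (simp add: powr_mult)
  qed
  finally have "2 ^ CARD('n) * (\<kappa> * IQ (\<lambda>x. \<bar>v x\<bar> powr p)) \<le> 2 ^ CARD('n) * (4 * (IQ (\<lambda>x. (norm (Dv x))\<^sup>2) * IQ (\<lambda>x. (v x)\<^sup>2) powr (2 / real CARD('n))))"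
    by (simp add: algebra_simps)
  then show ?thesis by (subst (asm) mult_le_cancel_left_pos) (auto simp: field_simps)
qed

subsection \<open>Cutting the cube\<close>

text \<open>A cutoff of class C1: 1 for t <= 0, (1 - t^2)^2 on [0, 1] and 0 for t >= 1. Squaring the
  positive parts makes both corners differentiable and keeps the derivative explicit.\<close>

definition cutS :: "real \<Rightarrow> real" where
  "cutS t = (max 0 (1 - (max 0 t)\<^sup>2))\<^sup>2"

definition cutS' :: "real \<Rightarrow> real" where
  "cutS' t = 2 * max 0 (1 - (max 0 t)\<^sup>2) * (- (2 * max 0 t))"

lemma DERIV_max_square: "((\<lambda>s::real. (max 0 s)\<^sup>2) has_real_derivative 2 * max 0 s) (at s)"
proof -
  consider "s > 0" | "s < 0" | "s = 0" by linarith
  then show ?thesis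
  proof cases
    case 1
    have "((\<lambda>s::real. s\<^sup>2) has_real_derivative 2 * max 0 s) (at s)" using 1 by (auto intro!: derivative_eq_intros)
    then show ?thesis
      by (rule has_field_derivative_transform_within_open[where S="{0<..}"]) (use 1 in auto)
  next
    case 2
    have "((\<lambda>s::real. 0) has_real_derivative 2 * max 0 s) (at s)" using 2 by auto
    then show ?thesis
      by (rule has_field_derivative_transform_within_open[where S="{..<0}"]) (use 2 in auto)
  next
    case 3
    have "((\<lambda>h::real. (max 0 h)\<^sup>2 / h) \<longlongrightarrow> 0) (at 0)"
    proof (rule Lim_null_comparison)
      show "eventually (\<lambda>h::real. norm ((max 0 h)\<^sup>2 / h) \<le> \<bar>h\<bar>) (at 0)"
        by (intro always_eventually allI) (auto simp: max_def power2_eq_square)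
      show "((\<lambda>h::real. \<bar>h\<bar>) \<longlongrightarrow> 0) (at 0)" by (auto intro!: tendsto_eq_intros)
    qed
    then show ?thesis using 3 by (simp add: DERIV_def)
  qed
qed

lemma DERIV_cutS: "(cutS has_real_derivative cutS' t) (at t)"
proof -
  have "((\<lambda>t. 1 - (max 0 t)\<^sup>2) has_real_derivative 0 - 2 * max 0 t) (at t)"
    by (intro derivative_intros DERIV_max_square)
  from DERIV_chain2[OF DERIV_max_square this] show ?thesis
    by (simp add: cutS_def[abs_def] cutS'_def)
qed

lemma cutS_range: "0 \<le> cutS t" "cutS t \<le> 1"
  unfolding cutS_def by (auto intro!: power_le_one)

lemma cutS_le_0: "t \<le> 0 \<Longrightarrow> cutS t = 1"
  by (simp add: cutS_def max_def)

lemma max_square_ge_1: "t \<ge> 1 \<Longrightarrow> max 0 (1 - (max 0 t)\<^sup>2) = (0::real)"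
  using one_le_power[of t 2] by (simp add: max_absorb2)

lemma cutS_ge_1: "t \<ge> 1 \<Longrightarrow> cutS t = 0"
  by (simp add: cutS_def max_square_ge_1)

lemma cutS'_bound: "\<bar>cutS' t\<bar> \<le> 4"
proof (cases "t \<ge> 1")
  case True
  then have "cutS' t = 0" by (simp add: cutS'_def max_square_ge_1)
  then show ?thesis by simp
next
  case False
  have "\<bar>cutS' t\<bar> = 4 * (max 0 (1 - (max 0 t)\<^sup>2) * max 0 t)" by (simp add: cutS'_def abs_mult)
  also have "\<dots> \<le> 4 * (1 * 1)" using False by (intro mult_left_mono mult_mono) auto
  finally show ?thesis by simp
qed

lemma continuous_cutS': "continuous_on S (\<lambda>x. cutS' (f x))" if "continuous_on S f"
  unfolding cutS'_def using that by (intro continuous_intros)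

lemma C1_mult_coord:
  fixes v :: "real^'a::finite \<Rightarrow> real"
  assumes v: "C1 v Dv" and \<eta>: "\<And>t. (\<eta> has_real_derivative \<eta>' t) (at t)" "continuous_on UNIV \<eta>'"
  shows "C1 (\<lambda>x. \<eta> (x $ i) * v x) (\<lambda>x. \<eta> (x $ i) *\<^sub>R Dv x + (\<eta>' (x $ i) * v x) *\<^sub>R axis i 1)"
  unfolding C1_def
proof (intro conjI allI)
  fix x
  have "((\<lambda>x. \<eta> (x $ i)) has_derivative (\<lambda>h. \<eta>' (x $ i) * h $ i)) (at x)"
    using has_derivative_compose[of "\<lambda>x. x $ i" "\<lambda>h. h $ i" x UNIV \<eta> "(*) (\<eta>' (x $ i))"] \<eta>(1)[of "x $ i"]
    by (simp add: bounded_linear_imp_has_derivative bounded_linear_vec_nth has_field_derivative_def)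
  moreover have "(v has_derivative (\<lambda>h. Dv x \<bullet> h)) (at x)" using v by (simp add: C1_def)
  ultimately have "((\<lambda>x. \<eta> (x $ i) * v x) has_derivative (\<lambda>h. \<eta> (x $ i) * (Dv x \<bullet> h) + \<eta>' (x $ i) * h $ i * v x)) (at x)"
    by (rule has_derivative_mult)
  then show "((\<lambda>x. \<eta> (x $ i) * v x) has_derivative (\<lambda>h. (\<eta> (x $ i) *\<^sub>R Dv x + (\<eta>' (x $ i) * v x) *\<^sub>R axis i 1) \<bullet> h)) (at x)"
    by (rule has_derivative_eq_rhs) (auto simp: inner_add_left inner_axis' algebra_simps)
next
  have "continuous_on UNIV \<eta>" using \<eta>(1) DERIV_continuous continuous_at_imp_continuous_on by blast
  then have "continuous_on UNIV (\<lambda>x::real^'a. \<eta> (x $ i))" "continuous_on UNIV (\<lambda>x::real^'a. \<eta>' (x $ i))"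
    using \<eta>(2) by (auto intro: continuous_on_compose2[OF _ continuous_on_component[OF continuous_on_id]])
  then show "continuous_on UNIV (\<lambda>x. \<eta> (x $ i) *\<^sub>R Dv x + (\<eta>' (x $ i) * v x) *\<^sub>R axis i 1)"
    by (intro continuous_on_add continuous_on_scaleR continuous_on_mult continuous_on_const
        C1_continuous[OF v] C1_continuous_grad[OF v])
qed

text \<open>The cross term is split by Young's inequality with weight \<epsilon>: for small
  \<epsilon> the first coefficient stays close to 1 and the large one falls on
  \<open>b\<close>.\<close>

lemma norm_add_square_le:
  fixes a b :: "'a::real_inner"
  assumes "\<epsilon> > 0"
  shows "(norm (a + b))\<^sup>2 \<le> (1 + \<epsilon>) * (norm a)\<^sup>2 + (1 + 1 / \<epsilon>) * (norm b)\<^sup>2"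
proof -
  have "norm (a + b) \<le> norm a + norm b" by (rule norm_triangle_ineq)
  then have "(norm (a + b))\<^sup>2 \<le> (norm a + norm b)\<^sup>2" by (intro power_mono) auto
  also have "\<dots> \<le> (1 + \<epsilon>) * (norm a)\<^sup>2 + (1 + 1 / \<epsilon>) * (norm b)\<^sup>2"
  proof -
    have "0 \<le> (\<epsilon> * norm a - norm b)\<^sup>2 / \<epsilon>" using assms by simp
    also have "\<dots> = \<epsilon> * (norm a)\<^sup>2 - 2 * norm a * norm b + (norm b)\<^sup>2 / \<epsilon>"
      using assms by (simp add: power2_eq_square field_simps)
    finally show ?thesis by (simp add: power2_eq_square algebra_simps)
  qed
  finally show ?thesis .
qed

text \<open>Outside the strip (a_j, a_j + 2\<delta>) one of the two cutoffs equals 1, so the j-th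
  summand is at most 0 there. The strips are disjoint, hence at most one summand is positive, and it
  is at most 1.\<close>

lemma cut_sum_le:
  fixes t p \<delta> a0 :: real
  assumes \<delta>: "\<delta> > 0"
  shows "(\<Sum>j<N. 1 - cutS ((t - (a0 + 2 * real j * \<delta>)) / \<delta>) powr p - cutS ((a0 + 2 * real j * \<delta> + 2 * \<delta> - t) / \<delta>) powr p) \<le> 1"
proof -
  define a where "a j = a0 + 2 * real j * \<delta>" for j
  have "1 - cutS ((t - a j) / \<delta>) powr p - cutS ((a j + 2 * \<delta> - t) / \<delta>) powr p \<le> (if a j < t \<and> t < a j + 2 * \<delta> then 1 else 0)" for j
  proof -
    have nn: "cutS ((t - a j) / \<delta>) powr p \<ge> 0" "cutS ((a j + 2 * \<delta> - t) / \<delta>) powr p \<ge> 0" by auto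
    consider "t \<le> a j" | "t \<ge> a j + 2 * \<delta>" | "a j < t \<and> t < a j + 2 * \<delta>" by linarith
    then show ?thesis
    proof cases
      case 1
      then have "cutS ((t - a j) / \<delta>) = 1" using \<delta> by (intro cutS_le_0) (simp add: divide_nonpos_pos)
      then show ?thesis using nn 1 by simp
    next
      case 2
      then have "cutS ((a j + 2 * \<delta> - t) / \<delta>) = 1" using \<delta> by (intro cutS_le_0) (simp add: divide_nonpos_pos)
      then show ?thesis using nn 2 by simp
    next
      case 3
      then show ?thesis unfolding if_P[OF 3] using nn by linarith
    qed
  qed
  then have "(\<Sum>j<N. 1 - cutS ((t - a j) / \<delta>) powr p - cutS ((a j + 2 * \<delta> - t) / \<delta>) powr p)
     \<le> (\<Sum>j<N. (if a j < t \<and> t < a j + 2 * \<delta> then 1 else 0))" by (intro sum_mono) auto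
  also have "\<dots> = real (card ({..<N} \<inter> {j. a j < t \<and> t < a j + 2 * \<delta>}))" by (simp add: sum.If_cases)
  also have "\<dots> \<le> 1"
  proof -
    have "j = k" if "a j < t \<and> t < a j + 2 * \<delta>" "a k < t \<and> t < a k + 2 * \<delta>" for j k
    proof -
      have *: "j \<le> k" if "a j < t" "t < a k + 2 * \<delta>" for j k
      proof -
        have "2 * \<delta> * real j < 2 * \<delta> * (real k + 1)" using that by (simp add: a_def algebra_simps)
        then have "real j < real k + 1" using \<delta> by simp
        then show ?thesis by simp
      qed
      show ?thesis using *[of j k] *[of k j] that by auto
    qed
    then have "card ({..<N} \<inter> {j. a j < t \<and> t < a j + 2 * \<delta>}) \<le> 1"
      by (simp add: card_le_Suc0_iff_eq)
    then show ?thesis by simp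
  qed
  finally show ?thesis by (simp add: a_def)
qed

lemma C1_cut:
  fixes v :: "real^'n::finite \<Rightarrow> real"
  assumes v: "C1 v Dv"
  shows "C1 (\<lambda>x. cutS (c * x $ i + b) * v x) (\<lambda>x. cutS (c * x $ i + b) *\<^sub>R Dv x + (cutS' (c * x $ i + b) * c * v x) *\<^sub>R axis i 1)"
proof (rule C1_mult_coord[OF v, of "\<lambda>t. cutS (c * t + b)" "\<lambda>t. cutS' (c * t + b) * c"])
  show "((\<lambda>t. cutS (c * t + b)) has_real_derivative cutS' (c * t + b) * c) (at t)" for t
    by (rule DERIV_chain2[OF DERIV_cutS]) (auto intro!: derivative_eq_intros)
  show "continuous_on UNIV (\<lambda>t. cutS' (c * t + b) * c)"
    by (intro continuous_intros continuous_cutS')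
qed

lemma cut_grad_bound:
  fixes Dv :: "real^'n::finite"
  assumes "\<epsilon> > 0" "\<bar>c\<bar> \<le> C"
  shows "(norm (cutS s *\<^sub>R Dv + (cutS' s * c * y) *\<^sub>R axis i 1))\<^sup>2 \<le> (1 + \<epsilon>) * ((cutS s)\<^sup>2 * (norm Dv)\<^sup>2) + (1 + 1 / \<epsilon>) * ((4 * C)\<^sup>2 * y\<^sup>2)"
proof -
  have "(norm ((cutS' s * c * y) *\<^sub>R (axis i 1 :: real^'n)))\<^sup>2 = (\<bar>cutS' s\<bar> * \<bar>c\<bar>)\<^sup>2 * y\<^sup>2"
    by (simp add: power_mult_distrib)
  also have "\<dots> \<le> (4 * C)\<^sup>2 * y\<^sup>2"
    using assms(2) cutS'_bound[of s] by (intro mult_right_mono power_mono mult_mono) auto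
  finally have "(1 + 1 / \<epsilon>) * (norm ((cutS' s * c * y) *\<^sub>R (axis i 1 :: real^'n)))\<^sup>2 \<le> (1 + 1 / \<epsilon>) * ((4 * C)\<^sup>2 * y\<^sup>2)"
    using assms(1) by (intro mult_left_mono) auto
  moreover have "(norm (cutS s *\<^sub>R Dv))\<^sup>2 = (cutS s)\<^sup>2 * (norm Dv)\<^sup>2" by (simp add: power_mult_distrib)
  ultimately show ?thesis
    using norm_add_square_le[OF assms(1), of "cutS s *\<^sub>R Dv" "(cutS' s * c * y) *\<^sub>R axis i 1"] by simp
qed

lemma GN_cube_C1:
  fixes I :: "'n::finite set"
  assumes GN: "GN_bound TYPE('n) p \<kappa>" and p: "p > 0" and "0 < \<kappa>'" "\<kappa>' < \<kappa>"
  shows "\<exists>K\<ge>0. \<forall>(v::real^'n \<Rightarrow> real) Dv. C1 v Dv \<and> (\<forall>x i. x \<in> cubeQ \<and> i \<notin> I \<and> x $ i \<ge> 2/3 \<longrightarrow> v x = 0) \<longrightarrow>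
     \<kappa>' / 4 * IQ (\<lambda>x. \<bar>v x\<bar> powr p)
       \<le> (IQ (\<lambda>x. (norm (Dv x))\<^sup>2) + K * IQ (\<lambda>x. (v x)\<^sup>2)) * IQ (\<lambda>x. (v x)\<^sup>2) powr (2 / real CARD('n))"
  using finite[of I] assms(3,4)
proof (induction I arbitrary: \<kappa>' rule: finite_induct)
  case empty
  have "\<kappa>' / 4 * IQ (\<lambda>x. \<bar>v x\<bar> powr p) \<le> (IQ (\<lambda>x. (norm (Dv x))\<^sup>2) + 0 * IQ (\<lambda>x. (v x)\<^sup>2)) * IQ (\<lambda>x. (v x)\<^sup>2) powr (2 / real CARD('n))"
    if "C1 v Dv" "\<forall>x i. x \<in> cubeQ \<and> i \<notin> {} \<and> x $ i \<ge> 2/3 \<longrightarrow> v x = 0" for v :: "real^'n \<Rightarrow> real" and Dv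
  proof -
    have "\<kappa>' / 4 * IQ (\<lambda>x. \<bar>v x\<bar> powr p) \<le> \<kappa> / 4 * IQ (\<lambda>x. \<bar>v x\<bar> powr p)"
      using empty by (intro mult_right_mono IQ_nonneg) auto
    also have "\<dots> \<le> IQ (\<lambda>x. (norm (Dv x))\<^sup>2) * IQ (\<lambda>x. (v x)\<^sup>2) powr (2 / real CARD('n))"
      using that empty by (intro corner_inequality[OF GN p]) auto
    finally show ?thesis by simp
  qed
  then show ?case by (intro exI[of _ 0]) auto
next
  case (insert i I)
  define d where "d = real CARD('n)"
  \<comment> \<open>The induction hypothesis is used at the midpoint between \<kappa>' and \<kappa>;
    the other half of the gap pays for the present cut.\<close>
  define \<kappa>2 where "\<kappa>2 = (\<kappa> + \<kappa>') / 2"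
  have \<kappa>2: "0 < \<kappa>2" "\<kappa>2 < \<kappa>" "\<kappa>' < \<kappa>2" using insert.prems by (auto simp: \<kappa>2_def)
  obtain K where K: "K \<ge> 0" and KI: "\<And>(v::real^'n \<Rightarrow> real) Dv. C1 v Dv \<Longrightarrow> (\<And>x k. x \<in> cubeQ \<Longrightarrow> k \<notin> I \<Longrightarrow> x $ k \<ge> 2/3 \<Longrightarrow> v x = 0) \<Longrightarrow>
     \<kappa>2 / 4 * IQ (\<lambda>x. \<bar>v x\<bar> powr p) \<le> (IQ (\<lambda>x. (norm (Dv x))\<^sup>2) + K * IQ (\<lambda>x. (v x)\<^sup>2)) * IQ (\<lambda>x. (v x)\<^sup>2) powr (2 / d)"
    using insert.IH[OF \<kappa>2(1,2)] unfolding d_def by blast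
  \<comment> \<open>N has to absorb two losses: the fraction 1/N of the p-th power mass and the
    factor 1 + 1/N on the Dirichlet integral.\<close>
  have lim: "(\<lambda>N. \<kappa>2 * (1 - 1 / real N) - \<kappa>' * (1 + 1 / real N)) \<longlonglongrightarrow> \<kappa>2 * (1 - 0) - \<kappa>' * (1 + 0)"
    by (intro tendsto_intros lim_1_over_n)
  have "eventually (\<lambda>N. 0 < \<kappa>2 * (1 - 1 / real N) - \<kappa>' * (1 + 1 / real N)) sequentially"
    by (rule order_tendstoD(1)[OF lim]) (use \<kappa>2 in simp)
  then have "eventually (\<lambda>N. 0 < \<kappa>2 * (1 - 1 / real N) - \<kappa>' * (1 + 1 / real N) \<and> N \<ge> 1) sequentially"
    using eventually_ge_at_top[of 1] by eventually_elim simp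
  then obtain N :: nat where N': "0 < \<kappa>2 * (1 - 1 / real N) - \<kappa>' * (1 + 1 / real N) \<and> N \<ge> 1"
    using eventually_happens'[OF sequentially_bot] by blast
  have N: "\<kappa>' * (1 + 1 / real N) \<le> \<kappa>2 * (1 - 1 / real N)" "N \<ge> 1" using N' by linarith+
  \<comment> \<open>The N strips of width 2\<delta> = 1/(3N) fill [1/3, 2/3] exactly.\<close>
  define \<epsilon> \<delta> where "\<epsilon> = 1 / real N" and "\<delta> = 1 / (6 * real N)"
  have e: "\<epsilon> > 0" "\<delta> > 0" using N(2) by (auto simp: \<epsilon>_def \<delta>_def)
  define a where "a j = 1/3 + 2 * real j * \<delta>" for j
  have a: "1/3 \<le> a j" "a j + 2 * \<delta> \<le> 2/3" if "j < N" for j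
  proof -
    show "1/3 \<le> a j" using e by (simp add: a_def)
    have "2 * (real j + 1) * \<delta> \<le> 2 * real N * \<delta>" using that e by (intro mult_right_mono) auto
    also have "\<dots> = 1/3" using N(2) by (simp add: \<delta>_def)
    finally show "a j + 2 * \<delta> \<le> 2/3" by (simp add: a_def algebra_simps)
  qed
  \<comment> \<open>Two pieces, each with a cutoff of derivative at most 4/\<delta> and the large
    Young coefficient.\<close>
  define M where "M = 2 * ((1 + 1 / \<epsilon>) * (4 * (1 / \<delta>))\<^sup>2)"
  have M0: "M \<ge> 0" using e by (simp add: M_def)
  \<comment> \<open>\<open>fl\<close> is the reflection x_i -> 1 - x_i, which preserves the cube and
    swaps its left and right ends in direction i.\<close>
  define m where "m k = (if k = i then - 1 else 1 :: real)" for k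
  define fl where "fl = diag m (axis i 1)"
  have m1: "\<bar>m k\<bar> = 1" for k by (simp add: m_def)
  have fl_nth: "fl x $ k = (if k = i then 1 - x $ i else x $ k)" for x k
    by (auto simp: fl_def m_def axis_def)
  have flQ: "fl x \<in> cubeQ \<longleftrightarrow> x \<in> cubeQ" for x
    by (auto simp: mem_cubeQ fl_nth)
  have flIQ: "IQ (\<lambda>x. f (fl x)) = IQ f" for f
    unfolding fl_def by (rule diag_cubeQ_invariant[OF m1]) (use flQ fl_def in simp)
  have main: "\<kappa>' / 4 * IQ (\<lambda>x. \<bar>v x\<bar> powr p) \<le> (IQ (\<lambda>x. (norm (Dv x))\<^sup>2) + (M + 2 * K) * IQ (\<lambda>x. (v x)\<^sup>2)) * IQ (\<lambda>x. (v x)\<^sup>2) powr (2 / d)"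
    if v: "C1 v Dv" and van: "\<forall>x k. x \<in> cubeQ \<and> k \<notin> insert i I \<and> x $ k \<ge> 2/3 \<longrightarrow> v x = 0"
    for v :: "real^'n \<Rightarrow> real" and Dv
  proof -
    \<comment> \<open>\<open>\<eta>0\<close> vanishes to the right of the middle of the strip and
      \<open>\<eta>1\<close> to the left, so \<eta>0^2 + \<eta>1^2 <= 1 and the gradients of the
      pieces add up to no more than that of v, apart from the cutoff terms. The affine arguments are
      shaped for \<open>C1_cut\<close>.\<close>
    define \<eta>0 where "\<eta>0 j t = cutS ((1/\<delta>) * t + - a j / \<delta>)" for j t
    define \<eta>1 where "\<eta>1 j t = cutS ((-1/\<delta>) * t + (a j + 2 * \<delta>) / \<delta>)" for j t
    have \<eta>0': "\<eta>0 j t = cutS ((t - a j) / \<delta>)" for j t by (simp add: \<eta>0_def diff_divide_distrib)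
    have \<eta>1': "\<eta>1 j t = cutS ((a j + 2 * \<delta> - t) / \<delta>)" for j t by (simp add: \<eta>1_def diff_divide_distrib)
    have r: "0 \<le> \<eta>0 j t" "\<eta>0 j t \<le> 1" "0 \<le> \<eta>1 j t" "\<eta>1 j t \<le> 1" for j t
      by (auto simp: \<eta>0_def \<eta>1_def cutS_range)
    have z0: "\<eta>0 j t = 0" if "t \<ge> a j + \<delta>" for j t
      unfolding \<eta>0' using that e by (intro cutS_ge_1) (simp add: field_simps)
    have z1: "\<eta>1 j t = 0" if "t \<le> a j + \<delta>" for j t
      unfolding \<eta>1' using that e by (intro cutS_ge_1) (simp add: field_simps)
    define v0 where "v0 j x = \<eta>0 j (x $ i) * v x" for j x
    define v1 where "v1 j x = \<eta>1 j (x $ i) * v x" for j x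
    define D0 where "D0 j x = \<eta>0 j (x $ i) *\<^sub>R Dv x + (cutS' ((1/\<delta>) * x $ i + - a j / \<delta>) * (1/\<delta>) * v x) *\<^sub>R axis i 1" for j x
    define D1 where "D1 j x = \<eta>1 j (x $ i) *\<^sub>R Dv x + (cutS' ((-1/\<delta>) * x $ i + (a j + 2 * \<delta>) / \<delta>) * (-1/\<delta>) * v x) *\<^sub>R axis i 1" for j x
    have C0: "C1 (v0 j) (D0 j)" for j unfolding v0_def D0_def \<eta>0_def by (rule C1_cut[OF v])
    have C1': "C1 (v1 j) (D1 j)" for j unfolding v1_def D1_def \<eta>1_def by (rule C1_cut[OF v])
    define c where "c = IQ (\<lambda>x. \<bar>v x\<bar> powr p)"
    define A where "A = IQ (\<lambda>x. (norm (Dv x))\<^sup>2)"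
    define b where "b = IQ (\<lambda>x. (v x)\<^sup>2)"
    have b0: "b \<ge> 0" "A \<ge> 0" "c \<ge> 0" by (auto simp: b_def A_def c_def intro!: IQ_nonneg)
    define X where "X = b powr (2 / d)"
    have X0: "X \<ge> 0" by (simp add: X_def)
    have cp: "continuous_on S (\<lambda>x. \<bar>v x\<bar> powr p)" "continuous_on S (\<lambda>x. \<bar>v0 j x\<bar> powr p)" "continuous_on S (\<lambda>x. \<bar>v1 j x\<bar> powr p)" for S j
      using C1_continuous[OF v] C1_continuous[OF C0] C1_continuous[OF C1'] p by (auto intro!: continuous_on_abs_powr)
    have csq: "continuous_on S (\<lambda>x. (v x)\<^sup>2)" "continuous_on S (\<lambda>x. (v0 j x)\<^sup>2)" "continuous_on S (\<lambda>x. (v1 j x)\<^sup>2)" for S j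
      using C1_continuous[OF v] C1_continuous[OF C0] C1_continuous[OF C1'] by (auto intro!: continuous_intros)
    have cD: "continuous_on S (\<lambda>x. (norm (Dv x))\<^sup>2)" "continuous_on S (\<lambda>x. (norm (D0 j x))\<^sup>2)" "continuous_on S (\<lambda>x. (norm (D1 j x))\<^sup>2)" for S j
      using C1_continuous_grad[OF v] C1_continuous_grad[OF C0] C1_continuous_grad[OF C1'] by (auto intro!: continuous_intros)
    \<comment> \<open>Averaging: if every strip cost more than c/N of the mass c, the costs would
      sum to more than c, against \<open>cut_sum_le\<close>.\<close>
    obtain j where j: "j < N" "c * (1 - 1 / real N) \<le> IQ (\<lambda>x. \<bar>v0 j x\<bar> powr p) + IQ (\<lambda>x. \<bar>v1 j x\<bar> powr p)"
    proof (rule ccontr)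
      assume "\<not> thesis"
      then have lt: "IQ (\<lambda>x. \<bar>v0 j x\<bar> powr p) + IQ (\<lambda>x. \<bar>v1 j x\<bar> powr p) < c * (1 - 1 / real N)" if "j < N" for j
        using \<open>\<And>j. \<lbrakk>j < N; c * (1 - 1 / real N) \<le> IQ (\<lambda>x. \<bar>v0 j x\<bar> powr p) + IQ (\<lambda>x. \<bar>v1 j x\<bar> powr p)\<rbrakk> \<Longrightarrow> thesis\<close> that
        by (meson not_le)
      have "c = (\<Sum>j<N. c / real N)" using N(2) by simp
      also have "\<dots> < (\<Sum>j<N. c - IQ (\<lambda>x. \<bar>v0 j x\<bar> powr p) - IQ (\<lambda>x. \<bar>v1 j x\<bar> powr p))"
      proof (rule sum_strict_mono)
        fix j assume "j \<in> {..<N}"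
        then have "IQ (\<lambda>x. \<bar>v0 j x\<bar> powr p) + IQ (\<lambda>x. \<bar>v1 j x\<bar> powr p) < c - c / real N"
          using lt[of j] by (simp add: right_diff_distrib)
        then show "c / real N < c - IQ (\<lambda>x. \<bar>v0 j x\<bar> powr p) - IQ (\<lambda>x. \<bar>v1 j x\<bar> powr p)" by linarith
      qed (use N(2) in \<open>auto simp: lessThan_empty_iff\<close>)
      also have "\<dots> = (\<Sum>j<N. IQ (\<lambda>x. \<bar>v x\<bar> powr p - \<bar>v0 j x\<bar> powr p - \<bar>v1 j x\<bar> powr p))"
      proof (rule sum.cong[OF refl])
        fix j
        have "IQ (\<lambda>x. \<bar>v x\<bar> powr p - \<bar>v0 j x\<bar> powr p - \<bar>v1 j x\<bar> powr p) = IQ (\<lambda>x. \<bar>v x\<bar> powr p - \<bar>v0 j x\<bar> powr p) - IQ (\<lambda>x. \<bar>v1 j x\<bar> powr p)"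
          by (intro IQ_diff continuous_on_diff cp)
        also have "IQ (\<lambda>x. \<bar>v x\<bar> powr p - \<bar>v0 j x\<bar> powr p) = c - IQ (\<lambda>x. \<bar>v0 j x\<bar> powr p)"
          unfolding c_def by (intro IQ_diff cp)
        finally show "c - IQ (\<lambda>x. \<bar>v0 j x\<bar> powr p) - IQ (\<lambda>x. \<bar>v1 j x\<bar> powr p) = IQ (\<lambda>x. \<bar>v x\<bar> powr p - \<bar>v0 j x\<bar> powr p - \<bar>v1 j x\<bar> powr p)" by simp
      qed
      also have "\<dots> = IQ (\<lambda>x. \<Sum>j<N. \<bar>v x\<bar> powr p - \<bar>v0 j x\<bar> powr p - \<bar>v1 j x\<bar> powr p)"
        by (rule IQ_sum[symmetric]) (intro continuous_on_diff cp)
      also have "\<dots> \<le> c" unfolding c_def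
      proof (rule IQ_mono)
        show "continuous_on cubeQ (\<lambda>x. \<Sum>j<N. \<bar>v x\<bar> powr p - \<bar>v0 j x\<bar> powr p - \<bar>v1 j x\<bar> powr p)"
          by (intro continuous_on_sum continuous_on_diff cp)
        fix x :: "real^'n"
        have "(\<Sum>j<N. \<bar>v x\<bar> powr p - \<bar>v0 j x\<bar> powr p - \<bar>v1 j x\<bar> powr p) = (\<Sum>j<N. 1 - \<eta>0 j (x $ i) powr p - \<eta>1 j (x $ i) powr p) * \<bar>v x\<bar> powr p"
          unfolding v0_def v1_def sum_distrib_right
          by (rule sum.cong[OF refl]) (simp add: abs_mult powr_mult r abs_of_nonneg left_diff_distrib)
        also have "\<dots> \<le> 1 * \<bar>v x\<bar> powr p"
          unfolding \<eta>0' \<eta>1' a_def by (intro mult_right_mono cut_sum_le e) simp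
        finally show "(\<Sum>j<N. \<bar>v x\<bar> powr p - \<bar>v0 j x\<bar> powr p - \<bar>v1 j x\<bar> powr p) \<le> \<bar>v x\<bar> powr p" by simp
      qed (rule cp)
      finally show False by simp
    qed
    have sq_le: "(v0 j x)\<^sup>2 \<le> (v x)\<^sup>2" "(v1 j x)\<^sup>2 \<le> (v x)\<^sup>2" for x
      unfolding v0_def v1_def power_mult_distrib using r
      by (auto intro!: mult_left_le_one_le power_le_one)
    \<comment> \<open>Each piece may carry nearly the whole square integral, so both powers are
      bounded by that of v; what is shared between the pieces is the Dirichlet integral and the p-th
      power mass.\<close>
    have B0: "IQ (\<lambda>x. (v0 j x)\<^sup>2) \<le> b" "IQ (\<lambda>x. (v1 j x)\<^sup>2) \<le> b"
      unfolding b_def using sq_le by (auto intro!: IQ_mono csq)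
    have S: "IQ (\<lambda>x. (norm (D0 j x))\<^sup>2) + IQ (\<lambda>x. (norm (D1 j x))\<^sup>2) \<le> (1 + \<epsilon>) * A + M * b"
    proof -
      have "IQ (\<lambda>x. (norm (D0 j x))\<^sup>2) + IQ (\<lambda>x. (norm (D1 j x))\<^sup>2) = IQ (\<lambda>x. (norm (D0 j x))\<^sup>2 + (norm (D1 j x))\<^sup>2)"
        by (intro IQ_add[symmetric] cD)
      also have "\<dots> \<le> IQ (\<lambda>x. (1 + \<epsilon>) * (norm (Dv x))\<^sup>2 + M * (v x)\<^sup>2)"
      proof (rule IQ_mono)
        fix x :: "real^'n"
        have de: "\<bar>1 / \<delta>\<bar> \<le> 1 / \<delta>" "\<bar>- 1 / \<delta>\<bar> \<le> 1 / \<delta>" using e by auto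
        have "(norm (D0 j x))\<^sup>2 \<le> (1 + \<epsilon>) * ((\<eta>0 j (x $ i))\<^sup>2 * (norm (Dv x))\<^sup>2) + (1 + 1 / \<epsilon>) * ((4 * (1 / \<delta>))\<^sup>2 * (v x)\<^sup>2)"
          unfolding D0_def \<eta>0_def by (rule cut_grad_bound[OF e(1) de(1)])
        moreover have "(norm (D1 j x))\<^sup>2 \<le> (1 + \<epsilon>) * ((\<eta>1 j (x $ i))\<^sup>2 * (norm (Dv x))\<^sup>2) + (1 + 1 / \<epsilon>) * ((4 * (1 / \<delta>))\<^sup>2 * (v x)\<^sup>2)"
          unfolding D1_def \<eta>1_def by (rule cut_grad_bound[OF e(1) de(2)])
        moreover have "(1 + \<epsilon>) * ((\<eta>0 j (x $ i))\<^sup>2 * (norm (Dv x))\<^sup>2) + (1 + \<epsilon>) * ((\<eta>1 j (x $ i))\<^sup>2 * (norm (Dv x))\<^sup>2) \<le> (1 + \<epsilon>) * (norm (Dv x))\<^sup>2"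
        proof -
          have "(\<eta>0 j (x $ i))\<^sup>2 + (\<eta>1 j (x $ i))\<^sup>2 \<le> 1"
            using z0[where j=j and t="x $ i"] z1[where j=j and t="x $ i"] r[of j "x $ i"]
            by (cases "x $ i \<le> a j + \<delta>") (auto intro!: power_le_one)
          then have "((\<eta>0 j (x $ i))\<^sup>2 + (\<eta>1 j (x $ i))\<^sup>2) * ((1 + \<epsilon>) * (norm (Dv x))\<^sup>2) \<le> 1 * ((1 + \<epsilon>) * (norm (Dv x))\<^sup>2)"
            using e by (intro mult_right_mono) auto
          then show ?thesis by (simp add: algebra_simps)
        qed
        moreover have "(1 + 1 / \<epsilon>) * ((4 * (1 / \<delta>))\<^sup>2 * (v x)\<^sup>2) + (1 + 1 / \<epsilon>) * ((4 * (1 / \<delta>))\<^sup>2 * (v x)\<^sup>2) = M * (v x)\<^sup>2"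
          by (simp add: M_def)
        ultimately show "(norm (D0 j x))\<^sup>2 + (norm (D1 j x))\<^sup>2 \<le> (1 + \<epsilon>) * (norm (Dv x))\<^sup>2 + M * (v x)\<^sup>2"
          by linarith
      qed (intro continuous_intros cD csq)+
      also have "\<dots> = (1 + \<epsilon>) * A + M * b"
        by (subst IQ_add) (auto simp: IQ_cmult A_def b_def intro!: continuous_on_mult cD csq continuous_on_const)
      finally show ?thesis .
    qed
    have I0: "\<kappa>2 / 4 * IQ (\<lambda>x. \<bar>v0 j x\<bar> powr p) \<le> (IQ (\<lambda>x. (norm (D0 j x))\<^sup>2) + K * b) * X"
    proof -
      have "\<kappa>2 / 4 * IQ (\<lambda>x. \<bar>v0 j x\<bar> powr p) \<le> (IQ (\<lambda>x. (norm (D0 j x))\<^sup>2) + K * IQ (\<lambda>x. (v0 j x)\<^sup>2)) * IQ (\<lambda>x. (v0 j x)\<^sup>2) powr (2 / d)"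
      proof (rule KI[OF C0])
        fix x k assume x: "x \<in> cubeQ" "k \<notin> I" "2/3 \<le> x $ k"
        show "v0 j x = 0"
        proof (cases "k = i")
          case True
          then have "\<eta>0 j (x $ i) = 0" using x a[OF j(1)] e by (intro z0) auto
          then show ?thesis by (simp add: v0_def)
        next
          case False
          then have "v x = 0" using van x by blast
          then show ?thesis by (simp add: v0_def)
        qed
      qed
      also have "\<dots> \<le> (IQ (\<lambda>x. (norm (D0 j x))\<^sup>2) + K * b) * X"
        unfolding X_def using B0 K b0 by (intro mult_mono add_mono mult_left_mono powr_mono2)
          (auto simp: d_def intro!: IQ_nonneg add_nonneg_nonneg)
      finally show ?thesis .
    qed
    \<comment> \<open>The right piece vanishes near x_i = 0; after the reflection it vanishes where
      the induction hypothesis asks for it.\<close>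
    have I1: "\<kappa>2 / 4 * IQ (\<lambda>x. \<bar>v1 j x\<bar> powr p) \<le> (IQ (\<lambda>x. (norm (D1 j x))\<^sup>2) + K * b) * X"
    proof -
      define vf where "vf x = v1 j (fl x)" for x
      define Df where "Df x = (\<chi> k. m k * D1 j (fl x) $ k)" for x
      have Cf: "C1 vf Df" unfolding vf_def Df_def fl_def by (rule C1_diag[OF C1'])
      have nf: "(norm (Df x))\<^sup>2 = (norm (D1 j (fl x)))\<^sup>2" for x
      proof -
        have "(m k)\<^sup>2 = 1" for k by (simp add: m_def)
        then show ?thesis by (simp add: norm_power2_vec Df_def power_mult_distrib)
      qed
      have "\<kappa>2 / 4 * IQ (\<lambda>x. \<bar>vf x\<bar> powr p) \<le> (IQ (\<lambda>x. (norm (Df x))\<^sup>2) + K * IQ (\<lambda>x. (vf x)\<^sup>2)) * IQ (\<lambda>x. (vf x)\<^sup>2) powr (2 / d)"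
      proof (rule KI[OF Cf])
        fix x k assume x: "x \<in> cubeQ" "k \<notin> I" "2/3 \<le> x $ k"
        show "vf x = 0"
        proof (cases "k = i")
          case True
          then have "\<eta>1 j (fl x $ i) = 0" using x a[OF j(1)] e by (intro z1) (auto simp: fl_nth)
          then show ?thesis by (simp add: vf_def v1_def)
        next
          case False
          then have "v (fl x) = 0" using van x flQ by (simp add: fl_nth) (metis fl_nth flQ x(1,3))
          then show ?thesis by (simp add: vf_def v1_def)
        qed
      qed
      also have "IQ (\<lambda>x. (norm (Df x))\<^sup>2) = IQ (\<lambda>x. (norm (D1 j x))\<^sup>2)" unfolding nf by (rule flIQ)
      also have "IQ (\<lambda>x. (vf x)\<^sup>2) = IQ (\<lambda>x. (v1 j x)\<^sup>2)" unfolding vf_def by (rule flIQ)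
      also have "IQ (\<lambda>x. \<bar>vf x\<bar> powr p) = IQ (\<lambda>x. \<bar>v1 j x\<bar> powr p)" unfolding vf_def by (rule flIQ)
      also have "(IQ (\<lambda>x. (norm (D1 j x))\<^sup>2) + K * IQ (\<lambda>x. (v1 j x)\<^sup>2)) * IQ (\<lambda>x. (v1 j x)\<^sup>2) powr (2 / d) \<le> (IQ (\<lambda>x. (norm (D1 j x))\<^sup>2) + K * b) * X"
        unfolding X_def using B0 K b0 by (intro mult_mono add_mono mult_left_mono powr_mono2)
          (auto simp: d_def intro!: IQ_nonneg add_nonneg_nonneg)
      finally show ?thesis .
    qed
    have "\<kappa>' / 4 * c * (1 + \<epsilon>) = (\<kappa>' * (1 + 1 / real N)) * (c / 4)" by (simp add: \<epsilon>_def)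
    also have "\<dots> \<le> (\<kappa>2 * (1 - 1 / real N)) * (c / 4)" using N(1) b0 by (intro mult_right_mono) auto
    also have "\<dots> = \<kappa>2 / 4 * (c * (1 - 1 / real N))" by simp
    also have "\<dots> \<le> \<kappa>2 / 4 * (IQ (\<lambda>x. \<bar>v0 j x\<bar> powr p) + IQ (\<lambda>x. \<bar>v1 j x\<bar> powr p))"
      using \<kappa>2 j(2) by (intro mult_left_mono) auto
    also have "\<dots> \<le> (IQ (\<lambda>x. (norm (D0 j x))\<^sup>2) + K * b) * X + (IQ (\<lambda>x. (norm (D1 j x))\<^sup>2) + K * b) * X"
      using I0 I1 by (simp add: distrib_left)
    also have "\<dots> = ((IQ (\<lambda>x. (norm (D0 j x))\<^sup>2) + IQ (\<lambda>x. (norm (D1 j x))\<^sup>2)) + 2 * K * b) * X"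
      by (simp add: algebra_simps)
    also have "\<dots> \<le> (((1 + \<epsilon>) * A + M * b) + 2 * K * b) * X"
      by (rule mult_right_mono[OF _ X0]) (use S in linarith)
    \<comment> \<open>The lower order terms are enlarged by the same factor 1 + \<epsilon>, which
      then cancels on both sides.\<close>
    also have "\<dots> \<le> (((1 + \<epsilon>) * A + (1 + \<epsilon>) * (M * b)) + (1 + \<epsilon>) * (2 * K * b)) * X"
    proof (rule mult_right_mono[OF _ X0])
      have "M * b \<le> (1 + \<epsilon>) * (M * b)" "2 * K * b \<le> (1 + \<epsilon>) * (2 * K * b)"
        using e M0 K b0 by (auto simp: distrib_right)
      then show "(1 + \<epsilon>) * A + M * b + 2 * K * b \<le> (1 + \<epsilon>) * A + (1 + \<epsilon>) * (M * b) + (1 + \<epsilon>) * (2 * K * b)"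
        by linarith
    qed
    also have "\<dots> = (A + (M + 2 * K) * b) * X * (1 + \<epsilon>)" by (simp add: algebra_simps)
    finally have "\<kappa>' / 4 * c \<le> (A + (M + 2 * K) * b) * X"
      using e by (simp add: mult_le_cancel_right_pos)
    then show ?thesis by (simp add: c_def A_def b_def X_def)
  qed
  show ?case
    using main M0 K unfolding d_def by (intro exI[of _ "M + 2 * K"]) auto
qed

section \<open>Passage from C1 functions to Sobolev functions\<close>

lemma EQ_fatou:
  assumes m: "\<And>n. f n \<in> borel_measurable lebesgue"
    and ae: "AE x in lebesgue. x \<in> cubeQ \<longrightarrow> (\<lambda>n. f n x) \<longlonglongrightarrow> f' x"
    and b: "\<And>n. EQ (f n) \<le> c n" and c: "c \<longlonglongrightarrow> c'"
  shows "EQ f' \<le> c'"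
proof -
  have "EQ f' = (\<integral>\<^sup>+x. liminf (\<lambda>n. ennreal (f n x) * indicator cubeQ x) \<partial>lebesgue)"
    unfolding EQ_def
  proof (rule nn_integral_cong_AE)
    show "AE x in lebesgue. ennreal (f' x) * indicator cubeQ x = liminf (\<lambda>n. ennreal (f n x) * indicator cubeQ x)"
      using ae
    proof eventually_elim
      case (elim x)
      show ?case
      proof (cases "x \<in> cubeQ")
        case True
        then have "(\<lambda>n. ennreal (f n x)) \<longlonglongrightarrow> ennreal (f' x)" using elim by (intro tendsto_ennrealI) auto
        then have "liminf (\<lambda>n. ennreal (f n x)) = ennreal (f' x)" by (intro lim_imp_Liminf) auto
        then show ?thesis using True by simp
      next
        case False
        have "liminf (\<lambda>n. (0::ennreal)) = 0" by (intro lim_imp_Liminf) auto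
        then show ?thesis using False by simp
      qed
    qed
  qed
  also have "\<dots> \<le> liminf (\<lambda>n. EQ (f n))"
    unfolding EQ_def
    by (intro nn_integral_liminf borel_measurable_times_ennreal measurable_compose[OF m measurable_ennreal] borel_measurable_indicator lebesgue_cubeQ)
  also have "\<dots> \<le> liminf c" using b by (intro Liminf_mono) auto
  also have "\<dots> = c'" using c by (intro lim_imp_Liminf) auto
  finally show ?thesis .
qed

lemma C1_set_integrable: "C1 v Dv \<Longrightarrow> set_integrable lebesgue cubeQ v"
  using C1_continuous set_integrable_IQ by blast

lemma EQ_abs_eq:
  assumes "set_integrable lebesgue cubeQ f"
  shows "EQ (\<lambda>x. \<bar>f x\<bar>) = ennreal (\<integral>x. norm (indicator cubeQ x *\<^sub>R f x) \<partial>lebesgue)"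
proof -
  have "EQ (\<lambda>x. \<bar>f x\<bar>) = (\<integral>\<^sup>+x. ennreal (norm (indicator cubeQ x *\<^sub>R f x)) \<partial>lebesgue)"
    unfolding EQ_def by (intro nn_integral_cong) (auto simp: indicator_def)
  then show ?thesis using assms unfolding set_integrable_def
    by (simp add: nn_integral_eq_integral)
qed

lemma IQ_diff_le_EQ:
  assumes "set_integrable lebesgue cubeQ f" "set_integrable lebesgue cubeQ h"
  shows "ennreal \<bar>IQ f - IQ h\<bar> \<le> EQ (\<lambda>x. \<bar>f x - h x\<bar>)"
proof -
  have i: "set_integrable lebesgue cubeQ (\<lambda>x. f x - h x)" using assms by (rule set_integral_diff)
  have "IQ f - IQ h = (\<integral>x. indicator cubeQ x *\<^sub>R (f x - h x) \<partial>lebesgue)"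
    using set_integral_diff(2)[OF assms] by (simp add: IQ_def set_lebesgue_integral_def)
  then have "\<bar>IQ f - IQ h\<bar> \<le> (\<integral>x. norm (indicator cubeQ x *\<^sub>R (f x - h x)) \<partial>lebesgue)"
    using integral_norm_bound[of lebesgue "\<lambda>x. indicator cubeQ x *\<^sub>R (f x - h x)"] by (simp del: scaleR_right_diff_distrib)
  then show ?thesis unfolding EQ_abs_eq[OF i] by (rule ennreal_leI)
qed

lemma L1_imp_AE_subseq:
  fixes f :: "nat \<Rightarrow> real^'n::finite \<Rightarrow> real"
  assumes i: "\<And>n. set_integrable lebesgue cubeQ (f n)" "set_integrable lebesgue cubeQ u"
    and l: "\<And>n. EQ (\<lambda>x. \<bar>f n x - u x\<bar>) \<le> ennreal (c n)" and c: "c \<longlonglongrightarrow> 0" "\<And>n. c n \<ge> 0"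
  obtains r where "strict_mono r" "AE x in lebesgue. x \<in> cubeQ \<longrightarrow> (\<lambda>n. f (r n) x) \<longlonglongrightarrow> u x"
proof -
  define h where "h n x = indicator cubeQ x *\<^sub>R (f n x - u x)" for n x
  have ih: "set_integrable lebesgue cubeQ (\<lambda>x. f n x - u x)" for n using i by (intro set_integral_diff) auto
  then have ih': "integrable lebesgue (h n)" for n unfolding h_def set_integrable_def by simp
  have "(\<integral>x. norm (h n x) \<partial>lebesgue) \<le> c n" for n
  proof -
    have "ennreal (\<integral>x. norm (h n x) \<partial>lebesgue) \<le> ennreal (c n)"
      using l[of n] unfolding EQ_abs_eq[OF ih] h_def .
    then show ?thesis using c(2) by (simp add: ennreal_le_iff)
  qed
  then have "(\<lambda>n. \<integral>x. norm (h n x) \<partial>lebesgue) \<longlonglongrightarrow> 0"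
    by (intro tendsto_sandwich[OF _ _ tendsto_const c(1)]) auto
  from tendsto_L1_AE_subseq[OF ih' this] obtain r where r: "strict_mono r" "AE x in lebesgue. (\<lambda>n. h (r n) x) \<longlonglongrightarrow> 0" by blast
  have "AE x in lebesgue. x \<in> cubeQ \<longrightarrow> (\<lambda>n. f (r n) x) \<longlonglongrightarrow> u x"
    using r(2)
  proof eventually_elim
    case (elim x)
    then show ?case by (auto simp: h_def dest: LIM_zero_cancel)
  qed
  then show thesis using r(1) that by blast
qed

lemma C1_approx_seq:
  fixes u :: "real^'n::finite \<Rightarrow> real"
  assumes W: "W11Q u g"
  obtains v Dv where "\<And>n::nat. C1 (v n) (Dv n)"
    "\<And>n. EQ (\<lambda>x. (norm (Dv n x))\<^sup>2) \<le> ennreal (1 + 1 / (real n + 1)) * EQ (\<lambda>x. (norm (g x))\<^sup>2)"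
    "\<And>n. EQ (\<lambda>x. (v n x)\<^sup>2) \<le> ennreal (1 + 1 / (real n + 1)) * EQ (\<lambda>x. (u x)\<^sup>2)"
    "AE x in lebesgue. x \<in> cubeQ \<longrightarrow> (\<lambda>n. v n x) \<longlonglongrightarrow> u x"
    "(\<lambda>n. IQ (v n)) \<longlonglongrightarrow> IQ u"
proof -
  define P where "P n w \<longleftrightarrow> C1 (fst w) (snd w) \<and> EQ (\<lambda>x. \<bar>fst w x - u x\<bar>) \<le> ennreal (1 / (real n + 1)) \<and>
    EQ (\<lambda>x. (norm (snd w x))\<^sup>2) \<le> ennreal (1 + 1 / (real n + 1)) * EQ (\<lambda>x. (norm (g x))\<^sup>2) \<and>
    EQ (\<lambda>x. (fst w x)\<^sup>2) \<le> ennreal (1 + 1 / (real n + 1)) * EQ (\<lambda>x. (u x)\<^sup>2)"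
    for n :: nat and w :: "(real^'n \<Rightarrow> real) \<times> (real^'n \<Rightarrow> real^'n)"
  have "\<exists>w. P n w" for n
  proof -
    have n: "1 / (real n + 1) > 0" by simp
    obtain v Dv where "C1 v Dv" "EQ (\<lambda>x. \<bar>v x - u x\<bar>) \<le> ennreal (1 / (real n + 1))"
      "EQ (\<lambda>x. (norm (Dv x))\<^sup>2) \<le> ennreal (1 + 1 / (real n + 1)) * EQ (\<lambda>x. (norm (g x))\<^sup>2)"
      "EQ (\<lambda>x. (v x)\<^sup>2) \<le> ennreal (1 + 1 / (real n + 1)) * EQ (\<lambda>x. (u x)\<^sup>2)"
      by (rule C1_density[OF W n]) blast
    then have "P n (v, Dv)" by (simp add: P_def)
    then show ?thesis ..
  qed
  then obtain w where w: "\<And>n. P n (w n)" by metis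
  define v Dv where "v n = fst (w n)" and "Dv n = snd (w n)" for n
  have v: "\<And>n. C1 (v n) (Dv n)" "\<And>n. EQ (\<lambda>x. \<bar>v n x - u x\<bar>) \<le> ennreal (1 / (real n + 1))"
    "\<And>n. EQ (\<lambda>x. (norm (Dv n x))\<^sup>2) \<le> ennreal (1 + 1 / (real n + 1)) * EQ (\<lambda>x. (norm (g x))\<^sup>2)"
    "\<And>n. EQ (\<lambda>x. (v n x)\<^sup>2) \<le> ennreal (1 + 1 / (real n + 1)) * EQ (\<lambda>x. (u x)\<^sup>2)"
    using w unfolding P_def v_def Dv_def by blast+
  have iu: "set_integrable lebesgue cubeQ u" using W by (simp add: W11Q_def)
  have lim0: "(\<lambda>n. 1 / (real n + 1)) \<longlonglongrightarrow> 0" using LIMSEQ_inverse_real_of_nat by (simp add: inverse_eq_divide add.commute)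
  obtain r where r: "strict_mono r" "AE x in lebesgue. x \<in> cubeQ \<longrightarrow> (\<lambda>n. v (r n) x) \<longlonglongrightarrow> u x"
    by (rule L1_imp_AE_subseq[OF C1_set_integrable[OF v(1)] iu v(2) lim0]) auto
  \<comment> \<open>The index \<open>r n\<close> is at least n, so the bounds with n hold along the
    subsequence.\<close>
  have rn: "1 / (real (r n) + 1) \<le> 1 / (real n + 1)" for n
    using seq_suble[OF r(1), of n] by (intro divide_left_mono) auto
  have le: "ennreal (1 + 1 / (real (r n) + 1)) * E \<le> ennreal (1 + 1 / (real n + 1)) * E" for n E
    using rn[of n] by (intro mult_right_mono ennreal_leI) auto
  have I: "(\<lambda>n. IQ (v (r n))) \<longlonglongrightarrow> IQ u"
  proof -
    have "\<bar>IQ (v (r n)) - IQ u\<bar> \<le> 1 / (real n + 1)" for n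
    proof -
      have "ennreal \<bar>IQ (v (r n)) - IQ u\<bar> \<le> ennreal (1 / (real (r n) + 1))"
        using IQ_diff_le_EQ[OF C1_set_integrable[OF v(1)] iu] v(2) order_trans by blast
      then have "\<bar>IQ (v (r n)) - IQ u\<bar> \<le> 1 / (real (r n) + 1)" by (subst (asm) ennreal_le_iff) auto
      then show ?thesis using rn[of n] by linarith
    qed
    then have "(\<lambda>n. IQ (v (r n)) - IQ u) \<longlonglongrightarrow> 0"
      by (intro Lim_null_comparison[OF _ lim0]) auto
    then show ?thesis by (rule LIM_zero_cancel)
  qed
  show thesis
  proof (rule that[of "\<lambda>n. v (r n)" "\<lambda>n. Dv (r n)"])
    show "EQ (\<lambda>x. (norm (Dv (r n) x))\<^sup>2) \<le> ennreal (1 + 1 / (real n + 1)) * EQ (\<lambda>x. (norm (g x))\<^sup>2)" for n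
      using order_trans[OF v(3) le] .
    show "EQ (\<lambda>x. (v (r n) x)\<^sup>2) \<le> ennreal (1 + 1 / (real n + 1)) * EQ (\<lambda>x. (u x)\<^sup>2)" for n
      using order_trans[OF v(4) le] .
  qed (use v(1) r I in auto)
qed

text \<open>Density: the right-hand side of the C1 inequality is controlled up to factors 1 +
  1/(n+1), and the left-hand side is lower semicontinuous by Fatou's lemma. In particular the p-th
  power of u is integrable.\<close>

lemma GN_cube:
  assumes GN: "GN_bound TYPE('n::finite) p \<kappa>" and p: "p > 0" and \<kappa>: "0 < \<kappa>'" "\<kappa>' < \<kappa>"
  obtains K where "K \<ge> 0" "\<And>(u::real^'n \<Rightarrow> real) g. W11Q u g \<Longrightarrow> EQ (\<lambda>x. (norm (g x))\<^sup>2) < \<infinity> \<Longrightarrow> EQ (\<lambda>x. (u x)\<^sup>2) < \<infinity> \<Longrightarrow>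
    ennreal (\<kappa>' / 4) * EQ (\<lambda>x. \<bar>u x\<bar> powr p) \<le> ennreal ((enn2real (EQ (\<lambda>x. (norm (g x))\<^sup>2)) + K * enn2real (EQ (\<lambda>x. (u x)\<^sup>2)))
       * enn2real (EQ (\<lambda>x. (u x)\<^sup>2)) powr (2 / real CARD('n)))"
proof -
  obtain K where K: "K \<ge> 0" and KC: "\<And>(v::real^'n \<Rightarrow> real) Dv. C1 v Dv \<Longrightarrow>
     \<kappa>' / 4 * IQ (\<lambda>x. \<bar>v x\<bar> powr p)
       \<le> (IQ (\<lambda>x. (norm (Dv x))\<^sup>2) + K * IQ (\<lambda>x. (v x)\<^sup>2)) * IQ (\<lambda>x. (v x)\<^sup>2) powr (2 / real CARD('n))"
    using GN_cube_C1[OF GN p \<kappa>, of UNIV] by auto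
  have "ennreal (\<kappa>' / 4) * EQ (\<lambda>x. \<bar>u x\<bar> powr p) \<le> ennreal ((enn2real (EQ (\<lambda>x. (norm (g x))\<^sup>2)) + K * enn2real (EQ (\<lambda>x. (u x)\<^sup>2)))
       * enn2real (EQ (\<lambda>x. (u x)\<^sup>2)) powr (2 / real CARD('n)))"
    if W: "W11Q u g" and fin: "EQ (\<lambda>x. (norm (g x))\<^sup>2) < \<infinity>" "EQ (\<lambda>x. (u x)\<^sup>2) < \<infinity>" for u :: "real^'n \<Rightarrow> real" and g
  proof -
    obtain v Dv where v: "\<And>n::nat. C1 (v n) (Dv n)"
      "\<And>n. EQ (\<lambda>x. (norm (Dv n x))\<^sup>2) \<le> ennreal (1 + 1 / (real n + 1)) * EQ (\<lambda>x. (norm (g x))\<^sup>2)"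
      "\<And>n. EQ (\<lambda>x. (v n x)\<^sup>2) \<le> ennreal (1 + 1 / (real n + 1)) * EQ (\<lambda>x. (u x)\<^sup>2)"
      "AE x in lebesgue. x \<in> cubeQ \<longrightarrow> (\<lambda>n. v n x) \<longlonglongrightarrow> u x" by (rule C1_approx_seq[OF W]) blast
    define a b where "a = enn2real (EQ (\<lambda>x. (norm (g x))\<^sup>2))" and "b = enn2real (EQ (\<lambda>x. (u x)\<^sup>2))"
    have ab: "EQ (\<lambda>x. (norm (g x))\<^sup>2) = ennreal a" "EQ (\<lambda>x. (u x)\<^sup>2) = ennreal b" "a \<ge> 0" "b \<ge> 0"
      using fin by (auto simp: a_def b_def)
    define q where "q n = 1 + 1 / (real n + 1)" for n :: nat
    have q0: "q n \<ge> 0" for n by (simp add: q_def)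
    have lq: "q \<longlonglongrightarrow> 1" unfolding q_def by real_asymp
    have cont: "continuous_on S (\<lambda>x. (v n x)\<^sup>2)" "continuous_on S (\<lambda>x. (norm (Dv n x))\<^sup>2)" "continuous_on S (\<lambda>x. \<bar>v n x\<bar> powr p)" for n S
      using C1_continuous[OF v(1)] C1_continuous_grad[OF v(1)] p by (auto intro!: continuous_intros continuous_on_abs_powr)
    have An: "IQ (\<lambda>x. (norm (Dv n x))\<^sup>2) \<le> q n * a" for n
    proof -
      have "ennreal (IQ (\<lambda>x. (norm (Dv n x))\<^sup>2)) \<le> ennreal (q n * a)"
        using v(2)[of n] ab q0 by (subst (asm) EQ_eq_IQ) (auto simp: cont ennreal_mult q_def)
      then show ?thesis using ab q0[of n] by (subst (asm) ennreal_le_iff) auto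
    qed
    have Bn: "IQ (\<lambda>x. (v n x)\<^sup>2) \<le> q n * b" for n
    proof -
      have "ennreal (IQ (\<lambda>x. (v n x)\<^sup>2)) \<le> ennreal (q n * b)"
        using v(3)[of n] ab q0 by (subst (asm) EQ_eq_IQ) (auto simp: cont ennreal_mult q_def)
      then show ?thesis using ab q0[of n] by (subst (asm) ennreal_le_iff) auto
    qed
    have nn: "0 \<le> IQ (\<lambda>x. (v n x)\<^sup>2)" "0 \<le> IQ (\<lambda>x. (norm (Dv n x))\<^sup>2)" "0 \<le> IQ (\<lambda>x. \<bar>v n x\<bar> powr p)" for n by (auto intro!: IQ_nonneg)
    have bound: "EQ (\<lambda>x. \<bar>v n x\<bar> powr p) \<le> ennreal ((q n * a + K * (q n * b)) * (q n * b) powr (2 / real CARD('n)) / (\<kappa>' / 4))" for n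
    proof -
      have "\<kappa>' / 4 * IQ (\<lambda>x. \<bar>v n x\<bar> powr p) \<le> (IQ (\<lambda>x. (norm (Dv n x))\<^sup>2) + K * IQ (\<lambda>x. (v n x)\<^sup>2)) * IQ (\<lambda>x. (v n x)\<^sup>2) powr (2 / real CARD('n))"
        by (rule KC[OF v(1)])
      also have "\<dots> \<le> (q n * a + K * (q n * b)) * (q n * b) powr (2 / real CARD('n))"
        using An[of n] Bn[of n] nn[of n] K ab q0[of n] by (intro mult_mono add_mono mult_left_mono powr_mono2) auto
      finally have "IQ (\<lambda>x. \<bar>v n x\<bar> powr p) \<le> (q n * a + K * (q n * b)) * (q n * b) powr (2 / real CARD('n)) / (\<kappa>' / 4)"
        using \<kappa> by (subst pos_le_divide_eq) (auto simp: mult.commute)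
      then show ?thesis by (subst EQ_eq_IQ) (auto simp: cont intro: ennreal_leI)
    qed
    have "EQ (\<lambda>x. \<bar>u x\<bar> powr p) \<le> ennreal ((1 * a + K * (1 * b)) * (1 * b) powr (2 / real CARD('n)) / (\<kappa>' / 4))"
    proof (rule EQ_fatou[OF _ _ bound])
      show "(\<lambda>x. \<bar>v n x\<bar> powr p) \<in> borel_measurable lebesgue" for n
        by (intro borel_measurable_lebesgue_continuous cont)
      show "AE x in lebesgue. x \<in> cubeQ \<longrightarrow> (\<lambda>n. \<bar>v n x\<bar> powr p) \<longlonglongrightarrow> \<bar>u x\<bar> powr p"
        using v(4) by eventually_elim (use p in \<open>auto intro!: tendsto_powr2 tendsto_rabs\<close>)
      show "(\<lambda>n. ennreal ((q n * a + K * (q n * b)) * (q n * b) powr (2 / real CARD('n)) / (\<kappa>' / 4))) \<longlonglongrightarrow> ennreal ((1 * a + K * (1 * b)) * (1 * b) powr (2 / real CARD('n)) / (\<kappa>' / 4))"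
        using ab q0 \<kappa> by (intro tendsto_ennrealI tendsto_intros lq tendsto_powr2) auto
    qed
    then have "ennreal (\<kappa>' / 4) * EQ (\<lambda>x. \<bar>u x\<bar> powr p) \<le> ennreal (\<kappa>' / 4) * ennreal ((a + K * b) * b powr (2 / real CARD('n)) / (\<kappa>' / 4))"
      by (intro mult_left_mono) auto
    also have "\<dots> = ennreal ((a + K * b) * b powr (2 / real CARD('n)))"
      using \<kappa> ab K by (subst ennreal_mult[symmetric]) auto
    finally show ?thesis by (simp add: a_def b_def)
  qed
  then show thesis using that K by blast
qed

subsection \<open>The Poincare inequality\<close>

text \<open>The fundamental theorem of calculus along the segment from y to x, then Jensen in t. The
  factor d is the squared diameter of the cube; the indicator of the cube is free because the
  segment stays inside.\<close>

lemma segment_square_le: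
  fixes v :: "real^'n::finite \<Rightarrow> real"
  assumes v: "C1 v Dv" and xy: "x \<in> cubeQ" "y \<in> cubeQ"
  shows "ennreal ((v x - v y)\<^sup>2) \<le> (\<integral>\<^sup>+t. ennreal (real CARD('n)) * (ennreal ((norm (Dv (y + t *\<^sub>R (x - y))))\<^sup>2) * indicator cubeQ (y + t *\<^sub>R (x - y)) * indicator {0..1} t) \<partial>lborel)"
proof -
  define F where "F t = v (y + t *\<^sub>R (x - y))" for t
  define f where "f t = Dv (y + t *\<^sub>R (x - y)) \<bullet> (x - y)" for t
  have line: "continuous_on UNIV (\<lambda>t. y + t *\<^sub>R (x - y))" by (intro continuous_intros)
  have fc: "continuous_on UNIV f" unfolding f_def
    by (intro continuous_intros continuous_on_compose2[OF C1_continuous_grad[OF v, of UNIV] line]) auto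
  have F: "(F has_real_derivative f t) (at t)" for t
  proof -
    have "((\<lambda>t. y + t *\<^sub>R (x - y)) has_derivative (\<lambda>h. h *\<^sub>R (x - y))) (at t)" by (auto intro!: derivative_eq_intros)
    moreover have "(v has_derivative (\<lambda>h. Dv (y + t *\<^sub>R (x - y)) \<bullet> h)) (at (y + t *\<^sub>R (x - y)))" using v by (simp add: C1_def)
    ultimately have "(F has_derivative (\<lambda>h. Dv (y + t *\<^sub>R (x - y)) \<bullet> (h *\<^sub>R (x - y)))) (at t)"
      unfolding F_def by (rule has_derivative_compose)
    then show ?thesis unfolding has_field_derivative_def f_def
      by (rule has_derivative_eq_rhs) (auto simp: mult.commute)
  qed
  have "(\<integral>t. f t * indicator {0..1} t \<partial>lborel) = F 1 - F 0"
    by (rule integral_FTC_Icc_real) (use F fc in \<open>auto simp: continuous_on_eq_continuous_at\<close>)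
  then have "ennreal ((v x - v y)\<^sup>2) = ennreal ((\<integral>t. f t * indicator {0..1} t \<partial>lborel)\<^sup>2)" by (simp add: F_def)
  also have "\<dots> \<le> (\<integral>\<^sup>+t. ennreal ((f t)\<^sup>2 * indicator {0..1} t) \<partial>lborel)"
    by (rule square_integral_le) (use borel_measurable_continuous_onI[OF fc] in auto)
  also have "\<dots> \<le> (\<integral>\<^sup>+t. ennreal (real CARD('n)) * (ennreal ((norm (Dv (y + t *\<^sub>R (x - y))))\<^sup>2) * indicator cubeQ (y + t *\<^sub>R (x - y)) * indicator {0..1} t) \<partial>lborel)"
  proof (rule nn_integral_mono)
    fix t :: real
    show "ennreal ((f t)\<^sup>2 * indicator {0..1} t) \<le> ennreal (real CARD('n)) * (ennreal ((norm (Dv (y + t *\<^sub>R (x - y))))\<^sup>2) * indicator cubeQ (y + t *\<^sub>R (x - y)) * indicator {0..1} t)"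
    proof (cases "t \<in> {0..1}")
      case True
      have "convex (cubeQ :: (real^'n) set)" by (simp add: cubeQ_def)
      then have "(1 - t) *\<^sub>R y + t *\<^sub>R x \<in> cubeQ" using xy True by (intro convexD_alt) auto
      moreover have "(1 - t) *\<^sub>R y + t *\<^sub>R x = y + t *\<^sub>R (x - y)" by (simp add: algebra_simps)
      ultimately have inQ: "y + t *\<^sub>R (x - y) \<in> cubeQ" by simp
      have "(norm (x - y))\<^sup>2 = (\<Sum>i\<in>UNIV. (x $ i - y $ i)\<^sup>2)" by (simp add: norm_power2_vec)
      also have "\<dots> \<le> (\<Sum>i\<in>(UNIV::'n set). 1)"
      proof (rule sum_mono)
        fix i
        have "\<bar>x $ i - y $ i\<bar> \<le> 1" using xy by (auto simp: mem_cubeQ abs_le_iff) (smt (verit))+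
        then show "(x $ i - y $ i)\<^sup>2 \<le> 1" by (simp add: abs_square_le_1)
      qed
      finally have n: "(norm (x - y))\<^sup>2 \<le> real CARD('n)" by simp
      have "(f t)\<^sup>2 \<le> (norm (Dv (y + t *\<^sub>R (x - y))) * norm (x - y))\<^sup>2"
        unfolding f_def by (rule power2_le_iff_abs_le[THEN iffD2]) (auto intro: Cauchy_Schwarz_ineq2)
      also have "\<dots> \<le> real CARD('n) * (norm (Dv (y + t *\<^sub>R (x - y))))\<^sup>2"
        using mult_right_mono[OF n, of "(norm (Dv (y + t *\<^sub>R (x - y))))\<^sup>2"] by (simp add: power_mult_distrib mult.commute)
      finally show ?thesis using True inQ by (simp add: ennreal_mult[symmetric] ennreal_leI)
    qed simp
  qed
  finally show ?thesis .
qed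

text \<open>For t >= 1/2 the substitution is made in x, where the point depends on x with factor t,
  otherwise in y with factor 1 - t. The factor is at least 1/2 in either case, so the Jacobian never
  exceeds 2^d.\<close>

lemma nn_integral_segment_le:
  fixes F :: "real^'n::finite \<Rightarrow> ennreal" and t :: real
  assumes F[measurable]: "F \<in> borel_measurable borel" and t: "0 \<le> t" "t \<le> 1"
  shows "(\<integral>\<^sup>+x. (\<integral>\<^sup>+y. F (y + t *\<^sub>R (x - y)) * indicator cubeQ y * indicator cubeQ x \<partial>lborel) \<partial>lborel) \<le> 2 ^ CARD('n) * (\<integral>\<^sup>+x. F x \<partial>lborel)"
proof -
  have pw: "(\<integral>\<^sup>+x. F (diag (\<lambda>_. s) z x) \<partial>lborel) \<le> 2 ^ CARD('n) * (\<integral>\<^sup>+x. F x \<partial>lborel)" if s: "s \<ge> 1/2" for s z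
  proof -
    have "(\<integral>\<^sup>+x. F (diag (\<lambda>_. s) z x) \<partial>lborel) = ennreal (1 / (\<Prod>i\<in>(UNIV::'n set). \<bar>s\<bar>)) * (\<integral>\<^sup>+x. F x \<partial>lborel)"
      using s by (intro nn_integral_diag_lborel) auto
    also have "1 / (\<Prod>i\<in>(UNIV::'n set). \<bar>s\<bar>) = (1 / s) ^ CARD('n)" using s by (simp add: power_divide)
    also have "ennreal ((1 / s) ^ CARD('n)) \<le> ennreal (2 ^ CARD('n))"
      using s by (intro ennreal_leI power_mono) (auto simp: field_simps)
    also have "ennreal (2 ^ CARD('n)) = 2 ^ CARD('n)" by (simp add: ennreal_power[symmetric])
    finally show ?thesis by (simp add: mult_right_mono)
  qed
  have ind: "(\<integral>\<^sup>+x. c * indicator cubeQ (x::real^'n) \<partial>lborel) = c" for c :: ennreal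
    using nn_integral_cmult_indicator[of "cubeQ :: (real^'n) set" lborel c] by simp
  show ?thesis
  proof (cases "t \<ge> 1/2")
    case True
    have "(\<integral>\<^sup>+x. (\<integral>\<^sup>+y. F (y + t *\<^sub>R (x - y)) * indicator cubeQ y * indicator cubeQ x \<partial>lborel) \<partial>lborel)
      = (\<integral>\<^sup>+y. (\<integral>\<^sup>+x. F (y + t *\<^sub>R (x - y)) * indicator cubeQ y * indicator cubeQ x \<partial>lborel) \<partial>lborel)"
      by (rule lborel_pair.Fubini'[symmetric]) measurable
    also have "\<dots> \<le> (\<integral>\<^sup>+y. (2 ^ CARD('n) * (\<integral>\<^sup>+x. F x \<partial>lborel)) * indicator cubeQ (y::real^'n) \<partial>lborel)"
    proof (rule nn_integral_mono)
      fix y :: "real^'n"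
      have "(\<integral>\<^sup>+x. F (y + t *\<^sub>R (x - y)) * indicator cubeQ y * indicator cubeQ x \<partial>lborel) \<le> (\<integral>\<^sup>+x. F (diag (\<lambda>_. t) ((1 - t) *\<^sub>R y) x) * indicator cubeQ y \<partial>lborel)"
      proof (rule nn_integral_mono)
        fix x :: "real^'n"
        have "y + t *\<^sub>R (x - y) = diag (\<lambda>_. t) ((1 - t) *\<^sub>R y) x" by (simp add: vec_eq_iff algebra_simps)
        then show "F (y + t *\<^sub>R (x - y)) * indicator cubeQ y * indicator cubeQ x \<le> F (diag (\<lambda>_. t) ((1 - t) *\<^sub>R y) x) * indicator cubeQ y"
          by (simp add: indicator_def)
      qed
      also have "\<dots> = (\<integral>\<^sup>+x. F (diag (\<lambda>_. t) ((1 - t) *\<^sub>R y) x) \<partial>lborel) * indicator cubeQ y"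
        by (rule nn_integral_multc) measurable
      also have "\<dots> \<le> (2 ^ CARD('n) * (\<integral>\<^sup>+x. F x \<partial>lborel)) * indicator cubeQ y"
        by (intro mult_right_mono pw True) simp
      finally show "(\<integral>\<^sup>+x. F (y + t *\<^sub>R (x - y)) * indicator cubeQ y * indicator cubeQ x \<partial>lborel) \<le> (2 ^ CARD('n) * (\<integral>\<^sup>+x. F x \<partial>lborel)) * indicator cubeQ y" .
    qed
    finally show ?thesis by (simp only: ind)
  next
    case False
    have "(\<integral>\<^sup>+x. (\<integral>\<^sup>+y. F (y + t *\<^sub>R (x - y)) * indicator cubeQ y * indicator cubeQ x \<partial>lborel) \<partial>lborel)
      \<le> (\<integral>\<^sup>+x. (2 ^ CARD('n) * (\<integral>\<^sup>+x. F x \<partial>lborel)) * indicator cubeQ (x::real^'n) \<partial>lborel)"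
    proof (rule nn_integral_mono)
      fix x :: "real^'n"
      have "(\<integral>\<^sup>+y. F (y + t *\<^sub>R (x - y)) * indicator cubeQ y * indicator cubeQ x \<partial>lborel) \<le> (\<integral>\<^sup>+y. F (diag (\<lambda>_. 1 - t) (t *\<^sub>R x) y) * indicator cubeQ x \<partial>lborel)"
      proof (rule nn_integral_mono)
        fix y :: "real^'n"
        have "y + t *\<^sub>R (x - y) = diag (\<lambda>_. 1 - t) (t *\<^sub>R x) y" by (simp add: vec_eq_iff algebra_simps)
        then show "F (y + t *\<^sub>R (x - y)) * indicator cubeQ y * indicator cubeQ x \<le> F (diag (\<lambda>_. 1 - t) (t *\<^sub>R x) y) * indicator cubeQ x"
          by (simp add: indicator_def)
      qed
      also have "\<dots> = (\<integral>\<^sup>+y. F (diag (\<lambda>_. 1 - t) (t *\<^sub>R x) y) \<partial>lborel) * indicator cubeQ x"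
        by (rule nn_integral_multc) measurable
      also have "\<dots> \<le> (2 ^ CARD('n) * (\<integral>\<^sup>+x. F x \<partial>lborel)) * indicator cubeQ x"
        using False by (intro mult_right_mono pw) auto
      finally show "(\<integral>\<^sup>+y. F (y + t *\<^sub>R (x - y)) * indicator cubeQ y * indicator cubeQ x \<partial>lborel) \<le> (2 ^ CARD('n) * (\<integral>\<^sup>+x. F x \<partial>lborel)) * indicator cubeQ x" .
    qed
    then show ?thesis by (simp only: ind)
  qed
qed

text \<open>v - IQ v is the average of v(x) - v(y) over y; Jensen, the estimate along segments and
  an exchange of integrals give the squared diameter d times the Jacobian bound 2^d.\<close>

lemma poincare_C1:
  fixes v :: "real^'n::finite \<Rightarrow> real"
  assumes v: "C1 v Dv"
  shows "EQ (\<lambda>x. (v x - IQ v)\<^sup>2) \<le> ennreal (real CARD('n) * 2 ^ CARD('n)) * EQ (\<lambda>x. (norm (Dv x))\<^sup>2)"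
proof -
  have [measurable]: "v \<in> borel_measurable borel" "Dv \<in> borel_measurable borel"
    using borel_measurable_continuous_onI C1_continuous[OF v] C1_continuous_grad[OF v] by blast+
  define F where "F x = ennreal ((norm (Dv x))\<^sup>2) * indicator cubeQ x" for x
  have [measurable]: "F \<in> borel_measurable borel" unfolding F_def by measurable
  define c where "c = ennreal (real CARD('n))"
  have iQ: "integrable lborel (indicator cubeQ :: real^'n \<Rightarrow> real)" "(\<integral>y. indicator cubeQ (y::real^'n) \<partial>lborel) = (1::real)"
    by (auto simp: measure_def)
  have iv: "integrable lborel (\<lambda>y. v y * indicator cubeQ y)" "IQ v = (\<integral>y. v y * indicator cubeQ y \<partial>lborel)"
  proof -
    have "integrable lebesgue (\<lambda>y. v y * indicator cubeQ y)"
      using C1_set_integrable[OF v] unfolding set_integrable_def by (simp add: mult.commute)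
    then show "integrable lborel (\<lambda>y. v y * indicator cubeQ y)" by (subst (asm) integrable_completion) measurable
    have "IQ v = (\<integral>y. v y * indicator cubeQ y \<partial>lebesgue)"
      unfolding IQ_def set_lebesgue_integral_def by (simp add: mult.commute)
    also have "\<dots> = (\<integral>y. v y * indicator cubeQ y \<partial>lborel)" by (rule integral_completion) measurable
    finally show "IQ v = (\<integral>y. v y * indicator cubeQ y \<partial>lborel)" .
  qed
  have jens: "ennreal ((v x - IQ v)\<^sup>2) \<le> (\<integral>\<^sup>+y. ennreal ((v x - v y)\<^sup>2) * indicator cubeQ y \<partial>lborel)" for x
  proof -
    have "v x - IQ v = (\<integral>y. v x * indicator cubeQ y - v y * indicator cubeQ y \<partial>lborel)"
      using iQ iv by (subst Bochner_Integration.integral_diff) auto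
    also have "\<dots> = (\<integral>y. (v x - v y) * indicator cubeQ y \<partial>lborel)" by (simp add: left_diff_distrib)
    finally have "ennreal ((v x - IQ v)\<^sup>2) = ennreal ((\<integral>y. (v x - v y) * indicator cubeQ y \<partial>lborel)\<^sup>2)" by simp
    also have "\<dots> \<le> (\<integral>\<^sup>+y. ennreal ((v x - v y)\<^sup>2 * indicator cubeQ y) \<partial>lborel)"
      by (rule square_integral_le) (use iQ in auto)
    also have "\<dots> = (\<integral>\<^sup>+y. ennreal ((v x - v y)\<^sup>2) * indicator cubeQ y \<partial>lborel)"
      by (intro nn_integral_cong) (auto simp: indicator_def)
    finally show ?thesis .
  qed
  define G where "G x y t = F (y + t *\<^sub>R (x - y)) * indicator cubeQ y * indicator cubeQ x * indicator {0..1} t" for x y and t :: real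
  have "EQ (\<lambda>x. (v x - IQ v)\<^sup>2) = (\<integral>\<^sup>+x. ennreal ((v x - IQ v)\<^sup>2) * indicator cubeQ x \<partial>lborel)"
    by (simp add: EQ_def nn_integral_completion)
  also have "\<dots> \<le> (\<integral>\<^sup>+x. (\<integral>\<^sup>+y. (\<integral>\<^sup>+t. c * G x y t \<partial>lborel) \<partial>lborel) \<partial>lborel)"
  proof (rule nn_integral_mono)
    fix x :: "real^'n"
    have "(\<integral>\<^sup>+y. ennreal ((v x - v y)\<^sup>2) * indicator cubeQ y \<partial>lborel) * indicator cubeQ x \<le> (\<integral>\<^sup>+y. (\<integral>\<^sup>+t. c * G x y t \<partial>lborel) \<partial>lborel)"
    proof (cases "x \<in> cubeQ")
      case True
      have "(\<integral>\<^sup>+y. ennreal ((v x - v y)\<^sup>2) * indicator cubeQ y \<partial>lborel) \<le> (\<integral>\<^sup>+y. (\<integral>\<^sup>+t. c * G x y t \<partial>lborel) \<partial>lborel)"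
      proof (rule nn_integral_mono)
        fix y :: "real^'n"
        show "ennreal ((v x - v y)\<^sup>2) * indicator cubeQ y \<le> (\<integral>\<^sup>+t. c * G x y t \<partial>lborel)"
          using segment_square_le[OF v True, of y] True by (cases "y \<in> cubeQ") (auto simp: G_def F_def c_def)
      qed
      then show ?thesis using True by simp
    qed simp
    then show "ennreal ((v x - IQ v)\<^sup>2) * indicator cubeQ x \<le> (\<integral>\<^sup>+y. (\<integral>\<^sup>+t. c * G x y t \<partial>lborel) \<partial>lborel)"
      using jens[of x] by (meson mult_right_mono order_trans zero_le)
  qed
  \<comment> \<open>Two exchanges bring t outside, since the estimate in (x, y) is available for
    each fixed t.\<close>
  also have "\<dots> = (\<integral>\<^sup>+x. (\<integral>\<^sup>+t. (\<integral>\<^sup>+y. c * G x y t \<partial>lborel) \<partial>lborel) \<partial>lborel)"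
    unfolding G_def by (intro nn_integral_cong lborel_pair.Fubini'[symmetric]) measurable
  also have "\<dots> = (\<integral>\<^sup>+t. (\<integral>\<^sup>+x. (\<integral>\<^sup>+y. c * G x y t \<partial>lborel) \<partial>lborel) \<partial>lborel)"
    unfolding G_def by (rule lborel_pair.Fubini'[symmetric]) measurable
  also have "\<dots> \<le> (\<integral>\<^sup>+t. (c * (2 ^ CARD('n) * (\<integral>\<^sup>+x. F x \<partial>lborel))) * indicator {0..1} (t::real) \<partial>lborel)"
  proof (rule nn_integral_mono)
    fix t :: real
    show "(\<integral>\<^sup>+x. (\<integral>\<^sup>+y. c * G x y t \<partial>lborel) \<partial>lborel) \<le> (c * (2 ^ CARD('n) * (\<integral>\<^sup>+x. F x \<partial>lborel))) * indicator {0..1} t"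
    proof (cases "t \<in> {0..1}")
      case True
      have "(\<integral>\<^sup>+x. (\<integral>\<^sup>+y. c * G x y t \<partial>lborel) \<partial>lborel) = (\<integral>\<^sup>+x. c * (\<integral>\<^sup>+y. F (y + t *\<^sub>R (x - y)) * indicator cubeQ y * indicator cubeQ x \<partial>lborel) \<partial>lborel)"
        unfolding G_def using True by (intro nn_integral_cong) (simp, intro nn_integral_cmult, measurable)
      also have "\<dots> = c * (\<integral>\<^sup>+x. (\<integral>\<^sup>+y. F (y + t *\<^sub>R (x - y)) * indicator cubeQ y * indicator cubeQ x \<partial>lborel) \<partial>lborel)"
        by (rule nn_integral_cmult) measurable
      also have "\<dots> \<le> c * (2 ^ CARD('n) * (\<integral>\<^sup>+x. F x \<partial>lborel))"
        using True by (intro mult_left_mono nn_integral_segment_le) auto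
      finally show ?thesis using True by simp
    qed (simp add: G_def)
  qed
  also have "\<dots> = c * (2 ^ CARD('n) * (\<integral>\<^sup>+x. F x \<partial>lborel))"
    by (subst nn_integral_cmult_indicator) auto
  also have "(\<integral>\<^sup>+x. F x \<partial>lborel) = EQ (\<lambda>x. (norm (Dv x))\<^sup>2)"
    by (simp add: EQ_def F_def nn_integral_completion)
  also have "c * (2 ^ CARD('n) * EQ (\<lambda>x. (norm (Dv x))\<^sup>2)) = ennreal (real CARD('n) * 2 ^ CARD('n)) * EQ (\<lambda>x. (norm (Dv x))\<^sup>2)"
    by (simp add: c_def ennreal_mult ennreal_power[symmetric] mult.assoc)
  finally show ?thesis .
qed

lemma poincare:
  fixes u :: "real^'n::finite \<Rightarrow> real"
  assumes W: "W11Q u g" and fin: "EQ (\<lambda>x. (norm (g x))\<^sup>2) < \<infinity>"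
  shows "EQ (\<lambda>x. (u x - IQ u)\<^sup>2) \<le> ennreal (real CARD('n) * 2 ^ CARD('n)) * EQ (\<lambda>x. (norm (g x))\<^sup>2)"
proof -
  obtain v Dv where v: "\<And>n::nat. C1 (v n) (Dv n)"
      "\<And>n. EQ (\<lambda>x. (norm (Dv n x))\<^sup>2) \<le> ennreal (1 + 1 / (real n + 1)) * EQ (\<lambda>x. (norm (g x))\<^sup>2)"
      "AE x in lebesgue. x \<in> cubeQ \<longrightarrow> (\<lambda>n. v n x) \<longlonglongrightarrow> u x" "(\<lambda>n. IQ (v n)) \<longlonglongrightarrow> IQ u"
    by (rule C1_approx_seq[OF W]) blast
  define C where "C = real CARD('n) * 2 ^ CARD('n)"
  define a where "a = enn2real (EQ (\<lambda>x. (norm (g x))\<^sup>2))"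
  have a: "EQ (\<lambda>x. (norm (g x))\<^sup>2) = ennreal a" "a \<ge> 0" using fin by (auto simp: a_def)
  have C0: "C \<ge> 0" by (simp add: C_def)
  have "EQ (\<lambda>x. (u x - IQ u)\<^sup>2) \<le> ennreal (C * ((1 + 0) * a))"
  proof (rule EQ_fatou[where f="\<lambda>n x. (v n x - IQ (v n))\<^sup>2" and c="\<lambda>n. ennreal (C * ((1 + 1 / (real n + 1)) * a))"])
    show "(\<lambda>x. (v n x - IQ (v n))\<^sup>2) \<in> borel_measurable lebesgue" for n
      by (intro borel_measurable_lebesgue_continuous continuous_intros C1_continuous[OF v(1)])
    show "AE x in lebesgue. x \<in> cubeQ \<longrightarrow> (\<lambda>n. (v n x - IQ (v n))\<^sup>2) \<longlonglongrightarrow> (u x - IQ u)\<^sup>2"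
      using v(3) by eventually_elim (auto intro!: tendsto_intros v(4))
    have "(\<lambda>n. 1 / (real n + 1)) \<longlonglongrightarrow> 0" by real_asymp
    then show "(\<lambda>n. ennreal (C * ((1 + 1 / (real n + 1)) * a))) \<longlonglongrightarrow> ennreal (C * ((1 + 0) * a))"
      by (intro tendsto_ennrealI tendsto_intros)
    fix n
    have "EQ (\<lambda>x. (v n x - IQ (v n))\<^sup>2) \<le> ennreal C * EQ (\<lambda>x. (norm (Dv n x))\<^sup>2)"
      unfolding C_def by (rule poincare_C1[OF v(1)])
    also have "\<dots> \<le> ennreal C * (ennreal (1 + 1 / (real n + 1)) * ennreal a)"
      using v(2)[of n] unfolding a by (rule mult_left_mono) simp
    also have "\<dots> = ennreal (C * ((1 + 1 / (real n + 1)) * a))"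
      using C0 a by (simp add: ennreal_mult)
    finally show "EQ (\<lambda>x. (v n x - IQ (v n))\<^sup>2) \<le> ennreal (C * ((1 + 1 / (real n + 1)) * a))" .
  qed
  then show ?thesis using C0 a by (simp add: C_def[symmetric] ennreal_mult)
qed

subsection \<open>Mean-square convergence on the cube\<close>

text \<open>Measurability of the restriction to the cube: \<open>W11Q\<close> says nothing about the
  values of a function outside it.\<close>

definition mQ :: "(real^'n::finite \<Rightarrow> real) \<Rightarrow> bool" where
  "mQ f \<longleftrightarrow> (\<lambda>x. indicator cubeQ x * f x) \<in> borel_measurable lebesgue"

lemma mQ_set_integrable: "set_integrable lebesgue cubeQ f \<Longrightarrow> mQ f"
  unfolding set_integrable_def mQ_def by (drule borel_measurable_integrable) simp

lemma mQ_const: "mQ (\<lambda>x. c)"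
  unfolding mQ_def by (intro borel_measurable_times borel_measurable_const borel_measurable_indicator lebesgue_cubeQ)

lemma mQ_diff: "mQ f \<Longrightarrow> mQ h \<Longrightarrow> mQ (\<lambda>x. f x - h x)"
  unfolding mQ_def right_diff_distrib by (rule borel_measurable_diff)

lemma mQ_mult:
  assumes "mQ f" "mQ h"
  shows "mQ (\<lambda>x. f x * h x)"
proof -
  have "(\<lambda>x. indicator cubeQ x * (f x * h x)) = (\<lambda>x. (indicator cubeQ x * f x) * (indicator cubeQ x * h x))"
    by (auto simp: fun_eq_iff indicator_def)
  then show ?thesis using borel_measurable_times[OF assms[unfolded mQ_def]] unfolding mQ_def by simp
qed

lemma mQ_cmult: "mQ f \<Longrightarrow> mQ (\<lambda>x. c * f x)"
  by (intro mQ_mult mQ_const)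

lemma mQ_power2: "mQ f \<Longrightarrow> mQ (\<lambda>x. (f x)\<^sup>2)"
  unfolding power2_eq_square by (rule mQ_mult)

lemma mQ_sum: "(\<And>i. i \<in> I \<Longrightarrow> mQ (f i)) \<Longrightarrow> mQ (\<lambda>x. \<Sum>i\<in>I. f i x)"
  unfolding mQ_def sum_distrib_left by (rule borel_measurable_sum)

lemma mQ_measurable: "f \<in> borel_measurable lebesgue \<Longrightarrow> mQ f"
  unfolding mQ_def by (intro borel_measurable_times borel_measurable_indicator lebesgue_cubeQ)

lemma mQ_norm_power2: "(\<And>i. mQ (\<lambda>x. g x $ i)) \<Longrightarrow> mQ (\<lambda>x. (norm (g x))\<^sup>2)"
  unfolding norm_power2_vec by (intro mQ_sum mQ_power2)

lemma mQ_ennreal: "mQ f \<Longrightarrow> (\<lambda>x. ennreal (f x) * indicator cubeQ x) \<in> borel_measurable lebesgue"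
proof -
  assume "mQ f"
  then have "(\<lambda>x. ennreal (indicator cubeQ x * f x)) \<in> borel_measurable lebesgue"
    unfolding mQ_def by (rule measurable_compose[OF _ measurable_ennreal])
  moreover have "(\<lambda>x. ennreal (indicator cubeQ x * f x)) = (\<lambda>x. ennreal (f x) * indicator cubeQ x)"
    by (auto simp: fun_eq_iff indicator_def)
  ultimately show ?thesis by simp
qed

lemma EQ_add:
  assumes "mQ f" "mQ h" "\<And>x. 0 \<le> f x" "\<And>x. 0 \<le> h x"
  shows "EQ (\<lambda>x. f x + h x) = EQ f + EQ h"
  unfolding EQ_def using assms
  by (subst nn_integral_add[symmetric]) (auto intro!: mQ_ennreal nn_integral_cong simp: distrib_right)

lemma EQ_cmult: "mQ f \<Longrightarrow> 0 \<le> c \<Longrightarrow> EQ (\<lambda>x. c * f x) = ennreal c * EQ f"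
  unfolding EQ_def by (subst nn_integral_cmult[symmetric]) (auto intro!: mQ_ennreal nn_integral_cong simp: ennreal_mult' mult.assoc)

lemma EQ_const: "EQ (\<lambda>x::real^'n::finite. c) = ennreal c"
  unfolding EQ_def using nn_integral_cmult_indicator[of "cubeQ :: (real^'n) set" lebesgue "ennreal c"] by simp

lemma EQ_sum:
  assumes "finite I" "\<And>i. i \<in> I \<Longrightarrow> mQ (f i)" "\<And>i x. 0 \<le> f i x"
  shows "EQ (\<lambda>x. \<Sum>i\<in>I. f i x) = (\<Sum>i\<in>I. EQ (f i))"
  using assms
proof (induction I rule: finite_induct)
  case empty
  then show ?case by (simp add: EQ_const)
next
  case (insert i I)
  have "EQ (\<lambda>x. f i x + (\<Sum>i\<in>I. f i x)) = EQ (f i) + EQ (\<lambda>x. \<Sum>i\<in>I. f i x)"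
    using insert by (intro EQ_add mQ_sum sum_nonneg) auto
  then show ?case using insert by simp
qed

text \<open>Cauchy-Schwarz on a set of measure 1, in the form |f| <= s/2 + f^2/(2s) with s the
  square root of e.\<close>

lemma EQ_abs_le:
  fixes f :: "real^'a::finite \<Rightarrow> real"
  assumes f: "mQ f" "EQ (\<lambda>x. (f x)\<^sup>2) \<le> ennreal e" and e: "e > 0"
  shows "EQ (\<lambda>x. \<bar>f x\<bar>) \<le> ennreal (sqrt e)"
proof -
  define s where "s = sqrt e"
  have s: "s > 0" "s * s = e" using e by (auto simp: s_def)
  have "EQ (\<lambda>x. \<bar>f x\<bar>) \<le> EQ (\<lambda>x. s / 2 + 1 / (2 * s) * (f x)\<^sup>2)"
  proof (rule EQ_mono)
    fix x
    have "0 \<le> (s - \<bar>f x\<bar>)\<^sup>2 / (2 * s)" using s by simp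
    also have "\<dots> = s / 2 - \<bar>f x\<bar> + 1 / (2 * s) * (f x)\<^sup>2" using s by (simp add: field_simps power2_eq_square)
    finally show "\<bar>f x\<bar> \<le> s / 2 + 1 / (2 * s) * (f x)\<^sup>2" by simp
  qed
  also have "\<dots> = ennreal (s / 2) + ennreal (1 / (2 * s)) * EQ (\<lambda>x. (f x)\<^sup>2)"
  proof -
    have "EQ (\<lambda>x. s / 2 + 1 / (2 * s) * (f x)\<^sup>2) = EQ (\<lambda>x::real^'a. s / 2) + EQ (\<lambda>x. 1 / (2 * s) * (f x)\<^sup>2)"
      using f s by (intro EQ_add mQ_const mQ_cmult mQ_power2) auto
    also have "EQ (\<lambda>x. 1 / (2 * s) * (f x)\<^sup>2) = ennreal (1 / (2 * s)) * EQ (\<lambda>x. (f x)\<^sup>2)"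
      using f s by (intro EQ_cmult mQ_power2) auto
    finally show ?thesis by (simp only: EQ_const)
  qed
  also have "\<dots> \<le> ennreal (s / 2) + ennreal (1 / (2 * s)) * ennreal e"
    using f by (intro add_left_mono mult_left_mono) auto
  also have "\<dots> = ennreal (s / 2 + 1 / (2 * s) * e)"
    using s e by (simp add: ennreal_mult[symmetric] ennreal_plus[symmetric] del: ennreal_plus)
  also have "s / 2 + 1 / (2 * s) * e = s" using s by (auto simp: field_simps)
  finally show ?thesis by (simp add: s_def)
qed

lemma EQ_square_imp_integrable:
  assumes f: "mQ f" "EQ (\<lambda>x. (f x)\<^sup>2) < \<infinity>"
  shows "set_integrable lebesgue cubeQ f"
proof -
  obtain e where e: "e > 0" "EQ (\<lambda>x. (f x)\<^sup>2) \<le> ennreal e"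
  proof -
    obtain r where "r \<ge> 0" "EQ (\<lambda>x. (f x)\<^sup>2) = ennreal r" using f(2) by (cases "EQ (\<lambda>x. (f x)\<^sup>2)") auto
    then show ?thesis using that[of "r + 1"] by (auto intro: ennreal_leI)
  qed
  have "EQ (\<lambda>x. \<bar>f x\<bar>) < \<infinity>" using EQ_abs_le[OF f(1) e(2,1)] by (simp add: order_le_less_trans)
  moreover have "EQ (\<lambda>x. \<bar>f x\<bar>) = (\<integral>\<^sup>+x. ennreal (norm (indicator cubeQ x * f x)) \<partial>lebesgue)"
    unfolding EQ_def by (intro nn_integral_cong) (auto simp: indicator_def)
  ultimately show ?thesis
    using f(1) unfolding set_integrable_def mQ_def by (simp add: integrable_iff_bounded)
qed

lemma square_add_le: "((x::real) + y)\<^sup>2 \<le> 2 * x\<^sup>2 + 2 * y\<^sup>2"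
  using zero_le_power2[of "x - y"] by (simp add: power2_eq_square algebra_simps)

lemma square_diff_le: "((x::real) - y)\<^sup>2 \<le> 2 * x\<^sup>2 + 2 * y\<^sup>2"
  using square_add_le[of x "- y"] by simp

lemma EQ_square_add_le:
  assumes "mQ f" "mQ h"
  shows "EQ (\<lambda>x. (f x + h x)\<^sup>2) \<le> 2 * EQ (\<lambda>x. (f x)\<^sup>2) + 2 * EQ (\<lambda>x. (h x)\<^sup>2)"
proof -
  have "EQ (\<lambda>x. (f x + h x)\<^sup>2) \<le> EQ (\<lambda>x. 2 * (f x)\<^sup>2 + 2 * (h x)\<^sup>2)"
    by (intro EQ_mono square_add_le)
  also have "\<dots> = 2 * EQ (\<lambda>x. (f x)\<^sup>2) + 2 * EQ (\<lambda>x. (h x)\<^sup>2)"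
    using assms by (subst EQ_add) (auto simp: EQ_cmult mQ_power2 intro!: mQ_cmult)
  finally show ?thesis .
qed

text \<open>A Cauchy sequence in mean square is Cauchy in L^1, so a subsequence converges almost
  everywhere; Fatou's lemma applied to f_i minus that subsequence identifies its limit as the
  mean-square limit of the full sequence.\<close>

lemma L2_complete:
  fixes f :: "nat \<Rightarrow> real^'n::finite \<Rightarrow> real"
  assumes m: "\<And>n. mQ (f n)" and fin: "\<And>n. EQ (\<lambda>x. (f n x)\<^sup>2) < \<infinity>"
    and cauchy: "\<And>e. e > 0 \<Longrightarrow> \<exists>N. \<forall>i\<ge>N. \<forall>j\<ge>N. EQ (\<lambda>x. (f i x - f j x)\<^sup>2) \<le> ennreal e"
  obtains u where "set_integrable lebesgue cubeQ u" "EQ (\<lambda>x. (u x)\<^sup>2) < \<infinity>"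
    "\<And>e. e > 0 \<Longrightarrow> \<exists>N. \<forall>i\<ge>N. EQ (\<lambda>x. (f i x - u x)\<^sup>2) \<le> ennreal e"
proof -
  define s where "s n x = indicator cubeQ x *\<^sub>R f n x" for n x
  have si: "set_integrable lebesgue cubeQ (f n)" for n by (rule EQ_square_imp_integrable[OF m fin])
  then have ints: "integrable lebesgue (s n)" for n by (simp add: s_def[abs_def] set_integrable_def)
  have sm: "s n \<in> borel_measurable lebesgue" for n using ints by auto
  obtain r where r: "strict_mono r" "AE x in lebesgue. Cauchy (\<lambda>i. s (r i) x)"
  proof (rule cauchy_L1_AE_cauchy_subseq[OF ints])
    fix e :: real assume e: "e > 0"
    \<comment> \<open>The L^1 distance is at most the square root of the mean-square bound, so this
      gives e/2.\<close>
    define e' where "e' = (e/2)\<^sup>2"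
    have e': "e' > 0" "sqrt e' = e/2" using e by (auto simp: e'_def)
    obtain N where N: "\<forall>i\<ge>N. \<forall>j\<ge>N. EQ (\<lambda>x. (f i x - f j x)\<^sup>2) \<le> ennreal e'" using cauchy[OF e'(1)] by blast
    have "LINT x|lebesgue. norm (s i x - s j x) < e" if "i \<ge> N" "j \<ge> N" for i j
    proof -
      have sd: "set_integrable lebesgue cubeQ (\<lambda>x. f i x - f j x)" using si by (intro set_integral_diff) auto
      have "EQ (\<lambda>x. \<bar>f i x - f j x\<bar>) \<le> ennreal (e/2)"
        using EQ_abs_le[OF mQ_diff[OF m m], of i j e'] N that e' by auto
      then have "ennreal (LINT x|lebesgue. norm (indicator cubeQ x *\<^sub>R (f i x - f j x))) \<le> ennreal (e/2)"
        unfolding EQ_abs_eq[OF sd] .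
      then have "(LINT x|lebesgue. norm (indicator cubeQ x *\<^sub>R (f i x - f j x))) \<le> e/2" using e by (subst (asm) ennreal_le_iff) auto
      then show ?thesis using e unfolding s_def scaleR_right_diff_distrib[symmetric] by linarith
    qed
    then show "\<exists>N. \<forall>i\<ge>N. \<forall>j\<ge>N. LINT x|lebesgue. norm (s i x - s j x) < e" by blast
  qed blast
  define u where "u x = lim (\<lambda>i. s (r i) x)" for x
  have um: "u \<in> borel_measurable lebesgue"
    unfolding u_def by (rule borel_measurable_lim_metric) (rule sm)
  have ae: "AE x in lebesgue. x \<in> cubeQ \<longrightarrow> (\<lambda>i. f (r i) x) \<longlonglongrightarrow> u x"
    using r(2)
  proof eventually_elim
    case (elim x)
    then have "(\<lambda>i. s (r i) x) \<longlonglongrightarrow> u x" unfolding u_def by (simp add: Cauchy_convergent_iff convergent_LIMSEQ_iff)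
    then show ?case by (auto simp: s_def)
  qed
  have conv: "\<exists>N. \<forall>i\<ge>N. EQ (\<lambda>x. (f i x - u x)\<^sup>2) \<le> ennreal e" if e: "e > 0" for e
  proof -
    obtain N where N: "\<forall>i\<ge>N. \<forall>j\<ge>N. EQ (\<lambda>x. (f i x - f j x)\<^sup>2) \<le> ennreal e" using cauchy[OF e] by blast
    have "EQ (\<lambda>x. (f i x - u x)\<^sup>2) \<le> ennreal e" if i: "i \<ge> N" for i
    proof -
      have "EQ (\<lambda>x. (s i x - u x)\<^sup>2) \<le> ennreal e"
      \<comment> \<open>The shift by N puts \<open>r (n + N)\<close> beyond N, so that the Cauchy
        bound holds for every n. \<open>s\<close> is used because \<open>f\<close> is known to be
        measurable only on the cube.\<close>
      proof (rule EQ_fatou[where f="\<lambda>n x. (s i x - s (r (n + N)) x)\<^sup>2" and c="\<lambda>_. ennreal e"])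
        show "(\<lambda>x. (s i x - s (r (n + N)) x)\<^sup>2) \<in> borel_measurable lebesgue" for n
          by (intro borel_measurable_power borel_measurable_diff sm)
        show "AE x in lebesgue. x \<in> cubeQ \<longrightarrow> (\<lambda>n. (s i x - s (r (n + N)) x)\<^sup>2) \<longlonglongrightarrow> (s i x - u x)\<^sup>2"
          using ae
        proof eventually_elim
          case (elim x)
          show ?case
          proof
            assume x: "x \<in> cubeQ"
            then have "(\<lambda>n. f (r n) x) \<longlonglongrightarrow> u x" using elim by simp
            then have "(\<lambda>n. f (r (n + N)) x) \<longlonglongrightarrow> u x" by (rule LIMSEQ_ignore_initial_segment)
            then show "(\<lambda>n. (s i x - s (r (n + N)) x)\<^sup>2) \<longlonglongrightarrow> (s i x - u x)\<^sup>2"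
              using x by (auto simp: s_def intro!: tendsto_intros)
          qed
        qed
        fix n
        have "r (n + N) \<ge> N" using seq_suble[OF r(1), of "n + N"] by simp
        then have "EQ (\<lambda>x. (f i x - f (r (n + N)) x)\<^sup>2) \<le> ennreal e" using N i by blast
        moreover have "EQ (\<lambda>x. (s i x - s (r (n + N)) x)\<^sup>2) = EQ (\<lambda>x. (f i x - f (r (n + N)) x)\<^sup>2)"
          by (rule EQ_cong) (simp add: s_def)
        ultimately show "EQ (\<lambda>x. (s i x - s (r (n + N)) x)\<^sup>2) \<le> ennreal e" by simp
      qed simp
      moreover have "EQ (\<lambda>x. (s i x - u x)\<^sup>2) = EQ (\<lambda>x. (f i x - u x)\<^sup>2)"
        by (rule EQ_cong) (simp add: s_def)
      ultimately show ?thesis by simp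
    qed
    then show ?thesis by blast
  qed
  have uQ: "mQ u" by (rule mQ_measurable[OF um])
  have ufin: "EQ (\<lambda>x. (u x)\<^sup>2) < \<infinity>"
  proof -
    obtain N where N: "EQ (\<lambda>x. (f N x - u x)\<^sup>2) \<le> ennreal 1" using conv[of 1] by auto
    have "EQ (\<lambda>x. (u x)\<^sup>2) \<le> EQ (\<lambda>x. 2 * (f N x)\<^sup>2 + 2 * (f N x - u x)\<^sup>2)"
      by (rule EQ_mono) (use square_diff_le[of "f N x" "f N x - u x" for x] in simp)
    also have "\<dots> = 2 * EQ (\<lambda>x. (f N x)\<^sup>2) + 2 * EQ (\<lambda>x. (f N x - u x)\<^sup>2)"
      using m uQ by (subst EQ_add) (auto simp: EQ_cmult mQ_power2 mQ_diff intro!: mQ_cmult)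
    also have "\<dots> < \<infinity>" using fin[of N] N by (auto simp: ennreal_mult_less_top order_le_less_trans)
    finally show ?thesis .
  qed
  show thesis using that[of u] EQ_square_imp_integrable[OF uQ ufin] ufin conv by blast
qed

subsection \<open>Operations on Sobolev functions\<close>

lemma W11Q_mQ: "W11Q u g \<Longrightarrow> mQ u" "W11Q u g \<Longrightarrow> mQ (\<lambda>x. g x $ i)"
  unfolding W11Q_def using mQ_set_integrable by blast+

lemma W11Q_lincomb:
  assumes "W11Q u g" "W11Q v h"
  shows "W11Q (\<lambda>x. a * u x + b * v x) (\<lambda>x. a *\<^sub>R g x + b *\<^sub>R h x)"
  using assms unfolding W11Q_def
  by (auto intro!: weak_gradient_lincomb set_integral_add(1) set_integrable_mult_right)

lemma W11Q_const: "W11Q (\<lambda>x. c) (\<lambda>x. 0)"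
  unfolding W11Q_def using weak_gradient_const by (auto intro!: set_integrable_IQ)

lemma W11Q_diag:
  fixes u :: "real^'n::finite \<Rightarrow> real" and l :: real
  assumes W: "W11Q u g" and l: "l > 0" and T: "diag (\<lambda>_. l) t ` cubeQ \<subseteq> cubeQ" "diag (\<lambda>_. l) t ` box 0 1 \<subseteq> box 0 1"
  shows "W11Q (\<lambda>x. u (diag (\<lambda>_. l) t x)) (\<lambda>x. l *\<^sub>R g (diag (\<lambda>_. l) t x))"
proof -
  have si: "set_integrable lebesgue cubeQ (\<lambda>x. f (diag (\<lambda>_. l) t x))" if f: "set_integrable lebesgue cubeQ f" for f :: "real^'n \<Rightarrow> real"
  proof -
    have "integrable lebesgue (\<lambda>x. indicator cubeQ (diag (\<lambda>_. l) t x) *\<^sub>R f (diag (\<lambda>_. l) t x))"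
      using integrable_diag[where m="\<lambda>_. l" and t=t, OF _ f[unfolded set_integrable_def]] l by simp
    then have "integrable lebesgue (\<lambda>x. indicator cubeQ x *\<^sub>R (indicator cubeQ (diag (\<lambda>_. l) t x) *\<^sub>R f (diag (\<lambda>_. l) t x)))"
      by (rule integrable_mult_indicator[OF lebesgue_cubeQ])
    moreover have "(\<lambda>x. indicator cubeQ x *\<^sub>R (indicator cubeQ (diag (\<lambda>_. l) t x) *\<^sub>R f (diag (\<lambda>_. l) t x))) = (\<lambda>x. indicator cubeQ x *\<^sub>R f (diag (\<lambda>_. l) t x))"
      using T(1) by (auto simp: indicator_def fun_eq_iff)
    ultimately show ?thesis unfolding set_integrable_def by (simp only:)
  qed
  have "weak_gradient (box 0 1) (\<lambda>x. u (diag (\<lambda>_. l) t x)) (\<lambda>x. \<chi> i. l * g (diag (\<lambda>_. l) t x) $ i)"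
    using W l T(2) unfolding W11Q_def interior_cubeQ by (intro weak_gradient_diag[where S="box 0 1"]) auto
  moreover have "(\<lambda>x. \<chi> i. l * g (diag (\<lambda>_. l) t x) $ i) = (\<lambda>x. l *\<^sub>R g (diag (\<lambda>_. l) t x))"
    by (auto simp: fun_eq_iff vec_eq_iff)
  ultimately show ?thesis
    using W si unfolding W11Q_def interior_cubeQ by (auto intro!: set_integrable_mult_right)
qed

lemma test_integral_limit:
  fixes f :: "nat \<Rightarrow> real^'n::finite \<Rightarrow> real"
  assumes f: "\<And>n. set_integrable lebesgue cubeQ (f n)" "set_integrable lebesgue cubeQ u"
    and conv: "\<And>e. e > 0 \<Longrightarrow> \<exists>N. \<forall>i\<ge>N. EQ (\<lambda>x. (f i x - u x)\<^sup>2) \<le> ennreal e"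
    and \<psi>: "continuous_on UNIV \<psi>" "\<And>x. x \<notin> cubeQ \<Longrightarrow> \<psi> x = 0"
  shows "(\<lambda>n. \<integral>x. f n x * \<psi> x \<partial>lebesgue) \<longlonglongrightarrow> (\<integral>x. u x * \<psi> x \<partial>lebesgue)"
proof -
  obtain M where M: "M \<ge> 0" "\<And>x. norm (\<psi> x) \<le> M"
    using continuous_compact_support_bounded[OF \<psi> compact_cubeQ] by metis
  have int: "integrable lebesgue (\<lambda>x. h x * \<psi> x)" if "set_integrable lebesgue cubeQ h" for h
    by (rule integrable_times_test[OF that \<psi> compact_cubeQ])
  show ?thesis
  proof (rule LIMSEQ_I)
    fix e :: real assume e: "e > 0"
    \<comment> \<open>The 1 avoids division by 0, and M e / (2 (M + 1)) stays below e.\<close>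
    define e' where "e' = (e / (2 * (M + 1)))\<^sup>2"
    have e': "e' > 0" "sqrt e' = e / (2 * (M + 1))" using e M by (auto simp: e'_def)
    obtain N where N: "\<forall>i\<ge>N. EQ (\<lambda>x. (f i x - u x)\<^sup>2) \<le> ennreal e'" using conv[OF e'(1)] by blast
    have "norm ((\<integral>x. f n x * \<psi> x \<partial>lebesgue) - (\<integral>x. u x * \<psi> x \<partial>lebesgue)) < e" if n: "n \<ge> N" for n
    proof -
      have sd: "set_integrable lebesgue cubeQ (\<lambda>x. f n x - u x)" using f by (intro set_integral_diff)
      have "EQ (\<lambda>x. \<bar>f n x - u x\<bar>) \<le> ennreal (e / (2 * (M + 1)))"
        using EQ_abs_le[OF mQ_set_integrable[OF sd], of e'] N n e' by auto
      then have l1: "(LINT x|lebesgue. norm (indicator cubeQ x *\<^sub>R (f n x - u x))) \<le> e / (2 * (M + 1))"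
        unfolding EQ_abs_eq[OF sd] using e M by (subst (asm) ennreal_le_iff) auto
      have "norm ((\<integral>x. f n x * \<psi> x \<partial>lebesgue) - (\<integral>x. u x * \<psi> x \<partial>lebesgue)) = norm (\<integral>x. (f n x - u x) * \<psi> x \<partial>lebesgue)"
        using int[OF f(1)[of n]] int[OF f(2)] by (simp add: left_diff_distrib)
      also have "\<dots> \<le> (\<integral>x. norm ((f n x - u x) * \<psi> x) \<partial>lebesgue)" by (rule integral_norm_bound)
      also have "\<dots> \<le> (\<integral>x. M * norm (indicator cubeQ x *\<^sub>R (f n x - u x)) \<partial>lebesgue)"
      proof (rule integral_mono)
        show "integrable lebesgue (\<lambda>x. norm ((f n x - u x) * \<psi> x))" using int[OF sd] by (rule integrable_norm)
        show "integrable lebesgue (\<lambda>x. M * norm (indicator cubeQ x *\<^sub>R (f n x - u x)))"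
          using sd unfolding set_integrable_def by (intro integrable_mult_right integrable_norm) auto
        show "norm ((f n x - u x) * \<psi> x) \<le> M * norm (indicator cubeQ x *\<^sub>R (f n x - u x))" for x
          using M(2)[of x] \<psi>(2)[of x] by (cases "x \<in> cubeQ") (auto simp: abs_mult mult.commute[of M] intro!: mult_left_mono)
      qed
      also have "\<dots> = M * (\<integral>x. norm (indicator cubeQ x *\<^sub>R (f n x - u x)) \<partial>lebesgue)" by simp
      also have "\<dots> \<le> M * (e / (2 * (M + 1)))" using l1 M by (intro mult_left_mono)
      also have "\<dots> < e"
      proof -
        have "0 < M * e + e * 2" using e M by (simp add: add_nonneg_pos)
        then show ?thesis using e M by (simp add: field_simps)
      qed
      finally show ?thesis .
    qed
    then show "\<exists>N. \<forall>n\<ge>N. norm ((\<integral>x. f n x * \<psi> x \<partial>lebesgue) - (\<integral>x. u x * \<psi> x \<partial>lebesgue)) < e" by blast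
  qed
qed

text \<open>Both sides of the integration by parts are continuous under mean-square convergence,
  because test functions and their partials are bounded.\<close>

lemma W11Q_closed:
  fixes v :: "nat \<Rightarrow> real^'n::finite \<Rightarrow> real"
  assumes W: "\<And>n. W11Q (v n) (h n)" and s: "set_integrable lebesgue cubeQ u" "\<And>i. set_integrable lebesgue cubeQ (\<lambda>x. g x $ i)"
    and cv: "\<And>e. e > 0 \<Longrightarrow> \<exists>N. \<forall>n\<ge>N. EQ (\<lambda>x. (v n x - u x)\<^sup>2) \<le> ennreal e"
    and cg: "\<And>e i. e > 0 \<Longrightarrow> \<exists>N. \<forall>n\<ge>N. EQ (\<lambda>x. (h n x $ i - g x $ i)\<^sup>2) \<le> ennreal e"
  shows "W11Q u g"
proof -
  have box_sub: "box 0 1 \<subseteq> (cubeQ :: (real^'n) set)" by (simp add: cubeQ_def box_subset_cbox)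
  have Ws: "set_integrable lebesgue cubeQ (v n)" "set_integrable lebesgue cubeQ (\<lambda>x. h n x $ i)" "weak_gradient (box 0 1) (v n) (h n)" for n i
    using W[of n] by (auto simp: W11Q_def interior_cubeQ)
  have "weak_gradient (box 0 1) u g"
    unfolding weak_gradient_iff
  proof (intro conjI allI impI ballI)
    fix K :: "(real^'n) set" assume K: "compact K \<and> K \<subseteq> box 0 1"
    then have Km: "K \<in> sets lebesgue" "K \<subseteq> cubeQ" using lmeasurable_compact box_sub by blast+
    show "set_integrable lebesgue K u" by (rule set_integrable_subset[OF s(1) Km])
    show "set_integrable lebesgue K (\<lambda>x. g x $ i)" for i by (rule set_integrable_subset[OF s(2) Km])
  next
    fix \<phi> i assume \<phi>: "\<phi> \<in> test_funs (box 0 (1::real^'n))"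
    note T = test_funsD[OF \<phi>]
    have z: "\<phi> x = 0" "partial_deriv i \<phi> x = 0" if "x \<notin> cubeQ" for x
      using T(3,4,5) box_sub that by blast+
    have l1: "(\<lambda>n. \<integral>x. v n x * partial_deriv i \<phi> x \<partial>lebesgue) \<longlonglongrightarrow> (\<integral>x. u x * partial_deriv i \<phi> x \<partial>lebesgue)"
      by (rule test_integral_limit[OF Ws(1) s(1) cv T(7) z(2)])
    have l2: "(\<lambda>n. - (\<integral>x. h n x $ i * \<phi> x \<partial>lebesgue)) \<longlonglongrightarrow> - (\<integral>x. g x $ i * \<phi> x \<partial>lebesgue)"
      by (rule tendsto_minus[OF test_integral_limit[OF Ws(2) s(2) cg T(6) z(1)]])
    have "(\<integral>x. v n x * partial_deriv i \<phi> x \<partial>lebesgue) = - (\<integral>x. h n x $ i * \<phi> x \<partial>lebesgue)" for n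
      using Ws(3)[of n] \<phi> unfolding weak_gradient_iff by blast
    then show "(\<integral>x. u x * partial_deriv i \<phi> x \<partial>lebesgue) = - (\<integral>x. g x $ i * \<phi> x \<partial>lebesgue)"
      using LIMSEQ_unique[OF l1] l2 by simp
  qed
  then show ?thesis using s by (simp add: W11Q_def interior_cubeQ)
qed

subsection \<open>Lower semicontinuity of the Dirichlet integral\<close>

lemma parallelogram_square:
  fixes a b :: "'a::real_inner"
  shows "(norm (a - b))\<^sup>2 + 4 * (norm ((1/2) *\<^sub>R a + (1/2) *\<^sub>R b))\<^sup>2 = 2 * (norm a)\<^sup>2 + 2 * (norm b)\<^sup>2"
  by (simp add: power2_norm_eq_inner inner_diff_left inner_diff_right inner_add_left inner_add_right inner_commute)

text \<open>Consider the infimum of the Dirichlet integral over the functions closer and closer to u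
  in mean square. Near-minimizers have a midpoint that is as close to u and therefore has nearly the
  same energy, so the parallelogram law forces their gradients to be Cauchy. The limit of the
  gradients is a weak gradient of u, with energy at most a.\<close>

lemma dirichlet_lsc:
  fixes u :: "real^'n::finite \<Rightarrow> real"
  assumes us: "set_integrable lebesgue cubeQ u" and a0: "a \<ge> 0"
    and app: "\<And>\<delta>. \<delta> > 0 \<Longrightarrow> \<exists>v h. W11Q v h \<and> EQ (\<lambda>x. (v x - u x)\<^sup>2) \<le> ennreal \<delta> \<and> EQ (\<lambda>x. (norm (h x))\<^sup>2) \<le> ennreal (a + \<delta>)"
  obtains g where "W11Q u g" "EQ (\<lambda>x. (norm (g x))\<^sup>2) \<le> ennreal a"
proof -
  \<comment> \<open>The finite energies of competitors at squared distance at most \<delta> from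
    u.\<close>
  define S where "S \<delta> = {e. \<exists>v h. W11Q v h \<and> EQ (\<lambda>x. (v x - u x)\<^sup>2) \<le> ennreal \<delta> \<and> EQ (\<lambda>x. (norm (h x))\<^sup>2) = ennreal e \<and> e \<ge> 0}" for \<delta>
  have S_ne: "\<exists>e\<in>S \<delta>. e \<le> a + \<delta>'" if dd: "0 < \<delta>'" "\<delta>' \<le> \<delta>" for \<delta> \<delta>'
  proof -
    obtain v h where vh: "W11Q v h" "EQ (\<lambda>x. (v x - u x)\<^sup>2) \<le> ennreal \<delta>'" "EQ (\<lambda>x. (norm (h x))\<^sup>2) \<le> ennreal (a + \<delta>')"
      using app[OF dd(1)] by blast
    obtain e where e: "e \<ge> 0" "EQ (\<lambda>x. (norm (h x))\<^sup>2) = ennreal e"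
      using vh(3) by (cases "EQ (\<lambda>x. (norm (h x))\<^sup>2)") (auto simp: top_unique)
    have "EQ (\<lambda>x. (v x - u x)\<^sup>2) \<le> ennreal \<delta>" using vh(2) dd(2) by (meson ennreal_leI order_trans)
    then have "e \<in> S \<delta>" unfolding S_def using vh(1) e by blast
    moreover have "e \<le> a + \<delta>'" using vh(3) e a0 dd(1) by (simp add: ennreal_le_iff del: ennreal_plus)
    ultimately show ?thesis by blast
  qed
  have S_bdd: "bdd_below (S \<delta>)" for \<delta> by (rule bdd_belowI[of _ 0]) (auto simp: S_def)
  have S_mono: "S \<delta>' \<subseteq> S \<delta>" if "\<delta>' \<le> \<delta>" for \<delta> \<delta>'
    unfolding S_def using order_trans[OF _ ennreal_leI[OF that]] by blast
  define D where "D n = 1 / (real n + 1)" for n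
  have D0: "D n > 0" for n by (simp add: D_def)
  have Dmono: "D k \<le> D n" if "n \<le> k" for n k unfolding D_def using that by (intro divide_left_mono) auto
  have Dlim: "D \<longlonglongrightarrow> 0" unfolding D_def by real_asymp
  \<comment> \<open>The sets shrink with \<open>D n\<close>, so \<mu> increases; it is bounded by a
    and therefore Cauchy.\<close>
  define \<mu> where "\<mu> n = Inf (S (D n))" for n
  have ne: "S (D n) \<noteq> {}" for n using S_ne[of "D n" "D n"] D0[of n] by auto
  have \<mu>_le: "\<mu> n \<le> a" for n
  proof (rule field_le_epsilon)
    fix e :: real assume e: "e > 0"
    obtain x where "x \<in> S (D n)" "x \<le> a + min e (D n)" using S_ne[of "min e (D n)" "D n"] e D0[of n] by auto
    then show "\<mu> n \<le> a + e" unfolding \<mu>_def using cInf_lower[OF _ S_bdd, of x "D n"] by linarith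
  qed
  have \<mu>_mono: "\<mu> n \<le> \<mu> k" if "n \<le> k" for n k
    unfolding \<mu>_def by (rule cInf_superset_mono[OF ne S_bdd S_mono[OF Dmono[OF that]]])
  obtain L where "\<mu> \<longlonglongrightarrow> L"
    by (rule incseq_convergent[of \<mu> a]) (use \<mu>_le \<mu>_mono in \<open>auto simp: incseq_def\<close>)
  then have Cau: "Cauchy \<mu>" by (rule LIMSEQ_imp_Cauchy)
  define P where "P n w e \<longleftrightarrow> W11Q (fst w) (snd w) \<and> EQ (\<lambda>x. (fst w x - u x)\<^sup>2) \<le> ennreal (D n) \<and>
     EQ (\<lambda>x. (norm (snd w x))\<^sup>2) = ennreal e \<and> e \<ge> 0 \<and> e < \<mu> n + D n" for n and w :: "(real^'n \<Rightarrow> real) \<times> (real^'n \<Rightarrow> real^'n)" and e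
  have "\<exists>w e. P n w e" for n
  proof -
    have "\<mu> n < \<mu> n + D n" using D0[of n] by simp
    then obtain e where e: "e \<in> S (D n)" "e < \<mu> n + D n" unfolding \<mu>_def using cInf_lessD[OF ne[of n]] by blast
    then obtain v h where "W11Q v h" "EQ (\<lambda>x. (v x - u x)\<^sup>2) \<le> ennreal (D n)" "EQ (\<lambda>x. (norm (h x))\<^sup>2) = ennreal e" "e \<ge> 0"
      unfolding S_def by blast
    then have "P n (v, h) e" using e by (simp add: P_def)
    then show ?thesis by blast
  qed
  then obtain w E where wE: "\<And>n. P n (w n) (E n)" by metis
  define v h where "v n = fst (w n)" and "h n = snd (w n)" for n
  have W: "W11Q (v n) (h n)" and vu: "EQ (\<lambda>x. (v n x - u x)\<^sup>2) \<le> ennreal (D n)"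
    and hE: "EQ (\<lambda>x. (norm (h n x))\<^sup>2) = ennreal (E n)" and E: "E n \<ge> 0" "E n < \<mu> n + D n" for n
    using wE[of n] unfolding P_def v_def h_def by auto
  note mv = W11Q_mQ(1)[OF W] and mh = W11Q_mQ(2)[OF W]
  have mu: "mQ u" by (rule mQ_set_integrable[OF us])
  have mhn: "mQ (\<lambda>x. (norm (h n x))\<^sup>2)" for n by (rule mQ_norm_power2[OF mh])
  \<comment> \<open>Both functions lie within \<open>D n\<close> of u, hence so does their midpoint
    by convexity, and its energy is at least \<open>\<mu> n\<close>. Subtracting four times this
    from 2 E_n + 2 E_k bounds the energy of the difference.\<close>
  have diff: "EQ (\<lambda>x. (norm (h n x - h k x))\<^sup>2) \<le> ennreal (2 * (\<mu> k - \<mu> n) + 2 * D n + 2 * D k)" if nk: "n \<le> k" for n k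
  proof -
    define vm where "vm x = (1/2) * v n x + (1/2) * v k x" for x
    define hm where "hm x = (1/2) *\<^sub>R h n x + (1/2) *\<^sub>R h k x" for x
    have Wm: "W11Q vm hm" unfolding vm_def hm_def by (rule W11Q_lincomb[OF W W])
    have mhm: "mQ (\<lambda>x. (norm (hm x))\<^sup>2)" by (rule mQ_norm_power2[OF W11Q_mQ(2)[OF Wm]])
    have mhd: "mQ (\<lambda>x. (norm (h n x - h k x))\<^sup>2)"
      by (rule mQ_norm_power2) (use mQ_diff[OF mh mh] in simp)
    have "EQ (\<lambda>x. (vm x - u x)\<^sup>2) \<le> EQ (\<lambda>x. 1/2 * (v n x - u x)\<^sup>2 + 1/2 * (v k x - u x)\<^sup>2)"
    proof (rule EQ_mono)
      fix x
      have "(vm x - u x)\<^sup>2 = (1/4) * ((v n x - u x) + (v k x - u x))\<^sup>2" by (simp add: vm_def power2_eq_square field_simps)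
      also have "\<dots> \<le> (1/4) * (2 * (v n x - u x)\<^sup>2 + 2 * (v k x - u x)\<^sup>2)" by (intro mult_left_mono square_add_le) auto
      finally show "(vm x - u x)\<^sup>2 \<le> 1/2 * (v n x - u x)\<^sup>2 + 1/2 * (v k x - u x)\<^sup>2" by simp
    qed
    also have "\<dots> = EQ (\<lambda>x. 1/2 * (v n x - u x)\<^sup>2) + EQ (\<lambda>x. 1/2 * (v k x - u x)\<^sup>2)"
      by (intro EQ_add mQ_cmult mQ_power2 mQ_diff mv mu) auto
    also have "\<dots> = ennreal (1/2) * EQ (\<lambda>x. (v n x - u x)\<^sup>2) + ennreal (1/2) * EQ (\<lambda>x. (v k x - u x)\<^sup>2)"
      by (intro arg_cong2[where f="(+)"] EQ_cmult mQ_power2 mQ_diff mv mu) auto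
    also have "\<dots> \<le> ennreal (1/2) * ennreal (D n) + ennreal (1/2) * ennreal (D n)"
      using vu[of n] order_trans[OF vu[of k] ennreal_leI[OF Dmono[OF nk]]] by (intro add_mono mult_left_mono) auto
    also have "\<dots> = ennreal (D n)"
    proof -
      have "ennreal (1/2) * ennreal (D n) = ennreal (D n / 2)" using D0[of n] by (subst ennreal_mult[symmetric]) auto
      moreover have "ennreal (D n / 2) + ennreal (D n / 2) = ennreal (D n)" using D0[of n] by (subst ennreal_plus[symmetric]) auto
      ultimately show ?thesis by (simp only:)
    qed
    finally have vmu: "EQ (\<lambda>x. (vm x - u x)\<^sup>2) \<le> ennreal (D n)" .
    have sum: "EQ (\<lambda>x. (norm (h n x - h k x))\<^sup>2) + ennreal 4 * EQ (\<lambda>x. (norm (hm x))\<^sup>2) = ennreal (2 * E n + 2 * E k)"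
    proof -
      have "EQ (\<lambda>x. (norm (h n x - h k x))\<^sup>2) + ennreal 4 * EQ (\<lambda>x. (norm (hm x))\<^sup>2)
         = EQ (\<lambda>x. (norm (h n x - h k x))\<^sup>2 + 4 * (norm (hm x))\<^sup>2)"
        using mhm mhd by (subst EQ_add) (auto simp: EQ_cmult intro!: mQ_cmult)
      also have "\<dots> = EQ (\<lambda>x. 2 * (norm (h n x))\<^sup>2 + 2 * (norm (h k x))\<^sup>2)"
        unfolding hm_def parallelogram_square ..
      also have "\<dots> = EQ (\<lambda>x. 2 * (norm (h n x))\<^sup>2) + EQ (\<lambda>x. 2 * (norm (h k x))\<^sup>2)"
        by (intro EQ_add mQ_cmult mhn) auto
      also have "\<dots> = ennreal 2 * EQ (\<lambda>x. (norm (h n x))\<^sup>2) + ennreal 2 * EQ (\<lambda>x. (norm (h k x))\<^sup>2)"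
        by (intro arg_cong2[where f="(+)"] EQ_cmult mhn) auto
      also have "\<dots> = ennreal (2 * E n + 2 * E k)"
        unfolding hE using E(1)[of n] E(1)[of k] by (simp add: ennreal_mult ennreal_plus)
      finally show ?thesis .
    qed
    obtain y where y: "EQ (\<lambda>x. (norm (hm x))\<^sup>2) = ennreal y" "y \<ge> 0"
      using sum by (cases "EQ (\<lambda>x. (norm (hm x))\<^sup>2)") (auto simp: ennreal_mult_top)
    obtain z where z: "EQ (\<lambda>x. (norm (h n x - h k x))\<^sup>2) = ennreal z" "z \<ge> 0"
      using sum by (cases "EQ (\<lambda>x. (norm (h n x - h k x))\<^sup>2)") auto
    have "ennreal (z + 4 * y) = ennreal (2 * E n + 2 * E k)"
      using sum y z by (simp add: ennreal_mult ennreal_plus)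
    then have eq: "z + 4 * y = 2 * E n + 2 * E k"
      using y z E(1)[of n] E(1)[of k] by (subst (asm) ennreal_inj) auto
    have "y \<in> S (D n)" unfolding S_def using Wm vmu y by blast
    then have "\<mu> n \<le> y" unfolding \<mu>_def by (rule cInf_lower[OF _ S_bdd])
    then have "4 * \<mu> n \<le> 4 * y" by simp
    moreover have "2 * E n \<le> 2 * \<mu> n + 2 * D n" "2 * E k \<le> 2 * \<mu> k + 2 * D k"
      using E(2)[of n] E(2)[of k] by simp_all
    ultimately have "z \<le> 2 * (\<mu> k - \<mu> n) + 2 * D n + 2 * D k" using eq by (simp add: right_diff_distrib)
    then show ?thesis unfolding z(1) by (rule ennreal_leI)
  qed
  have hC: "\<exists>N. \<forall>i\<ge>N. \<forall>j\<ge>N. EQ (\<lambda>x. (norm (h i x - h j x))\<^sup>2) \<le> ennreal e" if e: "e > 0" for e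
  proof -
    obtain N1 where N1: "\<And>i j. i \<ge> N1 \<Longrightarrow> j \<ge> N1 \<Longrightarrow> dist (\<mu> i) (\<mu> j) < e / 6"
      using Cau e unfolding Cauchy_def by (metis divide_pos_pos zero_less_numeral)
    have "eventually (\<lambda>n. D n < e / 6) sequentially" using Dlim e by (intro order_tendstoD) auto
    then obtain N2 where N2: "\<And>n. n \<ge> N2 \<Longrightarrow> D n < e / 6" by (auto simp: eventually_sequentially)
    have le: "EQ (\<lambda>x. (norm (h i x - h j x))\<^sup>2) \<le> ennreal e" if "i \<ge> max N1 N2" "i \<le> j" for i j
    proof -
      have "2 * (\<mu> j - \<mu> i) + 2 * D i + 2 * D j \<le> e"
      proof -
        have "\<mu> j - \<mu> i \<le> \<bar>\<mu> j - \<mu> i\<bar>" by (rule abs_ge_self)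
        also have "\<dots> = dist (\<mu> i) (\<mu> j)" by (simp add: dist_real_def abs_minus_commute)
        also have "\<dots> \<le> e / 6" by (rule less_imp_le[OF N1]) (use that in auto)
        finally have "\<mu> j - \<mu> i \<le> e / 6" .
        moreover have "D i \<le> e / 6" "D j \<le> e / 6" using N2[of i] N2[of j] that by simp_all
        ultimately have "2 * (\<mu> j - \<mu> i) + 2 * D i + 2 * D j \<le> 2 * (e / 6) + 2 * (e / 6) + 2 * (e / 6)"
          by (intro add_mono mult_left_mono) auto
        then show ?thesis by simp
      qed
      then show ?thesis using diff[OF that(2)] by (meson ennreal_leI order_trans)
    qed
    have "EQ (\<lambda>x. (norm (h i x - h j x))\<^sup>2) \<le> ennreal e" if "i \<ge> max N1 N2" "j \<ge> max N1 N2" for i j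
      using le[of i j] le[of j i] that by (cases "i \<le> j") (auto simp: norm_minus_commute)
    then show ?thesis by blast
  qed
  have comp_le: "EQ (\<lambda>x. (f x $ i)\<^sup>2) \<le> EQ (\<lambda>x. (norm (f x))\<^sup>2)" for f :: "real^'n \<Rightarrow> real^'n" and i
    by (rule EQ_mono) (simp add: component_le_norm_cart power2_le_iff_abs_le)
  have "\<exists>gi. set_integrable lebesgue cubeQ gi \<and> (\<forall>e>0. \<exists>N. \<forall>n\<ge>N. EQ (\<lambda>x. (h n x $ i - gi x)\<^sup>2) \<le> ennreal e)" for i
  proof (rule L2_complete[of "\<lambda>n x. h n x $ i"])
    show "mQ (\<lambda>x. h n x $ i)" for n by (rule mh)
    show "EQ (\<lambda>x. (h n x $ i)\<^sup>2) < \<infinity>" for n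
      using comp_le[of "h n" i] hE[of n] by (simp add: order_le_less_trans)
    show "\<exists>N. \<forall>p\<ge>N. \<forall>q\<ge>N. EQ (\<lambda>x. (h p x $ i - h q x $ i)\<^sup>2) \<le> ennreal e" if e: "e > 0" for e
    proof -
      obtain N where N: "\<forall>p\<ge>N. \<forall>q\<ge>N. EQ (\<lambda>x. (norm (h p x - h q x))\<^sup>2) \<le> ennreal e" using hC[OF e] by blast
      have "EQ (\<lambda>x. (h p x $ i - h q x $ i)\<^sup>2) \<le> ennreal e" if "p \<ge> N" "q \<ge> N" for p q
        using order_trans[OF comp_le[of "\<lambda>x. h p x - h q x" i]] N that by simp
      then show ?thesis by blast
    qed
  qed blast
  then have "\<forall>i. \<exists>gi. set_integrable lebesgue cubeQ gi \<and> (\<forall>e>0. \<exists>N. \<forall>n\<ge>N. EQ (\<lambda>x. (h n x $ i - gi x)\<^sup>2) \<le> ennreal e)" by blast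
  from choice[OF this] obtain gc where gcc: "\<forall>i. set_integrable lebesgue cubeQ (gc i) \<and> (\<forall>e>0. \<exists>N. \<forall>n\<ge>N. EQ (\<lambda>x. (h n x $ i - gc i x)\<^sup>2) \<le> ennreal e)"
    by blast
  have gc: "\<And>i. set_integrable lebesgue cubeQ (gc i)" "\<And>i e. e > 0 \<Longrightarrow> \<exists>N. \<forall>n\<ge>N. EQ (\<lambda>x. (h n x $ i - gc i x)\<^sup>2) \<le> ennreal e"
    using gcc by blast+
  define g where "g x = (\<chi> i. gc i x)" for x
  have gi: "g x $ i = gc i x" for x i by (simp add: g_def)
  have vconv: "\<exists>N. \<forall>n\<ge>N. EQ (\<lambda>x. (v n x - u x)\<^sup>2) \<le> ennreal e" if "e > 0" for e
  proof -
    have "eventually (\<lambda>n. D n < e) sequentially" using Dlim that by (intro order_tendstoD) auto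
    then obtain N where "\<And>n. n \<ge> N \<Longrightarrow> D n < e" by (auto simp: eventually_sequentially)
    then have "\<And>n. n \<ge> N \<Longrightarrow> EQ (\<lambda>x. (v n x - u x)\<^sup>2) \<le> ennreal e"
      using vu by (meson ennreal_leI less_imp_le order_trans)
    then show ?thesis by blast
  qed
  have Wg: "W11Q u g"
    by (rule W11Q_closed[OF W us _ vconv]) (use gc in \<open>simp_all add: gi\<close>)
  have mg: "mQ (\<lambda>x. g x $ i)" for i using mQ_set_integrable[OF gc(1)] by (simp add: gi)
  have gconv: "\<exists>N. \<forall>n\<ge>N. EQ (\<lambda>x. (norm (g x - h n x))\<^sup>2) \<le> ennreal e" if e: "e > 0" for e
  proof -
    define e' where "e' = e / real CARD('n)"
    have e': "e' > 0" using e by (simp add: e'_def)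
    have "\<forall>\<^sub>F n in sequentially. \<forall>i\<in>(UNIV::'n set). EQ (\<lambda>x. (h n x $ i - gc i x)\<^sup>2) \<le> ennreal e'"
      using gc(2)[OF e'] by (subst eventually_ball_finite_distrib) (auto simp: eventually_sequentially)
    then obtain N where N: "\<And>n i. n \<ge> N \<Longrightarrow> EQ (\<lambda>x. (h n x $ i - gc i x)\<^sup>2) \<le> ennreal e'"
      by (auto simp: eventually_sequentially)
    have "EQ (\<lambda>x. (norm (g x - h n x))\<^sup>2) \<le> ennreal e" if n: "n \<ge> N" for n
    proof -
      have "EQ (\<lambda>x. (norm (g x - h n x))\<^sup>2) = EQ (\<lambda>x. \<Sum>i\<in>UNIV. (h n x $ i - gc i x)\<^sup>2)"
        by (simp add: norm_power2_vec gi power2_commute)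
      also have "\<dots> = (\<Sum>i\<in>UNIV. EQ (\<lambda>x. (h n x $ i - gc i x)\<^sup>2))"
        by (intro EQ_sum mQ_power2 mQ_diff mh mQ_set_integrable gc) auto
      also have "\<dots> \<le> (\<Sum>i\<in>(UNIV::'n set). ennreal e')" by (intro sum_mono N n)
      also have "\<dots> = ennreal e" using e by (simp add: e'_def ennreal_of_nat_eq_real_of_nat ennreal_mult[symmetric])
      finally show ?thesis .
    qed
    then show ?thesis by blast
  qed
  have "EQ (\<lambda>x. (norm (g x))\<^sup>2) \<le> ennreal a + ennreal \<eta>" if \<eta>: "\<eta> > 0" for \<eta>
  proof -
    \<comment> \<open>Three errors of size \<eta>/3: \<epsilon> times the energy, which is below a +
      1, the excess of \<open>E n\<close> over a, and the distance of the gradients weighted by 1 +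
      1/\<epsilon>.\<close>
    define \<epsilon> where "\<epsilon> = (\<eta> / 3) / (a + 1)"
    have "x / y * y = x" if "y > 0" for x y :: real using that by simp
    note cancel = this
    have \<epsilon>: "\<epsilon> > 0" "\<epsilon> * (a + 1) = \<eta> / 3"
      unfolding \<epsilon>_def using \<eta> a0 by (intro divide_pos_pos cancel; simp)+
    define e' where "e' = (\<eta> / 3) / (1 + 1 / \<epsilon>)"
    have p1: "1 + 1 / \<epsilon> > 0" using \<epsilon> by (simp add: add_pos_pos)
    have e': "e' > 0" "(1 + 1 / \<epsilon>) * e' = \<eta> / 3"
      unfolding e'_def mult.commute[of "1 + 1 / \<epsilon>"] using \<eta> p1 by (intro divide_pos_pos cancel; simp)+
    obtain N1 where N1: "\<And>n. n \<ge> N1 \<Longrightarrow> EQ (\<lambda>x. (norm (g x - h n x))\<^sup>2) \<le> ennreal e'" using gconv[OF e'(1)] by blast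
    have "eventually (\<lambda>n. D n < min 1 (\<eta> / 3)) sequentially" using Dlim \<eta> by (intro order_tendstoD) auto
    then obtain N2 where N2: "\<And>n. n \<ge> N2 \<Longrightarrow> D n < min 1 (\<eta> / 3)" by (auto simp: eventually_sequentially)
    define n where "n = max N1 N2"
    have mgd: "mQ (\<lambda>x. (norm (g x - h n x))\<^sup>2)" by (rule mQ_norm_power2) (use mQ_diff[OF mg mh] in simp)
    have "EQ (\<lambda>x. (norm (g x))\<^sup>2) \<le> EQ (\<lambda>x. (1 + \<epsilon>) * (norm (h n x))\<^sup>2 + (1 + 1 / \<epsilon>) * (norm (g x - h n x))\<^sup>2)"
      by (rule EQ_mono) (use norm_add_square_le[OF \<epsilon>(1), of "h n x" "g x - h n x" for x] in simp)
    also have "\<dots> = ennreal (1 + \<epsilon>) * EQ (\<lambda>x. (norm (h n x))\<^sup>2) + ennreal (1 + 1 / \<epsilon>) * EQ (\<lambda>x. (norm (g x - h n x))\<^sup>2)"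
      using \<epsilon> p1 mhn mgd by (subst EQ_add) (auto simp: EQ_cmult simp del: ennreal_plus intro!: mQ_cmult)
    also have "\<dots> \<le> ennreal (1 + \<epsilon>) * ennreal (E n) + ennreal (1 + 1 / \<epsilon>) * ennreal e'"
      unfolding hE using N1[of n] by (intro add_left_mono mult_left_mono) (auto simp: n_def)
    also have "\<dots> = ennreal ((1 + \<epsilon>) * E n + (1 + 1 / \<epsilon>) * e')"
      using \<epsilon> p1 e' E(1)[of n] by (simp add: ennreal_mult[symmetric] ennreal_plus[symmetric] del: ennreal_plus)
    also have "\<dots> \<le> ennreal (a + \<eta>)"
    proof (rule ennreal_leI)
      have "E n \<le> a + D n" using E(2)[of n] \<mu>_le[of n] by linarith
      moreover have "D n < 1" "D n < \<eta> / 3" using N2[of n] by (auto simp: n_def)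
      ultimately have "E n \<le> a + \<eta> / 3" "\<epsilon> * E n \<le> \<epsilon> * (a + 1)" using \<epsilon> by (auto intro!: mult_left_mono)
      then show "(1 + \<epsilon>) * E n + (1 + 1 / \<epsilon>) * e' \<le> a + \<eta>" using \<epsilon>(2) e'(2) by (simp add: distrib_right)
    qed
    also have "\<dots> = ennreal a + ennreal \<eta>" using a0 \<eta> by (simp add: ennreal_plus)
    finally show ?thesis .
  qed
  then have "EQ (\<lambda>x. (norm (g x))\<^sup>2) \<le> ennreal a" by (rule ennreal_le_epsilon)
  then show thesis using that Wg by blast
qed

subsection \<open>Compactness\<close>

definition cells :: "nat \<Rightarrow> ('n::finite \<Rightarrow> nat) set" where
  "cells N = {k. \<forall>i. k i < N}"

lemma finite_cells: "finite (cells N :: ('n::finite \<Rightarrow> nat) set)"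
proof -
  have "(cells N :: ('n \<Rightarrow> nat) set) = PiE UNIV (\<lambda>_. {..<N})" by (auto simp: cells_def PiE_def)
  then show ?thesis by (simp add: finite_PiE)
qed

definition cellmap :: "nat \<Rightarrow> ('n \<Rightarrow> nat) \<Rightarrow> real^'n::finite \<Rightarrow> real^'n" where
  "cellmap N k = diag (\<lambda>_. 1 / real N) (\<chi> i. real (k i) / real N)"

lemma cellmap_nth: "cellmap N k x $ i = (real (k i) + x $ i) / real N"
  by (simp add: cellmap_def add_divide_distrib)

lemma cellmap_subset:
  fixes k :: "'n::finite \<Rightarrow> nat"
  assumes "k \<in> cells N"
  shows "cellmap N k ` cubeQ \<subseteq> cubeQ" "cellmap N k ` box 0 1 \<subseteq> box 0 1"
proof -
  have k: "real (k i) + 1 \<le> real N" for i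
  proof -
    have "k i + 1 \<le> N" using assms by (simp add: cells_def Suc_le_eq)
    then have "real (k i + 1) \<le> real N" by (rule of_nat_mono)
    then show ?thesis by simp
  qed
  have N: "real N > 0" using k[of undefined] by linarith
  show "cellmap N k ` cubeQ \<subseteq> cubeQ"
  proof safe
    fix x :: "real^'n" assume x: "x \<in> cubeQ"
    have "0 \<le> (real (k i) + x $ i) / real N \<and> (real (k i) + x $ i) / real N \<le> 1" for i
      using k[of i] N x[unfolded mem_cubeQ, rule_format, of i] by (auto simp: divide_le_eq)
    then show "cellmap N k x \<in> cubeQ" by (simp add: mem_cubeQ cellmap_nth)
  qed
  show "cellmap N k ` box 0 1 \<subseteq> box 0 1"
  proof safe
    fix x :: "real^'n" assume x: "x \<in> box 0 1"
    have "0 < (real (k i) + x $ i) / real N \<and> (real (k i) + x $ i) / real N < 1" for i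
    proof -
      have "0 < x $ i" "x $ i < 1" using x by (auto simp: mem_box_cart)
      then show ?thesis using k[of i] N by (auto simp: divide_less_eq)
    qed
    then show "cellmap N k x \<in> box 0 1" by (simp add: mem_box_cart cellmap_nth)
  qed
qed

lemma W11Q_cell:
  assumes "W11Q u g" "k \<in> cells N" "N > 0"
  shows "W11Q (\<lambda>x. u (cellmap N k x)) (\<lambda>x. (1 / real N) *\<^sub>R g (cellmap N k x))"
  using cellmap_subset[OF assms(2)] assms(1,3) unfolding cellmap_def by (intro W11Q_diag) auto

text \<open>The half-open subcubes of side 1/N partition the cube apart from the null set where some
  coordinate equals 1; the integer part of N x_i selects the cell. The weight is the volume of a
  cell.\<close>

lemma EQ_cells:
  fixes f :: "real^'n::finite \<Rightarrow> real"
  assumes m: "mQ f" and N: "N > 0"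
  shows "EQ f = (\<Sum>k\<in>cells N. ennreal ((1 / real N) ^ CARD('n)) * EQ (\<lambda>x. f (cellmap N k x)))"
proof -
  define F where "F x = ennreal (f x) * indicator cubeQ x" for x
  have Fm[measurable]: "F \<in> borel_measurable lebesgue" unfolding F_def by (rule mQ_ennreal[OF m])
  define c where "c k = {x::real^'n. \<forall>i. real (k i) / real N \<le> x $ i \<and> x $ i < (real (k i) + 1) / real N}" for k
  have "c k \<in> sets borel" for k
  proof -
    have eq: "c k = (\<Inter>i\<in>UNIV. {x. real (k i) / real N \<le> x $ i} \<inter> {x. x $ i < (real (k i) + 1) / real N})" by (auto simp: c_def)
    show ?thesis unfolding eq
      by (intro sets.finite_INT sets.Int borel_closed borel_open closed_halfspace_component_ge_cart open_halfspace_component_lt_cart) auto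
  qed
  then have cm[measurable]: "c k \<in> sets lebesgue" for k by (simp add: sets_completionI_sets)
  have N': "real N > 0" using N by simp
  have "EQ f = (\<integral>\<^sup>+x. (\<Sum>k\<in>cells N. F x * indicator (c k) x) \<partial>lebesgue)"
    unfolding EQ_def F_def[symmetric]
  proof (rule nn_integral_cong_AE)
    show "AE x in lebesgue. F x = (\<Sum>k\<in>cells N. F x * indicator (c k) x)"
      using AE_coordinate_neq[of 1]
    proof eventually_elim
      case (elim x)
      show ?case
      proof (cases "x \<in> cubeQ")
        case True
        have x: "0 \<le> x $ i" "x $ i < 1" for i using True elim by (auto simp: mem_cubeQ less_le)
        define k0 where "k0 i = nat \<lfloor>real N * x $ i\<rfloor>" for i
        have fl: "0 \<le> \<lfloor>real N * x $ i\<rfloor>" for i using x(1)[of i] by simp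
        have "x \<in> c k \<longleftrightarrow> k = k0" for k
        proof -
          have "(real (k i) / real N \<le> x $ i \<and> x $ i < (real (k i) + 1) / real N) \<longleftrightarrow> \<lfloor>real N * x $ i\<rfloor> = int (k i)" for i
            using N' by (subst floor_eq_iff) (auto simp: field_simps)
          also have "(\<lfloor>real N * x $ i\<rfloor> = int (k i)) \<longleftrightarrow> k i = k0 i" for i using fl[of i] by (auto simp: k0_def)
          finally show ?thesis by (auto simp: c_def fun_eq_iff)
        qed
        then have ind: "indicator (c k) x = (if k = k0 then 1 else (0::ennreal))" for k by (simp add: indicator_def)
        have "k0 \<in> cells N"
        proof -
          have "k0 i < N" for i
          proof -
            have "real N * x $ i < real N * 1" using x(2)[of i] N' by (intro mult_strict_left_mono)
            then have "\<lfloor>real N * x $ i\<rfloor> < int N" by (simp add: floor_less_iff)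
            then show ?thesis using fl[of i] by (simp add: k0_def nat_less_iff)
          qed
          then show ?thesis by (simp add: cells_def)
        qed
        then show ?thesis by (simp add: finite_cells ind if_distrib[of "(*) (F x)"] cong: if_cong)
      qed (simp add: F_def)
    qed
  qed
  also have "\<dots> = (\<Sum>k\<in>cells N. (\<integral>\<^sup>+x. F x * indicator (c k) x \<partial>lebesgue))"
    by (rule nn_integral_sum) measurable
  also have "\<dots> = (\<Sum>k\<in>cells N. ennreal ((1 / real N) ^ CARD('n)) * EQ (\<lambda>x. f (cellmap N k x)))"
  proof (rule sum.cong[OF refl])
    fix k :: "'n \<Rightarrow> nat" assume k: "k \<in> cells N"
    have "(\<integral>\<^sup>+x. F x * indicator (c k) x \<partial>lebesgue) = ennreal (\<Prod>i\<in>(UNIV::'n set). \<bar>1 / real N\<bar>) * (\<integral>\<^sup>+x. F (cellmap N k x) * indicator (c k) (cellmap N k x) \<partial>lebesgue)"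
      unfolding cellmap_def using N' by (intro nn_integral_diag) (auto intro!: borel_measurable_times_ennreal borel_measurable_indicator)
    also have "(\<integral>\<^sup>+x. F (cellmap N k x) * indicator (c k) (cellmap N k x) \<partial>lebesgue) = EQ (\<lambda>x. f (cellmap N k x))"
      unfolding EQ_def
    proof (rule nn_integral_cong_AE)
      show "AE x in lebesgue. F (cellmap N k x) * indicator (c k) (cellmap N k x) = ennreal (f (cellmap N k x)) * indicator cubeQ x"
        using AE_coordinate_neq[of 1]
      proof eventually_elim
        case (elim x)
        have "cellmap N k x \<in> c k \<longleftrightarrow> (\<forall>i. 0 \<le> x $ i \<and> x $ i < 1)"
          using N' by (simp add: c_def cellmap_nth divide_le_cancel divide_less_cancel)
        also have "\<dots> \<longleftrightarrow> x \<in> cubeQ" using elim by (auto simp: mem_cubeQ less_le)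
        finally have iff: "cellmap N k x \<in> c k \<longleftrightarrow> x \<in> cubeQ" .
        show ?case
        proof (cases "x \<in> cubeQ")
          case True
          then have "cellmap N k x \<in> cubeQ" using cellmap_subset(1)[OF k] by blast
          then show ?thesis using iff True by (simp add: F_def)
        qed (use iff in simp)
      qed
    qed
    finally show "(\<integral>\<^sup>+x. F x * indicator (c k) x \<partial>lebesgue) = ennreal ((1 / real N) ^ CARD('n)) * EQ (\<lambda>x. f (cellmap N k x))"
      by simp
  qed
  finally show ?thesis .
qed

text \<open>On each cell the function is its mean plus an oscillation; the Poincare inequality,
  scaled to side 1/N, gains the factor 1/N^2 for the oscillation. The volume factor of the means, at
  most 1, is dropped.\<close>

lemma L2_cell_bound:
  fixes w :: "real^'n::finite \<Rightarrow> real"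
  assumes W: "W11Q w h" and fin: "EQ (\<lambda>x. (norm (h x))\<^sup>2) < \<infinity>" and N: "N > 0"
  shows "EQ (\<lambda>x. (w x)\<^sup>2) \<le> ennreal (2 * (real CARD('n) * 2 ^ CARD('n)) / (real N)\<^sup>2) * EQ (\<lambda>x. (norm (h x))\<^sup>2)
     + (\<Sum>k\<in>cells N. ennreal (2 * (IQ (\<lambda>x. w (cellmap N k x)))\<^sup>2))"
proof -
  define C where "C = real CARD('n) * 2 ^ CARD('n)"
  define l where "l = ennreal ((1 / real N) ^ CARD('n))"
  have C0: "C \<ge> 0" by (simp add: C_def)
  have N': "real N \<ge> 1" using N by simp
  have l1: "l \<le> 1" unfolding l_def using N' by (simp add: power_le_one)
  have l0: "l \<noteq> 0" unfolding l_def using N' by simp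
  have mw: "mQ w" by (rule W11Q_mQ(1)[OF W])
  have mh: "mQ (\<lambda>x. (norm (h x))\<^sup>2)" by (rule mQ_norm_power2[OF W11Q_mQ(2)[OF W]])
  have cell: "l * EQ (\<lambda>x. (w (cellmap N k x))\<^sup>2) \<le> ennreal (2 * C / (real N)\<^sup>2) * (l * EQ (\<lambda>x. (norm (h (cellmap N k x)))\<^sup>2)) + ennreal (2 * (IQ (\<lambda>x. w (cellmap N k x)))\<^sup>2)"
    if k: "k \<in> cells N" for k :: "'n \<Rightarrow> nat"
  proof -
    let ?w = "\<lambda>x. w (cellmap N k x)" and ?h = "\<lambda>x. (1 / real N) *\<^sub>R h (cellmap N k x)"
    have Wk: "W11Q ?w ?h" by (rule W11Q_cell[OF W k N])
    have mk: "mQ ?w" by (rule W11Q_mQ(1)[OF Wk])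
    have mhk: "mQ (\<lambda>x. (norm (h (cellmap N k x)))\<^sup>2)"
    proof -
      have "mQ (\<lambda>x. (real N)\<^sup>2 * (norm (?h x))\<^sup>2)" by (intro mQ_cmult mQ_norm_power2 W11Q_mQ(2)[OF Wk])
      then show ?thesis using N' by (simp add: power_divide)
    qed
    have hk: "EQ (\<lambda>x. (norm (?h x))\<^sup>2) = ennreal (1 / (real N)\<^sup>2) * EQ (\<lambda>x. (norm (h (cellmap N k x)))\<^sup>2)"
    proof -
      have "EQ (\<lambda>x. (norm (?h x))\<^sup>2) = EQ (\<lambda>x. 1 / (real N)\<^sup>2 * (norm (h (cellmap N k x)))\<^sup>2)"
        by (rule EQ_cong) (simp add: power_divide)
      also have "\<dots> = ennreal (1 / (real N)\<^sup>2) * EQ (\<lambda>x. (norm (h (cellmap N k x)))\<^sup>2)"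
        by (rule EQ_cmult[OF mhk]) simp
      finally show ?thesis .
    qed
    have lf: "l * EQ (\<lambda>x. (norm (h (cellmap N k x)))\<^sup>2) \<le> EQ (\<lambda>x. (norm (h x))\<^sup>2)"
      unfolding EQ_cells[OF mh N] l_def[symmetric]
      by (rule member_le_sum[OF k, where f="\<lambda>k. l * EQ (\<lambda>x. (norm (h (cellmap N k x)))\<^sup>2)"]) (auto simp: finite_cells)
    then have "l * EQ (\<lambda>x. (norm (h (cellmap N k x)))\<^sup>2) < \<infinity>" using fin by (rule order_le_less_trans)
    then have "EQ (\<lambda>x. (norm (h (cellmap N k x)))\<^sup>2) < \<infinity>" using l0 by (auto simp: ennreal_mult_less_top)
    then have finh: "EQ (\<lambda>x. (norm (?h x))\<^sup>2) < \<infinity>" unfolding hk by (simp add: ennreal_mult_less_top)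
    have P: "EQ (\<lambda>x. (?w x - IQ ?w)\<^sup>2) \<le> ennreal C * EQ (\<lambda>x. (norm (?h x))\<^sup>2)"
      unfolding C_def by (rule poincare[OF Wk finh])
    have "EQ (\<lambda>x. (?w x)\<^sup>2) = EQ (\<lambda>x. ((?w x - IQ ?w) + IQ ?w)\<^sup>2)" by simp
    also have "\<dots> \<le> 2 * EQ (\<lambda>x. (?w x - IQ ?w)\<^sup>2) + 2 * EQ (\<lambda>x::real^'n. (IQ ?w)\<^sup>2)"
      by (intro EQ_square_add_le mQ_diff mk mQ_const)
    also have "\<dots> \<le> 2 * (ennreal C * EQ (\<lambda>x. (norm (?h x))\<^sup>2)) + 2 * ennreal ((IQ ?w)\<^sup>2)"
      using P by (intro add_mono mult_left_mono) (auto simp: EQ_const)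
    also have "2 * (ennreal C * EQ (\<lambda>x. (norm (?h x))\<^sup>2)) = ennreal (2 * C / (real N)\<^sup>2) * EQ (\<lambda>x. (norm (h (cellmap N k x)))\<^sup>2)"
    proof -
      have "ennreal (2 * C / (real N)\<^sup>2) = ennreal 2 * ennreal C * ennreal (1 / (real N)\<^sup>2)"
        using C0 by (subst ennreal_mult[symmetric], simp, simp, subst ennreal_mult[symmetric]) auto
      then show ?thesis unfolding hk by (simp add: mult.assoc)
    qed
    also have "2 * ennreal ((IQ ?w)\<^sup>2) = ennreal (2 * (IQ ?w)\<^sup>2)" by (simp add: ennreal_mult')
    finally have "l * EQ (\<lambda>x. (?w x)\<^sup>2) \<le> l * (ennreal (2 * C / (real N)\<^sup>2) * EQ (\<lambda>x. (norm (h (cellmap N k x)))\<^sup>2) + ennreal (2 * (IQ ?w)\<^sup>2))"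
      by (rule mult_left_mono) simp
    also have "\<dots> = ennreal (2 * C / (real N)\<^sup>2) * (l * EQ (\<lambda>x. (norm (h (cellmap N k x)))\<^sup>2)) + l * ennreal (2 * (IQ ?w)\<^sup>2)"
      by (simp add: distrib_left mult.left_commute)
    also have "\<dots> \<le> ennreal (2 * C / (real N)\<^sup>2) * (l * EQ (\<lambda>x. (norm (h (cellmap N k x)))\<^sup>2)) + 1 * ennreal (2 * (IQ ?w)\<^sup>2)"
      using l1 by (intro add_left_mono mult_right_mono) auto
    finally show ?thesis by simp
  qed
  have "EQ (\<lambda>x. (w x)\<^sup>2) = (\<Sum>k\<in>cells N. l * EQ (\<lambda>x. (w (cellmap N k x))\<^sup>2))"
    unfolding l_def by (rule EQ_cells[OF mQ_power2[OF mw] N])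
  also have "\<dots> \<le> (\<Sum>k\<in>cells N. ennreal (2 * C / (real N)\<^sup>2) * (l * EQ (\<lambda>x. (norm (h (cellmap N k x)))\<^sup>2)) + ennreal (2 * (IQ (\<lambda>x. w (cellmap N k x)))\<^sup>2))"
    by (intro sum_mono cell)
  also have "\<dots> = ennreal (2 * C / (real N)\<^sup>2) * (\<Sum>k\<in>cells N. l * EQ (\<lambda>x. (norm (h (cellmap N k x)))\<^sup>2)) + (\<Sum>k\<in>cells N. ennreal (2 * (IQ (\<lambda>x. w (cellmap N k x)))\<^sup>2))"
    by (simp add: sum.distrib sum_distrib_left)
  also have "(\<Sum>k\<in>cells N. l * EQ (\<lambda>x. (norm (h (cellmap N k x)))\<^sup>2)) = EQ (\<lambda>x. (norm (h x))\<^sup>2)"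
    unfolding l_def by (rule EQ_cells[OF mh N, symmetric])
  finally show ?thesis by (simp add: C_def)
qed

text \<open>The oscillation inside cells of side 1/N is of order 1/N^2 uniformly in n, and the
  finitely many cell means are bounded. A diagonal sequence makes the cell means converge for all N
  at once.\<close>

lemma rellich:
  fixes u :: "nat \<Rightarrow> real^'n::finite \<Rightarrow> real"
  assumes W: "\<And>n. W11Q (u n) (g n)" and gM: "\<And>n. EQ (\<lambda>x. (norm (g n x))\<^sup>2) \<le> ennreal M"
    and uM: "\<And>n. EQ (\<lambda>x. (u n x)\<^sup>2) \<le> ennreal M" and M: "M > 0"
  obtains s :: "nat \<Rightarrow> nat" where "strict_mono s" "\<And>e. e > 0 \<Longrightarrow> \<exists>N. \<forall>i\<ge>N. \<forall>j\<ge>N. EQ (\<lambda>x. (u (s i) x - u (s j) x)\<^sup>2) \<le> ennreal e"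
proof -
  define c where "c N k n = IQ (\<lambda>x. u n (cellmap N k x))" for N :: nat and k :: "'n \<Rightarrow> nat" and n
  have cb: "\<exists>B. \<forall>n. \<bar>c N k n\<bar> \<le> B" if k: "k \<in> cells N" and N: "N > 0" for N k
  proof -
    \<comment> \<open>The square integral over one rescaled cell is at most N^d times that over the
      cube, and Cauchy-Schwarz bounds the mean by its root.\<close>
    define B where "B = real N ^ CARD('n) * M"
    have B: "B > 0" using N M by (simp add: B_def)
    have "\<bar>c N k n\<bar> \<le> sqrt B" for n
    proof -
      let ?w = "\<lambda>x. u n (cellmap N k x)"
      have Wk: "W11Q ?w (\<lambda>x. (1 / real N) *\<^sub>R g n (cellmap N k x))" by (rule W11Q_cell[OF W k N])
      define l where "l = ennreal ((1 / real N) ^ CARD('n))"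
      have "l * EQ (\<lambda>x. (?w x)\<^sup>2) \<le> EQ (\<lambda>x. (u n x)\<^sup>2)"
        unfolding EQ_cells[OF mQ_power2[OF W11Q_mQ(1)[OF W]] N] l_def[symmetric]
        by (rule member_le_sum[OF k, where f="\<lambda>k. l * EQ (\<lambda>x. (u n (cellmap N k x))\<^sup>2)"]) (auto simp: finite_cells)
      also have "\<dots> \<le> ennreal M" by (rule uM)
      finally have "ennreal (real N ^ CARD('n)) * (l * EQ (\<lambda>x. (?w x)\<^sup>2)) \<le> ennreal (real N ^ CARD('n)) * ennreal M"
        by (rule mult_left_mono) simp
      moreover have "ennreal (real N ^ CARD('n)) * l = 1"
        unfolding l_def using N by (subst ennreal_mult[symmetric]) (auto simp: power_mult_distrib[symmetric])
      ultimately have "EQ (\<lambda>x. (?w x)\<^sup>2) \<le> ennreal B"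
        using M by (simp add: B_def ennreal_mult mult.assoc[symmetric])
      from EQ_abs_le[OF W11Q_mQ(1)[OF Wk] this B]
      have "EQ (\<lambda>x. \<bar>?w x\<bar>) \<le> ennreal (sqrt B)" .
      moreover have "ennreal \<bar>c N k n\<bar> \<le> EQ (\<lambda>x. \<bar>?w x\<bar>)"
        using IQ_diff_le_EQ[of ?w "\<lambda>_. 0"] Wk by (simp add: W11Q_def c_def IQ_def)
      ultimately have "ennreal \<bar>c N k n\<bar> \<le> ennreal (sqrt B)" by (rule order_trans[rotated])
      then show ?thesis using B by (subst (asm) ennreal_le_iff) auto
    qed
    then show ?thesis by blast
  qed
  \<comment> \<open>A pair (N, k) is coded by one natural number for the diagonal argument; codes
    that name no cell get the value 0, a convergent sequence.\<close>
  define c' where "c' j n = (let (N, k) = from_nat j in if N > 0 \<and> k \<in> cells N then c N k n else 0)" for j n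
  have c'b: "\<exists>B. \<forall>n. \<bar>c' j n\<bar> \<le> B" for j
  proof -
    define N where "N = fst (from_nat j :: nat \<times> ('n \<Rightarrow> nat))"
    define k where "k = snd (from_nat j :: nat \<times> ('n \<Rightarrow> nat))"
    have Nk: "from_nat j = (N, k)" by (simp add: N_def k_def)
    show ?thesis using cb[of k N] by (cases "N > 0 \<and> k \<in> cells N") (auto simp: c'_def Nk)
  qed
  interpret subseqs "\<lambda>j s. convergent (\<lambda>n. c' j (s n))"
  proof
    fix j and s :: "nat \<Rightarrow> nat"
    obtain B where "\<forall>n. \<bar>c' j n\<bar> \<le> B" using c'b by blast
    then have "bounded (range (\<lambda>n. c' j (s n)))" by (auto simp: bounded_iff)
    then obtain L r where "strict_mono r" "((\<lambda>n. c' j (s n)) \<circ> r) \<longlonglongrightarrow> L"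
      using bounded_imp_convergent_subsequence by blast
    then show "\<exists>r'. strict_mono r' \<and> convergent (\<lambda>n. c' j ((s \<circ> r') n))"
      by (auto simp: convergent_def o_def)
  qed
  define s where "s = diagseq"
  have s: "strict_mono s" unfolding s_def by (rule subseq_diagseq)
  have conv: "convergent (\<lambda>n. c' j (s n))" for j
  proof -
    have "convergent (\<lambda>n. c' j ((diagseq \<circ> ((+) (Suc j))) n))"
    proof (rule diagseq_holds)
      fix r t :: "nat \<Rightarrow> nat" and n assume "strict_mono r" "convergent (\<lambda>m. c' n (t m))"
      then show "convergent (\<lambda>m. c' n ((t \<circ> r) m))"
        using convergent_subseq_convergent[of "\<lambda>m. c' n (t m)" r] by (simp add: o_def)
    qed
    then have "convergent (\<lambda>n. c' j (s (n + Suc j)))" by (simp add: s_def o_def add.commute)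
    then show ?thesis using convergent_ignore_initial_segment[of "\<lambda>n. c' j (s n)" "Suc j"] by simp
  qed
  have conv_c: "convergent (\<lambda>n. c N k (s n))" if "k \<in> cells N" "N > 0" for N k
    using conv[of "to_nat (N, k)"] that by (simp add: c'_def)
  have "\<exists>n0. \<forall>i\<ge>n0. \<forall>j\<ge>n0. EQ (\<lambda>x. (u (s i) x - u (s j) x)\<^sup>2) \<le> ennreal e" if e: "e > 0" for e
  proof -
    define C where "C = real CARD('n) * 2 ^ CARD('n)"
    have C: "C > 0" by (simp add: C_def)
    \<comment> \<open>4 M bounds the Dirichlet integral of a difference of two members of the
      sequence.\<close>
    have "(\<lambda>N. 2 * C / (real N)\<^sup>2 * (4 * M)) \<longlonglongrightarrow> 0" by real_asymp
    then have "eventually (\<lambda>N. 2 * C / (real N)\<^sup>2 * (4 * M) < e / 2) sequentially" using e by (intro order_tendstoD) auto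
    then have "eventually (\<lambda>N. 2 * C / (real N)\<^sup>2 * (4 * M) < e / 2 \<and> N > 0) sequentially"
      using eventually_gt_at_top[of 0] by eventually_elim simp
    then obtain N :: nat where N: "2 * C / (real N)\<^sup>2 * (4 * M) < e / 2" "N > 0"
      using eventually_happens'[OF sequentially_bot] by blast
    \<comment> \<open>Each cell contributes 2 \<eta>, so all of them contribute at most e/2; the
      summand 1 keeps the denominator positive. Two means within \<rho> of the limit differ by less
      than 2 \<rho>, whose square is \<eta>.\<close>
    define \<eta> where "\<eta> = e / (4 * (real (card (cells N :: ('n \<Rightarrow> nat) set)) + 1))"
    have \<eta>: "\<eta> > 0" using e by (simp add: \<eta>_def)
    define \<rho> where "\<rho> = sqrt \<eta> / 2"
    have \<rho>: "\<rho> > 0" "(2 * \<rho>)\<^sup>2 = \<eta>" using \<eta> by (auto simp: \<rho>_def)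
    have "\<forall>\<^sub>F n in sequentially. \<forall>k\<in>cells N. \<bar>c N k (s n) - lim (\<lambda>n. c N k (s n))\<bar> < \<rho>"
    proof (subst eventually_ball_finite_distrib[OF finite_cells], intro ballI)
      fix k :: "'n \<Rightarrow> nat" assume "k \<in> cells N"
      then have "(\<lambda>n. c N k (s n)) \<longlonglongrightarrow> lim (\<lambda>n. c N k (s n))" using conv_c N(2) by (simp add: convergent_LIMSEQ_iff)
      then show "\<forall>\<^sub>F n in sequentially. \<bar>c N k (s n) - lim (\<lambda>n. c N k (s n))\<bar> < \<rho>"
        using \<rho>(1) by (auto simp: tendsto_iff dist_real_def)
    qed
    then obtain n0 where n0: "\<And>n k. n \<ge> n0 \<Longrightarrow> k \<in> cells N \<Longrightarrow> \<bar>c N k (s n) - lim (\<lambda>n. c N k (s n))\<bar> < \<rho>"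
      by (auto simp: eventually_sequentially)
    have "EQ (\<lambda>x. (u (s i) x - u (s j) x)\<^sup>2) \<le> ennreal e" if ij: "i \<ge> n0" "j \<ge> n0" for i j
    proof -
      let ?w = "\<lambda>x. 1 * u (s i) x + (-1) * u (s j) x" and ?h = "\<lambda>x. 1 *\<^sub>R g (s i) x + (-1) *\<^sub>R g (s j) x"
      have Ww: "W11Q ?w ?h" by (rule W11Q_lincomb[OF W W])
      have mg: "mQ (\<lambda>x. (norm (g n x))\<^sup>2)" for n by (rule mQ_norm_power2[OF W11Q_mQ(2)[OF W]])
      have hM: "EQ (\<lambda>x. (norm (?h x))\<^sup>2) \<le> ennreal (4 * M)"
      proof -
        have "EQ (\<lambda>x. (norm (?h x))\<^sup>2) \<le> EQ (\<lambda>x. 2 * (norm (g (s i) x))\<^sup>2 + 2 * (norm (g (s j) x))\<^sup>2)"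
          by (rule EQ_mono) (use norm_add_square_le[of 1 "g (s i) x" "- g (s j) x" for x] in simp)
        also have "\<dots> = ennreal 2 * EQ (\<lambda>x. (norm (g (s i) x))\<^sup>2) + ennreal 2 * EQ (\<lambda>x. (norm (g (s j) x))\<^sup>2)"
          using mg by (subst EQ_add) (auto simp: EQ_cmult intro!: mQ_cmult)
        also have "\<dots> \<le> ennreal 2 * ennreal M + ennreal 2 * ennreal M"
          by (intro add_mono mult_left_mono gM) auto
        also have "\<dots> = ennreal (4 * M)"
        proof -
          have "ennreal (2 * M) = ennreal 2 * ennreal M" using M by (intro ennreal_mult) auto
          moreover have "ennreal (4 * M) = ennreal (2 * M) + ennreal (2 * M)"
            using M by (subst ennreal_plus[symmetric]) auto
          ultimately show ?thesis by (simp only:)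
        qed
        finally show ?thesis .
      qed
      have fin: "EQ (\<lambda>x. (norm (?h x))\<^sup>2) < \<infinity>" using hM by (simp add: order_le_less_trans)
      have IQw: "IQ (\<lambda>x. ?w (cellmap N k x)) = c N k (s i) - c N k (s j)" if k: "k \<in> cells N" for k
      proof -
        have "set_integrable lebesgue cubeQ (\<lambda>x. u n (cellmap N k x))" for n
          using W11Q_cell[OF W k N(2)] by (simp add: W11Q_def)
        from set_integral_diff(2)[OF this[of "s i"] this[of "s j"]] show ?thesis by (simp add: c_def IQ_def)
      qed
      have sq: "(c N k (s i) - c N k (s j))\<^sup>2 \<le> \<eta>" if k: "k \<in> cells N" for k
      proof -
        have "\<bar>c N k (s i) - c N k (s j)\<bar> \<le> 2 * \<rho>" using n0[OF ij(1) k] n0[OF ij(2) k] by linarith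
        then have "(c N k (s i) - c N k (s j))\<^sup>2 \<le> (2 * \<rho>)\<^sup>2" using \<rho>(1) by (intro power2_le_iff_abs_le[THEN iffD2]) auto
        then show ?thesis using \<rho>(2) by simp
      qed
      have "EQ (\<lambda>x. (u (s i) x - u (s j) x)\<^sup>2) = EQ (\<lambda>x. (?w x)\<^sup>2)" by simp
      also have "\<dots> \<le> ennreal (2 * C / (real N)\<^sup>2) * EQ (\<lambda>x. (norm (?h x))\<^sup>2) + (\<Sum>k\<in>cells N. ennreal (2 * (IQ (\<lambda>x. ?w (cellmap N k x)))\<^sup>2))"
        unfolding C_def by (rule L2_cell_bound[OF Ww fin N(2)])
      also have "\<dots> \<le> ennreal (2 * C / (real N)\<^sup>2) * ennreal (4 * M) + (\<Sum>k\<in>(cells N :: ('n \<Rightarrow> nat) set). ennreal (2 * \<eta>))"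
      proof (intro add_mono mult_left_mono sum_mono ennreal_leI hM)
        show "(IQ (\<lambda>x. ?w (cellmap N k x)))\<^sup>2 \<le> \<eta>" if "k \<in> cells N" for k
          unfolding IQw[OF that] by (rule sq[OF that])
      qed auto
      also have "\<dots> = ennreal (2 * C / (real N)\<^sup>2 * (4 * M)) + ennreal (real (card (cells N :: ('n \<Rightarrow> nat) set)) * (2 * \<eta>))"
      proof (rule arg_cong2[where f="(+)"])
        show "ennreal (2 * C / (real N)\<^sup>2) * ennreal (4 * M) = ennreal (2 * C / (real N)\<^sup>2 * (4 * M))"
          using C M by (intro ennreal_mult[symmetric]) auto
        show "(\<Sum>k\<in>(cells N :: ('n \<Rightarrow> nat) set). ennreal (2 * \<eta>)) = ennreal (real (card (cells N :: ('n \<Rightarrow> nat) set)) * (2 * \<eta>))"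
          using \<eta> by (subst ennreal_mult) (auto simp: ennreal_of_nat_eq_real_of_nat)
      qed
      also have "\<dots> \<le> ennreal (e / 2) + ennreal (e / 2)"
      proof (intro add_mono ennreal_leI)
        show "2 * C / (real N)\<^sup>2 * (4 * M) \<le> e / 2" using N by simp
        show "real (card (cells N :: ('n \<Rightarrow> nat) set)) * (2 * \<eta>) \<le> e / 2"
          using e by (simp add: \<eta>_def field_simps)
      qed
      also have "\<dots> = ennreal e" using e by (simp add: ennreal_plus[symmetric] del: ennreal_plus)
      finally show ?thesis .
    qed
    then show ?thesis by blast
  qed
  then show thesis by (intro that[OF s])
qed

subsection \<open>The upper bound\<close>

lemma ennreal_divide_leI:
  fixes x k C :: ennreal
  assumes "x \<le> k * C" "C \<noteq> 0"
  shows "x / C \<le> k"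
proof (cases "C = top")
  case True
  then show ?thesis by simp
next
  case False
  have "x / C \<le> k * C / C" using assms(1) by (rule divide_right_mono_ennreal)
  also have "\<dots> = k" using False assms(2) by (rule ennreal_mult_divide_eq[rotated])
  finally show ?thesis .
qed

lemma ennreal_le_divide_four: "(x::ennreal) \<le> y / 4 \<longleftrightarrow> 4 * x \<le> y"
proof
  assume "x \<le> y / 4"
  then have "4 * x \<le> 4 * (y / 4)" by (rule mult_left_mono) simp
  also have "\<dots> = y" using ennreal_mult_divide_eq[of 4 y] by (simp add: ennreal_times_divide mult.commute)
  finally show "4 * x \<le> y" .
next
  assume "4 * x \<le> y"
  then have "x * 4 / 4 \<le> y / 4" by (intro divide_right_mono_ennreal) (simp add: mult.commute)
  then show "x \<le> y / 4" by (simp add: ennreal_mult_divide_eq)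
qed

text \<open>The mass to the left of a hyperplane depends continuously on its position, because
  hyperplanes are null sets, and runs from 0 to the total; the intermediate value theorem finds the
  half.\<close>

lemma bisect_integral:
  fixes f :: "real^'n::finite \<Rightarrow> real"
  assumes f: "integrable lebesgue f" "\<And>x. 0 \<le> f x" and pos: "(\<integral>x. f x \<partial>lebesgue) > 0"
  obtains t where "(\<integral>x. f x * indicator {x. x $ i < t} x \<partial>lebesgue) = (\<integral>x. f x \<partial>lebesgue) / 2"
proof -
  define B where "B = (\<integral>x. f x \<partial>lebesgue)"
  define \<phi> where "\<phi> t = (\<integral>x. f x * indicator {x. x $ i < t} x \<partial>lebesgue)" for t
  have fm: "f \<in> borel_measurable lebesgue" using f by auto
  have hs: "{x::real^'n. x $ i < t} \<in> sets lebesgue" for t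
    using borel_open[OF open_halfspace_component_lt_cart[of i t]] by (simp add: sets_completionI_sets)
  have m: "(\<lambda>x. f x * indicator {x. x $ i < t} x) \<in> borel_measurable lebesgue" for t
    by (intro borel_measurable_times fm borel_measurable_indicator hs)
  have bd: "AE x in lebesgue. norm (f x * indicator {x. x $ i < t} x) \<le> f x" for t
    using f(2) by (intro AE_I2) (auto simp: indicator_def)
  have cont: "isCont \<phi> t" for t
  proof (rule continuous_at_sequentiallyI)
    fix s assume s: "s \<longlonglongrightarrow> t"
    show "(\<lambda>n. \<phi> (s n)) \<longlonglongrightarrow> \<phi> t" unfolding \<phi>_def
    proof (rule integral_dominated_convergence[OF m m f(1) _ bd])
      show "AE x in lebesgue. (\<lambda>n. f x * indicator {x. x $ i < s n} x) \<longlonglongrightarrow> f x * indicator {x. x $ i < t} x"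
        using AE_coordinate_neq[of t]
      proof eventually_elim
        case (elim x)
        have "eventually (\<lambda>n. indicator {x. x $ i < s n} x = (indicator {x. x $ i < t} x :: real)) sequentially"
        proof (cases "x $ i < t")
          case True
          then show ?thesis using order_tendstoD(1)[OF s, of "x $ i"] by (auto elim!: eventually_mono)
        next
          case False
          then have "x $ i > t" using elim by (metis linorder_neqE_linordered_idom)
          then show ?thesis using order_tendstoD(2)[OF s, of "x $ i"] by (auto elim!: eventually_mono)
        qed
        then have "(\<lambda>n. indicator {x. x $ i < s n} x :: real) \<longlonglongrightarrow> indicator {x. x $ i < t} x"
          by (rule tendsto_eventually)
        then show ?case by (rule tendsto_mult_left)
      qed
    qed
  qed
  have up: "(\<lambda>n. \<phi> (real n)) \<longlonglongrightarrow> B" unfolding \<phi>_def B_def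
  proof (rule integral_dominated_convergence[OF fm m f(1) _ bd], rule AE_I2)
    fix x
    have "eventually (\<lambda>n. x $ i < real n) sequentially"
      using filterlim_real_sequentially by (simp add: filterlim_at_top_dense)
    then have "eventually (\<lambda>n. f x * indicator {x. x $ i < real n} x = f x) sequentially"
      by eventually_elim simp
    then show "(\<lambda>n. f x * indicator {x. x $ i < real n} x) \<longlonglongrightarrow> f x" by (rule tendsto_eventually)
  qed
  have z: "(\<lambda>x. 0::real) \<in> borel_measurable (lebesgue :: (real^'n) measure)" by simp
  have "(\<lambda>n. \<phi> (- real n)) \<longlonglongrightarrow> (\<integral>x. 0 \<partial>(lebesgue :: (real^'n) measure))" unfolding \<phi>_def
  proof (rule integral_dominated_convergence[OF z m f(1) _ bd], rule AE_I2)
    fix x :: "real^'n"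
    have "eventually (\<lambda>n. - x $ i < real n) sequentially"
      using filterlim_real_sequentially by (simp add: filterlim_at_top_dense)
    then have "eventually (\<lambda>n. f x * indicator {x. x $ i < - real n} x = 0) sequentially"
      by eventually_elim simp
    then show "(\<lambda>n. f x * indicator {x. x $ i < - real n} x) \<longlonglongrightarrow> 0" by (rule tendsto_eventually)
  qed
  then have dn: "(\<lambda>n. \<phi> (- real n)) \<longlonglongrightarrow> 0" by simp
  have B: "B > 0" using pos by (simp add: B_def)
  have "eventually (\<lambda>n. \<phi> (- real n) < B / 2) sequentially" using dn B by (intro order_tendstoD) auto
  moreover have "eventually (\<lambda>n. B / 2 < \<phi> (real n)) sequentially" using up B by (intro order_tendstoD) auto
  ultimately have "eventually (\<lambda>n. \<phi> (- real n) < B / 2 \<and> B / 2 < \<phi> (real n)) sequentially" by eventually_elim simp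
  then obtain n where n: "\<phi> (- real n) < B / 2 \<and> B / 2 < \<phi> (real n)"
    using eventually_happens'[OF sequentially_bot] by blast
  have "\<exists>t. - real n \<le> t \<and> t \<le> real n \<and> \<phi> t = B / 2"
    by (rule IVT) (use n cont in auto)
  then show thesis using that by (auto simp: \<phi>_def B_def)
qed

text \<open>Intersections of open half-spaces bounded by coordinate hyperplanes, with side
  \<open>s i\<close> at position \<open>t $ i\<close>; for \<open>UNIV\<close> this is an open
  orthant with corner t.\<close>

definition orth :: "'n set \<Rightarrow> ('n \<Rightarrow> real) \<Rightarrow> real^'n \<Rightarrow> (real^'n::finite) set" where
  "orth I s t = {x. \<forall>i\<in>I. s i * (x $ i - t $ i) > 0}"

lemma orth_measurable: "orth I s t \<in> sets lebesgue"
proof -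
  have eq: "orth I s t = (\<Inter>i\<in>I. {x. s i * (x $ i - t $ i) > 0})" by (auto simp: orth_def)
  have "open {x. s i * (x $ i - t $ i) > 0}" for i
    by (intro open_Collect_less continuous_intros)
  then have "open (orth I s t)" unfolding eq by (intro open_INT) auto
  then show ?thesis by (simp add: borel_open sets_completionI_sets)
qed

text \<open>Written as a * X <= r * c with X and r fixed, the condition is additive over a
  partition: if it failed on both halves, it would fail on their union. Thus one half keeps it,
  while the bisection halves the square integral whichever half is taken.\<close>

lemma best_orthant:
  fixes u :: "real^'n::finite \<Rightarrow> real" and a c :: "real^'n \<Rightarrow> ennreal"
  assumes u: "integrable lebesgue (\<lambda>x. (u x)\<^sup>2)" "(\<integral>x. (u x)\<^sup>2 \<partial>lebesgue) = B" "B > 0"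
    and a: "a \<in> borel_measurable lebesgue" and c: "c \<in> borel_measurable lebesgue"
    and le: "(\<integral>\<^sup>+x. a x \<partial>lebesgue) * X \<le> r * (\<integral>\<^sup>+x. c x \<partial>lebesgue)"
  shows "\<exists>s t. (\<forall>i. s i = 1 \<or> s i = -1) \<and> (\<integral>x. (u x)\<^sup>2 * indicator (orth I s t) x \<partial>lebesgue) = B / 2 ^ card I \<and>
    (\<integral>\<^sup>+x. a x * indicator (orth I s t) x \<partial>lebesgue) * X \<le> r * (\<integral>\<^sup>+x. c x * indicator (orth I s t) x \<partial>lebesgue)"
  using finite[of I]
proof (induction I rule: finite_induct)
  case empty
  have "orth {} (\<lambda>_. 1) 0 = (UNIV :: (real^'n) set)" by (simp add: orth_def)
  then show ?case using u le by (intro exI[of _ "\<lambda>_. 1"] exI[of _ 0]) simp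
next
  case (insert i I)
  then obtain s t where s: "\<forall>i. s i = 1 \<or> s i = -1" and st: "(\<integral>x. (u x)\<^sup>2 * indicator (orth I s t) x \<partial>lebesgue) = B / 2 ^ card I"
    "(\<integral>\<^sup>+x. a x * indicator (orth I s t) x \<partial>lebesgue) * X \<le> r * (\<integral>\<^sup>+x. c x * indicator (orth I s t) x \<partial>lebesgue)" by blast
  let ?R = "orth I s t"
  define f where "f x = (u x)\<^sup>2 * indicator ?R x" for x
  have fi: "integrable lebesgue f" unfolding f_def using u(1) orth_measurable
    by (subst mult.commute) (intro integrable_mult_indicator[where 'b=real, simplified])
  obtain t0 where t0: "(\<integral>x. f x * indicator {x. x $ i < t0} x \<partial>lebesgue) = B / 2 ^ card I / 2"
    using bisect_integral[OF fi, of i] st(1) u(3) by (auto simp: f_def)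
  define t' where "t' = (\<chi> k. if k = i then t0 else t $ k)"
  define s1 where "s1 = s(i := 1)"
  define s2 where "s2 = s(i := -1)"
  let ?P = "orth (insert i I) s1 t'" and ?M = "orth (insert i I) s2 t'"
  have memP: "x \<in> ?P \<longleftrightarrow> x \<in> ?R \<and> x $ i > t0" and memM: "x \<in> ?M \<longleftrightarrow> x \<in> ?R \<and> x $ i < t0" for x
    using insert.hyps(2) by (auto simp: orth_def s1_def s2_def t'_def)
  have split_le: "(indicator ?P x :: ennreal) + indicator ?M x \<le> indicator ?R x" for x
    using memP[of x] memM[of x] by (auto simp: indicator_def)
  have split_AE: "AE x in lebesgue. (indicator ?R x :: ennreal) = indicator ?P x + indicator ?M x"
    using AE_coordinate_neq[of t0]
  proof eventually_elim
    case (elim x)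
    have "x $ i < t0 \<or> x $ i > t0" using elim by (metis linorder_neqE_linordered_idom)
    then show ?case using memP[of x] memM[of x] by (auto simp: indicator_def)
  qed
  have nn_split: "(\<integral>\<^sup>+x. h x * indicator ?R x \<partial>lebesgue) = (\<integral>\<^sup>+x. h x * indicator ?P x \<partial>lebesgue) + (\<integral>\<^sup>+x. h x * indicator ?M x \<partial>lebesgue)"
    if h: "h \<in> borel_measurable lebesgue" for h :: "real^'n \<Rightarrow> ennreal"
  proof -
    have "(\<integral>\<^sup>+x. h x * indicator ?R x \<partial>lebesgue) = (\<integral>\<^sup>+x. h x * indicator ?P x + h x * indicator ?M x \<partial>lebesgue)"
      by (rule nn_integral_cong_AE) (use split_AE in eventually_elim, simp add: distrib_left)
    then show ?thesis using h by (simp add: nn_integral_add borel_measurable_times_ennreal borel_measurable_indicator orth_measurable)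
  qed
  have card: "card (insert i I) = Suc (card I)" using insert.hyps by simp
  have BM: "(\<integral>x. (u x)\<^sup>2 * indicator ?M x \<partial>lebesgue) = B / 2 ^ card (insert i I)"
  proof -
    have "(\<integral>x. (u x)\<^sup>2 * indicator ?M x \<partial>lebesgue) = (\<integral>x. f x * indicator {x. x $ i < t0} x \<partial>lebesgue)"
      by (rule Bochner_Integration.integral_cong) (auto simp: f_def indicator_def memM)
    then show ?thesis using t0 by (simp add: card)
  qed
  have iPM: "integrable lebesgue (\<lambda>x. (u x)\<^sup>2 * indicator S x)" if "S \<in> sets lebesgue" for S
    using integrable_mult_indicator[OF that u(1)] by (simp add: mult.commute)
  have BP: "(\<integral>x. (u x)\<^sup>2 * indicator ?P x \<partial>lebesgue) = B / 2 ^ card (insert i I)"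
  proof -
    have "(\<integral>x. f x \<partial>lebesgue) = (\<integral>x. (u x)\<^sup>2 * indicator ?P x + (u x)\<^sup>2 * indicator ?M x \<partial>lebesgue)"
    proof (rule integral_cong_AE)
      show "AE x in lebesgue. f x = (u x)\<^sup>2 * indicator ?P x + (u x)\<^sup>2 * indicator ?M x"
        using AE_coordinate_neq[of t0]
      proof eventually_elim
        case (elim x)
        have "x $ i < t0 \<or> x $ i > t0" using elim by (metis linorder_neqE_linordered_idom)
        then show ?case using memP[of x] memM[of x] by (auto simp: f_def indicator_def)
      qed
    qed (use fi iPM[OF orth_measurable] in auto)
    also have "\<dots> = (\<integral>x. (u x)\<^sup>2 * indicator ?P x \<partial>lebesgue) + (\<integral>x. (u x)\<^sup>2 * indicator ?M x \<partial>lebesgue)"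
      by (rule Bochner_Integration.integral_add) (rule iPM[OF orth_measurable])+
    finally show ?thesis using BM st(1) by (simp add: f_def card field_simps)
  qed
  have "(\<integral>\<^sup>+x. a x * indicator ?P x \<partial>lebesgue) * X + (\<integral>\<^sup>+x. a x * indicator ?M x \<partial>lebesgue) * X
     \<le> r * (\<integral>\<^sup>+x. c x * indicator ?P x \<partial>lebesgue) + r * (\<integral>\<^sup>+x. c x * indicator ?M x \<partial>lebesgue)"
    using st(2) unfolding nn_split[OF a] nn_split[OF c] by (simp add: distrib_left distrib_right)
  \<comment> \<open>Two strict reverse inequalities would add up to a strict one.\<close>
  then have "(\<integral>\<^sup>+x. a x * indicator ?P x \<partial>lebesgue) * X \<le> r * (\<integral>\<^sup>+x. c x * indicator ?P x \<partial>lebesgue) \<or>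
    (\<integral>\<^sup>+x. a x * indicator ?M x \<partial>lebesgue) * X \<le> r * (\<integral>\<^sup>+x. c x * indicator ?M x \<partial>lebesgue)"
    by (meson add_strict_mono not_le)
  moreover have "\<forall>i. s1 i = 1 \<or> s1 i = -1" "\<forall>i. s2 i = 1 \<or> s2 i = -1" using s by (auto simp: s1_def s2_def)
  ultimately show ?case using BM BP by blast
qed

text \<open>The set on the right is the image of the unit cube: the cube of side n with corner t, on
  the side given by the signs. As n grows, these cubes fill the orthant.\<close>

lemma nn_integral_rescale:
  fixes F :: "real^'n::finite \<Rightarrow> ennreal"
  assumes F: "F \<in> borel_measurable lebesgue" and s: "\<And>i. s i = 1 \<or> s i = -1" and n: "n > 0"
  shows "(\<integral>\<^sup>+x. F (diag (\<lambda>i. s i * real n) t x) * indicator cubeQ x \<partial>lebesgue)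
    = ennreal ((1 / real n) ^ CARD('n)) * (\<integral>\<^sup>+y. F y * indicator {y. \<forall>i. 0 \<le> s i * (y $ i - t $ i) \<and> s i * (y $ i - t $ i) \<le> real n} y \<partial>lebesgue)"
proof -
  let ?m = "\<lambda>i. s i * real n"
  let ?S = "{y. \<forall>i. 0 \<le> s i * (y $ i - t $ i) \<and> s i * (y $ i - t $ i) \<le> real n}"
  have m: "?m i \<noteq> 0" "\<bar>?m i\<bar> = real n" for i using s[of i] n by (auto simp: abs_mult)
  have ss: "s i * s i = 1" for i using s[of i] by auto
  have S: "?S \<in> sets lebesgue"
  proof -
    have "?S = (\<Inter>i\<in>UNIV. {y. 0 \<le> s i * (y $ i - t $ i)} \<inter> {y. s i * (y $ i - t $ i) \<le> real n})" by auto
    moreover have "closed {y. 0 \<le> s i * (y $ i - t $ i)}" "closed {y. s i * (y $ i - t $ i) \<le> real n}" for i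
      by (intro closed_Collect_le continuous_intros)+
    ultimately have "closed ?S" by (metis (no_types, lifting) closed_INT closed_Int)
    then show ?thesis by (simp add: borel_closed sets_completionI_sets)
  qed
  have mem: "diag ?m t x \<in> ?S \<longleftrightarrow> x \<in> cubeQ" for x
  proof -
    have "s i * (diag ?m t x $ i - t $ i) = real n * x $ i" for i
    proof -
      have "s i * (diag ?m t x $ i - t $ i) = (s i * s i) * (real n * x $ i)" by simp
      then show ?thesis by (simp only: ss)
    qed
    then have "diag ?m t x \<in> ?S \<longleftrightarrow> (\<forall>i. 0 \<le> real n * x $ i \<and> real n * x $ i \<le> real n)"
      by (simp only: mem_Collect_eq)
    also have "\<dots> \<longleftrightarrow> x \<in> cubeQ" using n by (simp add: mem_cubeQ zero_le_mult_iff)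
    finally show ?thesis .
  qed
  have "(\<integral>\<^sup>+y. F y * indicator ?S y \<partial>lebesgue) = ennreal (\<Prod>i\<in>UNIV. \<bar>?m i\<bar>) * (\<integral>\<^sup>+x. F (diag ?m t x) * indicator ?S (diag ?m t x) \<partial>lebesgue)"
    by (rule nn_integral_diag[where m="?m", OF m(1)]) (intro borel_measurable_times_ennreal F borel_measurable_indicator S)
  also have "(\<integral>\<^sup>+x. F (diag ?m t x) * indicator ?S (diag ?m t x) \<partial>lebesgue) = (\<integral>\<^sup>+x. F (diag ?m t x) * indicator cubeQ x \<partial>lebesgue)"
    unfolding indicator_def mem ..
  also have "(\<Prod>i\<in>(UNIV::'n set). \<bar>?m i\<bar>) = real n ^ CARD('n)" by (simp only: m(2)) simp
  finally have "ennreal ((1 / real n) ^ CARD('n)) * (\<integral>\<^sup>+y. F y * indicator ?S y \<partial>lebesgue)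
    = (ennreal ((1 / real n) ^ CARD('n)) * ennreal (real n ^ CARD('n))) * (\<integral>\<^sup>+x. F (diag ?m t x) * indicator cubeQ x \<partial>lebesgue)"
    by (simp add: mult.assoc)
  also have "ennreal ((1 / real n) ^ CARD('n)) * ennreal (real n ^ CARD('n)) = 1"
    using n by (subst ennreal_mult[symmetric]) (auto simp: power_mult_distrib[symmetric])
  finally show ?thesis by simp
qed

text \<open>The condition on \<open>k\<close> is for infinite \<open>C\<close>: then the quotient is
  0 while x is arbitrary, and k * C has to be infinite.\<close>

lemma ennreal_divide_leD:
  fixes x k C :: ennreal
  assumes "x / C \<le> k" "C \<noteq> 0" "k \<noteq> 0"
  shows "x \<le> k * C"
proof (cases "C = top")
  case True
  then show ?thesis using assms(3) by (simp add: ennreal_mult_top)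
next
  case False
  have "x = x / C * C" using False assms(2) ennreal_divide_self[of C] by (simp add: ennreal_divide_times top.not_eq_extremum)
  also have "\<dots> \<le> k * C" using assms(1) by (rule mult_right_mono) simp
  finally show ?thesis .
qed

lemma GQ_const_le: "GQ_admissible u g \<Longrightarrow> GQ_const TYPE('n::finite) \<le> GQ_quot (u :: real^'n \<Rightarrow> real) g"
  unfolding GQ_const_def by (rule INF_lower2[of "(u, g)"]) auto

lemma GQ_quot_eq:
  fixes u :: "real^'n::finite \<Rightarrow> real"
  assumes "EQ (\<lambda>x. (norm (g x))\<^sup>2) < \<infinity>" "EQ (\<lambda>x. (u x)\<^sup>2) < \<infinity>"
  shows "GQ_quot u g = ennreal (enn2real (EQ (\<lambda>x. (norm (g x))\<^sup>2)) * enn2real (EQ (\<lambda>x. (u x)\<^sup>2)) powr (2 / real CARD('n)))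
    / EQ (\<lambda>x. \<bar>u x - IQ u\<bar> powr (2 + 4 / real CARD('n)))"
  using assms unfolding GQ_quot_def GN_quot_def Let_def EQ_def[symmetric] meanQ_def IQ_def[symmetric] by auto

text \<open>Competitors on the cube are obtained by magnifying the unit cube to side n inside the
  best orthant, which concentrates u at a corner. By the dilation invariance the only n-dependent
  defects are the missing tail and the mean, and both disappear in the limit by Fatou's
  lemma.\<close>

lemma GQ_le_quot:
  fixes u :: "real^'n::finite \<Rightarrow> real"
  assumes H: "H1 u g" and nz: "\<not> (AE x in lebesgue. u x = 0)"
  shows "GQ_const TYPE('n) \<le> GN_quot UNIV 0 u g / 4"
proof -
  define d where "d = real CARD('n)"
  define p where "p = 2 + 4 / d"
  have d: "d > 0" "d \<ge> 1" by (auto simp: d_def Suc_le_eq)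
  have p: "p > 0" using d by (simp add: p_def add_pos_pos)
  have um: "u \<in> borel_measurable lebesgue" and ui: "integrable lebesgue (\<lambda>x. (u x)\<^sup>2)"
    and gm: "g \<in> borel_measurable lebesgue" and gi: "integrable lebesgue (\<lambda>x. (norm (g x))\<^sup>2)"
    and wg: "weak_gradient UNIV u g" using H by (auto simp: H1_def)
  define A where "A = (\<integral>x. (norm (g x))\<^sup>2 \<partial>lebesgue)"
  define B where "B = (\<integral>x. (u x)\<^sup>2 \<partial>lebesgue)"
  define C where "C = (\<integral>\<^sup>+x. ennreal (\<bar>u x\<bar> powr p) \<partial>lebesgue)"
  have A0: "A \<ge> 0" by (simp add: A_def)
  have Ae: "(\<integral>\<^sup>+x. ennreal ((norm (g x))\<^sup>2) \<partial>lebesgue) = ennreal A"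
    unfolding A_def using gi by (intro nn_integral_eq_integral) auto
  have Be: "(\<integral>\<^sup>+x. ennreal ((u x)\<^sup>2) \<partial>lebesgue) = ennreal B"
    unfolding B_def using ui by (intro nn_integral_eq_integral) auto
  have B: "B > 0"
  proof (rule ccontr)
    assume "\<not> B > 0"
    then have "B = 0" unfolding B_def by (meson integral_nonneg not_less order_antisym zero_le_power2 Bochner_Integration.integral_nonneg)
    then have "AE x in lebesgue. (u x)\<^sup>2 = 0"
      unfolding B_def using integral_nonneg_eq_0_iff_AE[OF ui] by auto
    then show False using nz by auto
  qed
  have cm: "(\<lambda>x. ennreal (\<bar>u x\<bar> powr p)) \<in> borel_measurable lebesgue"
    and am: "(\<lambda>x. ennreal ((norm (g x))\<^sup>2)) \<in> borel_measurable lebesgue"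
    using um gm by measurable
  have C0: "C \<noteq> 0"
  proof
    assume "C = 0"
    then have "AE x in lebesgue. ennreal (\<bar>u x\<bar> powr p) = 0" unfolding C_def using cm by (subst (asm) nn_integral_0_iff_AE) auto
    then have "AE x in lebesgue. u x = 0" by eventually_elim (auto simp: ennreal_eq_0_iff)
    then show False using nz by simp
  qed
  define Xr where "Xr = B powr (2 / d)"
  have Xr: "Xr > 0" using B by (simp add: Xr_def)
  have Q: "GN_quot UNIV 0 u g = ennreal (A * Xr) / C"
    unfolding GN_quot_def Let_def using Ae Be A0 B by (simp add: C_def p_def d_def Xr_def)
  show ?thesis
  proof (cases "GN_quot UNIV 0 u g = top")
    case True
    then show ?thesis by (simp add: ennreal_le_divide_four)
  next
    case False
    then obtain q where q: "GN_quot UNIV 0 u g = ennreal q" "q \<ge> 0" by (cases "GN_quot UNIV 0 u g") auto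
    have "GQ_const TYPE('n) \<le> ennreal (q / 4) + ennreal e" if e: "e > 0" for e
    proof -
      \<comment> \<open>r is positive even for q = 0, the gap to r' absorbs the passage to the limit
        in n, and r'/4 = q/4 + e.\<close>
      define r r' where "r = q + 2 * e" and "r' = q + 4 * e"
      have r: "r > 0" "r' > r" using e q(2) by (auto simp: r_def r'_def)
      have "ennreal (A * Xr) / C \<le> ennreal r" using q e by (simp add: Q[symmetric] r_def ennreal_leI del: ennreal_plus)
      then have "ennreal (A * Xr) \<le> ennreal r * C" by (rule ennreal_divide_leD) (use C0 r in auto)
      then have le: "(\<integral>\<^sup>+x. ennreal ((norm (g x))\<^sup>2) \<partial>lebesgue) * ennreal Xr \<le> ennreal r * (\<integral>\<^sup>+x. ennreal (\<bar>u x\<bar> powr p) \<partial>lebesgue)"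
        unfolding Ae C_def[symmetric] using A0 Xr by (simp add: ennreal_mult)
      obtain s t where s: "\<forall>i. s i = 1 \<or> s i = -1" and BO: "(\<integral>x. (u x)\<^sup>2 * indicator (orth UNIV s t) x \<partial>lebesgue) = B / 2 ^ CARD('n)"
        and le2: "(\<integral>\<^sup>+x. ennreal ((norm (g x))\<^sup>2) * indicator (orth UNIV s t) x \<partial>lebesgue) * ennreal Xr
          \<le> ennreal r * (\<integral>\<^sup>+x. ennreal (\<bar>u x\<bar> powr p) * indicator (orth UNIV s t) x \<partial>lebesgue)"
        using best_orthant[OF ui B_def[symmetric] B am cm le, of UNIV] by blast
      define Or where "Or = orth UNIV s t"
      have Om: "Or \<in> sets lebesgue" unfolding Or_def by (rule orth_measurable)
      define b where "b = B / 2 ^ CARD('n)"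
      have b: "b > 0" using B by (simp add: b_def)
      \<comment> \<open>Halving the square integral d times divides its power 2/d by 4.\<close>
      have bX: "b powr (2 / d) = Xr / 4"
      proof -
        have "b powr (2 / d) = B powr (2 / d) / (2 ^ CARD('n)) powr (2 / d)" using B by (simp add: b_def powr_divide)
        also have "((2::real) ^ CARD('n)) powr (2 / d) = (2 powr d) powr (2 / d)" by (simp add: powr_realpow d_def)
        also have "\<dots> = 2 powr 2" using d by (simp add: powr_powr)
        also have "\<dots> = 4" using powr_realpow[of 2 2] by simp
        finally show ?thesis by (simp add: Xr_def)
      qed
      have iO: "integrable lebesgue (\<lambda>x. (u x)\<^sup>2 * indicator Or x)"
        using integrable_mult_indicator[OF Om ui] by (simp add: mult.commute)
      have BOe: "(\<integral>\<^sup>+x. ennreal ((u x)\<^sup>2) * indicator Or x \<partial>lebesgue) = ennreal b"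
      proof -
        have "(\<integral>\<^sup>+x. ennreal ((u x)\<^sup>2) * indicator Or x \<partial>lebesgue) = (\<integral>\<^sup>+x. ennreal ((u x)\<^sup>2 * indicator Or x) \<partial>lebesgue)"
          by (intro nn_integral_cong) (auto simp: indicator_def)
        also have "\<dots> = ennreal (\<integral>x. (u x)\<^sup>2 * indicator Or x \<partial>lebesgue)"
          using iO by (intro nn_integral_eq_integral) auto
        finally show ?thesis using BO by (simp add: b_def Or_def)
      qed
      define CO where "CO = (\<integral>\<^sup>+x. ennreal (\<bar>u x\<bar> powr p) * indicator Or x \<partial>lebesgue)"
      have CO0: "CO \<noteq> 0"
      proof
        assume "CO = 0"
        then have "AE x in lebesgue. ennreal (\<bar>u x\<bar> powr p) * indicator Or x = 0"
          unfolding CO_def by (subst (asm) nn_integral_0_iff_AE) (auto intro!: borel_measurable_times_ennreal cm borel_measurable_indicator Om)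
        then have "AE x in lebesgue. ennreal ((u x)\<^sup>2) * indicator Or x = 0"
          by eventually_elim (auto simp: ennreal_eq_0_iff indicator_def split: if_splits)
        then have "(\<integral>\<^sup>+x. ennreal ((u x)\<^sup>2) * indicator Or x \<partial>lebesgue) = (\<integral>\<^sup>+x. 0 \<partial>(lebesgue :: (real^'n) measure))"
          by (rule nn_integral_cong_AE)
        then show False using BOe b by simp
      qed
      have "(\<integral>\<^sup>+x. ennreal ((norm (g x))\<^sup>2) * indicator Or x \<partial>lebesgue) \<le> ennreal A"
        unfolding Ae[symmetric] by (intro nn_integral_mono) (auto simp: indicator_def)
      then obtain ao where ao: "(\<integral>\<^sup>+x. ennreal ((norm (g x))\<^sup>2) * indicator Or x \<partial>lebesgue) = ennreal ao" "ao \<ge> 0"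
        by (cases "(\<integral>\<^sup>+x. ennreal ((norm (g x))\<^sup>2) * indicator Or x \<partial>lebesgue)") (auto simp: top_unique)
      have leO: "ennreal (ao * Xr) \<le> ennreal r * CO"
        using le2 ao Xr unfolding Or_def[symmetric] CO_def[symmetric] by (simp add: ennreal_mult)
      define \<Phi> where "\<Phi> n = diag (\<lambda>i. s i * real n) t" for n :: nat
      define v where "v n x = u (\<Phi> n x)" for n x
      define h where "h n x = (\<chi> i. (s i * real n) * g (\<Phi> n x) $ i)" for n x
      define S where "S n = {y. \<forall>i. 0 \<le> s i * (y $ i - t $ i) \<and> s i * (y $ i - t $ i) \<le> real n}" for n :: nat
      have Sm: "S n \<in> sets lebesgue" for n
      proof -
        have "S n = (\<Inter>i\<in>UNIV. {y. 0 \<le> s i * (y $ i - t $ i)} \<inter> {y. s i * (y $ i - t $ i) \<le> real n})" by (auto simp: S_def)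
        moreover have "closed {y. 0 \<le> s i * (y $ i - t $ i)}" "closed {y. s i * (y $ i - t $ i) \<le> real n}" for i
          by (intro closed_Collect_le continuous_intros)+
        ultimately have "closed (S n)" by (metis (no_types, lifting) closed_INT closed_Int)
        then show ?thesis by (simp add: borel_closed sets_completionI_sets)
      qed
      have resc: "(\<integral>\<^sup>+x. F (\<Phi> n x) * indicator cubeQ x \<partial>lebesgue) = ennreal ((1 / real n) ^ CARD('n)) * (\<integral>\<^sup>+y. F y * indicator (S n) y \<partial>lebesgue)"
        if "F \<in> borel_measurable lebesgue" "n > 0" for F n
        unfolding \<Phi>_def S_def by (rule nn_integral_rescale) (use that s in auto)
      \<comment> \<open>The closed cube \<open>S n\<close> leaves the open orthant only in a null
        set of hyperplanes.\<close>
      have SO: "(\<integral>\<^sup>+y. F y * indicator (S n) y \<partial>lebesgue) \<le> (\<integral>\<^sup>+y. F y * indicator Or y \<partial>lebesgue)" for F n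
      proof (rule nn_integral_mono_AE)
        show "AE y in lebesgue. F y * indicator (S n) y \<le> F y * indicator Or y"
        proof -
          have "AE y in lebesgue. \<forall>i\<in>(UNIV::'n set). y $ i \<noteq> t $ i"
            by (rule AE_finite_allI, simp, rule eventually_mono[OF AE_coordinate_neq]) blast
          then show ?thesis
          proof eventually_elim
            case (elim y)
            have "y \<in> Or" if "y \<in> S n"
            proof -
              have "0 \<le> s i * (y $ i - t $ i)" "s i * (y $ i - t $ i) \<noteq> 0" for i
                using that elim s by (auto simp: S_def) (metis one_neq_neg_one zero_neq_one zero_neq_neg_one)
              then show ?thesis by (auto simp: Or_def orth_def less_le)
            qed
            then show ?case by (auto simp: indicator_def)
          qed
        qed
      qed
      have Wn: "W11Q (v n) (h n)" if n: "n > 0" for n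
      proof -
        have "s i * real n \<noteq> 0" for i using s n by (metis mult_eq_0_iff neg_equal_0_iff_equal of_nat_0_eq_iff less_irrefl one_neq_zero)
        then have w: "weak_gradient UNIV (v n) (h n)"
          unfolding v_def h_def \<Phi>_def by (rule weak_gradient_diag[OF wg]) auto
        then show ?thesis unfolding W11Q_def using compact_cubeQ weak_gradient_mono[OF w]
          unfolding weak_gradient_def[of UNIV] by auto
      qed
      define k where "k n = (1 / real n) ^ CARD('n)" for n :: nat
      have k: "k n > 0" "k n \<le> 1 / real n" if n: "n > 0" for n
      proof -
        show "k n > 0" using n by (simp add: k_def)
        have "k n \<le> (1 / real n) ^ 1" unfolding k_def using n by (intro power_decreasing) (auto simp: Suc_le_eq)
        then show "k n \<le> 1 / real n" by simp
      qed
      have EQv: "EQ (\<lambda>x. (v n x)\<^sup>2) \<le> ennreal (k n * b)" if n: "n > 0" for n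
      proof -
        have "EQ (\<lambda>x. (v n x)\<^sup>2) = ennreal (k n) * (\<integral>\<^sup>+y. ennreal ((u y)\<^sup>2) * indicator (S n) y \<partial>lebesgue)"
          unfolding EQ_def v_def k_def by (rule resc[of "\<lambda>y. ennreal ((u y)\<^sup>2)"]) (use n um in measurable)
        also have "\<dots> \<le> ennreal (k n) * ennreal b" using SO[of "\<lambda>y. ennreal ((u y)\<^sup>2)" n] BOe by (intro mult_left_mono) auto
        finally show ?thesis using b k[OF n] by (simp add: ennreal_mult)
      qed
      define mn where "mn n = IQ (v n)" for n
      \<comment> \<open>By Cauchy-Schwarz the squared mean is at most the square integral, which is
        at most b/n.\<close>
      have mn0: "(\<lambda>n. mn (Suc n)) \<longlonglongrightarrow> 0"
      proof (rule Lim_null_comparison)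
        show "eventually (\<lambda>n. norm (mn (Suc n)) \<le> sqrt (1 / real (Suc n) * b)) sequentially"
        proof (intro always_eventually allI)
          fix n
          have "EQ (\<lambda>x. (v (Suc n) x)\<^sup>2) \<le> ennreal (1 / real (Suc n) * b)"
            using order_trans[OF EQv[of "Suc n"] ennreal_leI[OF mult_right_mono[OF k(2)]]] b by simp
          then have "EQ (\<lambda>x. \<bar>v (Suc n) x\<bar>) \<le> ennreal (sqrt (1 / real (Suc n) * b))"
            using b by (intro EQ_abs_le W11Q_mQ(1)[OF Wn]) auto
          moreover have "ennreal \<bar>mn (Suc n)\<bar> \<le> EQ (\<lambda>x. \<bar>v (Suc n) x\<bar>)"
            using IQ_diff_le_EQ[of "v (Suc n)" "\<lambda>_. 0"] Wn[of "Suc n"] by (simp add: W11Q_def mn_def IQ_def)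
          ultimately have "ennreal \<bar>mn (Suc n)\<bar> \<le> ennreal (sqrt (1 / real (Suc n) * b))" by (rule order_trans[rotated])
          then show "norm (mn (Suc n)) \<le> sqrt (1 / real (Suc n) * b)" using b by (subst (asm) ennreal_le_iff) auto
        qed
        have "(\<lambda>n. sqrt (1 / real (Suc n) * b)) \<longlonglongrightarrow> sqrt (0 * b)"
          by (intro tendsto_intros) real_asymp
        then show "(\<lambda>n. sqrt (1 / real (Suc n) * b)) \<longlonglongrightarrow> 0" by simp
      qed
      define cn where "cn n = (\<integral>\<^sup>+y. ennreal (\<bar>u y - mn n\<bar> powr p) * indicator (S n) y \<partial>lebesgue)" for n
      have fm: "(\<lambda>y. ennreal (\<bar>u y - mn n\<bar> powr p)) \<in> borel_measurable lebesgue" for n using um by measurable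
      \<comment> \<open>If this failed for every n, Fatou's lemma on the growing cubes, with means
        tending to 0, would give r' * CO <= ao * Xr <= r * CO, which is impossible for r < r' and CO
        positive and finite.\<close>
      have "\<exists>n>0. ennreal (ao * Xr) < ennreal r' * cn n"
      proof (rule ccontr)
        assume "\<not> (\<exists>n>0. ennreal (ao * Xr) < ennreal r' * cn n)"
        then have le: "ennreal r' * cn (Suc n) \<le> ennreal (ao * Xr)" for n by (auto simp: not_less)
        have "CO \<le> (\<integral>\<^sup>+y. liminf (\<lambda>n. ennreal (\<bar>u y - mn (Suc n)\<bar> powr p) * indicator (S (Suc n)) y) \<partial>lebesgue)"
          unfolding CO_def
        proof (rule nn_integral_mono)
          fix y
          show "ennreal (\<bar>u y\<bar> powr p) * indicator Or y \<le> liminf (\<lambda>n. ennreal (\<bar>u y - mn (Suc n)\<bar> powr p) * indicator (S (Suc n)) y)"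
          proof (cases "y \<in> Or")
            case True
            have "eventually (\<lambda>n. \<forall>i\<in>(UNIV::'n set). s i * (y $ i - t $ i) \<le> real (Suc n)) sequentially"
            proof (subst eventually_ball_finite_distrib, simp, intro ballI)
              fix i
              show "eventually (\<lambda>n. s i * (y $ i - t $ i) \<le> real (Suc n)) sequentially"
                using eventually_ge_at_top[of "nat \<lceil>s i * (y $ i - t $ i)\<rceil>"]
                by eventually_elim linarith
            qed
            then have ev: "eventually (\<lambda>n. y \<in> S (Suc n)) sequentially"
              by eventually_elim (use True in \<open>auto simp: S_def Or_def orth_def less_imp_le\<close>)
            have "(\<lambda>n. \<bar>u y - mn (Suc n)\<bar> powr p) \<longlonglongrightarrow> \<bar>u y - 0\<bar> powr p"
              using p by (intro tendsto_powr2 tendsto_rabs tendsto_diff tendsto_const mn0) auto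
            then have "(\<lambda>n. ennreal (\<bar>u y - mn (Suc n)\<bar> powr p)) \<longlonglongrightarrow> ennreal (\<bar>u y\<bar> powr p)" by (intro tendsto_ennrealI) simp
            then have "(\<lambda>n. ennreal (\<bar>u y - mn (Suc n)\<bar> powr p) * indicator (S (Suc n)) y) \<longlonglongrightarrow> ennreal (\<bar>u y\<bar> powr p)"
              by (rule Lim_transform_eventually) (use ev in eventually_elim, simp)
            then have "liminf (\<lambda>n. ennreal (\<bar>u y - mn (Suc n)\<bar> powr p) * indicator (S (Suc n)) y) = ennreal (\<bar>u y\<bar> powr p)"
              by (intro lim_imp_Liminf) auto
            then show ?thesis using True by simp
          qed simp
        qed
        also have "\<dots> \<le> liminf (\<lambda>n. cn (Suc n))"
          unfolding cn_def by (intro nn_integral_liminf borel_measurable_times_ennreal fm borel_measurable_indicator Sm)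
        also have "\<dots> \<le> liminf (\<lambda>n. ennreal (ao * Xr) / ennreal r')"
        proof (intro Liminf_mono always_eventually allI)
          fix n
          have "cn (Suc n) = cn (Suc n) * ennreal r' / ennreal r'" using r by (subst ennreal_mult_divide_eq) auto
          also have "\<dots> \<le> ennreal (ao * Xr) / ennreal r'" using le[of n] by (intro divide_right_mono_ennreal) (simp add: mult.commute)
          finally show "cn (Suc n) \<le> ennreal (ao * Xr) / ennreal r'" .
        qed
        also have "\<dots> = ennreal (ao * Xr / r')" using r ao Xr by (subst Liminf_const) (auto simp: divide_ennreal)
        finally have CO: "CO \<le> ennreal (ao * Xr / r')" .
        then obtain co where co: "CO = ennreal co" "co \<ge> 0" by (cases CO) (auto simp: top_unique)
        have co0: "co > 0" using CO0 co by (simp add: less_le)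
        have "co \<le> ao * Xr / r'" using CO co ao Xr r by (subst (asm) co(1), subst (asm) ennreal_le_iff) auto
        then have "r' * co \<le> ao * Xr" using r by (simp add: pos_le_divide_eq mult.commute)
        moreover have "ao * Xr \<le> r * co"
          using leO co r by (simp add: ennreal_mult[symmetric] ennreal_le_iff)
        ultimately have "r' * co \<le> r * co" by simp
        then show False using r co0 by simp
      qed
      then obtain n where n: "n > 0" and lt: "ennreal (ao * Xr) < ennreal r' * cn n" by blast
      have cn0: "cn n \<noteq> 0" using lt by auto
      have k0: "k n > 0" using k[OF n] by simp
      have EQh: "EQ (\<lambda>x. (norm (h n x))\<^sup>2) \<le> ennreal (k n * ((real n)\<^sup>2 * ao))"
      proof -
        have "(norm (h n x))\<^sup>2 = (real n)\<^sup>2 * (norm (g (\<Phi> n x)))\<^sup>2" for x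
        proof -
          have "(s i)\<^sup>2 = 1" for i using s by (metis power_one one_power2 power2_minus)
          then show ?thesis by (simp add: norm_power2_vec h_def power_mult_distrib sum_distrib_left)
        qed
        then have "EQ (\<lambda>x. (norm (h n x))\<^sup>2) = (\<integral>\<^sup>+x. ennreal ((real n)\<^sup>2 * (norm (g (\<Phi> n x)))\<^sup>2) * indicator cubeQ x \<partial>lebesgue)"
          by (simp add: EQ_def)
        also have "\<dots> = ennreal (k n) * (\<integral>\<^sup>+y. ennreal ((real n)\<^sup>2 * (norm (g y))\<^sup>2) * indicator (S n) y \<partial>lebesgue)"
          unfolding k_def by (rule resc[of "\<lambda>y. ennreal ((real n)\<^sup>2 * (norm (g y))\<^sup>2)"]) (use n gm in measurable)
        also have "\<dots> \<le> ennreal (k n) * (\<integral>\<^sup>+y. ennreal ((real n)\<^sup>2 * (norm (g y))\<^sup>2) * indicator Or y \<partial>lebesgue)"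
          by (intro mult_left_mono SO) simp
        also have "(\<integral>\<^sup>+y. ennreal ((real n)\<^sup>2 * (norm (g y))\<^sup>2) * indicator Or y \<partial>lebesgue) = ennreal ((real n)\<^sup>2) * ennreal ao"
          unfolding ao(1)[symmetric]
          by (subst nn_integral_cmult[symmetric]) (auto intro!: borel_measurable_times_ennreal am borel_measurable_indicator Om nn_integral_cong simp: ennreal_mult mult.assoc)
        finally show ?thesis using k0 ao by (simp add: ennreal_mult)
      qed
      have fin: "EQ (\<lambda>x. (norm (h n x))\<^sup>2) < \<infinity>" "EQ (\<lambda>x. (v n x)\<^sup>2) < \<infinity>"
        using EQh EQv[OF n] by (auto simp: order_le_less_trans)
      have EQC: "EQ (\<lambda>x. \<bar>v n x - IQ (v n)\<bar> powr p) = ennreal (k n) * cn n"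
        unfolding EQ_def v_def[symmetric] cn_def k_def mn_def[symmetric]
        using resc[OF fm n] by (simp add: v_def)
      have C'0: "EQ (\<lambda>x. \<bar>v n x - IQ (v n)\<bar> powr p) \<noteq> 0" unfolding EQC using cn0 k0 by simp
      \<comment> \<open>A constant function equals its mean, so its p-th power integral would
        vanish.\<close>
      have adm: "GQ_admissible (v n) (h n)"
        unfolding GQ_admissible_def
      proof (intro conjI notI Wn n)
        assume "\<exists>c. AE x in lebesgue_on cubeQ. v n x = c"
        then obtain c where "AE x in lebesgue_on cubeQ. v n x = c" by blast
        then have ae: "AE x in lebesgue. x \<in> cubeQ \<longrightarrow> v n x = c"
          by (subst (asm) AE_restrict_space_iff) (auto simp: cubeQ_def)
        have "IQ (v n) = IQ (\<lambda>x::real^'n. c)" unfolding IQ_def set_lebesgue_integral_def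
        proof (rule integral_cong_AE)
          show "AE x in lebesgue. indicator cubeQ x *\<^sub>R v n x = indicator cubeQ x *\<^sub>R c"
            using ae by eventually_elim (auto simp: indicator_def)
          show "(\<lambda>x. indicator cubeQ x *\<^sub>R v n x) \<in> borel_measurable lebesgue"
            using W11Q_mQ(1)[OF Wn[OF n]] by (simp add: mQ_def)
        qed (auto intro!: borel_measurable_indicator)
        also have "\<dots> = c" unfolding IQ_def set_lebesgue_integral_def
          using integral_const by (simp add: measure_def)
        finally have "EQ (\<lambda>x. \<bar>v n x - IQ (v n)\<bar> powr p) = EQ (\<lambda>x::real^'n. 0)"
          using ae p by (intro EQ_cong_AE) (auto elim!: eventually_mono)
        then show False using C'0 by (simp add: EQ_const)
      qed
      have "ennreal (enn2real (EQ (\<lambda>x. (norm (h n x))\<^sup>2)) * enn2real (EQ (\<lambda>x. (v n x)\<^sup>2)) powr (2 / d)) \<le> ennreal (r' / 4) * (ennreal (k n) * cn n)"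
      proof -
        have a': "enn2real (EQ (\<lambda>x. (norm (h n x))\<^sup>2)) \<le> k n * ((real n)\<^sup>2 * ao)"
          using EQh k0 ao by (intro enn2real_leI) auto
        have b': "enn2real (EQ (\<lambda>x. (v n x)\<^sup>2)) \<le> k n * b"
          using EQv[OF n] k0 b by (intro enn2real_leI) auto
        have "enn2real (EQ (\<lambda>x. (norm (h n x))\<^sup>2)) * enn2real (EQ (\<lambda>x. (v n x)\<^sup>2)) powr (2 / d) \<le> k n * ((real n)\<^sup>2 * ao) * (k n * b) powr (2 / d)"
          using a' b' k0 ao d by (intro mult_mono powr_mono2) auto
        \<comment> \<open>With k = n^(-d) the power k^(2/d) = n^(-2) cancels the n^2 of the squared
          gradient; the common factor k remains on both sides.\<close>
        also have "(k n * b) powr (2 / d) = (1 / (real n)\<^sup>2) * (Xr / 4)"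
        proof -
          have "k n powr (2 / d) = ((1 / real n) powr d) powr (2 / d)" unfolding k_def d_def using n by (simp add: powr_realpow)
          also have "\<dots> = (1 / real n) powr 2" using d by (simp add: powr_powr)
          also have "\<dots> = 1 / (real n)\<^sup>2" using n powr_realpow[of "1 / real n" 2] by (simp add: power_divide)
          finally show ?thesis using k0 b by (simp add: powr_mult bX)
        qed
        also have "k n * ((real n)\<^sup>2 * ao) * ((1 / (real n)\<^sup>2) * (Xr / 4)) = k n * (1/4) * (ao * Xr)" using n by simp
        finally have "ennreal (enn2real (EQ (\<lambda>x. (norm (h n x))\<^sup>2)) * enn2real (EQ (\<lambda>x. (v n x)\<^sup>2)) powr (2 / d)) \<le> ennreal (k n * (1/4)) * ennreal (ao * Xr)"
          using k0 ao Xr by (subst ennreal_mult[symmetric]) (auto intro: ennreal_leI)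
        also have "\<dots> \<le> ennreal (k n * (1/4)) * (ennreal r' * cn n)" using lt by (intro mult_left_mono) auto
        also have "\<dots> = (ennreal (k n * (1/4)) * ennreal r') * cn n" by (simp add: mult.assoc)
        also have "ennreal (k n * (1/4)) * ennreal r' = ennreal (r' / 4) * ennreal (k n)"
          using k0 r by (subst (1 2) ennreal_mult[symmetric]) (auto simp: mult.commute)
        finally show ?thesis by (simp add: mult.assoc)
      qed
      then have "GQ_quot (v n) (h n) \<le> ennreal (r' / 4)"
        unfolding GQ_quot_eq[OF fin] d_def[symmetric] p_def[symmetric]
        by (intro ennreal_divide_leI C'0) (simp only: EQC)
      then have "GQ_const TYPE('n) \<le> ennreal (r' / 4)" using GQ_const_le[OF adm] by (rule order_trans[rotated])
      also have "r' / 4 = q / 4 + e" by (simp add: r'_def add_divide_distrib)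
      also have "ennreal (q / 4 + e) = ennreal (q / 4) + ennreal e" using q e by (simp add: ennreal_plus)
      finally show ?thesis .
    qed
    then have "GQ_const TYPE('n) \<le> ennreal (q / 4)" by (rule ennreal_le_epsilon)
    also have "ennreal (q / 4) = GN_quot UNIV 0 u g / 4" unfolding q(1) using q(2) by (simp add: divide_ennreal[symmetric])
    finally show ?thesis .
  qed
qed

lemma GQ_const_upper: "GQ_const TYPE('n::finite) \<le> G_const TYPE('n) / 4"
  unfolding ennreal_le_divide_four G_const_def
proof (rule INF_greatest)
  fix ug assume "ug \<in> {(u, g). H1 (u :: real^'n \<Rightarrow> real) g \<and> \<not> (AE x in lebesgue. u x = 0)}"
  then have "H1 (fst ug) (snd ug)" "\<not> (AE x in lebesgue. fst ug x = 0)" by auto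
  from GQ_le_quot[OF this] show "4 * GQ_const TYPE('n) \<le> GN_quot UNIV 0 (fst ug) (snd ug)"
    by (simp add: ennreal_le_divide_four)
qed

subsection \<open>The lower bound\<close>

text \<open>Either |y| <= \<epsilon> |x| and the first term suffices, or |x| < |y|/\<epsilon> and
  the second does. The coefficient of |x|^p tends to 1 with \<epsilon>, so the bound is sharp enough
  for a limit of p-th powers.\<close>

lemma abs_add_powr_le:
  fixes x y :: real
  assumes "p > 0" "\<epsilon> > 0"
  shows "\<bar>x + y\<bar> powr p \<le> (1 + \<epsilon>) powr p * \<bar>x\<bar> powr p + (1 + 1 / \<epsilon>) powr p * \<bar>y\<bar> powr p"
proof (cases "\<bar>y\<bar> \<le> \<epsilon> * \<bar>x\<bar>")
  case True
  then have "\<bar>x + y\<bar> \<le> (1 + \<epsilon>) * \<bar>x\<bar>" by (simp add: distrib_right)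
  then have "\<bar>x + y\<bar> powr p \<le> ((1 + \<epsilon>) * \<bar>x\<bar>) powr p" using assms by (intro powr_mono2) auto
  also have "\<dots> = (1 + \<epsilon>) powr p * \<bar>x\<bar> powr p" using assms by (simp add: powr_mult)
  finally show ?thesis by (simp add: add_increasing2)
next
  case False
  then have "\<bar>x\<bar> \<le> 1 / \<epsilon> * \<bar>y\<bar>" using assms by (simp add: field_simps)
  then have "\<bar>x + y\<bar> \<le> (1 + 1 / \<epsilon>) * \<bar>y\<bar>" by (simp add: distrib_right)
  then have "\<bar>x + y\<bar> powr p \<le> ((1 + 1 / \<epsilon>) * \<bar>y\<bar>) powr p" using assms by (intro powr_mono2) auto
  also have "\<dots> = (1 + 1 / \<epsilon>) powr p * \<bar>y\<bar> powr p" using assms by (simp add: powr_mult)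
  finally show ?thesis by (simp add: add_increasing)
qed

lemma mQ_abs_powr:
  assumes "mQ f" "p > 0"
  shows "mQ (\<lambda>x. \<bar>f x\<bar> powr p)"
proof -
  have "(\<lambda>x. indicator cubeQ x * (\<bar>f x\<bar> powr p)) = (\<lambda>x. \<bar>indicator cubeQ x * f x\<bar> powr p)"
    by (auto simp: fun_eq_iff indicator_def)
  moreover have "(\<lambda>x. \<bar>indicator cubeQ x * f x\<bar> powr p) \<in> borel_measurable lebesgue"
    using assms(1) unfolding mQ_def by (intro powr_real_measurable borel_measurable_abs borel_measurable_const)
  ultimately show ?thesis by (simp add: mQ_def)
qed

lemma EQ_eq_0_imp_AE:
  assumes "mQ f" "EQ f = 0"
  shows "AE x in lebesgue. x \<in> cubeQ \<longrightarrow> f x \<le> 0"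
proof -
  have "AE x in lebesgue. ennreal (f x) * indicator cubeQ x = 0"
    using assms(2) unfolding EQ_def by (subst (asm) nn_integral_0_iff_AE) (auto intro: mQ_ennreal assms)
  then show ?thesis by eventually_elim (auto simp: ennreal_eq_0_iff)
qed

lemma AE_lebesgue_on_cubeQ: "(AE x in lebesgue_on cubeQ. P x) \<longleftrightarrow> (AE x in lebesgue. x \<in> cubeQ \<longrightarrow> P x)"
  by (subst AE_restrict_space_iff) (auto simp: cubeQ_def)

lemma IQ_cong_AE:
  assumes "AE x in lebesgue. x \<in> cubeQ \<longrightarrow> u x = v x" "mQ u" "mQ v"
  shows "IQ u = IQ v"
  unfolding IQ_def set_lebesgue_integral_def
proof (rule integral_cong_AE)
  show "AE x in lebesgue. indicat_real cubeQ x *\<^sub>R u x = indicat_real cubeQ x *\<^sub>R v x"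
    using assms(1) by eventually_elim (auto simp: indicator_def)
qed (use assms(2,3) in \<open>simp_all add: mQ_def\<close>)

lemma IQ_const: "IQ (\<lambda>x::real^'n::finite. c) = c"
  unfolding IQ_def set_lebesgue_integral_def by (simp add: measure_def)

lemma EQ_variance:
  fixes u :: "real^'n::finite \<Rightarrow> real"
  assumes u: "mQ u" "EQ (\<lambda>x. (u x)\<^sup>2) < \<infinity>"
  shows "EQ (\<lambda>x. (u x - IQ u)\<^sup>2) \<le> EQ (\<lambda>x. (u x)\<^sup>2)"
proof -
  define m where "m = IQ u"
  let ?I = "indicator cubeQ :: real^'n \<Rightarrow> real"
  have i1: "integrable lebesgue (\<lambda>x. ?I x * u x)"
    using EQ_square_imp_integrable[OF u] by (simp add: set_integrable_def)
  have e2: "EQ (\<lambda>x. (f x)\<^sup>2) = (\<integral>\<^sup>+x. ennreal (?I x * (f x)\<^sup>2) \<partial>lebesgue)" for f :: "real^'n \<Rightarrow> real"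
    unfolding EQ_def by (intro nn_integral_cong) (auto simp: indicator_def)
  have i2: "integrable lebesgue (\<lambda>x. ?I x * (u x)\<^sup>2)"
    using u mQ_power2[OF u(1)] unfolding e2 mQ_def by (intro integrableI_nonneg) auto
  have i0: "integrable lebesgue ?I" by (auto simp: integrable_indicator_iff)
  have I0: "(\<integral>x. ?I x \<partial>lebesgue) = 1" by (simp add: measure_def)
  have I1: "(\<integral>x. ?I x * u x \<partial>lebesgue) = m" by (simp add: m_def IQ_def set_lebesgue_integral_def)
  have eq: "?I x * (u x - m)\<^sup>2 = ?I x * (u x)\<^sup>2 - 2 * m * (?I x * u x) + m\<^sup>2 * ?I x" for x
    by (simp add: power2_eq_square algebra_simps)
  have i3: "integrable lebesgue (\<lambda>x. ?I x * (u x - m)\<^sup>2)" unfolding eq using i0 i1 i2 by simp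
  have "(\<integral>x. ?I x * (u x - m)\<^sup>2 \<partial>lebesgue) = (\<integral>x. ?I x * (u x)\<^sup>2 \<partial>lebesgue) - m\<^sup>2"
    unfolding eq using i0 i1 i2 I0 I1 by (simp add: power2_eq_square)
  then have "(\<integral>x. ?I x * (u x - m)\<^sup>2 \<partial>lebesgue) \<le> (\<integral>x. ?I x * (u x)\<^sup>2 \<partial>lebesgue)" by simp
  then have "ennreal (\<integral>x. ?I x * (u x - m)\<^sup>2 \<partial>lebesgue) \<le> ennreal (\<integral>x. ?I x * (u x)\<^sup>2 \<partial>lebesgue)" by (rule ennreal_leI)
  then show ?thesis unfolding e2 m_def[symmetric] using i2 i3 by (simp add: nn_integral_eq_integral)
qed

lemma GN_bound_of_G_const:
  assumes \<kappa>: "\<kappa> > 0" "ennreal \<kappa> \<le> G_const TYPE('n::finite)"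
  shows "GN_bound TYPE('n) (2 + 4 / real CARD('n)) \<kappa>"
  unfolding GN_bound_def
proof (intro allI impI)
  fix w :: "real^'n \<Rightarrow> real" and g assume H: "H1 w g"
  define p where "p = 2 + 4 / real CARD('n)"
  define A where "A = (\<integral>x. (norm (g x))\<^sup>2 \<partial>lebesgue)"
  define B where "B = (\<integral>x. (w x)\<^sup>2 \<partial>lebesgue)"
  define C where "C = (\<integral>\<^sup>+x. ennreal (\<bar>w x\<bar> powr p) \<partial>lebesgue)"
  have Ae: "(\<integral>\<^sup>+x. ennreal ((norm (g x))\<^sup>2) \<partial>lebesgue) = ennreal A"
    unfolding A_def using H by (intro nn_integral_eq_integral) (auto simp: H1_def)
  have Be: "(\<integral>\<^sup>+x. ennreal ((w x)\<^sup>2) \<partial>lebesgue) = ennreal B"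
    unfolding B_def using H by (intro nn_integral_eq_integral) (auto simp: H1_def)
  have AB: "A \<ge> 0" "B \<ge> 0" by (auto simp: A_def B_def)
  show "ennreal \<kappa> * (\<integral>\<^sup>+x. ennreal (\<bar>w x\<bar> powr (2 + 4 / real CARD('n))) \<partial>lebesgue)
       \<le> ennreal ((\<integral>x. (norm (g x))\<^sup>2 \<partial>lebesgue) * (\<integral>x. (w x)\<^sup>2 \<partial>lebesgue) powr (2 / real CARD('n)))"
    unfolding p_def[symmetric] A_def[symmetric] B_def[symmetric] C_def[symmetric]
  \<comment> \<open>For C = 0 the left-hand side is 0. Otherwise w is an admissible competitor, and
    C cannot be infinite, since its quotient would then be 0 and below \<kappa>.\<close>
  proof (cases "C = 0")
    case False
    have "\<not> (AE x in lebesgue. w x = 0)"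
    proof
      assume "AE x in lebesgue. w x = 0"
      then have "C = (\<integral>\<^sup>+x. 0 \<partial>(lebesgue :: (real^'n) measure))" unfolding C_def
        by (intro nn_integral_cong_AE) (auto elim!: eventually_mono)
      then show False using False by simp
    qed
    then have "G_const TYPE('n) \<le> GN_quot UNIV 0 w g" unfolding G_const_def
      by (intro INF_lower2[of "(w, g)"]) (use H in auto)
    also have "GN_quot UNIV 0 w g = ennreal (A * B powr (2 / real CARD('n))) / C"
      unfolding GN_quot_def Let_def using Ae Be AB by (simp add: C_def p_def)
    finally have le: "ennreal \<kappa> \<le> ennreal (A * B powr (2 / real CARD('n))) / C" using \<kappa>(2) by (rule order_trans[rotated])
    have Ct: "C \<noteq> top"
    proof
      assume "C = top"
      then show False using le \<kappa>(1) by simp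
    qed
    have "ennreal \<kappa> * C \<le> ennreal (A * B powr (2 / real CARD('n))) / C * C"
      using le by (rule mult_right_mono) simp
    also have "\<dots> = ennreal (A * B powr (2 / real CARD('n)))"
      using False Ct ennreal_divide_self[of C] by (simp add: ennreal_divide_times top.not_eq_extremum)
    finally show "ennreal \<kappa> * C \<le> ennreal (A * B powr (2 / real CARD('n)))" .
  qed simp
qed

lemma EQ_pos_of_square:
  fixes u :: "real^'n::finite \<Rightarrow> real"
  assumes "mQ u" "EQ (\<lambda>x. (u x)\<^sup>2) \<noteq> 0" "p > 0"
  shows "EQ (\<lambda>x. \<bar>u x\<bar> powr p) \<noteq> 0"
proof
  assume "EQ (\<lambda>x. \<bar>u x\<bar> powr p) = 0"
  then have "AE x in lebesgue. x \<in> cubeQ \<longrightarrow> \<bar>u x\<bar> powr p \<le> 0"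
    by (rule EQ_eq_0_imp_AE[OF mQ_abs_powr[OF assms(1,3)]])
  then have "AE x in lebesgue. x \<in> cubeQ \<longrightarrow> (u x)\<^sup>2 = 0"
    by eventually_elim (metis abs_eq_0 antisym powr_ge_zero powr_eq_0_iff zero_power2)
  then have "EQ (\<lambda>x. (u x)\<^sup>2) = EQ (\<lambda>x::real^'n. 0)" by (rule EQ_cong_AE)
  then show False using assms(2) by (simp add: EQ_const)
qed

text \<open>The quotient is invariant under scaling, and subtracting the mean does not increase it.\<close>

lemma normalize_competitor:
  fixes u :: "real^'n::finite \<Rightarrow> real"
  assumes adm: "GQ_admissible u g" and quot: "GQ_quot u g \<le> ennreal \<rho>" and \<rho>: "\<rho> > 0"
    and fin: "\<And>(v::real^'n \<Rightarrow> real) h. W11Q v h \<Longrightarrow> EQ (\<lambda>x. (norm (h x))\<^sup>2) < \<infinity> \<Longrightarrow> EQ (\<lambda>x. (v x)\<^sup>2) < \<infinity> \<Longrightarrow>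
      EQ (\<lambda>x. \<bar>v x\<bar> powr (2 + 4 / real CARD('n))) < \<infinity>"
  obtains v :: "real^'n \<Rightarrow> real" and h a c where "W11Q v h" "IQ v = 0" "EQ (\<lambda>x. (v x)\<^sup>2) = 1" "EQ (\<lambda>x. (norm (h x))\<^sup>2) = ennreal a"
    "EQ (\<lambda>x. \<bar>v x\<bar> powr (2 + 4 / real CARD('n))) = ennreal c" "a \<ge> 0" "c \<ge> 0" "a \<le> \<rho> * c"
proof -
  define d where "d = real CARD('n)"
  define p where "p = 2 + 4 / d"
  have d: "d > 0" by (simp add: d_def)
  have p: "p > 0" using d by (simp add: p_def add_pos_pos)
  have W: "W11Q u g" and nc: "\<not> (\<exists>c. AE x in lebesgue_on cubeQ. u x = c)" using adm by (auto simp: GQ_admissible_def)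
  have finA: "EQ (\<lambda>x. (norm (g x))\<^sup>2) < \<infinity>" and finB: "EQ (\<lambda>x. (u x)\<^sup>2) < \<infinity>"
  proof -
    have "GQ_quot u g \<noteq> \<infinity>" using quot by (auto simp: top_unique)
    then have "\<not> (EQ (\<lambda>x. (norm (g x))\<^sup>2) = \<infinity> \<or> EQ (\<lambda>x. (u x)\<^sup>2) = \<infinity>)"
      unfolding GQ_quot_def GN_quot_def Let_def EQ_def[symmetric] by (auto split: if_splits)
    then show "EQ (\<lambda>x. (norm (g x))\<^sup>2) < \<infinity>" "EQ (\<lambda>x. (u x)\<^sup>2) < \<infinity>" by (auto simp: top.not_eq_extremum)
  qed
  define m where "m = IQ u"
  \<comment> \<open>Written as a linear combination with the constant function 1 and its gradient 0,
    so that \<open>W11Q_lincomb\<close> applies literally.\<close>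
  define w where "w x = 1 * u x + (- m) * 1" for x
  define gw where "gw x = 1 *\<^sub>R g x + (- m) *\<^sub>R (0::real^'n)" for x
  have Ww: "W11Q w gw" unfolding w_def gw_def by (rule W11Q_lincomb[OF W W11Q_const])
  have weq: "w x = u x - m" "gw x = g x" for x by (auto simp: w_def gw_def)
  note mw = W11Q_mQ(1)[OF Ww] and mg = W11Q_mQ(2)[OF W]
  define A where "A = enn2real (EQ (\<lambda>x. (norm (g x))\<^sup>2))"
  have A: "EQ (\<lambda>x. (norm (g x))\<^sup>2) = ennreal A" "A \<ge> 0" using finA by (auto simp: A_def)
  define B where "B = enn2real (EQ (\<lambda>x. (u x)\<^sup>2))"
  have B: "EQ (\<lambda>x. (u x)\<^sup>2) = ennreal B" "B \<ge> 0" using finB by (auto simp: B_def)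
  have bB: "EQ (\<lambda>x. (w x)\<^sup>2) \<le> EQ (\<lambda>x. (u x)\<^sup>2)" unfolding weq m_def by (rule EQ_variance[OF W11Q_mQ(1)[OF W] finB])
  define b where "b = enn2real (EQ (\<lambda>x. (w x)\<^sup>2))"
  have finb: "EQ (\<lambda>x. (w x)\<^sup>2) < \<infinity>" using bB finB by (rule order_le_less_trans)
  have b: "EQ (\<lambda>x. (w x)\<^sup>2) = ennreal b" "b \<ge> 0" using finb by (auto simp: b_def)
  have bB': "b \<le> B" using bB B b by (simp add: ennreal_le_iff)
  have b0: "b \<noteq> 0"
  proof
    assume "b = 0"
    then have "AE x in lebesgue. x \<in> cubeQ \<longrightarrow> (w x)\<^sup>2 \<le> 0"
      using b by (intro EQ_eq_0_imp_AE mQ_power2 mw) simp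
    then have "AE x in lebesgue. x \<in> cubeQ \<longrightarrow> u x = m" by eventually_elim (simp add: weq)
    then show False using nc AE_lebesgue_on_cubeQ by blast
  qed
  then have b_pos: "b > 0" using b by simp
  have finC: "EQ (\<lambda>x. \<bar>w x\<bar> powr p) < \<infinity>"
    unfolding p_def d_def by (rule fin[OF Ww]) (use finA finb in \<open>simp_all add: weq\<close>)
  define C where "C = enn2real (EQ (\<lambda>x. \<bar>w x\<bar> powr p))"
  have C: "EQ (\<lambda>x. \<bar>w x\<bar> powr p) = ennreal C" "C \<ge> 0" using finC by (auto simp: C_def)
  have C0: "EQ (\<lambda>x. \<bar>w x\<bar> powr p) \<noteq> 0" using b b0 p by (intro EQ_pos_of_square mw) auto
  have "ennreal (A * B powr (2 / d)) / EQ (\<lambda>x. \<bar>w x\<bar> powr p) \<le> ennreal \<rho>"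
    using quot unfolding GQ_quot_eq[OF finA finB] A_def[symmetric] B_def[symmetric] d_def[symmetric] p_def[symmetric] m_def[symmetric] weq .
  then have "ennreal (A * B powr (2 / d)) \<le> ennreal \<rho> * EQ (\<lambda>x. \<bar>w x\<bar> powr p)"
    by (rule ennreal_divide_leD) (use C0 \<rho> in auto)
  then have "ennreal (A * B powr (2 / d)) \<le> ennreal (\<rho> * C)" using C \<rho> by (simp add: ennreal_mult)
  then have AB: "A * B powr (2 / d) \<le> \<rho> * C" using C \<rho> by (subst (asm) ennreal_le_iff) auto
  define l where "l = 1 / sqrt b"
  have l: "l > 0" "l\<^sup>2 = 1 / b" using b_pos by (auto simp: l_def power_divide)
  define v where "v x = l * w x + 0 * 1" for x
  define h where "h x = l *\<^sub>R gw x + 0 *\<^sub>R (0::real^'n)" for x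
  have Wv: "W11Q v h" unfolding v_def h_def by (rule W11Q_lincomb[OF Ww W11Q_const])
  have veq: "v x = l * w x" "h x = l *\<^sub>R g x" for x by (auto simp: v_def h_def weq)
  have IQv: "IQ v = 0"
  proof -
    have "IQ w = IQ u - IQ (\<lambda>x::real^'n. m)" unfolding weq[abs_def] IQ_def
      using W by (intro set_integral_diff(2)) (auto simp: W11Q_def intro!: set_integrable_IQ)
    then have "IQ w = 0" by (simp add: IQ_const m_def)
    then show ?thesis unfolding veq[abs_def] by (simp add: IQ_cmult)
  qed
  have EQv: "EQ (\<lambda>x. (v x)\<^sup>2) = 1"
  proof -
    have "EQ (\<lambda>x. (v x)\<^sup>2) = EQ (\<lambda>x. (1 / b) * (w x)\<^sup>2)" by (simp add: veq power_mult_distrib l)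
    also have "\<dots> = ennreal (1 / b) * ennreal b" unfolding b(1)[symmetric] using b_pos by (intro EQ_cmult mQ_power2 mw) auto
    also have "\<dots> = 1" using b_pos by (subst ennreal_mult[symmetric]) auto
    finally show ?thesis .
  qed
  have EQh: "EQ (\<lambda>x. (norm (h x))\<^sup>2) = ennreal (1 / b * A)"
  proof -
    have "EQ (\<lambda>x. (norm (h x))\<^sup>2) = EQ (\<lambda>x. (1 / b) * (norm (g x))\<^sup>2)" by (simp add: veq power_mult_distrib l)
    also have "\<dots> = ennreal (1 / b) * ennreal A" unfolding A(1)[symmetric] using b_pos by (intro EQ_cmult mQ_norm_power2 mg) auto
    also have "\<dots> = ennreal (1 / b * A)" using b_pos A by (intro ennreal_mult[symmetric]) auto
    finally show ?thesis .
  qed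
  have EQc: "EQ (\<lambda>x. \<bar>v x\<bar> powr p) = ennreal (l powr p * C)"
  proof -
    have "EQ (\<lambda>x. \<bar>v x\<bar> powr p) = EQ (\<lambda>x. l powr p * \<bar>w x\<bar> powr p)"
      using l by (simp add: veq abs_mult powr_mult)
    also have "\<dots> = ennreal (l powr p) * ennreal C" unfolding C(1)[symmetric] using p by (intro EQ_cmult mQ_abs_powr mw) auto
    finally show ?thesis using C by (simp add: ennreal_mult)
  qed
  \<comment> \<open>Since p = 2 (1 + 2/d), scaling by b^(-1/2) multiplies the p-th power by b^(-1)
    b^(-2/d), exactly the degree of the numerator.\<close>
  have lp: "l powr p = 1 / (b * b powr (2 / d))"
  proof -
    have "l powr p = (b powr (- 1 / 2)) powr p" using b_pos by (simp add: l_def powr_half_sqrt[symmetric] powr_minus_divide)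
    also have "\<dots> = b powr (- (1 + 2 / d))" unfolding powr_powr by (simp add: p_def add_divide_distrib)
    also have "\<dots> = 1 / b powr (1 + 2 / d)" by (rule powr_minus_divide)
    also have "b powr (1 + 2 / d) = b * b powr (2 / d)" using b_pos by (simp add: powr_add)
    finally show ?thesis .
  qed
  have "1 / b * A \<le> \<rho> * (l powr p * C)"
  proof -
    have X: "b powr (2 / d) > 0" using b_pos by simp
    have "A * b powr (2 / d) \<le> A * B powr (2 / d)" using A bB' b d by (intro mult_left_mono powr_mono2) auto
    also have "\<dots> \<le> \<rho> * C" by (rule AB)
    finally have "A * b powr (2 / d) / (b * b powr (2 / d)) \<le> \<rho> * C / (b * b powr (2 / d))"
      using b_pos X by (intro divide_right_mono) auto
    moreover have "A * b powr (2 / d) / (b * b powr (2 / d)) = 1 / b * A" using X by simp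
    ultimately show ?thesis unfolding lp by simp
  qed
  then show thesis
    using that[OF Wv IQv EQv EQh EQc[unfolded p_def d_def]] b_pos A C by (simp add: p_def d_def)
qed

text \<open>The direct method under the assumption 4 G_Q < G. The strict gap is spent on \<kappa>'
  in \<open>GN_cube\<close>, first to bound a minimizing sequence and then to make it converge in
  L^p; the limit attains the infimum, against the hypothesis.\<close>

lemma GQ_const_lower:
  assumes nomin: "\<not> (\<exists>(u :: real^'n::finite \<Rightarrow> real) g. GQ_admissible u g \<and> GQ_quot u g = GQ_const TYPE('n))"
  shows "G_const TYPE('n) / 4 \<le> GQ_const TYPE('n)"
proof (rule ccontr)
  assume "\<not> G_const TYPE('n) / 4 \<le> GQ_const TYPE('n)"
  then have lt: "GQ_const TYPE('n) < G_const TYPE('n) / 4" by simp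
  have lt4: "4 * GQ_const TYPE('n) < G_const TYPE('n)"
  proof (rule ccontr)
    assume "\<not> 4 * GQ_const TYPE('n) < G_const TYPE('n)"
    then have "G_const TYPE('n) / 4 \<le> GQ_const TYPE('n) * 4 / 4"
      by (intro divide_right_mono_ennreal) (simp add: mult.commute)
    also have "\<dots> = GQ_const TYPE('n)" by (simp add: ennreal_mult_divide_eq)
    finally show False using lt by simp
  qed
  then obtain z where z: "4 * GQ_const TYPE('n) < z" "z < G_const TYPE('n)" using dense by blast
  obtain q where q: "GQ_const TYPE('n) = ennreal q" "q \<ge> 0" using lt by (cases "GQ_const TYPE('n)") auto
  obtain \<kappa> where \<kappa>: "z = ennreal \<kappa>" "\<kappa> \<ge> 0" using z(2) by (cases z) auto
  have "ennreal (4 * q) < ennreal \<kappa>" using z(1) q \<kappa> by (simp add: ennreal_mult)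
  then have q\<kappa>: "4 * q < \<kappa>" using q by (simp add: ennreal_less_iff)
  then have \<kappa>0: "\<kappa> > 0" using q by linarith
  define d where "d = real CARD('n)"
  define p where "p = 2 + 4 / d"
  have d: "d > 0" by (simp add: d_def)
  have p: "p > 0" using d by (simp add: p_def add_pos_pos)
  have GN: "GN_bound TYPE('n) p \<kappa>" unfolding p_def d_def
    by (rule GN_bound_of_G_const[OF \<kappa>0]) (use z(2) \<kappa> in simp)
  define \<kappa>' where "\<kappa>' = (4 * q + \<kappa>) / 2"
  have \<kappa>': "0 < \<kappa>'" "\<kappa>' < \<kappa>" "4 * q < \<kappa>'" using q\<kappa> \<kappa>0 q by (auto simp: \<kappa>'_def)
  obtain K where K: "K \<ge> 0" and KC: "\<And>(u::real^'n \<Rightarrow> real) g. W11Q u g \<Longrightarrow> EQ (\<lambda>x. (norm (g x))\<^sup>2) < \<infinity> \<Longrightarrow> EQ (\<lambda>x. (u x)\<^sup>2) < \<infinity> \<Longrightarrow>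
    ennreal (\<kappa>' / 4) * EQ (\<lambda>x. \<bar>u x\<bar> powr p) \<le> ennreal ((enn2real (EQ (\<lambda>x. (norm (g x))\<^sup>2)) + K * enn2real (EQ (\<lambda>x. (u x)\<^sup>2)))
       * enn2real (EQ (\<lambda>x. (u x)\<^sup>2)) powr (2 / d))"
    unfolding d_def by (rule GN_cube[OF GN p \<kappa>'(1,2)]) blast
  have finC: "EQ (\<lambda>x. \<bar>u x\<bar> powr p) < \<infinity>"
    if "W11Q u g" "EQ (\<lambda>x. (norm (g x))\<^sup>2) < \<infinity>" "EQ (\<lambda>x. (u x)\<^sup>2) < \<infinity>" for u :: "real^'n \<Rightarrow> real" and g
  proof -
    have "ennreal (\<kappa>' / 4) * EQ (\<lambda>x. \<bar>u x\<bar> powr p) < \<infinity>"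
      using KC[OF that] by (rule order_le_less_trans) simp
    then show ?thesis using \<kappa>' by (auto simp: ennreal_mult_less_top)
  qed
  \<comment> \<open>Half the gap: q + \<delta> lies midway between q and \<kappa>'/4.\<close>
  define \<delta> where "\<delta> = (\<kappa>' / 4 - q) / 2"
  have \<delta>: "\<delta> > 0" using \<kappa>' by (simp add: \<delta>_def)
  define P where "P n w a c \<longleftrightarrow> W11Q (fst w) (snd w) \<and> IQ (fst w) = 0 \<and> EQ (\<lambda>x. (fst w x)\<^sup>2) = 1 \<and> EQ (\<lambda>x. (norm (snd w x))\<^sup>2) = ennreal a \<and>
     EQ (\<lambda>x. \<bar>fst w x\<bar> powr p) = ennreal c \<and> a \<ge> 0 \<and> c \<ge> 0 \<and> a \<le> (q + \<delta> / (real n + 1)) * c"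
    for n :: nat and w :: "(real^'n \<Rightarrow> real) \<times> (real^'n \<Rightarrow> real^'n)" and a c
  have "\<exists>w a c. P n w a c" for n
  proof -
    have pos: "0 < q + \<delta> / (real n + 1)" using q \<delta> by (simp add: add_nonneg_pos)
    have "GQ_const TYPE('n) < ennreal (q + \<delta> / (real n + 1))"
      unfolding q(1) using q \<delta> by (subst ennreal_less_iff) auto
    then obtain ug where adm: "GQ_admissible (fst ug :: real^'n \<Rightarrow> real) (snd ug)" and qt: "GQ_quot (fst ug) (snd ug) < ennreal (q + \<delta> / (real n + 1))"
      unfolding GQ_const_def INF_less_iff by auto
    show ?thesis
    proof (rule normalize_competitor[OF adm less_imp_le[OF qt] pos])
      fix v :: "real^'n \<Rightarrow> real" and h
      assume "W11Q v h" "EQ (\<lambda>x. (norm (h x))\<^sup>2) < \<infinity>" "EQ (\<lambda>x. (v x)\<^sup>2) < \<infinity>"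
      from finC[OF this] show "EQ (\<lambda>x. \<bar>v x\<bar> powr (2 + 4 / real CARD('n))) < \<infinity>" by (simp only: p_def d_def)
    next
      fix v :: "real^'n \<Rightarrow> real" and h a c
      assume "W11Q v h" "IQ v = 0" "EQ (\<lambda>x. (v x)\<^sup>2) = 1" "EQ (\<lambda>x. (norm (h x))\<^sup>2) = ennreal a"
        "EQ (\<lambda>x. \<bar>v x\<bar> powr (2 + 4 / real CARD('n))) = ennreal c" "a \<ge> 0" "c \<ge> 0" "a \<le> (q + \<delta> / (real n + 1)) * c"
      then have "P n (v, h) a c" by (simp add: P_def p_def d_def)
      then show ?thesis by blast
    qed
  qed
  then obtain w a c where P: "\<And>n. P n (w n) (a n) (c n)" by metis
  define v h where "v n = fst (w n)" and "h n = snd (w n)" for n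
  have W: "W11Q (v n) (h n)" and IQv: "IQ (v n) = 0" and EQv: "EQ (\<lambda>x. (v n x)\<^sup>2) = 1"
    and EQh: "EQ (\<lambda>x. (norm (h n x))\<^sup>2) = ennreal (a n)" and EQc: "EQ (\<lambda>x. \<bar>v n x\<bar> powr p) = ennreal (c n)"
    and a0: "a n \<ge> 0" and c0: "c n \<ge> 0" and ac: "a n \<le> (q + \<delta> / (real n + 1)) * c n" for n
    using P[of n] unfolding P_def v_def h_def by auto
  note mv = W11Q_mQ(1)[OF W] and mh = W11Q_mQ(2)[OF W]
  \<comment> \<open>With B = 1 the cube inequality reads \<kappa>'/4 c <= a + K, while
    near-minimality gives a <= (q + \<delta>) c; the coefficients of c differ by \<delta>, so
    \<delta> c <= K.\<close>
  have c_le: "c n \<le> K / \<delta>" for n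
  proof -
    have "ennreal (\<kappa>' / 4) * ennreal (c n) \<le> ennreal (a n + K)"
      using KC[OF W[of n]] a0[of n] by (simp add: EQv EQh EQc)
    then have "ennreal (\<kappa>' / 4 * c n) \<le> ennreal (a n + K)" using \<kappa>' c0 by (subst ennreal_mult) auto
    then have "\<kappa>' / 4 * c n \<le> a n + K" using a0[of n] K by (subst (asm) ennreal_le_iff) auto
    also have "a n \<le> (q + \<delta>) * c n"
    proof -
      have "\<delta> / (real n + 1) \<le> \<delta>" using \<delta> by (simp add: divide_le_eq)
      then have "(q + \<delta> / (real n + 1)) * c n \<le> (q + \<delta>) * c n" using c0 by (intro mult_right_mono) auto
      then show ?thesis using ac[of n] by linarith
    qed
    finally have "\<kappa>' / 4 * c n - (q + \<delta>) * c n \<le> K" by simp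
    moreover have "\<kappa>' / 4 * c n - (q + \<delta>) * c n = \<delta> * c n"
    proof -
      have "\<kappa>' / 4 - (q + \<delta>) = \<delta>" by (simp add: \<delta>_def field_simps)
      then show ?thesis by (metis left_diff_distrib)
    qed
    ultimately show ?thesis using \<delta> by (simp add: pos_le_divide_eq mult.commute)
  qed
  \<comment> \<open>The summand 1 lets M bound the square integrals, which equal 1, as well as the
    energies.\<close>
  define M where "M = (q + \<delta>) * (K / \<delta>) + 1"
  have M1: "M \<ge> 1" using q \<delta> K by (simp add: M_def)
  have a_le: "a n \<le> M" for n
  proof -
    have "\<delta> / (real n + 1) \<le> \<delta>" using \<delta> by (simp add: divide_le_eq)
    then have "(q + \<delta> / (real n + 1)) * c n \<le> (q + \<delta>) * (K / \<delta>)"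
      using c0[of n] c_le[of n] q \<delta> by (intro mult_mono) auto
    then show ?thesis using ac[of n] by (simp add: M_def)
  qed
  obtain s :: "nat \<Rightarrow> nat" where s: "strict_mono s" and sC: "\<And>e. e > 0 \<Longrightarrow> \<exists>N. \<forall>i\<ge>N. \<forall>j\<ge>N. EQ (\<lambda>x. (v (s i) x - v (s j) x)\<^sup>2) \<le> ennreal e"
  proof (rule rellich[where u=v and g=h and M=M, OF W])
    show "EQ (\<lambda>x. (norm (h n x))\<^sup>2) \<le> ennreal M" for n unfolding EQh using a_le by (rule ennreal_leI)
    show "EQ (\<lambda>x. (v n x)\<^sup>2) \<le> ennreal M" for n unfolding EQv using M1 by simp
    show "M > 0" using M1 by simp
  qed blast
  obtain u where us: "set_integrable lebesgue cubeQ u" and ufin: "EQ (\<lambda>x. (u x)\<^sup>2) < \<infinity>"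
    and uconv: "\<And>e. e > 0 \<Longrightarrow> \<exists>N. \<forall>i\<ge>N. EQ (\<lambda>x. (v (s i) x - u x)\<^sup>2) \<le> ennreal e"
    by (rule L2_complete[of "\<lambda>n. v (s n)"]) (use mv sC EQv in auto)
  have mu: "mQ u" by (rule mQ_set_integrable[OF us])
  have "bounded (range (\<lambda>n. a (s n)))"
    unfolding bounded_iff using a0 a_le by (intro exI[of _ M]) auto
  then obtain \<alpha> r where r: "strict_mono r" and \<alpha>lim: "((\<lambda>n. a (s n)) \<circ> r) \<longlonglongrightarrow> \<alpha>"
    using bounded_imp_convergent_subsequence by blast
  define t where "t n = s (r n)" for n
  have tn: "t n \<ge> n" for n unfolding t_def using seq_suble[OF s, of "r n"] seq_suble[OF r, of n] by linarith
  have alim: "(\<lambda>n. a (t n)) \<longlonglongrightarrow> \<alpha>" using \<alpha>lim by (simp add: t_def o_def)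
  have \<alpha>0: "\<alpha> \<ge> 0" by (rule LIMSEQ_le_const[OF alim]) (use a0 in auto)
  have ev: "eventually (\<lambda>n. EQ (\<lambda>x. (v (t n) x - u x)\<^sup>2) \<le> ennreal e) sequentially" if e: "e > 0" for e
  proof -
    obtain N where N: "\<forall>i\<ge>N. EQ (\<lambda>x. (v (s i) x - u x)\<^sup>2) \<le> ennreal e" using uconv[OF e] by blast
    show ?thesis unfolding eventually_sequentially t_def
      using N seq_suble[OF r] by (meson order_trans)
  qed
  \<comment> \<open>The limit u is so far only a square-integrable function; lower semicontinuity
    supplies its weak gradient, with energy at most the limit \<alpha> of the energies.\<close>
  obtain g where Wu: "W11Q u g" and gA: "EQ (\<lambda>x. (norm (g x))\<^sup>2) \<le> ennreal \<alpha>"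
  proof (rule dirichlet_lsc[OF us \<alpha>0])
    fix e :: real assume e: "e > 0"
    have "eventually (\<lambda>n. a (t n) < \<alpha> + e) sequentially" using e by (intro order_tendstoD(2)[OF alim]) simp
    then have "eventually (\<lambda>n. a (t n) < \<alpha> + e \<and> EQ (\<lambda>x. (v (t n) x - u x)\<^sup>2) \<le> ennreal e) sequentially"
      using ev[OF e] by eventually_elim simp
    then obtain n where n: "a (t n) < \<alpha> + e \<and> EQ (\<lambda>x. (v (t n) x - u x)\<^sup>2) \<le> ennreal e"
      using eventually_happens'[OF sequentially_bot] by blast
    then have "EQ (\<lambda>x. (norm (h (t n) x))\<^sup>2) \<le> ennreal (\<alpha> + e)" unfolding EQh by (intro ennreal_leI) simp
    then show "\<exists>v h. W11Q v h \<and> EQ (\<lambda>x. (v x - u x)\<^sup>2) \<le> ennreal e \<and> EQ (\<lambda>x. (norm (h x))\<^sup>2) \<le> ennreal (\<alpha> + e)"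
      using W n by blast
  qed blast
  note mg = W11Q_mQ(2)[OF Wu]
  have gfin: "EQ (\<lambda>x. (norm (g x))\<^sup>2) < \<infinity>" using gA by (rule order_le_less_trans) simp
  have IQu: "IQ u = 0"
  proof (rule ccontr)
    assume nz: "IQ u \<noteq> 0"
    define e where "e = (\<bar>IQ u\<bar> / 2)\<^sup>2"
    have e: "e > 0" "sqrt e = \<bar>IQ u\<bar> / 2" using nz by (auto simp: e_def)
    obtain n where n: "EQ (\<lambda>x. (v (t n) x - u x)\<^sup>2) \<le> ennreal e"
      using eventually_happens'[OF sequentially_bot ev[OF e(1)]] by blast
    have "ennreal \<bar>IQ (v (t n)) - IQ u\<bar> \<le> EQ (\<lambda>x. \<bar>v (t n) x - u x\<bar>)"
      using W us by (intro IQ_diff_le_EQ) (auto simp: W11Q_def)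
    also have "\<dots> \<le> ennreal (sqrt e)" by (intro EQ_abs_le mQ_diff mv mu n e)
    finally have "ennreal \<bar>IQ u\<bar> \<le> ennreal (\<bar>IQ u\<bar> / 2)" by (simp add: IQv e)
    then have "\<bar>IQ u\<bar> \<le> \<bar>IQ u\<bar> / 2" by (subst (asm) ennreal_le_iff) auto
    then show False using nz by simp
  qed
  \<comment> \<open>Strong convergence keeps the normalization away from 0: for u = 0, a squared
    distance of 1/4 would give 1 <= 2 * 1/4.\<close>
  have u0: "EQ (\<lambda>x. (u x)\<^sup>2) \<noteq> 0"
  proof
    assume z: "EQ (\<lambda>x. (u x)\<^sup>2) = 0"
    obtain n where n: "EQ (\<lambda>x. (v (t n) x - u x)\<^sup>2) \<le> ennreal (1/4)"
      using eventually_happens'[OF sequentially_bot ev[of "1/4"]] by auto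
    have "1 = EQ (\<lambda>x. ((v (t n) x - u x) + u x)\<^sup>2)" by (simp add: EQv)
    also have "\<dots> \<le> 2 * EQ (\<lambda>x. (v (t n) x - u x)\<^sup>2) + 2 * EQ (\<lambda>x. (u x)\<^sup>2)"
      by (intro EQ_square_add_le mQ_diff mv mu)
    also have "\<dots> \<le> ennreal 2 * ennreal (1/4)" using n z by (simp add: mult_left_mono)
    also have "\<dots> = ennreal (1/2)" by (subst ennreal_mult[symmetric]) auto
    finally have "ennreal 1 \<le> ennreal (1/2)" by simp
    then show False by (subst (asm) ennreal_le_iff) auto
  qed
  \<comment> \<open>The square integral of u stands in the numerator of the quotient, so an upper
    bound is what the minimality needs.\<close>
  have uB: "EQ (\<lambda>x. (u x)\<^sup>2) \<le> 1"
  proof -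
    have "EQ (\<lambda>x. (u x)\<^sup>2) \<le> 1 + ennreal \<eta>" if \<eta>: "\<eta> > 0" for \<eta>
    proof -
      define \<epsilon> where "\<epsilon> = \<eta> / 2"
      have \<epsilon>: "\<epsilon> > 0" "1 + 1 / \<epsilon> > 0" using \<eta> by (auto simp: \<epsilon>_def add_pos_pos)
      define e where "e = (\<eta> / 2) / (1 + 1 / \<epsilon>)"
      have e: "e > 0" unfolding e_def using \<eta> \<epsilon> by (intro divide_pos_pos) auto
      have ee: "(1 + 1 / \<epsilon>) * e = \<eta> / 2"       proof -
        have "x * (y / x) = y" if "x > 0" for x y :: real using that by simp
        then show ?thesis unfolding e_def using \<epsilon>(2) by blast
      qed
      obtain n where n: "EQ (\<lambda>x. (v (t n) x - u x)\<^sup>2) \<le> ennreal e"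
        using eventually_happens'[OF sequentially_bot ev[OF e]] by blast
      have "EQ (\<lambda>x. (u x)\<^sup>2) \<le> EQ (\<lambda>x. (1 + \<epsilon>) * (v (t n) x)\<^sup>2 + (1 + 1 / \<epsilon>) * (v (t n) x - u x)\<^sup>2)"
      proof (rule EQ_mono)
        fix x
        show "(u x)\<^sup>2 \<le> (1 + \<epsilon>) * (v (t n) x)\<^sup>2 + (1 + 1 / \<epsilon>) * (v (t n) x - u x)\<^sup>2"
          using norm_add_square_le[OF \<epsilon>(1), of "v (t n) x" "u x - v (t n) x"] by (simp add: power2_commute[of "u x"])
      qed
      also have "\<dots> = EQ (\<lambda>x. (1 + \<epsilon>) * (v (t n) x)\<^sup>2) + EQ (\<lambda>x. (1 + 1 / \<epsilon>) * (v (t n) x - u x)\<^sup>2)"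
        using \<epsilon> by (intro EQ_add mQ_cmult mQ_power2 mQ_diff mv mu) auto
      also have "EQ (\<lambda>x. (1 + \<epsilon>) * (v (t n) x)\<^sup>2) = ennreal (1 + \<epsilon>) * EQ (\<lambda>x. (v (t n) x)\<^sup>2)"
        using \<epsilon> by (intro EQ_cmult mQ_power2 mv) auto
      also have "EQ (\<lambda>x. (1 + 1 / \<epsilon>) * (v (t n) x - u x)\<^sup>2) = ennreal (1 + 1 / \<epsilon>) * EQ (\<lambda>x. (v (t n) x - u x)\<^sup>2)"
        using \<epsilon> by (intro EQ_cmult mQ_power2 mQ_diff mv mu) auto
      also have "ennreal (1 + \<epsilon>) * EQ (\<lambda>x. (v (t n) x)\<^sup>2) + ennreal (1 + 1 / \<epsilon>) * EQ (\<lambda>x. (v (t n) x - u x)\<^sup>2)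
        \<le> ennreal (1 + \<epsilon>) * 1 + ennreal (1 + 1 / \<epsilon>) * ennreal e"
        using n by (intro add_mono mult_left_mono) (auto simp: EQv)
      also have "ennreal (1 + 1 / \<epsilon>) * ennreal e = ennreal (\<eta> / 2)"
        unfolding ee[symmetric] using \<epsilon> e by (intro ennreal_mult[symmetric]) auto
      also have "ennreal (1 + \<epsilon>) * 1 + ennreal (\<eta> / 2) = ennreal (1 + \<eta>)"
        using \<eta> by (simp only: mult_1_right) (subst ennreal_plus[symmetric], auto simp: \<epsilon>_def)
      also have "\<dots> = 1 + ennreal \<eta>" using \<eta> by (simp add: ennreal_plus)
      finally show ?thesis .
    qed
    then show ?thesis by (rule ennreal_le_epsilon)
  qed
  \<comment> \<open>Concentration is excluded here: the cube inequality applied to the difference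
    from u has bounded energy M2 and square integral below \<beta>, so its right-hand side (M2 + K
    \<beta>) \<beta>^(2/d) is arbitrarily small.\<close>
  have evC: "eventually (\<lambda>n. EQ (\<lambda>x. \<bar>v (t n) x - u x\<bar> powr p) \<le> ennreal \<eta>) sequentially" if \<eta>: "\<eta> > 0" for \<eta>
  proof -
    define M2 where "M2 = 2 * M + 2 * \<alpha>"
    have M2: "M2 \<ge> 0" using M1 \<alpha>0 by (simp add: M2_def)
    have lim: "((\<lambda>\<beta>. (M2 + K * \<beta>) * \<beta> powr (2 / d)) \<longlongrightarrow> (M2 + K * 0) * 0 powr (2 / d)) (at_right 0)"
      using d by (intro tendsto_mult tendsto_add tendsto_const tendsto_ident_at tendsto_powr2)
        (auto simp: eventually_at_filter)
    have "eventually (\<lambda>\<beta>. (M2 + K * \<beta>) * \<beta> powr (2 / d) < \<kappa>' / 4 * \<eta>) (at_right 0)"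
      by (rule order_tendstoD(2)[OF lim]) (use \<kappa>' \<eta> in simp)
    moreover have "eventually (\<lambda>\<beta>::real. \<beta> > 0) (at_right 0)" by (simp add: eventually_at_right_less)
    ultimately have "eventually (\<lambda>\<beta>. (M2 + K * \<beta>) * \<beta> powr (2 / d) < \<kappa>' / 4 * \<eta> \<and> \<beta> > 0) (at_right 0)"
      by eventually_elim simp
    then obtain \<beta> where \<beta>: "(M2 + K * \<beta>) * \<beta> powr (2 / d) < \<kappa>' / 4 * \<eta>" "\<beta> > 0"
      using eventually_happens'[OF trivial_limit_at_right_real] by blast
    show ?thesis using ev[OF \<beta>(2)]
    proof eventually_elim
      case (elim n)
      let ?w = "\<lambda>x. 1 * v (t n) x + (-1) * u x" and ?k = "\<lambda>x. 1 *\<^sub>R h (t n) x + (-1) *\<^sub>R g x"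
      have Ww: "W11Q ?w ?k" by (rule W11Q_lincomb[OF W Wu])
      have kM: "EQ (\<lambda>x. (norm (?k x))\<^sup>2) \<le> ennreal M2"
      proof -
        have "EQ (\<lambda>x. (norm (?k x))\<^sup>2) \<le> EQ (\<lambda>x. 2 * (norm (h (t n) x))\<^sup>2 + 2 * (norm (g x))\<^sup>2)"
          by (rule EQ_mono) (use norm_add_square_le[of 1 "h (t n) x" "- g x" for x] in simp)
        also have "\<dots> = EQ (\<lambda>x. 2 * (norm (h (t n) x))\<^sup>2) + EQ (\<lambda>x. 2 * (norm (g x))\<^sup>2)"
          by (intro EQ_add mQ_cmult mQ_norm_power2 mh mg) auto
        also have "\<dots> = ennreal 2 * EQ (\<lambda>x. (norm (h (t n) x))\<^sup>2) + ennreal 2 * EQ (\<lambda>x. (norm (g x))\<^sup>2)"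
          by (intro arg_cong2[where f="(+)"] EQ_cmult mQ_norm_power2 mh mg) auto
        also have "\<dots> \<le> ennreal 2 * ennreal M + ennreal 2 * ennreal \<alpha>"
          unfolding EQh using gA a_le by (intro add_mono mult_left_mono ennreal_leI) auto
        also have "ennreal 2 * ennreal M = ennreal (2 * M)" using M1 by (intro ennreal_mult[symmetric]) auto
        also have "ennreal 2 * ennreal \<alpha> = ennreal (2 * \<alpha>)" using \<alpha>0 by (intro ennreal_mult[symmetric]) auto
        also have "ennreal (2 * M) + ennreal (2 * \<alpha>) = ennreal M2" unfolding M2_def using M1 \<alpha>0 by (intro ennreal_plus[symmetric]) auto
        finally show ?thesis .
      qed
      have wb: "EQ (\<lambda>x. (?w x)\<^sup>2) \<le> ennreal \<beta>" using elim by simp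
      have f1: "EQ (\<lambda>x. (norm (?k x))\<^sup>2) < \<infinity>" using kM by (rule order_le_less_trans) simp
      have f2: "EQ (\<lambda>x. (?w x)\<^sup>2) < \<infinity>" using wb by (rule order_le_less_trans) simp
      have "ennreal (\<kappa>' / 4) * EQ (\<lambda>x. \<bar>?w x\<bar> powr p) \<le> ennreal ((enn2real (EQ (\<lambda>x. (norm (?k x))\<^sup>2)) + K * enn2real (EQ (\<lambda>x. (?w x)\<^sup>2))) * enn2real (EQ (\<lambda>x. (?w x)\<^sup>2)) powr (2 / d))"
        by (rule KC[OF Ww f1 f2])
      also have "\<dots> \<le> ennreal ((M2 + K * \<beta>) * \<beta> powr (2 / d))"
        using enn2real_leI[OF _ kM] enn2real_leI[OF _ wb] M2 \<beta> K d
        by (intro ennreal_leI mult_mono add_mono mult_left_mono powr_mono2) auto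
      also have "\<dots> \<le> ennreal (\<kappa>' / 4 * \<eta>)" using \<beta> by (intro ennreal_leI) simp
      also have "\<dots> = ennreal (\<kappa>' / 4) * ennreal \<eta>" using \<kappa>' \<eta> by (intro ennreal_mult) auto
      finally have "ennreal (\<kappa>' / 4) * EQ (\<lambda>x. \<bar>?w x\<bar> powr p) \<le> ennreal (\<kappa>' / 4) * ennreal \<eta>" .
      then have "EQ (\<lambda>x. \<bar>?w x\<bar> powr p) \<le> ennreal \<eta>"
        using \<kappa>' by (subst (asm) ennreal_mult_le_mult_iff) auto
      then show ?case by simp
    qed
  qed
  obtain cu where cu: "EQ (\<lambda>x. \<bar>u x\<bar> powr p) = ennreal cu" "cu \<ge> 0"
    using finC[OF Wu gfin ufin] by (cases "EQ (\<lambda>x. \<bar>u x\<bar> powr p)") auto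
  \<comment> \<open>The near-minimality a <= (q + o(1)) c passes to the limit, with c bounded
    through the p-th power of u and the small error \<eta>. Afterwards \<eta> tends to 0 before
    \<epsilon> does, because the coefficient of \<eta> blows up with 1/\<epsilon>.\<close>
  have step: "\<alpha> \<le> q * ((1 + \<epsilon>) powr p * cu + (1 + 1 / \<epsilon>) powr p * \<eta>)" if \<epsilon>: "\<epsilon> > 0" and \<eta>: "\<eta> > 0" for \<epsilon> \<eta>
  proof -
    define Y where "Y = (1 + \<epsilon>) powr p * cu + (1 + 1 / \<epsilon>) powr p * \<eta>"
    have Y0: "Y \<ge> 0" using cu \<eta> by (simp add: Y_def)
    have "eventually (\<lambda>n. a (t n) \<le> q * Y + K * (1 / (real n + 1))) sequentially"
      using evC[OF \<eta>]
    proof eventually_elim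
      case (elim n)
      have "ennreal (c (t n)) = EQ (\<lambda>x. \<bar>u x + (v (t n) x - u x)\<bar> powr p)" by (simp add: EQc)
      also have "\<dots> \<le> EQ (\<lambda>x. (1 + \<epsilon>) powr p * \<bar>u x\<bar> powr p + (1 + 1 / \<epsilon>) powr p * \<bar>v (t n) x - u x\<bar> powr p)"
        by (intro EQ_mono abs_add_powr_le p \<epsilon>)
      also have "\<dots> = EQ (\<lambda>x. (1 + \<epsilon>) powr p * \<bar>u x\<bar> powr p) + EQ (\<lambda>x. (1 + 1 / \<epsilon>) powr p * \<bar>v (t n) x - u x\<bar> powr p)"
        by (intro EQ_add mQ_cmult mQ_abs_powr mQ_diff mu mv p) auto
      also have "\<dots> = ennreal ((1 + \<epsilon>) powr p) * EQ (\<lambda>x. \<bar>u x\<bar> powr p) + ennreal ((1 + 1 / \<epsilon>) powr p) * EQ (\<lambda>x. \<bar>v (t n) x - u x\<bar> powr p)"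
        by (intro arg_cong2[where f="(+)"] EQ_cmult mQ_abs_powr mQ_diff mu mv p) auto
      also have "\<dots> \<le> ennreal ((1 + \<epsilon>) powr p) * ennreal cu + ennreal ((1 + 1 / \<epsilon>) powr p) * ennreal \<eta>"
        unfolding cu(1) using elim by (intro add_mono mult_left_mono) auto
      also have "ennreal ((1 + \<epsilon>) powr p) * ennreal cu = ennreal ((1 + \<epsilon>) powr p * cu)" using cu by (intro ennreal_mult[symmetric]) auto
      also have "ennreal ((1 + 1 / \<epsilon>) powr p) * ennreal \<eta> = ennreal ((1 + 1 / \<epsilon>) powr p * \<eta>)" using \<eta> by (intro ennreal_mult[symmetric]) auto
      also have "ennreal ((1 + \<epsilon>) powr p * cu) + ennreal ((1 + 1 / \<epsilon>) powr p * \<eta>) = ennreal Y"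
        unfolding Y_def using cu \<eta> by (intro ennreal_plus[symmetric]) auto
      finally have cY: "c (t n) \<le> Y" using Y0 by (subst (asm) ennreal_le_iff) auto
      have "1 / (real (t n) + 1) \<le> 1 / (real n + 1)" using tn[of n] by (intro divide_left_mono) auto
      then have d1: "\<delta> / (real (t n) + 1) \<le> \<delta> * (1 / (real n + 1))" using \<delta> by (metis mult_left_mono less_imp_le times_divide_eq_right mult_1_right)
      have "a (t n) \<le> (q + \<delta> / (real (t n) + 1)) * c (t n)" by (rule ac)
      also have "\<dots> = q * c (t n) + \<delta> / (real (t n) + 1) * c (t n)" by (simp add: distrib_right)
      also have "\<dots> \<le> q * Y + \<delta> * (1 / (real n + 1)) * (K / \<delta>)"
        using cY d1 q c0[of "t n"] c_le[of "t n"] \<delta> by (intro add_mono mult_left_mono mult_mono) auto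
      also have "\<delta> * (1 / (real n + 1)) * (K / \<delta>) = K * (1 / (real n + 1))" using \<delta> by simp
      finally show ?case .
    qed
    moreover have "(\<lambda>n. 1 / (real n + 1)) \<longlonglongrightarrow> 0" by real_asymp
    then have "(\<lambda>n. q * Y + K * (1 / (real n + 1))) \<longlonglongrightarrow> q * Y + K * 0" by (intro tendsto_intros)
    ultimately have "\<alpha> \<le> q * Y + K * 0" using alim tendsto_le[OF sequentially_bot] by blast
    then show ?thesis by (simp add: Y_def)
  qed
  have step2: "\<alpha> \<le> q * ((1 + \<epsilon>) powr p * cu)" if \<epsilon>: "\<epsilon> > 0" for \<epsilon>
  proof -
    have "((\<lambda>\<eta>. q * ((1 + \<epsilon>) powr p * cu + (1 + 1 / \<epsilon>) powr p * \<eta>)) \<longlongrightarrow> q * ((1 + \<epsilon>) powr p * cu + (1 + 1 / \<epsilon>) powr p * 0)) (at_right 0)"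
      by (intro tendsto_intros)
    moreover have "eventually (\<lambda>\<eta>. \<alpha> \<le> q * ((1 + \<epsilon>) powr p * cu + (1 + 1 / \<epsilon>) powr p * \<eta>)) (at_right 0)"
      using step[OF \<epsilon>] by (auto simp: eventually_at_filter)
    ultimately have "\<alpha> \<le> q * ((1 + \<epsilon>) powr p * cu + (1 + 1 / \<epsilon>) powr p * 0)"
      by (rule tendsto_lowerbound) simp
    then show ?thesis by simp
  qed
  have \<alpha>q: "\<alpha> \<le> q * cu"
  proof -
    have "((\<lambda>\<epsilon>. q * ((1 + \<epsilon>) powr p * cu)) \<longlongrightarrow> q * ((1 + 0) powr p * cu)) (at_right 0)"
      by (intro tendsto_intros) auto
    moreover have "eventually (\<lambda>\<epsilon>. \<alpha> \<le> q * ((1 + \<epsilon>) powr p * cu)) (at_right 0)"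
      using step2 by (auto simp: eventually_at_filter)
    ultimately have "\<alpha> \<le> q * ((1 + 0) powr p * cu)" by (rule tendsto_lowerbound) simp
    then show ?thesis by simp
  qed
  have adm: "GQ_admissible u g"
    unfolding GQ_admissible_def
  proof (intro conjI notI Wu)
    assume "\<exists>c. AE x in lebesgue_on cubeQ. u x = c"
    then obtain c where c: "AE x in lebesgue. x \<in> cubeQ \<longrightarrow> u x = c" unfolding AE_lebesgue_on_cubeQ by blast
    have "IQ u = c" using IQ_cong_AE[OF c mu mQ_const] by (simp add: IQ_const)
    then have "AE x in lebesgue. x \<in> cubeQ \<longrightarrow> (u x)\<^sup>2 = 0" using c IQu by (auto elim!: eventually_mono)
    then have "EQ (\<lambda>x. (u x)\<^sup>2) = EQ (\<lambda>x::real^'n. 0)" by (rule EQ_cong_AE)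
    then show False using u0 by (simp add: EQ_const)
  qed
  \<comment> \<open>Energy at most \<alpha>, square integral at most 1, mean 0 and \<alpha> <= q *
    cu give a quotient at most q. Since q is the infimum, u attains it.\<close>
  have "GQ_quot u g \<le> ennreal q"
    unfolding GQ_quot_eq[OF gfin ufin] d_def[symmetric] p_def[symmetric] IQu diff_zero
  proof (rule ennreal_divide_leI)
    have "enn2real (EQ (\<lambda>x. (norm (g x))\<^sup>2)) * enn2real (EQ (\<lambda>x. (u x)\<^sup>2)) powr (2 / d) \<le> \<alpha> * 1 powr (2 / d)"
      using enn2real_leI[OF \<alpha>0 gA] enn2real_leI[of 1 "EQ (\<lambda>x. (u x)\<^sup>2)"] uB \<alpha>0 d
      by (intro mult_mono powr_mono2) auto
    also have "\<dots> \<le> q * cu" using \<alpha>q by simp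
    finally show "ennreal (enn2real (EQ (\<lambda>x. (norm (g x))\<^sup>2)) * enn2real (EQ (\<lambda>x. (u x)\<^sup>2)) powr (2 / d)) \<le> ennreal q * EQ (\<lambda>x. \<bar>u x\<bar> powr p)"
      unfolding cu(1) using q cu by (subst ennreal_mult[symmetric]) (auto intro: ennreal_leI)
    show "EQ (\<lambda>x. \<bar>u x\<bar> powr p) \<noteq> 0" by (rule EQ_pos_of_square[OF mu u0 p])
  qed
  then have "GQ_quot u g = GQ_const TYPE('n)" using GQ_const_le[OF adm] q by simp
  then show False using nomin adm by blast
qed

theorem theorem4p3:
  assumes "CARD('n::finite) \<ge> 2"
    and "\<not> (\<exists>(u :: real^'n \<Rightarrow> real) g. GQ_admissible u g \<and> GQ_quot u g = GQ_const TYPE('n))"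
  shows "GQ_const TYPE('n) = G_const TYPE('n) / 4"
  using GQ_const_upper GQ_const_lower[OF assms(2)] by (rule antisym)

end
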